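(* (i) Let $g$ be a Lorentzian metric (signature $(+,-,-,-)$) on a real four-dimensional vector space. Regarded as a real representation of the Lie algebra $so(g)$, the space of force tensors $V(g)$ is a direct sum of eleven irreducible subrepresentations: two of dimension $1$, four of dimension $4$, two of dimension $6$, two of dimension $9$ and one of dimension $16$. All summands of the same dimension are isomorphic. In the classification of representations of the Lorentz group, the four-dimensional summands are isomorphic to $(\frac12,\frac12)$, and the summands of dimension six, nine and sixteen are isomorphic to $(1,0)\oplus(0,1)$, $(1,1)$ and $(\frac32,\frac12)\oplus(\frac12,\frac32)$, respectively. The summands of dimension $6$ and $16$ are irreducible over the reals, although reducible over the complex numbers. (ii) For $g=\eta=\mathrm{diag}(1,-1,-1,-1)$, with $\mathcal J=\Theta_{0123}$ acting componentwise, the decomposition is $$V(\eta)=V_r\oplus iV_c,\quad V_r=E_1\oplus E_4\oplus\mathcal JE_4\oplus E_6\oplus E_9\oplus E_{16},\quad V_c=\mathcal JE_1\oplus E_4''\oplus\mathcal JE_4''\oplus\mathcal JE_6\oplus\mathcal JE_9,$$ where $V_r$ is the real span of the $\boldsymbol\Theta^\beta_I$ with $|I|\in\{1,2\}$, $V_c$ is the real span of the $\boldsymbol\Theta^\beta_J$ with $|J|\in\{0,3,4\}$, and (summing over repeated indices, all spans real): - $E_1$ is spanned by $\mathbf u=\boldsymbol\Theta^\alpha_\alpha$; - $E_4$ has basis $\mathbf v_\alpha=\boldsymbol\Theta^\beta_{\beta\alpha}$, $\alpha=0,1,2,3$; - $iE_4''$ has basis $\mathbf w_\alpha=i\eta_{\alpha\beta}\boldsymbol\Theta^\beta_\emptyset$,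 $\alpha=0,1,2,3$; - $E_6$ is spanned by $\mathbf v_{\alpha\beta}=\mathcal J\boldsymbol\Theta^\epsilon_{\epsilon\alpha\beta}$, $\alpha<\beta$; - $E_9$ is the set of all $S^{\alpha\beta}\mathbf u_{\alpha\beta}$, where $\mathbf u_{\alpha\beta}=\frac12(\eta_{\alpha\epsilon}\boldsymbol\Theta^\epsilon_\beta+\eta_{\beta\epsilon}\boldsymbol\Theta^\epsilon_\alpha)$ and $S^{\alpha\beta}$ is real and symmetric with $\eta_{\alpha\beta}S^{\alpha\beta}=0$; - $E_{16}$ is the set of all $F^{\alpha\rho\sigma}\eta_{\alpha\beta}\boldsymbol\Theta^\beta_{\rho\sigma}$, where $F^{\alpha\rho\sigma}$ is real and satisfies $F^{\alpha\rho\sigma}=-F^{\alpha\sigma\rho}$, $\eta_{\alpha\rho}F^{\alpha\rho\sigma}=0$ and $\epsilon_{\alpha\rho\sigma\tau}F^{\alpha\rho\sigma}=0$. Each listed summand ($E_1,E_4,\mathcal JE_4,E_6,E_9,E_{16}$ in $V_r$, and $i$ times each listed summand of $V_c$) is an irreducible real $so(\eta)$-subrepresentation of $V(\eta)$, of dimension $1,4,4,6,9,16$ and $1,4,4,6,9$, respectively.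
   Context: Let $g$ be a symmetric bilinear form of signature $(+,-,-,-)$ on a real vector space with basis $\mathbf e_0,\dots,\mathbf e_3$, with $g_{\alpha\beta}=g(\mathbf e_\alpha,\mathbf e_\beta)$ and inverse matrix $g^{\alpha\beta}$. The complex exterior algebra $\bigwedge_*$ is a 16-dimensional complex vector space with basis $\mathbf e_I=\mathbf e_{\alpha_1}\wedge\cdots\wedge\mathbf e_{\alpha_k}$, $I=\alpha_1\cdots\alpha_k$ with $\alpha_1<\dots<\alpha_k$ (and $\mathbf e_\emptyset=1$), $|I|=k$; $\mathbf e_I$ is defined by the same formula for any multi-index. "$16\times16$ matrix" means a complex-linear operator on $\bigwedge_*$ in this basis; $\dagger$ is conjugate transpose. Gamma matrices: $\gamma_\alpha\psi=\mathbf e_\alpha\wedge\psi-\iota_\alpha\psi$, where $\iota_\alpha$ is linear with $\iota_\alpha \mathbf e_\emptyset=0$, $\iota_\alpha\mathbf e_\beta=g_{\alpha\beta}\mathbf e_\emptyset$, $\iota_\alpha(\mathbf e_I\wedge\mathbf e_J)=(\iota_\alpha\mathbf e_I)\wedge\mathbf e_J+(-1)^{|I|}\mathbf e_I\wedge\iota_\alpha\mathbf e_J$; $\gamma^\alpha=g^{\alpha\beta}\gamma_\beta$. Extended metric: $\hat g_{IJ}=0$ if $|I|\ne|J|$, and $\hat g_{IJ}=\det(g_{\alpha_i\beta_j})$ if $I=\alpha_1\cdots\alpha_k$, $J=\beta_1\cdots\beta_k$. A force tensor is a collection $\boldsymbol\theta=\{\theta_0,\dots,\theta_3\}$ of $16\times16$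 complex matrices with $\theta_\alpha^\dagger\hat g+\hat g\theta_\alpha=0$ and $[\gamma^\alpha,\theta_\beta]=0$ for all $\alpha,\beta$; $V(g)$ is the real vector space of force tensors. $so(g)$ is the real Lie algebra of $4\times4$ real matrices $L$ with $L^Tg+gL=0$; $L\mathbf e_\alpha=L_\alpha^\beta\mathbf e_\beta$. $\hat L$ is the extension of $L$ to $\bigwedge_*$ as a derivation: $\hat L\mathbf e_\emptyset=0$ and $\hat L\mathbf e_{\alpha_1\cdots\alpha_k}=\sum_i\mathbf e_{\alpha_1}\wedge\cdots\wedge(L\mathbf e_{\alpha_i})\wedge\cdots\wedge\mathbf e_{\alpha_k}$. $so(g)$ acts on $V(g)$ by $(L\cdot\boldsymbol\theta)_\alpha=[\hat L,\theta_\alpha]-L_\alpha^\beta\theta_\beta$. For half-integers $j,k$, $(j,k)$ is the usual irreducible complex representation of $so(\eta)\otimes\mathbb C\cong sl_2(\mathbb C)\oplus sl_2(\mathbb C)$ of dimension $(2j+1)(2k+1)$; a real representation is said to be isomorphic to a given sum of these if its complexification is. For $g=\eta$ and a multi-index $I$: $\Theta_I$ is the $16\times16$ matrix that commutes with all gamma matrices and satisfies $\Theta_I\mathbf e_\emptyset=\mathbf e_I$ (so $\Theta_I=0$ if $I$ has a repeated index). $\boldsymbol\Theta^\beta_I$ is the collection with components $(\boldsymbol\Theta^\beta_I)_\alpha=\delta^\beta_\alpha\Theta_I$. A matrix such as $\mathcal J$ acts on collections componentwise: $(\mathcal J\boldsymbol\theta)_\alpha=\mathcal J\theta_\alpha$;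 likewise multiplication by $i$. $\epsilon_{\alpha\rho\sigma\tau}$ is the totally antisymmetric Levi-Civita symbol with $\epsilon_{0123}=1$. *)

theory Defs
  imports "HOL-Analysis.Analysis"
begin

section \<open>The complex exterior algebra\<close>

text \<open>
  Indices are elements of the four-element type \<open>4\<close>, whose values are \<open>0 < 1 < 2 < 3\<close>.
  The coordinate of \<open>x\<close> at \<open>A = {\<alpha>\<^sub>1 < \<dots> < \<alpha>\<^sub>k}\<close> is its coefficient at
  \<open>e\<^bsub>\<alpha>\<^sub>1\<dots>\<alpha>\<^sub>k\<^esub>\<close>.  Multi-indices, in any order and possibly with repetitions, are lists.
\<close>

type_synonym ext = "complex^(4 set)"
type_synonym extop = "complex^(4 set)^(4 set)"
type_synonym coll = "extop^4"

definition wedge_basis :: "4 set \<Rightarrow> 4 set \<Rightarrow> ext" where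
  "wedge_basis A B =
     (if A \<inter> B = {} then axis (A \<union> B) ((-1) ^ card {(a, b). a \<in> A \<and> b \<in> B \<and> b < a}) else 0)"

definition wedge :: "ext \<Rightarrow> ext \<Rightarrow> ext" where
  "wedge x y = (\<Sum>A\<in>UNIV. \<Sum>B\<in>UNIV. (x $ A * y $ B) *s wedge_basis A B)"

definition ext_one :: ext where
  "ext_one = axis {} 1"

definition ext_e :: "4 \<Rightarrow> ext" where
  "ext_e a = axis {a} 1"

fun wedges :: "ext list \<Rightarrow> ext" where
  "wedges [] = ext_one"
| "wedges (x # xs) = wedge x (wedges xs)"

definition eI :: "4 list \<Rightarrow> ext" where
  "eI I = wedges (map ext_e I)"

text \<open>The linear operator with prescribed values on the basis \<open>e\<^sub>I\<close>, \<open>I\<close> increasing.\<close>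

definition op_on_basis :: "(4 list \<Rightarrow> ext) \<Rightarrow> extop" where
  "op_on_basis F = (\<chi> B A. F (sorted_list_of_set A) $ B)"

definition commutator :: "'a::ring_1^'n^'n \<Rightarrow> 'a^'n^'n \<Rightarrow> 'a^'n^'n" where
  "commutator A B = A ** B - B ** A"

definition dagger :: "extop \<Rightarrow> extop" where
  "dagger M = (\<chi> A B. cnj (M $ B $ A))"


section \<open>Metrics, gamma matrices, force tensors\<close>

definition eta :: "real^4^4" where
  "eta = (\<chi> a b. if a = b then (if a = 0 then 1 else -1) else 0)"

text \<open>The columns of \<open>P\<close> are the components of a basis that is orthonormal for \<open>g\<close>.\<close>

definition orthonormal_frame :: "real^4^4 \<Rightarrow> real^4^4 \<Rightarrow> bool" where
  "orthonormal_frame g P \<longleftrightarrow> invertible P \<and> transpose P ** g ** P = eta"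

definition lorentzian :: "real^4^4 \<Rightarrow> bool" where
  "lorentzian g \<longleftrightarrow> transpose g = g \<and> (\<exists>P. orthonormal_frame g P)"

text \<open>\<open>iota_list g a I\<close> is \<open>\<iota>\<^sub>a e\<^sub>I\<close>, by the antiderivation rule for \<open>e\<^sub>b \<and> e\<^sub>I\<close>.\<close>

fun iota_list :: "real^4^4 \<Rightarrow> 4 \<Rightarrow> 4 list \<Rightarrow> ext" where
  "iota_list g a [] = 0"
| "iota_list g a (b # I) = (g $ a $ b) *\<^sub>R eI I - wedge (ext_e b) (iota_list g a I)"

definition gamma_lower :: "real^4^4 \<Rightarrow> 4 \<Rightarrow> extop" where
  "gamma_lower g a = op_on_basis (\<lambda>I. wedge (ext_e a) (eI I) - iota_list g a I)"

definition gamma_upper :: "real^4^4 \<Rightarrow> 4 \<Rightarrow> extop" where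
  "gamma_upper g a = (\<Sum>b\<in>UNIV. (matrix_inv g $ a $ b) *\<^sub>R gamma_lower g b)"

text \<open>The determinant of the \<open>k \<times> k\<close> matrix \<open>g\<^bsub>\<alpha>\<^sub>i\<beta>\<^sub>j\<^esub>\<close> is written out (Leibniz
  formula), because the size \<open>k\<close> varies.\<close>

definition minor_det :: "real^4^4 \<Rightarrow> 4 list \<Rightarrow> 4 list \<Rightarrow> real" where
  "minor_det g I J =
     (\<Sum>p | p permutes {..<length I}. of_int (sign p) * (\<Prod>i<length I. g $ (I ! i) $ (J ! p i)))"

definition ext_metric :: "real^4^4 \<Rightarrow> extop" where
  "ext_metric g = (\<chi> A B. if card A \<noteq> card B then 0
     else of_real (minor_det g (sorted_list_of_set A) (sorted_list_of_set B)))"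

definition force_tensors :: "real^4^4 \<Rightarrow> coll set" where
  "force_tensors g = {\<theta>.
     (\<forall>a. dagger (\<theta> $ a) ** ext_metric g + ext_metric g ** (\<theta> $ a) = 0) \<and>
     (\<forall>a b. commutator (gamma_upper g a) (\<theta> $ b) = 0)}"


section \<open>The Lie algebra and its action\<close>

definition so :: "real^4^4 \<Rightarrow> (real^4^4) set" where
  "so g = {L. transpose L ** g + g ** L = 0}"

text \<open>\<open>L\<^sub>a\<^sup>b\<close> is the entry \<open>L $ b $ a\<close>, so that \<open>L\<close> acts on columns of components.\<close>

definition vec_act :: "real^4^4 \<Rightarrow> 4 \<Rightarrow> ext" where
  "vec_act L a = (\<Sum>b\<in>UNIV. (L $ b $ a) *\<^sub>R ext_e b)"

definition hat_op :: "real^4^4 \<Rightarrow> extop" where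
  "hat_op L = op_on_basis (\<lambda>I. \<Sum>i<length I. wedges ((map ext_e I)[i := vec_act L (I ! i)]))"

definition force_act :: "real^4^4 \<Rightarrow> coll \<Rightarrow> coll" where
  "force_act L \<theta> = (\<chi> a. commutator (hat_op L) (\<theta> $ a) - (\<Sum>b\<in>UNIV. (L $ b $ a) *\<^sub>R (\<theta> $ b)))"


section \<open>Real representations\<close>

definition lie_rep ::
  "(real^4^4) set \<Rightarrow> (real^4^4 \<Rightarrow> 'v::real_vector \<Rightarrow> 'v) \<Rightarrow> 'v set \<Rightarrow> bool" where
  "lie_rep G act V \<longleftrightarrow> subspace V \<and>
     (\<forall>L\<in>G. \<forall>v\<in>V. act L v \<in> V) \<and>
     (\<forall>L\<in>G. \<forall>v\<in>V. \<forall>w\<in>V. act L (v + w) = act L v + act L w) \<and>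
     (\<forall>L\<in>G. \<forall>v\<in>V. \<forall>c. act L (c *\<^sub>R v) = c *\<^sub>R act L v) \<and>
     (\<forall>L\<in>G. \<forall>M\<in>G. \<forall>v\<in>V. act (L + M) v = act L v + act M v) \<and>
     (\<forall>L\<in>G. \<forall>v\<in>V. \<forall>c. act (c *\<^sub>R L) v = c *\<^sub>R act L v) \<and>
     (\<forall>L\<in>G. \<forall>M\<in>G. \<forall>v\<in>V. act (commutator L M) v = act L (act M v) - act M (act L v))"

definition subrep :: "'l set \<Rightarrow> ('l \<Rightarrow> 'v::real_vector \<Rightarrow> 'v) \<Rightarrow> 'v set \<Rightarrow> 'v set \<Rightarrow> bool" where
  "subrep G act V U \<longleftrightarrow> subspace U \<and> U \<subseteq> V \<and> (\<forall>L\<in>G. \<forall>u\<in>U. act L u \<in> U)"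

definition irreducible_subrep ::
  "'l set \<Rightarrow> ('l \<Rightarrow> 'v::real_vector \<Rightarrow> 'v) \<Rightarrow> 'v set \<Rightarrow> 'v set \<Rightarrow> bool" where
  "irreducible_subrep G act V W \<longleftrightarrow>
     subrep G act V W \<and> W \<noteq> {0} \<and> (\<forall>U. subrep G act W U \<longrightarrow> U = {0} \<or> U = W)"

definition rep_iso :: "'l set \<Rightarrow> ('l \<Rightarrow> 'v::real_vector \<Rightarrow> 'v) \<Rightarrow> 'v set \<Rightarrow> 'v set \<Rightarrow> bool" where
  "rep_iso G act V W \<longleftrightarrow>
     (\<exists>T. linear T \<and> bij_betw T V W \<and> (\<forall>L\<in>G. \<forall>v\<in>V. T (act L v) = act L (T v)))"

definition is_direct_sum :: "'v::real_vector set \<Rightarrow> 'v set list \<Rightarrow> bool" where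
  "is_direct_sum V Us \<longleftrightarrow>
     (\<forall>U\<in>set Us. subspace U) \<and>
     V = {sum_list us | us. list_all2 (\<in>) us Us} \<and>
     (\<forall>v\<in>V. \<exists>!us. list_all2 (\<in>) us Us \<and> v = sum_list us)"

definition basis_family :: "('i \<Rightarrow> 'v::real_vector) \<Rightarrow> 'v set \<Rightarrow> bool" where
  "basis_family b U \<longleftrightarrow> inj b \<and> independent (range b) \<and> span (range b) = U"


section \<open>Complexification and the representations \<open>(j, k)\<close>\<close>

text \<open>The complexification of \<open>W\<close> is \<open>W \<times> W\<close>, where \<open>(x, y)\<close> stands for \<open>x + iy\<close>.\<close>

definition cpx_scale :: "complex \<Rightarrow> 'v::real_vector \<times> 'v \<Rightarrow> 'v \<times> 'v" where
  "cpx_scale c p =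
     (Re c *\<^sub>R fst p - Im c *\<^sub>R snd p, Im c *\<^sub>R fst p + Re c *\<^sub>R snd p)"

definition cpx_act :: "('l \<Rightarrow> 'v \<Rightarrow> 'v) \<Rightarrow> 'l \<Rightarrow> 'v \<times> 'v \<Rightarrow> 'v \<times> 'v" where
  "cpx_act act L p = (act L (fst p), act L (snd p))"

definition cpx_subspace :: "('v::real_vector \<times> 'v) set \<Rightarrow> bool" where
  "cpx_subspace U \<longleftrightarrow> 0 \<in> U \<and> (\<forall>x\<in>U. \<forall>y\<in>U. x + y \<in> U) \<and> (\<forall>c. \<forall>x\<in>U. cpx_scale c x \<in> U)"

definition cpx_reducible :: "'l set \<Rightarrow> ('l \<Rightarrow> 'v::real_vector \<Rightarrow> 'v) \<Rightarrow> 'v set \<Rightarrow> bool" where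
  "cpx_reducible G act W \<longleftrightarrow>
     (\<exists>U. cpx_subspace U \<and> U \<subseteq> W \<times> W \<and> (\<forall>L\<in>G. \<forall>u\<in>U. cpx_act act L u \<in> U) \<and>
          U \<noteq> {0} \<and> U \<noteq> W \<times> W)"

text \<open>
  Write \<open>L \<in> so(\<eta>)\<close> as \<open>\<Sum>\<^sub>i r\<^sub>i R\<^sub>i + b\<^sub>i B\<^sub>i\<close> with the rotations
  \<open>R\<^sub>3 : e\<^sub>1 \<mapsto> e\<^sub>2, e\<^sub>2 \<mapsto> - e\<^sub>1\<close> (and cyclically) and the boosts \<open>B\<^sub>i : e\<^sub>0 \<mapsto> e\<^sub>i, e\<^sub>i \<mapsto> e\<^sub>0\<close>.
  With \<open>\<tau>\<^sub>i = - i \<sigma>\<^sub>i / 2\<close> in terms of Pauli matrices, so that \<open>[\<tau>\<^sub>1, \<tau>\<^sub>2] = \<tau>\<^sub>3\<close> etc.,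
  the isomorphism of \<open>so(\<eta>) \<otimes> C\<close> with \<open>sl\<^sub>2(C) \<oplus> sl\<^sub>2(C)\<close> is the complex-linear extension of
  \<open>L \<mapsto> (\<Sum>\<^sub>i (r\<^sub>i + i b\<^sub>i) \<tau>\<^sub>i, \<Sum>\<^sub>i (r\<^sub>i - i b\<^sub>i) \<tau>\<^sub>i)\<close>.  A complex representation of
  \<open>so(\<eta>) \<otimes> C\<close> is given by its restriction to \<open>so(\<eta>)\<close>.
\<close>

definition sl2_mat :: "complex \<Rightarrow> complex \<Rightarrow> complex \<Rightarrow> complex^2^2" where
  "sl2_mat z1 z2 z3 = vector [vector [- \<i> * z3 / 2, - \<i> * (z1 - \<i> * z2) / 2],
                              vector [- \<i> * (z1 + \<i> * z2) / 2, \<i> * z3 / 2]]"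

definition sl2_left :: "real^4^4 \<Rightarrow> complex^2^2" where
  "sl2_left L = sl2_mat (Complex (L $ 3 $ 2) (L $ 1 $ 0)) (Complex (L $ 1 $ 3) (L $ 2 $ 0))
                        (Complex (L $ 2 $ 1) (L $ 3 $ 0))"

definition sl2_right :: "real^4^4 \<Rightarrow> complex^2^2" where
  "sl2_right L = sl2_mat (Complex (L $ 3 $ 2) (- (L $ 1 $ 0))) (Complex (L $ 1 $ 3) (- (L $ 2 $ 0)))
                         (Complex (L $ 2 $ 1) (- (L $ 3 $ 0)))"

lemma sum_UNIV4: "sum f (UNIV::4 set) = f 0 + f 1 + f 2 + (f 3 :: 'a::ab_group_add)"
proof -
  have "(4::4) = 0" by simp
  then show ?thesis unfolding sum_4 by (simp only: add_ac)
qed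

lemma so_eta_entries:
  assumes "L \<in> so eta"
  shows "L $ 0 $ 0 = 0" "L $ 1 $ 1 = 0" "L $ 2 $ 2 = 0" "L $ 3 $ 3 = 0"
    "L $ 0 $ 1 = L $ 1 $ 0" "L $ 0 $ 2 = L $ 2 $ 0" "L $ 0 $ 3 = L $ 3 $ 0"
    "L $ 1 $ 2 = - L $ 2 $ 1" "L $ 1 $ 3 = - L $ 3 $ 1" "L $ 2 $ 3 = - L $ 3 $ 2"
proof -
  have H: "\<And>a b. L $ b $ a * eta $ b $ b + eta $ a $ a * L $ a $ b = 0"
  proof -
    fix a b :: 4
    have "(\<Sum>k\<in>UNIV. L $ k $ a * eta $ k $ b) = (\<Sum>k\<in>UNIV. if k = b then L $ b $ a * eta $ b $ b else 0)"
      by (rule sum.cong) (auto simp: eta_def)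
    moreover have "(\<Sum>k\<in>UNIV. eta $ a $ k * L $ k $ b) = (\<Sum>k\<in>UNIV. if k = a then eta $ a $ a * L $ a $ b else 0)"
      by (rule sum.cong) (auto simp: eta_def)
    moreover have "(\<Sum>k\<in>UNIV. L $ k $ a * eta $ k $ b) + (\<Sum>k\<in>UNIV. eta $ a $ k * L $ k $ b) = 0"
      using assms by (simp add: so_def matrix_matrix_mult_def transpose_def vec_eq_iff)
    ultimately show "L $ b $ a * eta $ b $ b + eta $ a $ a * L $ a $ b = 0"
      by simp
  qed
  have E: "eta $ 0 $ 0 = 1" "eta $ 1 $ 1 = -1" "eta $ 2 $ 2 = -1" "eta $ 3 $ 3 = -1"
    by (simp_all add: eta_def)
  show "L $ 0 $ 0 = 0" using H[of 0 0] unfolding E by linarith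
  show "L $ 1 $ 1 = 0" using H[of 1 1] unfolding E by linarith
  show "L $ 2 $ 2 = 0" using H[of 2 2] unfolding E by linarith
  show "L $ 3 $ 3 = 0" using H[of 3 3] unfolding E by linarith
  show "L $ 0 $ 1 = L $ 1 $ 0" using H[of 0 1] unfolding E by linarith
  show "L $ 0 $ 2 = L $ 2 $ 0" using H[of 0 2] unfolding E by linarith
  show "L $ 0 $ 3 = L $ 3 $ 0" using H[of 0 3] unfolding E by linarith
  show "L $ 1 $ 2 = - L $ 2 $ 1" using H[of 1 2] unfolding E by linarith
  show "L $ 1 $ 3 = - L $ 3 $ 1" using H[of 1 3] unfolding E by linarith
  show "L $ 2 $ 3 = - L $ 3 $ 2" using H[of 2 3] unfolding E by linarith
qed

lemma commutator_sl2_mat: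
  "commutator (sl2_mat x1 x2 x3) (sl2_mat y1 y2 y3) =
     sl2_mat (x2 * y3 - x3 * y2) (x3 * y1 - x1 * y3) (x1 * y2 - x2 * y1)"
  by (simp add: sl2_mat_def commutator_def vec_eq_iff forall_2 matrix_matrix_mult_def sum_2
      complex_eq_iff) (simp add: algebra_simps add_divide_distrib diff_divide_distrib)

lemma sl2_bracket:
  assumes "L \<in> so eta" "M \<in> so eta"
  shows "sl2_left (commutator L M) = commutator (sl2_left L) (sl2_left M)"
    "sl2_right (commutator L M) = commutator (sl2_right L) (sl2_right M)"
proof -
  have entry: "commutator L M $ a $ b =
      L$a$0 * M$0$b + L$a$1 * M$1$b + L$a$2 * M$2$b + L$a$3 * M$3$b
      - (M$a$0 * L$0$b + M$a$1 * L$1$b + M$a$2 * L$2$b + M$a$3 * L$3$b)" for a b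
    by (simp add: commutator_def matrix_matrix_mult_def sum_UNIV4)
  note entries = entry so_eta_entries[OF assms(1)] so_eta_entries[OF assms(2)]
  show "sl2_left (commutator L M) = commutator (sl2_left L) (sl2_left M)"
    unfolding sl2_left_def commutator_sl2_mat
    by (intro cong[OF cong[OF cong[OF refl[of sl2_mat]]]]) (simp_all add: entries complex_eq_iff)
  show "sl2_right (commutator L M) = commutator (sl2_right L) (sl2_right M)"
    unfolding sl2_right_def commutator_sl2_mat
    by (intro cong[OF cong[OF cong[OF refl[of sl2_mat]]]]) (simp_all add: entries complex_eq_iff)
qed

text \<open>
  The action of \<open>X\<close> on the \<open>n\<close>-th symmetric power of \<open>C\<^sup>2\<close>, that is, on polynomials
  \<open>\<Sum>\<^sub>m f m x\<^sup>n\<^sup>-\<^sup>m y\<^sup>m\<close>, by the derivation with \<open>x \<mapsto> X\<^sub>1\<^sub>1 x + X\<^sub>2\<^sub>1 y\<close>, \<open>y \<mapsto> X\<^sub>1\<^sub>2 x + X\<^sub>2\<^sub>2 y\<close>.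
\<close>

definition sym_act :: "nat \<Rightarrow> complex^2^2 \<Rightarrow> (nat \<Rightarrow> complex) \<Rightarrow> nat \<Rightarrow> complex" where
  "sym_act n X f m =
     ((of_nat n - of_nat m) * X $ 1 $ 1 + of_nat m * X $ 2 $ 2) * f m
     + (if m = 0 then 0 else (of_nat n - of_nat m + 1) * X $ 2 $ 1 * f (m - 1))
     + (of_nat m + 1) * X $ 1 $ 2 * f (m + 1)"

definition twice :: "rat \<Rightarrow> nat" where
  "twice j = nat \<lfloor>2 * j\<rfloor>"

text \<open>
  The direct sum of the representations \<open>(j, k)\<close> for the pairs in a list \<open>l\<close> of pairs of
  half-integers.  The summand \<open>(j, k)\<close> is the tensor product of symmetric powers with exponents
  \<open>2j\<close> and \<open>2k\<close>, on which the two copies of \<open>sl\<^sub>2(C)\<close> act;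
  \<open>f s a b\<close> is the coordinate at the basis element \<open>(a, b)\<close> of the summand number \<open>s\<close>.
\<close>

definition jk_space :: "(rat \<times> rat) list \<Rightarrow> (nat \<Rightarrow> nat \<Rightarrow> nat \<Rightarrow> complex) set" where
  "jk_space l = {f. \<forall>s a b. f s a b \<noteq> 0 \<longrightarrow>
     s < length l \<and> a \<le> twice (fst (l ! s)) \<and> b \<le> twice (snd (l ! s))}"

definition jk_act :: "(rat \<times> rat) list \<Rightarrow> real^4^4 \<Rightarrow>
    (nat \<Rightarrow> nat \<Rightarrow> nat \<Rightarrow> complex) \<Rightarrow> nat \<Rightarrow> nat \<Rightarrow> nat \<Rightarrow> complex" where
  "jk_act l L f s a b = (if s < length l then
       sym_act (twice (fst (l ! s))) (sl2_left L) (\<lambda>a'. f s a' b) a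
       + sym_act (twice (snd (l ! s))) (sl2_right L) (\<lambda>b'. f s a b') b
     else 0)"

text \<open>
  The complexification of the real representation \<open>W\<close> of \<open>so(g)\<close> is isomorphic to the sum of
  the \<open>(j, k)\<close> in \<open>l\<close>.  Every orthonormal frame \<open>P\<close> identifies \<open>so(g)\<close> with \<open>so(\<eta>)\<close>
  by \<open>L \<mapsto> P\<^sup>-\<^sup>1 L P\<close>; the condition is required for all of them.
\<close>

definition has_type :: "real^4^4 \<Rightarrow> (real^4^4 \<Rightarrow> 'v::real_vector \<Rightarrow> 'v) \<Rightarrow> 'v set \<Rightarrow>
    (rat \<times> rat) list \<Rightarrow> bool" where
  "has_type g act W l \<longleftrightarrow> (\<forall>P. orthonormal_frame g P \<longrightarrow>
     (\<exists>\<Phi>. bij_betw \<Phi> (W \<times> W) (jk_space l) \<and>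
        (\<forall>x\<in>W \<times> W. \<forall>y\<in>W \<times> W. \<Phi> (x + y) = (\<lambda>s a b. \<Phi> x s a b + \<Phi> y s a b)) \<and>
        (\<forall>c. \<forall>x\<in>W \<times> W. \<Phi> (cpx_scale c x) = (\<lambda>s a b. c * \<Phi> x s a b)) \<and>
        (\<forall>L\<in>so g. \<forall>x\<in>W \<times> W.
           \<Phi> (cpx_act act L x) = jk_act l (matrix_inv P ** L ** P) (\<Phi> x))))"


section \<open>The summands for \<open>g = \<eta>\<close>\<close>

definition Theta :: "4 list \<Rightarrow> extop" where
  "Theta I = (THE M. (\<forall>a. commutator M (gamma_lower eta a) = 0) \<and> M *v ext_one = eI I)"

definition Theta_coll :: "4 \<Rightarrow> 4 list \<Rightarrow> coll" where
  "Theta_coll b I = (\<chi> a. if a = b then Theta I else 0)"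

definition op_coll :: "extop \<Rightarrow> coll \<Rightarrow> coll" where
  "op_coll M \<theta> = (\<chi> a. M ** (\<theta> $ a))"

definition JJ :: "coll \<Rightarrow> coll" where
  "JJ = op_coll (Theta [0, 1, 2, 3])"

definition imul :: "coll \<Rightarrow> coll" where
  "imul \<theta> = (\<chi> a A B. \<i> * \<theta> $ a $ A $ B)"

definition levi_civita :: "4 \<Rightarrow> 4 \<Rightarrow> 4 \<Rightarrow> 4 \<Rightarrow> real" where
  "levi_civita a b c d =
     (let p = (\<lambda>i::4. if i = 0 then a else if i = 1 then b else if i = 2 then c else d)
      in if inj p then of_int (sign p) else 0)"

definition u_vec :: coll where
  "u_vec = (\<Sum>a\<in>UNIV. Theta_coll a [a])"

definition v_vec :: "4 \<Rightarrow> coll" where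
  "v_vec a = (\<Sum>b\<in>UNIV. Theta_coll b [b, a])"

definition w_vec :: "4 \<Rightarrow> coll" where
  "w_vec a = imul (\<Sum>b\<in>UNIV. (eta $ a $ b) *\<^sub>R Theta_coll b [])"

definition v2_vec :: "4 \<Rightarrow> 4 \<Rightarrow> coll" where
  "v2_vec a b = JJ (\<Sum>e\<in>UNIV. Theta_coll e [e, a, b])"

definition u2_vec :: "4 \<Rightarrow> 4 \<Rightarrow> coll" where
  "u2_vec a b = (1/2) *\<^sub>R ((\<Sum>e\<in>UNIV. (eta $ a $ e) *\<^sub>R Theta_coll e [b])
                          + (\<Sum>e\<in>UNIV. (eta $ b $ e) *\<^sub>R Theta_coll e [a]))"

definition E1 :: "coll set" where
  "E1 = span {u_vec}"

definition E4 :: "coll set" where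
  "E4 = span (range v_vec)"

definition E4'' :: "coll set" where
  "E4'' = span (range (\<lambda>a. \<Sum>b\<in>UNIV. (eta $ a $ b) *\<^sub>R Theta_coll b []))"

definition E6 :: "coll set" where
  "E6 = span {v2_vec a b | a b. a < b}"

definition E9 :: "coll set" where
  "E9 = {\<Sum>a\<in>UNIV. \<Sum>b\<in>UNIV. S a b *\<^sub>R u2_vec a b | S.
     (\<forall>a b. S a b = S b a) \<and> (\<Sum>a\<in>UNIV. \<Sum>b\<in>UNIV. eta $ a $ b * S a b) = 0}"

definition E16 :: "coll set" where
  "E16 = {\<Sum>a\<in>UNIV. \<Sum>r\<in>UNIV. \<Sum>s\<in>UNIV. \<Sum>b\<in>UNIV. (F a r s * eta $ a $ b) *\<^sub>R Theta_coll b [r, s] | F.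
     (\<forall>a r s. F a r s = - F a s r) \<and>
     (\<forall>s. (\<Sum>a\<in>UNIV. \<Sum>r\<in>UNIV. eta $ a $ r * F a r s) = 0) \<and>
     (\<forall>t. (\<Sum>a\<in>UNIV. \<Sum>r\<in>UNIV. \<Sum>s\<in>UNIV. levi_civita a r s t * F a r s) = 0)}"

definition Vr :: "coll set" where
  "Vr = span {Theta_coll b I | b I. length I \<in> {1, 2}}"

definition Vc :: "coll set" where
  "Vc = span {Theta_coll b I | b I. length I \<in> {0, 3, 4}}"

end

theory Submission
  imports Defs
begin

text \<open>
  Let \<open>\<rho>\<^sub>a\<close> be the composition of the parity operator with \<open>e\<^sub>a \<and> \<cdot> + \<iota>\<^sub>a\<close>, that is, Clifford multiplication
  from the right.  These operators commute with the gamma matrices, generate their commutant, and are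
  anti-self-adjoint for the extended metric.  With respect to an orthonormal frame this identifies
  force tensors with tensors \<open>(s\<^sup>a, X\<^sup>a\<^sup>b, F\<^sup>a\<^sup>r\<^sup>s, Y\<^sup>a\<^sup>b, t\<^sup>a)\<close>, where \<open>F\<close> is antisymmetric in the last two
  indices, one tensor for each degree; the products of degree zero, three and four are self-adjoint and therefore
  carry a factor \<open>i\<close>, and those of degree three and four are the products of lower ones with the
  element of degree four.  The action of \<open>so(g)\<close> becomes the usual action on tensors, so that
  the summands are the trace, antisymmetric and traceless symmetric parts of \<open>X\<close> and \<open>Y\<close>, the
  vectors \<open>s\<close> and \<open>t\<close>, and the trace, totally antisymmetric and remaining parts of \<open>F\<close>.

  Each tensor space has an explicit equivariant injection into spinor polynomials.  Its surjectivity
  and the irreducibility over the reals both follow from one statement.  In a sum of representations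
  \<open>(j, k)\<close> in which each summand exceeds all others in one of its two spins, an invariant complex subspace
  that projects non-trivially to every summand is everything, because lowering and raising
  operators isolate the highest weight vectors.
\<close>

section \<open>Creation and annihilation operators\<close>

text \<open>The commutant is as small as claimed because 1 is a cyclic vector for the gamma
  matrices: an operator commuting with them is determined by its value at 1. Since
  \<open>rr a\<close> and \<open>gamma_lower g a\<close> agree at 1, products of right
  multiplications already attain every value. A count of real dimensions then shows that these
  products are independent.

  Real irreducibility is delicate in dimensions 6 and 16, where the complexification splits. An
  antilinear map exchanges (j, k) and (k, j), and on a real vector the second component is the image
  of the first under it. So a non-zero real invariant subspace projects non-trivially to both
  summands, and for j > k each of the two dominates the other in one spin. Applied to the whole
  tensor space, the same argument gives surjectivity without a dimension count.

  A frame of opposite orientation exchanges the two spins. Since all listed types are symmetric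
  under this exchange, they can hold for every orthonormal frame.\<close>

lemma num4_eq_0: "(4::4) = 0"
  by simp

text \<open>\<open>forall_4\<close> ranges over 1, 2, 3, 4; as 4 equals 0 in this type, the range
  becomes 0, 1, 2, 3.\<close>

lemma all4: "(\<forall>a::4. P a) \<longleftrightarrow> P 0 \<and> P 1 \<and> P 2 \<and> P 3"
  using forall_4[of P, unfolded num4_eq_0] by blast

section \<open>Bilinearity of matrix products\<close>

lemma matrix_add_rdistrib': "(A + B) ** C = A ** C + B ** C"
  for A B :: "'a::ring_1^'n^'m"
  by (simp add: vec_eq_iff matrix_matrix_mult_def algebra_simps sum.distrib)

lemma matrix_minus_mult_left: "(- A) ** B = - (A ** B)"
  and matrix_minus_mult_right: "A ** (- B) = - (A ** B)"
  for A :: "'a::ring_1^'n^'m" and B :: "'a^'k^'n"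
  by (simp_all add: vec_eq_iff matrix_matrix_mult_def sum_negf)

lemma matrix_diff_ldistrib: "A ** (B - C) = A ** B - A ** C"
  and matrix_diff_rdistrib: "(A' - B') ** C = A' ** C - B' ** C"
  for A A' B' :: "'a::ring_1^'n^'m"
  by (simp_all add: vec_eq_iff matrix_matrix_mult_def algebra_simps sum_subtractf)

lemma matrix_scaleR_left: "(k *\<^sub>R A) ** B = k *\<^sub>R (A ** B)"
  and matrix_scaleR_right: "A ** (k *\<^sub>R B) = k *\<^sub>R (A ** B)"
  for A :: "'a::real_algebra_1^'n^'m" and B :: "'a^'k^'n"
  by (simp_all add: vec_eq_iff matrix_matrix_mult_def scaleR_sum_right)

lemma matrix_mul_rsum: "A ** sum f S = (\<Sum>i\<in>S. A ** f i)"
  for A :: "'a::ring_1^'n^'m"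
  by (induction S rule: infinite_finite_induct) (simp_all add: matrix_add_ldistrib)

lemma matrix_mul_lsum: "sum f S ** A = (\<Sum>i\<in>S. f i ** A)"
  for A :: "'a::ring_1^'n^'m"
  by (induction S rule: infinite_finite_induct) (simp_all add: matrix_add_rdistrib')

lemma matrix_vector_lsum: "sum f S *v x = (\<Sum>i\<in>S. f i *v x)"
  for x :: "'a::ring_1^'n"
  by (induction S rule: infinite_finite_induct) (simp_all add: matrix_vector_mult_add_rdistrib)

lemma matrix_vector_rsum: "A *v sum f S = (\<Sum>i\<in>S. A *v f i)"
  for A :: "'a::ring_1^'n^'m"
  by (induction S rule: infinite_finite_induct) (simp_all add: matrix_vector_right_distrib)

lemma matrix_vector_scaleR_left: "(k *\<^sub>R A) *v x = k *\<^sub>R (A *v x)"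
  for A :: "'a::real_algebra_1^'n^'m"
  by (simp add: vec_eq_iff matrix_vector_mult_def scaleR_sum_right)

lemma matrix_vector_scaleR_right: "A *v (k *\<^sub>R x) = k *\<^sub>R (A *v x)"
  for A :: "'a::real_algebra_1^'n^'m"
  by (simp add: vec_eq_iff matrix_vector_mult_def scaleR_sum_right)

lemma matrix_vector_minus_left: "(- A) *v x = - (A *v x)"
  and matrix_vector_minus_right: "A *v (- x) = - (A *v x)"
  for A :: "'a::ring_1^'n^'m"
  by (simp_all add: vec_eq_iff matrix_vector_mult_def sum_negf)

lemmas mat_distrib = matrix_add_ldistrib matrix_add_rdistrib' matrix_minus_mult_left
  matrix_minus_mult_right matrix_diff_ldistrib matrix_diff_rdistrib
  matrix_scaleR_left matrix_scaleR_right

lemmas matvec_distrib = matrix_vector_mult_add_rdistrib matrix_vector_mult_diff_rdistrib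
  matrix_vector_right_distrib matrix_vector_mult_diff_distrib
  matrix_vector_scaleR_left matrix_vector_scaleR_right
  matrix_vector_minus_left matrix_vector_minus_right

section \<open>Creation, annihilation, parity and the imaginary unit as matrices\<close>

definition below :: "4 \<Rightarrow> 4 set \<Rightarrow> complex" where
  "below a A = (-1) ^ card {b \<in> A. b < a}"

lemma below_insert: "b \<notin> A \<Longrightarrow> below a (insert b A) = (if b < a then - below a A else below a A)"
proof -
  assume "b \<notin> A"
  have "{x \<in> insert b A. x < a} = (if b < a then insert b {x \<in> A. x < a} else {x \<in> A. x < a})"
    by auto
  then show ?thesis using \<open>b \<notin> A\<close> by (simp add: below_def)
qed

lemma below_remove: "b \<in> A \<Longrightarrow> below a (A - {b}) = (if b < a then - below a A else below a A)"
  using below_insert[of b "A - {b}" a] by (auto simp: insert_absorb split: if_splits)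

lemma below_square: "below a A * below a A = 1"
  by (simp add: below_def flip: power_mult_distrib)

text \<open>Column \<open>A\<close> is the image of the basis vector at \<open>A\<close>: e_a has to
  pass the factors of smaller index. \<open>below\<close> never counts \<open>a\<close> itself, so
  the same sign serves for the removal of \<open>a\<close> in \<open>ann\<close>, the metric-free
  contraction.\<close>

definition cre :: "4 \<Rightarrow> extop" where
  "cre a = (\<chi> B A. if a \<notin> A \<and> B = insert a A then below a A else 0)"

definition ann :: "4 \<Rightarrow> extop" where
  "ann a = (\<chi> B A. if a \<in> A \<and> B = A - {a} then below a A else 0)"

definition parity_op :: extop where
  "parity_op = (\<chi> B A. if B = A then (-1) ^ card A else 0)"

text \<open>Multiplication by i as a matrix, so that scalars can stay real throughout:
  representations, spans and dimensions are all over the reals.\<close>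

definition II :: extop where
  "II = mat \<i>"

lemma cre_nth: "(cre a *v x) $ B = (if a \<in> B then below a B * x $ (B - {a}) else 0)"
proof -
  have "(cre a *v x) $ B = (\<Sum>A\<in>UNIV. if A = B - {a} then (if a \<in> B then below a B * x $ (B - {a}) else 0) else 0)"
    unfolding matrix_vector_mult_def cre_def vec_lambda_beta
    by (rule sum.cong) (auto simp: below_remove below_insert)
  then show ?thesis by simp
qed

lemma ann_nth: "(ann a *v x) $ B = (if a \<notin> B then below a B * x $ (insert a B) else 0)"
proof -
  have "(ann a *v x) $ B = (\<Sum>A\<in>UNIV. if A = insert a B then (if a \<notin> B then below a B * x $ (insert a B) else 0) else 0)"
    unfolding matrix_vector_mult_def ann_def vec_lambda_beta
    by (rule sum.cong) (auto simp: below_remove below_insert insert_absorb)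
  then show ?thesis by simp
qed

lemma parity_nth: "(parity_op *v x) $ B = (-1) ^ card B * x $ B"
proof -
  have "(parity_op *v x) $ B = (\<Sum>A\<in>UNIV. if A = B then (-1) ^ card B * x $ B else 0)"
    unfolding matrix_vector_mult_def parity_op_def vec_lambda_beta by (rule sum.cong) auto
  then show ?thesis by simp
qed

lemma II_nth: "(II *v x) $ B = \<i> * x $ B"
proof -
  have "(II *v x) $ B = (\<Sum>A\<in>UNIV. if A = B then \<i> * x $ B else 0)"
    unfolding matrix_vector_mult_def II_def mat_def vec_lambda_beta by (rule sum.cong) auto
  then show ?thesis by simp
qed

lemmas op_nths = cre_nth ann_nth parity_nth II_nth

text \<open>Of the signs \<open>below a\<close> and \<open>below b\<close>, exactly one changes when
  the other index is removed first; this is the minus sign.\<close>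

lemma cre_cre: "cre a ** cre b = - (cre b ** cre a)"
  unfolding matrix_eq
proof (intro allI)
  fix x :: ext
  show "(cre a ** cre b) *v x = (- (cre b ** cre a)) *v x"
    by (cases a b rule: linorder_cases)
       (auto simp: vec_eq_iff op_nths matrix_vector_minus_left matrix_vector_mul_assoc[symmetric] below_remove
         Diff_insert2[symmetric] insert_commute)
qed

lemma ann_ann: "ann a ** ann b = - (ann b ** ann a)"
  unfolding matrix_eq
proof (intro allI)
  fix x :: ext
  show "(ann a ** ann b) *v x = (- (ann b ** ann a)) *v x"
    by (cases a b rule: linorder_cases)
       (auto simp: vec_eq_iff op_nths matrix_vector_minus_left matrix_vector_mul_assoc[symmetric] below_insert
         insert_commute)
qed

text \<open>The canonical anticommutation relation. For \<open>a = b\<close>, exactly one of the two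
  products survives at each coordinate, and there the sign occurs squared.\<close>

lemma ann_cre: "ann a ** cre b = (if a = b then mat 1 else 0) - cre b ** ann a"
  unfolding matrix_eq
proof (intro allI)
  fix x :: ext
  show "(ann a ** cre b) *v x = ((if a = b then mat 1 else 0) - cre b ** ann a) *v x"
  proof (cases "a = b")
    case True
    then show ?thesis
      by (auto simp: vec_eq_iff op_nths matvec_distrib matrix_vector_mul_assoc[symmetric] below_insert
         below_remove insert_absorb mult.assoc[symmetric] below_square)
  next
    case False
    then show ?thesis
      by (cases a b rule: linorder_cases)
         (auto simp: vec_eq_iff op_nths matvec_distrib matrix_vector_mul_assoc[symmetric] below_insert
         below_remove insert_Diff_if)
  qed
qed

lemma parity_cre: "parity_op ** cre a = - (cre a ** parity_op)"
  unfolding matrix_eq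
proof (intro allI)
  fix x :: ext
  have "(-1::complex) ^ (card B - Suc 0) = - ((-1) ^ card B)" if "a \<in> B" for B :: "4 set"
  proof -
    have "card B \<noteq> 0" using that by auto
    then obtain n where "card B = Suc n" using not0_implies_Suc by blast
    then show ?thesis by simp
  qed
  then show "(parity_op ** cre a) *v x = (- (cre a ** parity_op)) *v x"
    by (auto simp: vec_eq_iff op_nths matvec_distrib matrix_vector_mul_assoc[symmetric])
qed

lemma parity_ann: "parity_op ** ann a = - (ann a ** parity_op)"
  unfolding matrix_eq
  by (auto simp: vec_eq_iff op_nths matvec_distrib matrix_vector_mul_assoc[symmetric])

lemma parity_parity: "parity_op ** parity_op = mat 1"
  unfolding matrix_eq
  by (auto simp: vec_eq_iff op_nths matvec_distrib matrix_vector_mul_assoc[symmetric]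
    mult.assoc[symmetric] power_mult_distrib[symmetric])

lemma II_II: "II ** II = - mat 1"
  unfolding matrix_eq
  by (auto simp: vec_eq_iff op_nths matvec_distrib matrix_vector_mul_assoc[symmetric])

lemma II_central: "II ** M = M ** II"
  by (auto simp: vec_eq_iff II_def mat_def matrix_matrix_mult_def if_distrib if_distribR mult.commute cong: if_cong)

lemma ann_one: "ann a *v ext_one = 0"
  by (auto simp: vec_eq_iff op_nths ext_one_def axis_def)

lemma parity_one: "parity_op *v ext_one = ext_one"
  by (auto simp: vec_eq_iff op_nths ext_one_def axis_def)

section \<open>Wedge products with vectors as operators\<close>

lemma wedge_add_left: "wedge (x + y) z = wedge x z + wedge y z"
  by (simp add: wedge_def vec_eq_iff algebra_simps sum.distrib)

lemma wedge_scaleR_left: "wedge (c *\<^sub>R x) z = c *\<^sub>R wedge x z"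
  by (simp add: wedge_def vec_eq_iff algebra_simps scaleR_sum_right)

lemma wedge_zero_left: "wedge 0 z = 0"
  by (simp add: wedge_def vec_eq_iff)

lemma wedge_sum_left: "wedge (sum f S) z = (\<Sum>i\<in>S. wedge (f i) z)"
  by (induction S rule: infinite_finite_induct) (simp_all add: wedge_zero_left wedge_add_left)

text \<open>The inversions counted by \<open>wedge_basis\<close> for a singleton on the left are the
  elements counted by \<open>below\<close>. From here on wedge products are applications of
  \<open>cre\<close>.\<close>

lemma wedge_ext_e: "wedge (ext_e a) x = cre a *v x"
proof -
  have c: "card {(u, b). u = a \<and> b \<in> B \<and> b < u} = card {b \<in> B. b < a}" for B :: "4 set"
  proof -
    have "{(u, b). u = a \<and> b \<in> B \<and> b < u} = Pair a ` {b \<in> B. b < a}" by auto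
    then show ?thesis by (simp add: card_image inj_on_def)
  qed
  have "wedge (ext_e a) x = (\<Sum>A\<in>UNIV. if A = {a} then (\<Sum>B\<in>UNIV. x $ B *s wedge_basis {a} B) else 0)"
    unfolding wedge_def ext_e_def by (intro sum.cong) (auto simp: axis_def)
  also have "\<dots> = (\<Sum>B\<in>UNIV. x $ B *s wedge_basis {a} B)" by simp
  also have "\<dots> = cre a *v x"
    by (auto simp: vec_eq_iff cre_def matrix_vector_mult_def wedge_basis_def c below_def axis_def
      intro!: sum.cong)
  finally show ?thesis .
qed

lemma eI_Nil [simp]: "eI [] = ext_one"
  by (simp add: eI_def)

lemma eI_Cons [simp]: "eI (a # I) = cre a *v eI I"
  by (simp add: eI_def wedge_ext_e)

lemma eI_sorted: "sorted_wrt (<) I \<Longrightarrow> eI I = axis (set I) 1"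
proof (induction I)
  case Nil
  then show ?case by (simp add: ext_one_def)
next
  case (Cons a I)
  have "below a (insert a (set I)) = 1"
  proof -
    have "{b \<in> insert a (set I). b < a} = {}" using Cons.prems by auto
    then show ?thesis unfolding below_def by (simp only: card.empty power_0)
  qed
  moreover have "a \<notin> set I" using Cons.prems by auto
  ultimately show ?case using Cons by (auto simp: vec_eq_iff op_nths axis_def)
qed

lemma eI_sorted_list_of_set: "eI (sorted_list_of_set A) = axis A 1"
  by (subst eI_sorted) auto

lemma axis_matrix: "(M *v axis A 1) $ B = M $ B $ A" for M :: "'a::ring_1^'n^'m"
proof -
  have "(M *v axis A 1) $ B = (\<Sum>C\<in>UNIV. if C = A then M $ B $ A else 0)"
    unfolding matrix_vector_mult_def vec_lambda_beta by (rule sum.cong) (auto simp: axis_def)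
  then show ?thesis by simp
qed

lemma op_on_basis_eqI:
  assumes "\<And>I. F I = M *v eI I"
  shows "op_on_basis F = M"
  by (simp add: vec_eq_iff op_on_basis_def assms eI_sorted_list_of_set axis_matrix)

section \<open>Contractions, gamma matrices and derivations\<close>

definition iota :: "real^4^4 \<Rightarrow> 4 \<Rightarrow> extop" where
  "iota g a = (\<Sum>b\<in>UNIV. (g $ a $ b) *\<^sub>R ann b)"

lemma iota_cre: "iota g a ** cre b = (g $ a $ b) *\<^sub>R mat 1 - cre b ** iota g a"
proof -
  have "iota g a ** cre b = (\<Sum>c\<in>UNIV. (g $ a $ c) *\<^sub>R (if c = b then mat 1 else 0)) - cre b ** iota g a"
    by (simp add: iota_def matrix_mul_lsum matrix_mul_rsum ann_cre mat_distrib scaleR_diff_right sum_subtractf)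
  also have "(\<Sum>c\<in>UNIV. (g $ a $ c) *\<^sub>R (if c = b then mat 1 else (0::extop)))
      = (\<Sum>c\<in>UNIV. if c = b then (g $ a $ b) *\<^sub>R mat 1 else (0::extop))"
    by (intro sum.cong) auto
  finally show ?thesis by simp
qed

lemma iota_iota: "iota g a ** iota g b = - (iota g b ** iota g a)"
proof -
  have "iota g a ** iota g b = (\<Sum>d\<in>UNIV. \<Sum>c\<in>UNIV. (g $ a $ c * g $ b $ d) *\<^sub>R (ann c ** ann d))"
    by (simp add: iota_def matrix_mul_lsum matrix_mul_rsum mat_distrib mult.commute scaleR_sum_right)
  also have "\<dots> = (\<Sum>c\<in>UNIV. \<Sum>d\<in>UNIV. (g $ a $ c * g $ b $ d) *\<^sub>R (ann c ** ann d))"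
    by (rule sum.swap)
  also have "\<dots> = - (iota g b ** iota g a)"
    unfolding iota_def
    by (subst ann_ann) (simp add: matrix_mul_lsum matrix_mul_rsum mat_distrib mult.commute sum_negf scaleR_sum_right)
  finally show ?thesis .
qed

lemma parity_iota: "parity_op ** iota g a = - (iota g a ** parity_op)"
  by (simp add: iota_def matrix_mul_lsum matrix_mul_rsum parity_ann mat_distrib sum_negf)

lemma iota_one: "iota g a *v ext_one = 0"
  by (simp add: iota_def matrix_vector_lsum matvec_distrib ann_one)

text \<open>The recursion of \<open>iota_list\<close> is the relation \<open>iota_cre\<close>
  applied to e_I.\<close>

lemma iota_list_eq: "iota_list g a I = iota g a *v eI I"
  by (induction I)
    (simp_all add: iota_one wedge_ext_e matrix_vector_mul_assoc iota_cre matvec_distrib)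

lemma gamma_lower_eq: "gamma_lower g a = cre a - iota g a"
  unfolding gamma_lower_def
  by (rule op_on_basis_eqI) (simp add: wedge_ext_e iota_list_eq matvec_distrib)

text \<open>Second quantization of \<open>L\<close>: the derivation extending \<open>L\<close>
  replaces one factor at a time, that is, it annihilates e_a and creates the image of e_a.\<close>

definition hatm :: "real^4^4 \<Rightarrow> extop" where
  "hatm L = (\<Sum>a\<in>UNIV. \<Sum>b\<in>UNIV. (L $ b $ a) *\<^sub>R (cre b ** ann a))"

lemma hatm_cre: "hatm L ** cre c = cre c ** hatm L + (\<Sum>b\<in>UNIV. (L $ b $ c) *\<^sub>R cre b)"
proof -
  have *: "cre b ** ann a ** cre c = (if a = c then cre b else 0) + cre c ** (cre b ** ann a)" for a b
  proof -
    have "cre b ** ann a ** cre c = cre b ** (ann a ** cre c)" by (simp add: matrix_mul_assoc)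
    also have "\<dots> = (if a = c then cre b else 0) - (cre b ** cre c) ** ann a"
      by (simp add: ann_cre mat_distrib matrix_mul_assoc)
    also have "(cre b ** cre c) ** ann a = - (cre c ** (cre b ** ann a))"
      by (subst cre_cre) (simp add: mat_distrib matrix_mul_assoc)
    finally show ?thesis by simp
  qed
  have "hatm L ** cre c = (\<Sum>a\<in>UNIV. if a = c then \<Sum>b\<in>UNIV. (L $ b $ c) *\<^sub>R cre b else 0) + cre c ** hatm L"
    unfolding hatm_def matrix_mul_lsum matrix_mul_rsum sum.distrib[symmetric]
    by (intro sum.cong refl)
       (auto simp: matrix_mul_lsum matrix_mul_rsum sum.distrib[symmetric] * mat_distrib scaleR_add_right)
  then show ?thesis by simp
qed

text \<open>Annihilators transform contragrediently to \<open>cre\<close>: the other index of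
  \<open>L\<close> is summed, with the opposite sign.\<close>

lemma hatm_ann: "hatm L ** ann c = ann c ** hatm L - (\<Sum>a\<in>UNIV. (L $ c $ a) *\<^sub>R ann a)"
proof -
  have *: "cre b ** ann a ** ann c = ann c ** (cre b ** ann a) - (if b = c then ann a else 0)" for a b
  proof -
    have "ann c ** (cre b ** ann a) = (ann c ** cre b) ** ann a" by (simp add: matrix_mul_assoc)
    also have "\<dots> = (if b = c then ann a else 0) - cre b ** (ann c ** ann a)"
      by (simp add: ann_cre mat_distrib matrix_mul_assoc)
    also have "cre b ** (ann c ** ann a) = - (cre b ** ann a ** ann c)"
      by (subst ann_ann) (simp add: mat_distrib matrix_mul_assoc)
    finally show ?thesis by simp
  qed
  have **: "(\<Sum>b\<in>UNIV. (L $ b $ a) *\<^sub>R (if b = c then ann a else 0)) = (L $ c $ a) *\<^sub>R ann a" for a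
  proof -
    have "(\<Sum>b\<in>UNIV. (L $ b $ a) *\<^sub>R (if b = c then ann a else 0)) = (\<Sum>b\<in>UNIV. if b = c then (L $ c $ a) *\<^sub>R ann a else 0)"
      by (intro sum.cong) auto
    then show ?thesis by simp
  qed
  show ?thesis
    by (simp add: hatm_def matrix_mul_lsum matrix_mul_rsum mat_distrib * scaleR_diff_right sum_subtractf **)
qed

lemma hatm_one: "hatm L *v ext_one = 0"
  by (simp add: hatm_def matrix_vector_lsum matvec_distrib matrix_vector_mul_assoc[symmetric] ann_one)

lemma wedge_vec_act: "wedge (vec_act L c) x = (\<Sum>b\<in>UNIV. (L $ b $ c) *\<^sub>R cre b) *v x"
  by (simp add: vec_act_def wedge_sum_left wedge_scaleR_left wedge_ext_e matrix_vector_lsum matvec_distrib)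

text \<open>Replacing the head of the list gives the extra term of \<open>hatm_cre\<close>;
  replacing a later factor is the induction hypothesis under \<open>cre c\<close>.\<close>

lemma hat_op_list:
  "(\<Sum>i<length I. wedges ((map ext_e I)[i := vec_act L (I ! i)])) = hatm L *v eI I"
proof (induction I)
  case Nil
  then show ?case by (simp add: hatm_one)
next
  case (Cons c I)
  have "(\<Sum>i<length (c # I). wedges ((map ext_e (c # I))[i := vec_act L ((c # I) ! i)]))
    = wedge (vec_act L c) (eI I) + (\<Sum>i<length I. wedge (ext_e c) (wedges ((map ext_e I)[i := vec_act L (I ! i)])))"
    by (simp add: sum.lessThan_Suc_shift eI_def del: sum.lessThan_Suc)
  also have "\<dots> = (\<Sum>b\<in>UNIV. (L $ b $ c) *\<^sub>R cre b) *v eI I + cre c *v (hatm L *v eI I)"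
    by (simp add: wedge_vec_act wedge_ext_e Cons.IH[symmetric] matrix_vector_rsum)
  also have "\<dots> = hatm L *v eI (c # I)"
    by (simp add: matrix_vector_mul_assoc hatm_cre matvec_distrib)
  finally show ?case .
qed

lemma hat_op_eq: "hat_op L = hatm L"
  unfolding hat_op_def by (rule op_on_basis_eqI) (rule hat_op_list)

section \<open>The extended metric\<close>

subsection \<open>Leibniz determinants of size at most four\<close>

text \<open>The entries form a function on naturals because the size of a minor is not fixed by a
  type and rows and columns have to be deleted.\<close>

definition leib :: "nat \<Rightarrow> (nat \<Rightarrow> nat \<Rightarrow> real) \<Rightarrow> real" where
  "leib n a = (\<Sum>p | p permutes {..<n}. of_int (sign p) * (\<Prod>i<n. a i (p i)))"

lemma minor_det_leib: "minor_det g I J = leib (length I) (\<lambda>i j. g $ (I ! i) $ (J ! j))"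
  by (simp add: minor_det_def leib_def)

lemma leib_cong:
  assumes "\<And>i j. i < n \<Longrightarrow> j < n \<Longrightarrow> a i j = b i j"
  shows "leib n a = leib n b"
  unfolding leib_def
proof (intro sum.cong refl arg_cong2[where f = "(*)"] prod.cong)
  fix p i assume "p \<in> {p. p permutes {..<n}}" "i \<in> {..<n}"
  then show "a i (p i) = b i (p i)" using assms permutes_in_image[of p "{..<n}" i] by auto
qed

lemma leib_0: "leib 0 a = 1"
  by (simp add: leib_def)

lemma leib_1: "leib (Suc 0) a = a 0 0"
proof -
  have e: "{..<Suc 0} = {0}" by auto
  show ?thesis by (simp add: leib_def e sign_id)
qed

lemma leib_2: "leib (Suc (Suc 0)) a = a 0 0 * a 1 1 - a 0 1 * a 1 0"
proof -
  have e: "{..<Suc (Suc 0)} = insert 0 {1}" by auto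
  show ?thesis
    unfolding leib_def e
    by (subst sum_over_permutations_insert, simp_all)+
       (simp add: sign_compose permutation_swap_id sign_swap_id sign_id transpose_def)
qed

lemma leib_3: "leib (Suc (Suc (Suc 0))) a =
   a 0 0 * (a 1 1 * a 2 2 - a 1 2 * a 2 1) - a 0 1 * (a 1 0 * a 2 2 - a 1 2 * a 2 0)
   + a 0 2 * (a 1 0 * a 2 1 - a 1 1 * a 2 0)"
proof -
  have e: "{..<Suc (Suc (Suc 0))} = insert 0 (insert 1 {2})" by auto
  have f: "finite (insert 1 {2::nat})" "(0::nat) \<notin> insert 1 {2}" "finite {2::nat}" "(1::nat) \<notin> {2}"
    by auto
  show ?thesis
    unfolding leib_def e sum_over_permutations_insert[OF f(1,2)] sum_over_permutations_insert[OF f(3,4)]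
    by (simp add: sign_compose permutation_compose permutation_swap_id sign_swap_id sign_id transpose_def algebra_simps)
qed

lemma leib_4: "leib (Suc (Suc (Suc (Suc 0)))) a =
   (\<Sum>j<4. (-1) ^ j * a 0 j * leib 3 (\<lambda>i k. a (Suc i) (if k < j then k else Suc k)))"
proof -
  have e: "{..<Suc (Suc (Suc (Suc 0)))} = insert 0 (insert 1 (insert 2 {3}))" by auto
  have f: "finite (insert 1 (insert 2 {3::nat}))" "(0::nat) \<notin> insert 1 (insert 2 {3})"
    "finite (insert 2 {3::nat})" "(1::nat) \<notin> insert 2 {3}" "finite {3::nat}" "(2::nat) \<notin> {3}"
    by auto
  show ?thesis
    unfolding leib_def[of "Suc (Suc (Suc (Suc 0)))"] e sum_over_permutations_insert[OF f(1,2)]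
      sum_over_permutations_insert[OF f(3,4)] sum_over_permutations_insert[OF f(5,6)]
    by (simp add: sign_compose permutation_compose permutation_swap_id sign_swap_id sign_id transpose_def
        leib_3 eval_nat_numeral) (simp add: algebra_simps eval_nat_numeral)
qed

text \<open>Expansion along the first row. Minors of a metric in dimension four have size at most
  four, so it suffices to compare the explicit polynomials.\<close>

lemma leib_laplace:
  assumes "n < 4"
  shows "leib (Suc n) a =
    (\<Sum>j<Suc n. (-1) ^ j * a 0 j * leib n (\<lambda>i k. a (Suc i) (if k < j then k else Suc k)))"
proof -
  have "n = 0 \<or> n = 1 \<or> n = 2 \<or> n = 3" using assms by auto
  then show ?thesis
    using leib_4[of a]
    by (auto simp: leib_0 leib_1 leib_2 leib_3 eval_nat_numeral algebra_simps simp del: sum.lessThan_Suc)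
       (simp_all add: leib_0 leib_1 leib_2 leib_3 eval_nat_numeral algebra_simps)
qed

lemma leib_transpose:
  assumes "n \<le> 4"
  shows "leib n (\<lambda>i j. a j i) = leib n a"
proof -
  have "n = 0 \<or> n = 1 \<or> n = 2 \<or> n = 3 \<or> n = 4" using assms by auto
  then show ?thesis
    by (auto simp: leib_0 leib_1 leib_2 leib_3 leib_4 eval_nat_numeral algebra_simps)
qed


subsection \<open>Words in anticommuting operators\<close>

definition anticommuting :: "(4 \<Rightarrow> extop) \<Rightarrow> bool" where
  "anticommuting f \<longleftrightarrow> (\<forall>a b. f a ** f b = - (f b ** f a))"

text \<open>For \<open>cre\<close> this is \<open>eI\<close>; for \<open>cre_g g\<close> below it is
  the image of \<open>eI\<close> under the extended metric. Reordering a word uses only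
  anticommutation, hence has the same effect in both cases.\<close>

definition word :: "(4 \<Rightarrow> extop) \<Rightarrow> 4 list \<Rightarrow> ext" where
  "word f I = foldr (\<lambda>a x. f a *v x) I ext_one"

lemma word_simps [simp]: "word f [] = ext_one" "word f (a # I) = f a *v word f I"
  by (simp_all add: word_def)

lemma word_cre: "word cre I = eI I"
  by (induction I) simp_all

lemma anticommuting_cre: "anticommuting cre"
  unfolding anticommuting_def by (intro allI cre_cre)

text \<open>One step of insertion sort. The scalar and the sorted list are chosen before
  \<open>f\<close>, so that the same reordering applies to several families at once; a repeated
  index gives the scalar 0.\<close>

lemma word_insert:
  assumes "sorted_wrt (<) J"
  shows "\<exists>(s::real) J'. sorted_wrt (<) J' \<and> set J' \<subseteq> insert a (set J) \<and>
    (\<forall>f. anticommuting f \<longrightarrow> word f (a # J) = s *\<^sub>R word f J')"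
  using assms
proof (induction J)
  case Nil
  show ?case by (rule exI[of _ 1], rule exI[of _ "[a]"]) simp
next
  case (Cons h J)
  have sq: "f h *v (f h *v x) = 0" and sw: "f a *v (f h *v x) = - (f h *v (f a *v x))"
    if "anticommuting f" for f and x :: ext
  proof -
    show "f a *v (f h *v x) = - (f h *v (f a *v x))"
      unfolding matrix_vector_mul_assoc using that[unfolded anticommuting_def, rule_format, of a h]
      by (metis matrix_vector_minus_left)
    have "f h *v (f h *v x) = - (f h *v (f h *v x))"
      unfolding matrix_vector_mul_assoc using that[unfolded anticommuting_def, rule_format, of h h]
      by (metis matrix_vector_minus_left)
    then show "f h *v (f h *v x) = 0" by (simp add: vec_eq_iff)
  qed
  consider "a < h" | "a = h" | "h < a" by fastforce
  then show ?case
  proof cases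
    case 1
    with Cons.prems have "sorted_wrt (<) (a # h # J)" by auto
    then show ?thesis by (intro exI[of _ 1] exI[of _ "a # h # J"]) auto
  next
    case 2
    then show ?thesis by (intro exI[of _ 0] exI[of _ "[]"]) (simp add: sq)
  next
    case 3
    from Cons obtain s J' where J: "sorted_wrt (<) J'" "set J' \<subseteq> insert a (set J)"
      "\<And>f. anticommuting f \<Longrightarrow> f a *v word f J = s *\<^sub>R word f J'" by auto
    have "sorted_wrt (<) (h # J')" using J(1,2) 3 Cons.prems by auto
    moreover have "word f (a # h # J) = (- s) *\<^sub>R word f (h # J')" if "anticommuting f" for f
      using that by (simp add: sw J(3) matvec_distrib)
    ultimately show ?thesis using J(2) by (intro exI[of _ "- s"] exI[of _ "h # J'"]) auto
  qed
qed

lemma word_sort: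
  "\<exists>(s::real) J. sorted_wrt (<) J \<and> (\<forall>f. anticommuting f \<longrightarrow> word f I = s *\<^sub>R word f J)"
proof (induction I)
  case Nil
  show ?case by (rule exI[of _ 1], rule exI[of _ "[]"]) simp
next
  case (Cons a I)
  then obtain s J where J: "sorted_wrt (<) J" "\<And>f. anticommuting f \<Longrightarrow> word f I = s *\<^sub>R word f J"
    by blast
  from word_insert[OF J(1), of a] obtain t J' where J': "sorted_wrt (<) J'"
    "\<And>f. anticommuting f \<Longrightarrow> f a *v word f J = t *\<^sub>R word f J'" by auto
  have "word f (a # I) = (s * t) *\<^sub>R word f J'" if "anticommuting f" for f
    using that by (simp add: J(2) J'(2) matvec_distrib)
  with J'(1) show ?case by blast
qed

lemma matrix_eq_on_eI:
  assumes "\<And>I. M *v eI I = N *v eI I"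
  shows "M = N"
proof -
  have "(M *v axis A 1) $ B = (N *v axis A 1) $ B" for A B
    using assms[of "sorted_list_of_set A"] by (simp add: eI_sorted_list_of_set)
  then show ?thesis by (simp add: axis_matrix vec_eq_iff)
qed

subsection \<open>The extended metric as an exterior power\<close>

definition cre_g :: "real^4^4 \<Rightarrow> 4 \<Rightarrow> extop" where
  "cre_g g a = (\<Sum>b\<in>UNIV. (g $ a $ b) *\<^sub>R cre b)"

lemma anticommuting_cre_g: "anticommuting (cre_g g)"
  unfolding anticommuting_def
proof (intro allI)
  fix a b
  have "cre_g g a ** cre_g g b = (\<Sum>d\<in>UNIV. \<Sum>c\<in>UNIV. (g $ a $ c * g $ b $ d) *\<^sub>R (cre c ** cre d))"
    by (simp add: cre_g_def matrix_mul_lsum matrix_mul_rsum mat_distrib mult.commute scaleR_sum_right)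
  also have "\<dots> = (\<Sum>c\<in>UNIV. \<Sum>d\<in>UNIV. (g $ a $ c * g $ b $ d) *\<^sub>R (cre c ** cre d))"
    by (rule sum.swap)
  also have "\<dots> = - (cre_g g b ** cre_g g a)"
    unfolding cre_g_def
    by (subst cre_cre) (simp add: matrix_mul_lsum matrix_mul_rsum mat_distrib mult.commute sum_negf scaleR_sum_right)
  finally show "cre_g g a ** cre_g g b = - (cre_g g b ** cre_g g a)" .
qed

text \<open>In a sorted list, exactly the \<open>j\<close> earlier entries are smaller; this turns
  the sign of contraction into the sign of the Laplace expansion.\<close>

lemma below_sorted_nth:
  assumes "sorted_wrt (<) J" "j < length J"
  shows "below (J ! j) (set J) = (-1) ^ j"
proof -
  have d: "distinct J" using assms(1) strict_sorted_iff by blast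
  have "{b \<in> set J. b < J ! j} = (!) J ` {..<j}"
  proof (intro set_eqI iffI)
    fix b assume "b \<in> {b \<in> set J. b < J ! j}"
    then obtain i where i: "i < length J" "b = J ! i" "J ! i < J ! j" by (auto simp: in_set_conv_nth)
    have "i < j"
    proof (rule ccontr)
      assume "\<not> i < j"
      then have "J ! j \<le> J ! i" using assms(1) i(1) sorted_wrt_nth_less[OF assms(1), of j i]
        by (cases "i = j") auto
      with i(3) show False by simp
    qed
    with i show "b \<in> (!) J ` {..<j}" by auto
  qed (use assms sorted_wrt_nth_less[OF assms(1)] in auto)
  moreover have "card ((!) J ` {..<j}) = j"
    using d assms(2) by (subst card_image) (auto simp: inj_on_def nth_eq_iff_index_eq)
  ultimately show ?thesis by (simp add: below_def)
qed

definition del :: "nat \<Rightarrow> 'a list \<Rightarrow> 'a list" where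
  "del j J = take j J @ drop (Suc j) J"

lemma del_nth: "j < length J \<Longrightarrow> k < length J - 1 \<Longrightarrow> del j J ! k = J ! (if k < j then k else Suc k)"
  by (auto simp: del_def nth_append min_def)

lemma length_del: "j < length J \<Longrightarrow> length (del j J) = length J - 1"
  by (auto simp: del_def)

lemma sorted_del: 
  assumes "sorted_wrt (<) J"
  shows "sorted_wrt (<) (del j J)"
proof (cases "j < length J")
  case True
  then have "J = take j J @ J ! j # drop (Suc j) J" by (rule id_take_nth_drop)
  then have "sorted_wrt (<) (take j J @ J ! j # drop (Suc j) J)" using assms by simp
  then show ?thesis by (auto simp: del_def sorted_wrt_append)
qed (use assms in \<open>simp add: del_def\<close>)

lemma set_del:
  assumes "distinct J" "j < length J"
  shows "set (del j J) = set J - {J ! j}"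
proof -
  have "J = take j J @ J ! j # drop (Suc j) J" using assms(2) by (rule id_take_nth_drop)
  then have "distinct (take j J @ J ! j # drop (Suc j) J)"
    and "set J = set (take j J @ J ! j # drop (Suc j) J)" using assms(1) by simp_all
  then show ?thesis by (auto simp: del_def)
qed

text \<open>Induction on \<open>I\<close>: the outermost operator \<open>cre_g g a\<close> runs
  through the entries of the first row of the minor, and removing \<open>J ! j\<close> from the
  index set deletes column \<open>j\<close>. This is \<open>leib_laplace\<close>, whence the bound
  on the length.\<close>

lemma word_cre_g_entry:
  assumes "sorted_wrt (<) J"
  shows "length I \<le> 4 \<Longrightarrow> word (cre_g g) I $ set J = (if length I = length J then of_real (minor_det g I J) else 0)"
  using assms
proof (induction I arbitrary: J)
  case Nil
  then show ?case by (auto simp: ext_one_def axis_def minor_det_leib leib_0)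
next
  case (Cons a I)
  have d: "distinct J" using Cons.prems(2) strict_sorted_iff by blast
  have "word (cre_g g) (a # I) $ set J =
      (\<Sum>b\<in>UNIV. of_real (g $ a $ b) * (if b \<in> set J then below b (set J) * word (cre_g g) I $ (set J - {b}) else 0))"
    by (simp add: cre_g_def[of g a] matrix_vector_lsum matvec_distrib cre_nth scaleR_conv_of_real[symmetric])
  also have "\<dots> = (\<Sum>b\<in>set J. of_real (g $ a $ b) * (below b (set J) * word (cre_g g) I $ (set J - {b})))"
    by (rule sum.mono_neutral_cong_right) auto
  \<comment> \<open>Summing over positions instead of elements makes the column number
    available.\<close>
  also have "\<dots> = (\<Sum>j<length J. of_real (g $ a $ (J ! j)) * (below (J ! j) (set J) * word (cre_g g) I $ (set J - {J ! j})))"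
    by (rule sum.reindex_bij_betw[symmetric]) (simp add: bij_betw_nth[OF d])
  also have "\<dots> = (\<Sum>j<length J. of_real (g $ a $ (J ! j)) * ((-1) ^ j *
       (if Suc (length I) = length J then of_real (minor_det g I (del j J)) else 0)))"
  proof (intro sum.cong refl)
    fix j assume "j \<in> {..<length J}"
    then have j: "j < length J" by simp
    have "word (cre_g g) I $ (set J - {J ! j}) =
        (if length I = length (del j J) then of_real (minor_det g I (del j J)) else 0)"
      using Cons.IH[of "del j J"] Cons.prems by (simp add: sorted_del set_del[OF d j])
    moreover have "length I = length (del j J) \<longleftrightarrow> Suc (length I) = length J"
      using j by (auto simp: length_del)
    ultimately show "of_real (g $ a $ (J ! j)) * (below (J ! j) (set J) * word (cre_g g) I $ (set J - {J ! j})) =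
      of_real (g $ a $ (J ! j)) * ((-1) ^ j * (if Suc (length I) = length J then of_real (minor_det g I (del j J)) else 0))"
      by (simp add: below_sorted_nth[OF Cons.prems(2) j])
  qed
  also have "\<dots> = (if length (a # I) = length J then of_real (minor_det g (a # I) J) else 0)"
  proof (cases "length (a # I) = length J")
    case True
    have n: "length I < 4" using Cons.prems(1) by simp
    have "minor_det g (a # I) J = (\<Sum>j<Suc (length I). (-1) ^ j * g $ a $ (J ! j) *
        leib (length I) (\<lambda>i k. g $ (I ! i) $ (J ! (if k < j then k else Suc k))))"
      by (simp add: minor_det_leib leib_laplace[OF n] del: sum.lessThan_Suc)
    also have "\<dots> = (\<Sum>j<length J. (-1) ^ j * g $ a $ (J ! j) * minor_det g I (del j J))"
    proof (rule sum.cong)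
      fix j assume j: "j \<in> {..<length J}"
      have "minor_det g I (del j J) = leib (length I) (\<lambda>i k. g $ (I ! i) $ (J ! (if k < j then k else Suc k)))"
        unfolding minor_det_leib using j True by (intro leib_cong) (subst del_nth, auto)
      then show "(-1) ^ j * g $ a $ (J ! j) * leib (length I) (\<lambda>i k. g $ (I ! i) $ (J ! (if k < j then k else Suc k)))
        = (-1) ^ j * g $ a $ (J ! j) * minor_det g I (del j J)" by simp
    qed (use True in simp)
    finally show ?thesis using True by (simp add: mult_ac)
  next
    case False
    then show ?thesis by simp
  qed
  finally show ?case .
qed

lemma minor_det_sym:
  assumes "transpose g = g" "length I = length J" "length I \<le> 4"
  shows "minor_det g I J = minor_det g J I"
proof -
  have "g $ a $ b = g $ b $ a" for a b
    using arg_cong[OF assms(1), of "\<lambda>m. m $ b $ a"] by (simp add: transpose_def)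
  then show ?thesis
    using leib_transpose[of "length I" "\<lambda>i j. g $ (I ! i) $ (J ! j)"] assms(2,3)
    by (simp add: minor_det_leib)
qed

lemma card4_le: "card (A :: 4 set) \<le> 4"
  using card_mono[of UNIV A] by simp

text \<open>The extended metric is multiplicative: it sends a wedge of basis vectors to the wedge of
  their images. For increasing \<open>I\<close> this compares minors, with rows and columns
  exchanged, which is where the symmetry of \<open>g\<close> enters; other \<open>I\<close> are
  reordered by \<open>word_sort\<close>, identically on both sides.\<close>

lemma ext_metric_eI:
  assumes "transpose g = g"
  shows "ext_metric g *v eI I = word (cre_g g) I"
proof -
  have *: "ext_metric g *v eI J = word (cre_g g) J" if "sorted_wrt (<) J" for J
  proof -
    have J: "sorted_list_of_set (set J) = J" "length J = card (set J)"
      using that strict_sorted_iff[of J] distinct_card[of J] sorted_list_of_set_unique[of "set J" J] by auto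
    have "(ext_metric g *v eI J) $ A = word (cre_g g) J $ A" for A
      using word_cre_g_entry[of "sorted_list_of_set A" J g] minor_det_sym[OF assms, of "sorted_list_of_set A" J]
        card4_le[of A] J card4_le[of "set J"]
      by (auto simp: eI_sorted[OF that] axis_matrix ext_metric_def)
    then show ?thesis by (simp add: vec_eq_iff)
  qed
  obtain s J where "sorted_wrt (<) J" "\<And>f. anticommuting f \<Longrightarrow> word f I = s *\<^sub>R word f J"
    using word_sort[of I] by blast
  then show ?thesis
    using anticommuting_cre anticommuting_cre_g[of g] *[of J]
    by (simp add: word_cre[symmetric] matvec_distrib)
qed

text \<open>This relation, not the minors themselves, yields the adjoints of the Clifford
  operators.\<close>

lemma ext_metric_cre: "transpose g = g \<Longrightarrow> ext_metric g ** cre a = cre_g g a ** ext_metric g"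
  by (rule matrix_eq_on_eI)
     (simp add: matrix_vector_mul_assoc[symmetric] ext_metric_eI eI_Cons[symmetric] del: eI_Cons)

section \<open>Adjoints and nondegeneracy\<close>

lemma dagger_mult: "dagger (A ** B) = dagger B ** dagger A"
  by (simp add: dagger_def matrix_matrix_mult_def vec_eq_iff mult.commute)

lemma dagger_add: "dagger (A + B) = dagger A + dagger B"
  and dagger_diff: "dagger (A - B) = dagger A - dagger B"
  and dagger_scaleR: "dagger (c *\<^sub>R A) = c *\<^sub>R dagger A"
  and dagger_zero: "dagger 0 = 0"
  and dagger_dagger: "dagger (dagger A) = A"
  by (simp_all add: dagger_def vec_eq_iff)

lemma dagger_sum: "dagger (sum f S) = (\<Sum>i\<in>S. dagger (f i))"
  by (induction S rule: infinite_finite_induct) (simp_all add: dagger_add dagger_zero)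

lemma cnj_below: "cnj (below a A) = below a A"
  by (simp add: below_def)

lemma dagger_cre: "dagger (cre a) = ann a"
  by (auto simp: dagger_def cre_def ann_def vec_eq_iff cnj_below below_insert below_remove insert_absorb)

lemma dagger_parity: "dagger parity_op = parity_op"
  by (auto simp: dagger_def parity_op_def vec_eq_iff)

lemma dagger_II: "dagger II = - II"
  by (auto simp: dagger_def II_def mat_def vec_eq_iff)

lemma dagger_ext_metric:
  assumes "transpose g = g"
  shows "dagger (ext_metric g) = ext_metric g"
  using minor_det_sym[OF assms, of "sorted_list_of_set _" "sorted_list_of_set _"] card4_le
  by (auto simp: dagger_def ext_metric_def vec_eq_iff)

lemma parity_eI: "parity_op *v eI I = (-1) ^ length I *\<^sub>R eI I"
proof (induction I)
  case (Cons a I)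
  have "parity_op *v eI (a # I) = - (cre a *v (parity_op *v eI I))"
    by (simp add: matrix_vector_mul_assoc parity_cre matvec_distrib)
  with Cons show ?case by (simp add: matvec_distrib)
qed (simp add: parity_one)

text \<open>The metric vanishes between different degrees, so the signs for row and column agree
  wherever an entry is non-zero.\<close>

lemma parity_ext_metric: "parity_op ** ext_metric g = ext_metric g ** parity_op"
proof -
  have "(parity_op ** ext_metric g) $ B $ A = (ext_metric g ** parity_op) $ B $ A" for A B
  proof -
    have "(parity_op ** ext_metric g) $ B $ A = (parity_op *v (ext_metric g *v axis A 1)) $ B"
      by (simp add: matrix_vector_mul_assoc axis_matrix)
    also have "\<dots> = (-1) ^ card B * ext_metric g $ B $ A"
      by (simp add: parity_nth axis_matrix)
    also have "\<dots> = (-1) ^ card A * ext_metric g $ B $ A"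
      by (simp add: ext_metric_def)
    also have "\<dots> = (ext_metric g *v (parity_op *v axis A 1)) $ B"
    proof -
      have "parity_op *v axis A 1 = ((-1) ^ card A :: real) *\<^sub>R axis A 1"
        by (simp add: vec_eq_iff parity_nth axis_def) (simp add: scaleR_conv_of_real)
      then show ?thesis by (simp add: matvec_distrib axis_matrix) (simp add: scaleR_conv_of_real)
    qed
    also have "\<dots> = (ext_metric g ** parity_op) $ B $ A"
      by (simp add: matrix_vector_mul_assoc axis_matrix)
    finally show ?thesis .
  qed
  then show ?thesis by (simp add: vec_eq_iff)
qed

text \<open>The conjugate transpose of \<open>ext_metric_cre\<close>.\<close>

lemma ann_ext_metric:
  assumes "transpose g = g"
  shows "ann a ** ext_metric g = ext_metric g ** iota g a"
proof -
  have "dagger (ext_metric g ** cre a) = dagger (cre_g g a ** ext_metric g)"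
    by (simp add: ext_metric_cre assms)
  moreover have "dagger (cre_g g a) = iota g a"
    by (simp add: cre_g_def iota_def dagger_sum dagger_scaleR dagger_cre)
  ultimately show ?thesis
    by (simp add: dagger_mult dagger_cre dagger_ext_metric[OF assms])
qed

lemma matrix_inv_mult:
  fixes A :: "'a::semiring_1^'n^'m"
  assumes "invertible A"
  shows "A ** matrix_inv A = mat 1" "matrix_inv A ** A = mat 1"
  using someI_ex[OF assms[unfolded invertible_def]] by (simp_all add: matrix_inv_def)

text \<open>The kernel is stable under all contractions. Contracting with the elements of
  \<open>A\<close> one after the other moves the coordinate at \<open>A\<close> to degree zero,
  where the metric is 1, so every coordinate of a kernel vector vanishes.\<close>

lemma ext_metric_injective:
  assumes "transpose g = g" "invertible g" "ext_metric g *v x = 0"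
  shows "x = 0"
proof -
  have ker_iota: "ext_metric g *v (iota g a *v y) = 0" if "ext_metric g *v y = 0" for a y
    using that ann_ext_metric[OF assms(1), of a]
    by (metis matrix_vector_mul_assoc matrix_vector_mult_0_right)
  \<comment> \<open>Invertibility of \<open>g\<close> recovers the metric-free annihilators, which
    isolate single coordinates.\<close>
  have ann_iota: "ann b = (\<Sum>a\<in>UNIV. (matrix_inv g $ b $ a) *\<^sub>R iota g a)" for b
  proof -
    have "(\<Sum>a\<in>UNIV. (matrix_inv g $ b $ a) *\<^sub>R iota g a)
        = (\<Sum>c\<in>UNIV. (matrix_inv g ** g) $ b $ c *\<^sub>R ann c)"
      by (simp add: iota_def scaleR_sum_right matrix_matrix_mult_def scaleR_sum_left) (rule sum.swap)
    also have "matrix_inv g ** g = mat 1"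
      using assms(2) by (rule matrix_inv_mult)
    also have "(\<Sum>c\<in>UNIV. (mat 1 :: real^4^4) $ b $ c *\<^sub>R ann c) = (\<Sum>c\<in>UNIV. if c = b then ann b else 0)"
      by (intro sum.cong) (auto simp: mat_def)
    finally show ?thesis by simp
  qed
  have ker_ann: "ext_metric g *v (ann b *v y) = 0" if "ext_metric g *v y = 0" for b y
    by (simp add: ann_iota[of b] matrix_vector_lsum matrix_vector_rsum matvec_distrib ker_iota[OF that])
  have "\<forall>y. ext_metric g *v y = 0 \<longrightarrow> y $ A = 0" for A :: "4 set"
  proof (induction A rule: finite_induct[OF finite])
    case 1
    show ?case
    proof (intro allI impI)
      fix y :: ext assume "ext_metric g *v y = 0"
      then have "0 = (ext_metric g *v y) $ {}" by simp
      also have "\<dots> = (\<Sum>B\<in>(UNIV :: 4 set set). if B = {} then y $ {} else 0)"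
        unfolding matrix_vector_mult_def vec_lambda_beta
        by (rule sum.cong) (auto simp: ext_metric_def minor_det_leib leib_0)
      finally show "y $ {} = 0" by simp
    qed
  next
    case (2 a A)
    show ?case
    proof (intro allI impI)
      fix y :: ext assume "ext_metric g *v y = 0"
      then have "(ann a *v y) $ A = 0" using 2 ker_ann by blast
      then have "below a A * y $ insert a A = 0" using 2 by (simp add: ann_nth)
      then show "y $ insert a A = 0" using below_square[of a A] by auto
    qed
  qed
  then show ?thesis using assms(3) by (simp add: vec_eq_iff)
qed

section \<open>The commutant of the gamma matrices\<close>

lemma eta_eta: "eta ** eta = mat 1"
  unfolding vec_eq_iff all4 by (simp add: eta_def matrix_matrix_mult_def mat_def sum_UNIV4)

lemma sum_mat_one: "(\<Sum>c\<in>UNIV. (mat 1 :: real^'n^'n) $ b $ c *\<^sub>R f c) = (f b :: 'v::real_vector)"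
proof -
  have "(\<Sum>c\<in>UNIV. (mat 1 :: real^'n^'n) $ b $ c *\<^sub>R f c) = (\<Sum>c\<in>UNIV. if c = b then f b else 0)"
    by (intro sum.cong) (auto simp: mat_def)
  then show ?thesis by simp
qed

lemma sum_matrix_action:
  "(\<Sum>a\<in>UNIV. A $ b $ a *\<^sub>R (\<Sum>c\<in>UNIV. B $ a $ c *\<^sub>R f c)) = (\<Sum>c\<in>UNIV. (A ** B) $ b $ c *\<^sub>R (f c :: 'v::real_vector))"
  for A B :: "real^'n^'n"
  by (simp add: scaleR_sum_right matrix_matrix_mult_def scaleR_sum_left) (rule sum.swap)

lemma sum_matrix_action':
  "(\<Sum>a\<in>UNIV. A $ a $ b *\<^sub>R (\<Sum>c\<in>UNIV. B $ c $ a *\<^sub>R f c)) = (\<Sum>c\<in>UNIV. (B ** A) $ c $ b *\<^sub>R (f c :: 'v::real_vector))"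
  for A B :: "real^'n^'n"
  by (simp add: scaleR_sum_right matrix_matrix_mult_def scaleR_sum_left mult.commute) (rule sum.swap)

lemma parity_hatm: "parity_op ** hatm L = hatm L ** parity_op"
proof -
  have "parity_op ** (cre b ** ann a) = cre b ** ann a ** parity_op" for a b
  proof -
    have "parity_op ** (cre b ** ann a) = - (cre b ** (parity_op ** ann a))"
      by (simp add: matrix_mul_assoc parity_cre mat_distrib)
    then show ?thesis by (simp add: parity_ann mat_distrib matrix_mul_assoc)
  qed
  then show ?thesis
    by (simp add: hatm_def matrix_mul_lsum matrix_mul_rsum mat_distrib)
qed

text \<open>The vector 1 is cyclic: \<open>gamma_lower g a\<close> sends e_J to the wedge of e_a
  with e_J up to a term of degree lower by two, so induction on the length reaches every e_I.
  Closure under \<open>II\<close> supplies the complex multiples, as \<open>S\<close> is only a real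
  subspace.\<close>

lemma subspace_spanned_by_gamma:
  assumes S: "subspace S" "ext_one \<in> S" "\<And>x. x \<in> S \<Longrightarrow> II *v x \<in> S"
    "\<And>a x. x \<in> S \<Longrightarrow> gamma_lower g a *v x \<in> S"
  shows "S = UNIV"
proof -
  define D where "D k = span {eI J | J. length J = k}" for k
  have cre_D: "cre a *v x \<in> D (Suc k)" if "x \<in> D k" for a k x
    using that unfolding D_def
  proof (induction rule: span_induct_alt)
    case (step c x y)
    then have "cre a *v x \<in> span {eI J | J. length J = Suc k}"
      by (auto intro!: span_base) (metis eI_Cons length_Cons)
    with step show ?case by (simp add: matvec_distrib span_add span_scale)
  qed (simp add: span_0)
  have ann_D: "length I = Suc k \<Longrightarrow> ann b *v eI I \<in> D k" for b k I
  proof (induction I arbitrary: k)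
    case (Cons c I)
    have "eI I \<in> D k" unfolding D_def using Cons.prems by (intro span_base) auto
    moreover have "cre c *v (ann b *v eI I) \<in> D k"
    proof (cases I)
      case Nil
      then show ?thesis by (simp add: ann_one D_def span_0)
    next
      case (Cons d J)
      then show ?thesis using Cons.IH[of "k - 1"] Cons.prems cre_D[of "ann b *v eI I" "k - 1" c] by simp
    qed
    moreover have "ann b *v eI (c # I) = (if b = c then eI I else 0) - cre c *v (ann b *v eI I)"
      by (simp add: matrix_vector_mul_assoc ann_cre matvec_distrib)
    ultimately show ?case unfolding D_def by (auto intro: span_diff span_neg)
  qed simp
  have iota_D: "iota g b *v eI I \<in> D k" if "length I = Suc k" for b k I
    using ann_D[OF that] unfolding D_def iota_def matrix_vector_lsum
    by (auto intro!: span_sum span_scale simp: matvec_distrib)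
  have eI_S: "eI I \<in> S" for I
  proof (induction "length I" arbitrary: I rule: less_induct)
    case less
    show ?case
    proof (cases I)
      case Nil
      then show ?thesis using S(2) by simp
    next
      case (Cons a J)
      have J: "eI J \<in> S" using less Cons by simp
      have "iota g a *v eI J \<in> S"
      proof (cases J)
        case Nil
        then show ?thesis by (simp add: iota_one subspace_0[OF S(1)])
      next
        case (Cons b K)
        have "{eI M | M. length M = length K} \<subseteq> S"
          using less(1) \<open>I = a # J\<close> Cons by auto
        then have "D (length K) \<subseteq> S" unfolding D_def using S(1) by (rule span_minimal)
        then show ?thesis using iota_D[of J "length K"] Cons by auto
      qed
      moreover have "eI I = gamma_lower g a *v eI J + iota g a *v eI J"
        by (simp add: Cons gamma_lower_eq matvec_distrib)
      ultimately show ?thesis using S(4)[OF J, of a] subspace_add[OF S(1)] by simp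
    qed
  qed
  have "x \<in> S" for x :: ext
  proof -
    have "x = (\<Sum>A\<in>UNIV. Re (x $ A) *\<^sub>R axis A 1 + Im (x $ A) *\<^sub>R (II *v axis A 1))"
      unfolding vec_eq_iff
    proof
      fix B
      have "(\<Sum>A\<in>UNIV. Re (x $ A) *\<^sub>R axis A 1 + Im (x $ A) *\<^sub>R (II *v axis A 1)) $ B =
        (\<Sum>A\<in>UNIV. if A = B then x $ B else 0)"
        unfolding sum_component
        by (intro sum.cong refl) (auto simp: axis_def II_nth complex_eq_iff)
      then show "x $ B = (\<Sum>A\<in>UNIV. Re (x $ A) *\<^sub>R axis A 1 + Im (x $ A) *\<^sub>R (II *v axis A 1)) $ B"
        by simp
    qed
    also have "\<dots> \<in> S"
      using S(3) eI_S[of "sorted_list_of_set _"]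
      by (auto intro!: subspace_sum[OF S(1)] subspace_add[OF S(1)] subspace_scale[OF S(1)]
        simp: eI_sorted_list_of_set)
    finally show ?thesis .
  qed
  then show ?thesis by auto
qed

section \<open>Right Clifford multiplication in an orthonormal frame\<close>

locale lorentz_frame =
  fixes g P :: "real^4^4"
  assumes g_sym: "transpose g = g" and frame: "orthonormal_frame g P"
begin

definition Pi :: "real^4^4" where
  "Pi = matrix_inv P"

lemma P_inv: "P ** Pi = mat 1" "Pi ** P = mat 1"
  using frame matrix_inv_mult[of P] unfolding orthonormal_frame_def Pi_def by auto

lemma P_eta: "transpose P ** g ** P = eta"
  using frame by (simp add: orthonormal_frame_def)

lemma invertible_g: "invertible g"
proof -
  have "transpose P ** (g ** P ** eta) = mat 1"
    using P_eta eta_eta by (simp add: matrix_mul_assoc)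
  then have "g ** (P ** eta ** transpose P) = mat 1"
    by (subst (asm) matrix_left_right_inverse) (simp add: matrix_mul_assoc)
  then show ?thesis unfolding invertible_def using matrix_left_right_inverse by blast
qed

definition rr :: "4 \<Rightarrow> extop" where
  "rr a = (cre a + iota g a) ** parity_op"

text \<open>Right multiplication by the frame vector number \<alpha>. Its relations involve
  \<open>eta\<close> whatever \<open>g\<close> is, and so do all later computations.\<close>

definition rho :: "4 \<Rightarrow> extop" where
  "rho \<alpha> = (\<Sum>a\<in>UNIV. P $ a $ \<alpha> *\<^sub>R rr a)"

text \<open>Right multiplications compose in reverse order, so this is right multiplication by the
  product of the frame vectors 0, 1, 2, 3 in this order.\<close>

definition JO :: extop where
  "JO = rho 3 ** (rho 2 ** (rho 1 ** rho 0))"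

text \<open>In reverse order, as in \<open>JO\<close>. Antisymmetrizing makes the value at equal
  indices zero, in agreement with \<open>Theta [a, a] = 0\<close>.\<close>

definition rho2 :: "4 \<Rightarrow> 4 \<Rightarrow> extop" where
  "rho2 a b = (1/2) *\<^sub>R (rho b ** rho a - rho a ** rho b)"

lemma rr_rho: "rr a = (\<Sum>\<alpha>\<in>UNIV. Pi $ \<alpha> $ a *\<^sub>R rho \<alpha>)"
proof -
  have "(\<Sum>\<alpha>\<in>UNIV. Pi $ \<alpha> $ a *\<^sub>R rho \<alpha>) = (\<Sum>c\<in>UNIV. (P ** Pi) $ c $ a *\<^sub>R rr c)"
    unfolding rho_def by (rule sum_matrix_action')
  also have "\<dots> = (\<Sum>c\<in>UNIV. (mat 1 :: real^4^4) $ a $ c *\<^sub>R rr c)"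
    by (simp add: P_inv mat_def eq_commute)
  finally show ?thesis by (simp add: sum_mat_one)
qed

lemma g_nth_sym: "g $ a $ b = g $ b $ a"
  using arg_cong[OF g_sym, of "\<lambda>m. m $ b $ a"] by (simp add: transpose_def)

text \<open>The operators \<open>cre a + iota g a\<close> anticommute to twice \<open>g\<close>;
  moving the parity operator through the second factor changes the sign, which gives the same
  Clifford relation as for the gamma matrices.\<close>

lemma rr_rr: "rr a ** rr b = (- 2 * g $ a $ b) *\<^sub>R mat 1 - rr b ** rr a"
proof -
  have *: "rr a ** rr b = - ((cre a + iota g a) ** (cre b + iota g b))" for a b
  proof -
    have "rr a ** rr b = (cre a + iota g a) ** (parity_op ** (cre b + iota g b)) ** parity_op"
      by (simp add: rr_def matrix_mul_assoc)
    also have "parity_op ** (cre b + iota g b) = - ((cre b + iota g b) ** parity_op)"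
      by (simp add: mat_distrib parity_cre parity_iota)
    finally show ?thesis
      by (simp add: mat_distrib matrix_mul_assoc[symmetric] parity_parity)
  qed
  have c: "cre a ** cre b = - (cre b ** cre a)" "iota g a ** iota g b = - (iota g b ** iota g a)"
    by (rule cre_cre, rule iota_iota)
  have "rr a ** rr b + rr b ** rr a = - ((cre a + iota g a) ** (cre b + iota g b) + (cre b + iota g b) ** (cre a + iota g a))"
    by (simp add: *)
  also have "\<dots> = - (iota g a ** cre b + cre b ** iota g a + (iota g b ** cre a + cre a ** iota g b))"
    by (simp add: mat_distrib c algebra_simps)
  also have "\<dots> = (- 2 * g $ a $ b) *\<^sub>R mat 1"
    by (simp add: iota_cre g_nth_sym[of b a] algebra_simps scaleR_2[symmetric])
  finally show ?thesis by (simp add: algebra_simps)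
qed

lemma rho_rho: "rho a ** rho b = (- 2 * eta $ a $ b) *\<^sub>R mat 1 - rho b ** rho a"
proof -
  have "rho a ** rho b = (\<Sum>c\<in>UNIV. \<Sum>d\<in>UNIV. (P $ c $ a * P $ d $ b) *\<^sub>R (rr c ** rr d))"
    by (simp add: rho_def matrix_mul_lsum matrix_mul_rsum mat_distrib scaleR_sum_right)
       (subst sum.swap, simp add: mult.commute)
  also have "\<dots> = (\<Sum>c\<in>UNIV. \<Sum>d\<in>UNIV. (-2 * (P $ c $ a * (g $ c $ d * P $ d $ b))) *\<^sub>R mat 1)
     - (\<Sum>c\<in>UNIV. \<Sum>d\<in>UNIV. (P $ c $ a * P $ d $ b) *\<^sub>R (rr d ** rr c))"
    unfolding sum_subtractf[symmetric]
    by (subst rr_rr) (intro sum.cong refl, simp add: scaleR_diff_right mult_ac)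
  also have "(\<Sum>c\<in>UNIV. \<Sum>d\<in>UNIV. (P $ c $ a * P $ d $ b) *\<^sub>R (rr d ** rr c)) = rho b ** rho a"
    by (simp add: rho_def matrix_mul_lsum matrix_mul_rsum mat_distrib scaleR_sum_right)
  also have "(\<Sum>c\<in>UNIV. \<Sum>d\<in>UNIV. (-2 * (P $ c $ a * (g $ c $ d * P $ d $ b))) *\<^sub>R (mat 1 :: extop))
      = (-2 * (transpose P ** (g ** P)) $ a $ b) *\<^sub>R mat 1"
    by (simp add: matrix_matrix_mult_def transpose_def scaleR_sum_left sum_distrib_left sum_negf)
  also have "transpose P ** (g ** P) = eta" using P_eta by (simp add: matrix_mul_assoc)
  finally show ?thesis .
qed

lemma eta_entries: "eta $ 0 $ 0 = 1" "eta $ 1 $ 1 = -1" "eta $ 2 $ 2 = -1" "eta $ 3 $ 3 = -1"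
  "a \<noteq> b \<Longrightarrow> eta $ a $ b = 0"
  by (auto simp: eta_def)

lemma half_eq: "X = c *\<^sub>R Y - X \<Longrightarrow> X = (c/2) *\<^sub>R Y" for X Y :: extop
  by (simp add: vec_eq_iff complex_eq_iff field_simps)

lemma rho_square: "rho a ** rho a = (- (eta $ a $ a)) *\<^sub>R mat 1"
  using half_eq[OF rho_rho[of a a]] by simp

lemma rho_swap: "a \<noteq> b \<Longrightarrow> rho a ** rho b = - (rho b ** rho a)"
  using rho_rho[of a b] by (simp add: eta_entries)

lemma rho_squares: "rho 0 ** rho 0 = - mat 1" "rho 1 ** rho 1 = mat 1" "rho 2 ** rho 2 = mat 1" "rho 3 ** rho 3 = mat 1"
  by (simp_all add: rho_square eta_entries)

lemma rho_order: 
  "rho 1 ** rho 0 = - (rho 0 ** rho 1)" "rho 2 ** rho 0 = - (rho 0 ** rho 2)" "rho 3 ** rho 0 = - (rho 0 ** rho 3)"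
  "rho 2 ** rho 1 = - (rho 1 ** rho 2)" "rho 3 ** rho 1 = - (rho 1 ** rho 3)" "rho 3 ** rho 2 = - (rho 2 ** rho 3)"
  by (rule rho_swap, simp)+

lemma rho_left:
  "rho 0 ** (rho 0 ** M) = - M" "rho 1 ** (rho 1 ** M) = M" "rho 2 ** (rho 2 ** M) = M" "rho 3 ** (rho 3 ** M) = M"
  "rho 1 ** (rho 0 ** M) = - (rho 0 ** (rho 1 ** M))" "rho 2 ** (rho 0 ** M) = - (rho 0 ** (rho 2 ** M))"
  "rho 3 ** (rho 0 ** M) = - (rho 0 ** (rho 3 ** M))" "rho 2 ** (rho 1 ** M) = - (rho 1 ** (rho 2 ** M))"
  "rho 3 ** (rho 1 ** M) = - (rho 1 ** (rho 3 ** M))" "rho 3 ** (rho 2 ** M) = - (rho 2 ** (rho 3 ** M))"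
  by (simp_all add: matrix_mul_assoc rho_squares rho_order mat_distrib)

text \<open>A rewrite system that sorts words in the four operators by index and contracts squares.
  It decides the identities between Clifford words below, where matrix entries would be
  hopeless.\<close>

lemmas rho_normal = rho_squares rho_order rho_left mat_distrib matrix_mul_assoc[symmetric]

lemma JO_normal: "JO = rho 0 ** (rho 1 ** (rho 2 ** rho 3))"
  by (simp add: JO_def rho_normal)

lemma JO_rho: "JO ** rho a = - (rho a ** JO)"
proof -
  have "\<forall>a. JO ** rho a = - (rho a ** JO)"
    unfolding all4 by (simp add: JO_normal rho_normal)
  then show ?thesis by blast
qed

lemma JO_JO: "JO ** JO = - mat 1"
  by (simp add: JO_normal rho_normal)

lemma rho2_swap: "rho2 a b = - rho2 b a"
  by (simp add: rho2_def algebra_simps)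

lemma rho2_same: "rho2 a a = 0"
  by (simp add: rho2_def)

lemma rho2_distinct: "a \<noteq> b \<Longrightarrow> rho2 a b = rho b ** rho a"
  by (simp add: rho2_def rho_swap[of a b] scaleR_add_left[symmetric] scaleR_2[symmetric])

lemma rho_rho_rho2: "rho a ** rho b = rho2 b a - (eta $ a $ b) *\<^sub>R mat 1"
  by (cases "a = b") (simp_all add: rho2_same rho2_distinct rho_square eta_entries)

text \<open>Hodge duality of bivectors, which squares to -1 in this signature.\<close>

lemma JO_rho2: 
  "JO ** rho2 0 1 = rho2 2 3" "JO ** rho2 0 2 = rho2 3 1" "JO ** rho2 0 3 = rho2 1 2"
  "JO ** rho2 2 3 = - rho2 0 1" "JO ** rho2 3 1 = - rho2 0 2" "JO ** rho2 1 2 = - rho2 0 3"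
  by (simp_all add: rho2_distinct JO_normal rho_normal)

text \<open>By the symmetry of \<open>g\<close>, \<open>cre + iota\<close> anticommutes with
  \<open>cre - iota\<close>. The parity operator anticommutes with both, and this turns
  anticommutation into commutation.\<close>

lemma gamma_rr: "gamma_lower g a ** rr b = rr b ** gamma_lower g a"
proof -
  have "rr b ** gamma_lower g a = (cre b + iota g b) ** (parity_op ** (cre a - iota g a))"
    by (simp add: rr_def gamma_lower_eq matrix_mul_assoc)
  also have "parity_op ** (cre a - iota g a) = - ((cre a - iota g a) ** parity_op)"
    by (simp add: mat_distrib parity_cre parity_iota)
  also have "(cre b + iota g b) ** (- ((cre a - iota g a) ** parity_op)) = - ((cre b + iota g b) ** (cre a - iota g a)) ** parity_op"
    by (simp add: mat_distrib matrix_mul_assoc)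
  also have "- ((cre b + iota g b) ** (cre a - iota g a)) = (cre a - iota g a) ** (cre b + iota g b)"
    using cre_cre[of a b] iota_iota[of g a b] g_nth_sym[of a b]
    by (simp add: mat_distrib iota_cre algebra_simps)
  finally show ?thesis by (simp add: rr_def gamma_lower_eq matrix_mul_assoc)
qed

lemma gamma_rho: "gamma_lower g a ** rho b = rho b ** gamma_lower g a"
  by (simp add: rho_def matrix_mul_lsum matrix_mul_rsum mat_distrib gamma_rr)

lemma gamma_one: "gamma_lower g a *v ext_one = rr a *v ext_one"
  by (simp add: rr_def gamma_lower_eq matvec_distrib matrix_vector_mul_assoc[symmetric] parity_one iota_one)

text \<open>Across the metric, creation and contraction are each other's adjoints, so their sum is
  self-adjoint; moving the parity operator to the other side gives the minus sign.\<close>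

lemma dagger_rho: "dagger (rho a) ** ext_metric g = - (ext_metric g ** rho a)"
proof -
  have c: "dagger (iota g a) = cre_g g a" for a
    by (simp add: cre_g_def iota_def dagger_sum dagger_scaleR dagger_cre[symmetric] dagger_dagger)
  have "dagger (rr a) ** ext_metric g = - (ext_metric g ** rr a)" for a
  proof -
    have "dagger (rr a) ** ext_metric g = parity_op ** ((ann a + cre_g g a) ** ext_metric g)"
      by (simp add: rr_def dagger_mult dagger_add dagger_parity dagger_cre c matrix_mul_assoc)
    also have "(ann a + cre_g g a) ** ext_metric g = ext_metric g ** (iota g a + cre a)"
      by (simp add: mat_distrib ann_ext_metric[OF g_sym] ext_metric_cre[OF g_sym])
    also have "parity_op ** (ext_metric g ** (iota g a + cre a)) = ext_metric g ** (parity_op ** (iota g a + cre a))"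
      by (simp add: matrix_mul_assoc parity_ext_metric)
    also have "parity_op ** (iota g a + cre a) = - rr a"
      by (simp add: mat_distrib parity_cre parity_iota rr_def)
    finally show ?thesis by (simp add: mat_distrib)
  qed
  then show ?thesis
    by (simp add: rho_def dagger_sum dagger_scaleR matrix_mul_lsum matrix_mul_rsum mat_distrib sum_negf)
qed

text \<open>The anti-self-adjoint elements of the commutant, with six coordinates for the bivector part.\<close>

definition qq :: "real \<times> (real^4) \<times> (real \<times> real \<times> real \<times> real \<times> real \<times> real) \<times> (real^4) \<times> real \<Rightarrow> extop" where
  "qq = (\<lambda>(s, x, (e1, e2, e3, b1, b2, b3), y, t). s *\<^sub>R II + (\<Sum>a\<in>UNIV. x $ a *\<^sub>R rho a)
     + (e1 *\<^sub>R rho2 0 1 + e2 *\<^sub>R rho2 0 2 + e3 *\<^sub>R rho2 0 3 + b1 *\<^sub>R rho2 2 3 + b2 *\<^sub>R rho2 3 1 + b3 *\<^sub>R rho2 1 2)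
     + (\<Sum>a\<in>UNIV. y $ a *\<^sub>R (II ** (JO ** rho a))) + t *\<^sub>R (II ** JO))"

text \<open>A factor \<open>II\<close> occurs exactly where the Clifford product is self-adjoint, in
  degrees 0, 3 and 4.\<close>

definition BB :: "extop set" where
  "BB = {II, II ** JO} \<union> range rho \<union> range (\<lambda>a. II ** (JO ** rho a)) \<union> range (\<lambda>(a, b). rho2 a b)"

definition QQ :: "extop set" where
  "QQ = span BB"

text \<open>The complex span of the same products, which lemma \<open>commutant\<close> identifies
  with the full commutant of the gamma matrices.\<close>

definition AA :: "extop set" where
  "AA = span (BB \<union> (**) II ` BB)"

lemma linear_qq: "linear qq"
  by (rule linearI) (auto simp: qq_def scaleR_add_left sum.distrib scaleR_sum_right scaleR_add_right)

lemma QQ_eq: "QQ = range qq"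
proof
  have "subspace (range qq)" using linear_subspace_image[OF linear_qq subspace_UNIV] .
  moreover have "BB \<subseteq> range qq"
  proof -
    have "II = qq (1, 0, (0,0,0,0,0,0), 0, 0)" "II ** JO = qq (0, 0, (0,0,0,0,0,0), 0, 1)"
      by (simp_all add: qq_def)
    moreover have "(\<Sum>c\<in>UNIV. axis a 1 $ c *\<^sub>R f c) = (f a :: extop)" for f and a :: 4
    proof -
      have "(\<Sum>c\<in>UNIV. axis a 1 $ c *\<^sub>R f c) = (\<Sum>c\<in>UNIV. if c = a then f a else 0)"
        by (intro sum.cong) (auto simp: axis_def)
      then show ?thesis by simp
    qed
    then have "rho a = qq (0, axis a 1, (0,0,0,0,0,0), 0, 0)"
      "II ** (JO ** rho a) = qq (0, 0, (0,0,0,0,0,0), axis a 1, 0)" for a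
      by (simp_all add: qq_def)
    moreover have "\<forall>a b. rho2 a b \<in> range qq"
    proof -
      have *: "rho2 0 1 = qq (0, 0, (1,0,0,0,0,0), 0, 0)" "rho2 0 2 = qq (0, 0, (0,1,0,0,0,0), 0, 0)"
        "rho2 0 3 = qq (0, 0, (0,0,1,0,0,0), 0, 0)" "rho2 2 3 = qq (0, 0, (0,0,0,1,0,0), 0, 0)"
        "rho2 3 1 = qq (0, 0, (0,0,0,0,1,0), 0, 0)" "rho2 1 2 = qq (0, 0, (0,0,0,0,0,1), 0, 0)"
        by (simp_all add: qq_def)
      have n: "- z \<in> range qq \<longleftrightarrow> z \<in> range qq" for z
        using subspace_neg[OF \<open>subspace (range qq)\<close>, of z] subspace_neg[OF \<open>subspace (range qq)\<close>, of "- z"] by auto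
      show ?thesis unfolding all4
        by (simp add: rho2_same subspace_0[OF \<open>subspace (range qq)\<close>] rho2_swap[of 1 0] rho2_swap[of 2 0] rho2_swap[of 3 0]
            rho2_swap[of 3 2] rho2_swap[of 1 3] rho2_swap[of 2 1] n) (simp add: *)
    qed
    ultimately show ?thesis unfolding BB_def by (auto simp: image_iff) blast+
  qed
  ultimately show "QQ \<subseteq> range qq" unfolding QQ_def by (rule span_minimal[rotated])
  have b: "II \<in> QQ" "II ** JO \<in> QQ" "rho a \<in> QQ" "II ** (JO ** rho a) \<in> QQ" "rho2 a b \<in> QQ" for a b
    unfolding QQ_def BB_def by (auto intro!: span_base)
  show "range qq \<subseteq> QQ"
    using b unfolding QQ_def by (auto simp: qq_def intro!: span_add span_scale span_sum)
qed

lemma subspace_AA: "subspace AA" unfolding AA_def by (rule subspace_span)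

lemma QQ_AA: "QQ \<subseteq> AA" unfolding AA_def QQ_def by (rule span_mono) auto

lemma AA_eq: "AA = {p + II ** q | p q. p \<in> QQ \<and> q \<in> QQ}" (is "_ = ?R")
proof
  have s: "subspace QQ" unfolding QQ_def by (rule subspace_span)
  have "subspace ?R"
  proof (rule subspaceI)
    show "0 \<in> ?R" using subspace_0[OF s] by force
  next
    fix x y assume "x \<in> ?R" "y \<in> ?R"
    then obtain p q p' q' where "x = p + II ** q" "y = p' + II ** q'" "p \<in> QQ" "q \<in> QQ" "p' \<in> QQ" "q' \<in> QQ" by blast
    moreover then have "x + y = (p + p') + II ** (q + q')" by (simp add: mat_distrib)
    ultimately show "x + y \<in> ?R" using subspace_add[OF s] by blast
  next
    fix c x assume "x \<in> ?R"
    then obtain p q where "x = p + II ** q" "p \<in> QQ" "q \<in> QQ" by blast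
    moreover then have "c *\<^sub>R x = c *\<^sub>R p + II ** (c *\<^sub>R q)" by (simp add: mat_distrib scaleR_add_right)
    ultimately show "c *\<^sub>R x \<in> ?R" using subspace_scale[OF s] by blast
  qed
  moreover have "BB \<union> (**) II ` BB \<subseteq> ?R"
  proof -
    have "x = x + II ** 0" "II ** x = 0 + II ** x" for x :: extop by simp_all
    then show ?thesis using span_superset[of BB] subspace_0[OF s] unfolding QQ_def by blast
  qed
  ultimately show "AA \<subseteq> ?R" unfolding AA_def by (rule span_minimal[rotated])
  have "II ** q \<in> AA" if "q \<in> QQ" for q
    using that unfolding QQ_def
  proof (induction rule: span_induct_alt)
    case base then show ?case by (simp add: subspace_0[OF subspace_AA])
  next
    case (step c x y)
    have "II ** x \<in> AA" using step unfolding AA_def by (intro span_base) auto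
    then show ?case using step by (auto simp: mat_distrib intro!: subspace_add[OF subspace_AA] subspace_scale[OF subspace_AA])
  qed
  then show "?R \<subseteq> AA" using QQ_AA by (auto intro!: subspace_add[OF subspace_AA])
qed

lemma II_left: "II ** (II ** M) = - M"
  by (simp add: matrix_mul_assoc II_II mat_distrib)

lemma AA_neg: "- x \<in> AA \<longleftrightarrow> x \<in> AA"
  using subspace_neg[OF subspace_AA, of x] subspace_neg[OF subspace_AA, of "- x"] by auto

lemma AA_II: "II ** x \<in> AA" if "x \<in> AA"
proof -
  from that obtain p q where pq: "x = p + II ** q" "p \<in> QQ" "q \<in> QQ" unfolding AA_eq by blast
  then have "II ** x = (- q) + II ** p" by (simp add: mat_distrib II_left)
  moreover have "- q \<in> QQ" using pq unfolding QQ_def by (intro span_neg)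
  ultimately show ?thesis unfolding AA_eq using pq by blast
qed

lemma AA_members: "II \<in> AA" "rho a \<in> AA" "rho2 a b \<in> AA" "II ** JO \<in> AA" "II ** (JO ** rho a) \<in> AA"
  "mat 1 \<in> AA" "JO \<in> AA" "JO ** rho a \<in> AA"
proof -
  show *: "II \<in> AA" "rho a \<in> AA" "rho2 a b \<in> AA" "II ** JO \<in> AA" "II ** (JO ** rho a) \<in> AA"
    unfolding AA_def by (intro span_base, auto simp: BB_def)+
  show "mat 1 \<in> AA" "JO \<in> AA" "JO ** rho a \<in> AA"
    using AA_II[OF *(1)] AA_II[OF *(4)] AA_II[OF *(5)] AA_neg by (simp_all add: II_II II_left)
qed

lemma rho_words3: "rho 0 ** (rho 1 ** rho 2) = JO ** rho 3" "rho 0 ** (rho 1 ** rho 3) = - (JO ** rho 2)"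
  "rho 0 ** (rho 2 ** rho 3) = JO ** rho 1" "rho 1 ** (rho 2 ** rho 3) = JO ** rho 0"
  by (simp_all add: JO_normal rho_normal)

lemma rho2_rho_AA: "rho2 a b ** rho c \<in> AA"
proof -
  have "\<forall>a b c. rho2 a b ** rho c \<in> AA"
    unfolding all4
    by (simp add: rho2_same rho2_distinct rho_normal AA_neg subspace_0[OF subspace_AA])
      (simp add: rho_words3 AA_members AA_neg)
  then show ?thesis by blast
qed

lemma JO_rho2_AA: "JO ** rho2 a b \<in> AA"
proof -
  have "\<forall>a b. JO ** rho2 a b \<in> AA"
    unfolding all4
    by (simp add: rho2_same subspace_0[OF subspace_AA] rho2_swap[of 1 0] rho2_swap[of 2 0] rho2_swap[of 3 0]
            rho2_swap[of 3 2] rho2_swap[of 1 3] rho2_swap[of 2 1] mat_distrib AA_neg JO_rho2 AA_members)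
  then show ?thesis by blast
qed

text \<open>The products close up because triple products are \<open>JO\<close> times a generator up
  to sign, and \<open>JO\<close> sends bivectors to bivectors.\<close>

lemma BB_rho_AA: "b \<in> BB \<Longrightarrow> b ** rho c \<in> AA"
proof -
  assume "b \<in> BB"
  moreover have "II ** rho c \<in> AA" "(II ** JO) ** rho c \<in> AA"
    using AA_members AA_II by (auto simp: matrix_mul_assoc[symmetric])
  moreover have r: "rho a ** rho c \<in> AA" for a
    by (simp add: rho_rho_rho2 AA_members subspace_diff[OF subspace_AA] subspace_scale[OF subspace_AA] subspace_neg[OF subspace_AA])
  moreover have "II ** (JO ** rho a) ** rho c \<in> AA" for a
  proof -
    have "II ** (JO ** rho a) ** rho c = II ** (JO ** (rho2 c a - (eta $ a $ c) *\<^sub>R mat 1))"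
      by (simp add: matrix_mul_assoc[symmetric] rho_rho_rho2)
    also have "\<dots> = II ** (JO ** rho2 c a - (eta $ a $ c) *\<^sub>R JO)" by (simp add: mat_distrib)
    also have "\<dots> \<in> AA"
      by (intro AA_II subspace_diff[OF subspace_AA] subspace_scale[OF subspace_AA] JO_rho2_AA AA_members)
    finally show ?thesis .
  qed
  ultimately show ?thesis using rho2_rho_AA unfolding BB_def by auto
qed

lemma AA_rho: "x ** rho c \<in> AA" if "x \<in> AA"
  using that unfolding AA_def 
proof (induction rule: span_induct_alt)
  case base then show ?case by (simp add: span_0)
next
  case (step k x y)
  then have "x ** rho c \<in> AA"
    using BB_rho_AA[of _ c] AA_II by (auto simp: matrix_mul_assoc[symmetric])
  then have "k *\<^sub>R (x ** rho c) + y ** rho c \<in> AA"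
    using step(2) unfolding AA_def[symmetric] by (intro subspace_add[OF subspace_AA] subspace_scale[OF subspace_AA])
  then show ?case by (simp add: mat_distrib AA_def)
qed

lemma II_gamma: "gamma_lower g a ** (II ** M) = II ** (gamma_lower g a ** M)"
  by (metis II_central matrix_mul_assoc)

lemma gamma_rho_left: "gamma_lower g a ** (rho b ** M) = rho b ** (gamma_lower g a ** M)"
  by (simp add: matrix_mul_assoc gamma_rho)

lemma gamma_JO: "gamma_lower g a ** JO = JO ** gamma_lower g a"
  by (simp add: JO_def gamma_rho_left gamma_rho matrix_mul_assoc[symmetric])

lemma AA_commutes: "gamma_lower g a ** x = x ** gamma_lower g a" if "x \<in> AA"
proof -
  have "gamma_lower g a ** b = b ** gamma_lower g a" if "b \<in> BB" for b
  proof -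
    have "gamma_lower g a ** (II ** (JO ** rho c)) = II ** (JO ** rho c) ** gamma_lower g a" for c
      by (simp add: II_gamma) (metis gamma_JO gamma_rho matrix_mul_assoc)
    moreover have "gamma_lower g a ** rho2 c d = rho2 c d ** gamma_lower g a" for c d
      by (simp add: rho2_def mat_distrib gamma_rho_left gamma_rho matrix_mul_assoc[symmetric])
    moreover have "gamma_lower g a ** (II ** JO) = II ** JO ** gamma_lower g a"
      by (simp only: II_gamma gamma_JO) (simp only: matrix_mul_assoc)
    ultimately show ?thesis using that II_central gamma_rho unfolding BB_def by auto
  qed
  moreover then have "gamma_lower g a ** (II ** b) = II ** b ** gamma_lower g a" if "b \<in> BB" for b
    using that by (simp add: II_gamma matrix_mul_assoc[symmetric])
  ultimately have c: "gamma_lower g a ** b = b ** gamma_lower g a" if "b \<in> BB \<union> (**) II ` BB" for b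
    using that by blast
  show ?thesis
    using that unfolding AA_def
  proof (induction rule: span_induct_alt)
    case (step k x y)
    then show ?case using c[of x] by (simp add: mat_distrib)
  qed simp
qed

text \<open>If \<open>y\<close> is in \<open>AA\<close>, then a gamma matrix can be moved through
  \<open>y\<close> to act on 1, where it agrees with \<open>rr a\<close>. So the values at 1 are
  stable under the gamma matrices, and cyclicity applies.\<close>

lemma AA_one: "(\<lambda>x. x *v ext_one) ` AA = UNIV"
proof (rule subspace_spanned_by_gamma)
  have l: "linear (\<lambda>x :: extop. x *v ext_one)"
    by (rule linearI) (simp_all add: matvec_distrib)
  show "subspace ((\<lambda>x. x *v ext_one) ` AA)" using linear_subspace_image[OF l subspace_AA] .
  have "ext_one = mat 1 *v ext_one" by simp
  then show "ext_one \<in> (\<lambda>x. x *v ext_one) ` AA" using AA_members by blast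
  fix x assume "x \<in> (\<lambda>x. x *v ext_one) ` AA"
  then obtain y where y: "x = y *v ext_one" "y \<in> AA" by blast
  then show "II *v x \<in> (\<lambda>x. x *v ext_one) ` AA"
    using AA_II[OF y(2)] by (simp add: matrix_vector_mul_assoc)
  fix a
  have m: "y ** rr a \<in> AA"
    by (auto simp: rr_rho matrix_mul_rsum mat_distrib intro!: subspace_sum[OF subspace_AA] subspace_scale[OF subspace_AA] AA_rho y)
  have "gamma_lower g a *v x = y *v (gamma_lower g a *v ext_one)"
    using AA_commutes[OF y(2), of a] y(1) by (simp add: matrix_vector_mul_assoc)
  also have "\<dots> = (y ** rr a) *v ext_one"
    by (simp add: gamma_one matrix_vector_mul_assoc)
  finally show "gamma_lower g a *v x \<in> (\<lambda>x. x *v ext_one) ` AA" using m by blast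
qed

text \<open>The kernel of an operator in the commutant is stable under the gamma matrices; once it
  contains the cyclic vector it is everything.\<close>

lemma commutant_eq_0:
  assumes "\<And>a. gamma_lower g a ** M = M ** gamma_lower g a" "M *v ext_one = 0"
  shows "M = 0"
proof -
  have "{x. M *v x = 0} = UNIV"
  proof (rule subspace_spanned_by_gamma)
    show "subspace {x. M *v x = 0}" by (rule subspaceI) (simp_all add: matvec_distrib)
    show "ext_one \<in> {x. M *v x = 0}" using assms(2) by simp
    show "II *v x \<in> {x. M *v x = 0}" if "x \<in> {x. M *v x = 0}" for x
      using that by (simp add: matrix_vector_mul_assoc II_central[symmetric]) (simp add: matrix_vector_mul_assoc[symmetric])
    show "gamma_lower g a *v x \<in> {x. M *v x = 0}" if "x \<in> {x. M *v x = 0}" for x a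
      using that by (simp add: matrix_vector_mul_assoc assms(1)[symmetric]) (simp add: matrix_vector_mul_assoc[symmetric])
  qed
  then show ?thesis unfolding matrix_eq by auto
qed

text \<open>By \<open>AA_one\<close>, some element of \<open>AA\<close> has the same value at 1 as
  \<open>M\<close>; by \<open>commutant_eq_0\<close> the difference is zero.\<close>

lemma commutant: "(\<forall>a. gamma_lower g a ** M = M ** gamma_lower g a) \<longleftrightarrow> M \<in> AA"
proof
  assume c: "\<forall>a. gamma_lower g a ** M = M ** gamma_lower g a"
  obtain R where R: "R \<in> AA" "M *v ext_one = R *v ext_one"
    using AA_one by (metis UNIV_I image_iff)
  have "M - R = 0"
    using c AA_commutes[OF R(1)] R(2) by (intro commutant_eq_0) (simp_all add: mat_distrib matvec_distrib)
  then show "M \<in> AA" using R(1) by simp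
qed (use AA_commutes in blast)

text \<open>Independence by counting: the map is onto by \<open>AA_one\<close>, and both sides have
  real dimension 32.\<close>

lemma qq_pair_inj: "inj (\<lambda>(p, q). (qq p + II ** qq q) *v ext_one)" (is "inj ?f")
proof -
  have "linear (\<lambda>x. (qq (fst x) + II ** qq (snd x)) *v ext_one)"
    by (rule linearI)
       (simp_all only: fst_add snd_add fst_scaleR snd_scaleR linear_add[OF linear_qq] linear_scale[OF linear_qq],
        simp_all add: mat_distrib matvec_distrib scaleR_add_right)
  then have l: "linear ?f" by (simp add: case_prod_unfold)
  have "(p + II ** q) *v ext_one \<in> range ?f" if pq: "p \<in> QQ" "q \<in> QQ" for p q
  proof -
    obtain p' q' where "p = qq p'" "q = qq q'" using pq unfolding QQ_eq by blast
    then have "(p + II ** q) *v ext_one = ?f (p', q')" by simp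
    then show ?thesis by blast
  qed
  then have "(\<lambda>x. x *v ext_one) ` AA \<subseteq> range ?f" unfolding AA_eq by blast
  then have s: "surj ?f" unfolding AA_one by (rule top.extremum_uniqueI)
  show ?thesis using l s by (rule linear_surjective_imp_injective) simp
qed

lemma inj_qq: "inj qq"
proof (rule injI)
  fix p q assume "qq p = qq q"
  then show "p = q" using injD[OF qq_pair_inj, of "(p, 0)" "(q, 0)"] by simp
qed

lemma QQ_star: "dagger p ** ext_metric g = - (ext_metric g ** p)" if "p \<in> QQ"
proof -
  have L: "dagger (rho a) ** (ext_metric g ** M) = - (ext_metric g ** (rho a ** M))" for a M
    by (simp add: matrix_mul_assoc dagger_rho mat_distrib)
  have R: "M ** dagger (rho a) ** ext_metric g = - (M ** ext_metric g ** rho a)" for M :: extop and a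
    by (simp add: matrix_mul_assoc[symmetric] dagger_rho mat_distrib)
  \<comment> \<open>Four anti-self-adjoint factors give an even number of signs, and reversing four
    anticommuting factors takes six swaps, so \<open>JO\<close> is self-adjoint.\<close>
  have J: "dagger JO ** ext_metric g = ext_metric g ** JO"
    by (simp add: JO_def dagger_mult) (simp add: matrix_mul_assoc R mat_distrib dagger_rho, simp add: matrix_mul_assoc[symmetric] JO_normal JO_def rho_normal)
  have *: "dagger b ** ext_metric g = - (ext_metric g ** b)" if "b \<in> BB" for b
  proof -
    have "dagger II ** ext_metric g = - (ext_metric g ** II)"
      by (simp add: dagger_II mat_distrib II_central)
    moreover have i: "dagger (II ** M) ** ext_metric g = - (ext_metric g ** (II ** N))"
      if "dagger M ** ext_metric g = ext_metric g ** N" for M N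
    proof -
      have "dagger (II ** M) ** ext_metric g = - (II ** (dagger M ** ext_metric g))"
        by (simp add: dagger_mult dagger_II mat_distrib) (metis II_central matrix_mul_assoc)
      then show ?thesis by (simp add: that) (metis II_central matrix_mul_assoc)
    qed
    have "dagger (JO ** rho a) ** ext_metric g = ext_metric g ** (JO ** rho a)" for a
      by (simp add: dagger_mult matrix_mul_assoc[symmetric] J L) (simp add: JO_rho mat_distrib)
    with i J have "dagger (II ** JO) ** ext_metric g = - (ext_metric g ** (II ** JO))"
      "dagger (II ** (JO ** rho a)) ** ext_metric g = - (ext_metric g ** (II ** (JO ** rho a)))" for a
      by blast+
    moreover have "dagger (rho2 a b) ** ext_metric g = - (ext_metric g ** rho2 a b)" for a b
      by (simp add: rho2_def dagger_diff dagger_mult dagger_scaleR mat_distrib dagger_rho L matrix_mul_assoc[symmetric] scaleR_diff_right)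
    ultimately show ?thesis using that dagger_rho unfolding BB_def by auto
  qed
  show ?thesis
    using that unfolding QQ_def
    by (induction rule: span_induct_alt) (auto simp: * mat_distrib dagger_add dagger_scaleR dagger_zero)
qed

section \<open>Force tensors as anti-self-adjoint elements of the commutant\<close>

lemma gamma_upper_commute:
  "(\<forall>a. commutator (gamma_upper g a) M = 0) \<longleftrightarrow> (\<forall>a. gamma_lower g a ** M = M ** gamma_lower g a)"
proof
  assume *: "\<forall>a. commutator (gamma_upper g a) M = 0"
  have "gamma_lower g c = (\<Sum>a\<in>UNIV. g $ c $ a *\<^sub>R gamma_upper g a)" for c
    by (simp add: gamma_upper_def sum_matrix_action matrix_inv_mult[OF invertible_g] sum_mat_one)
  with * show "\<forall>a. gamma_lower g a ** M = M ** gamma_lower g a"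
    by (simp add: commutator_def matrix_mul_lsum matrix_mul_rsum mat_distrib)
next
  assume "\<forall>a. gamma_lower g a ** M = M ** gamma_lower g a"
  then show "\<forall>a. commutator (gamma_upper g a) M = 0"
    by (simp add: commutator_def gamma_upper_def matrix_mul_lsum matrix_mul_rsum mat_distrib)
qed

text \<open>In the decomposition of a commutant element as \<open>p\<close> plus i times
  \<open>q\<close>, with \<open>p\<close> and \<open>q\<close> in \<open>QQ\<close>, the second part
  is self-adjoint. The condition on force tensors says that this part vanishes.\<close>

lemma force_tensors_eq: "force_tensors g = {\<theta>. \<forall>a. \<theta> $ a \<in> QQ}"
proof -
  have "(dagger M ** ext_metric g + ext_metric g ** M = 0 \<and> (\<forall>a. commutator (gamma_upper g a) M = 0)) \<longleftrightarrow> M \<in> QQ" for M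
  proof
    assume M: "dagger M ** ext_metric g + ext_metric g ** M = 0 \<and> (\<forall>a. commutator (gamma_upper g a) M = 0)"
    then have "M \<in> AA" using commutant gamma_upper_commute by blast
    then obtain p q where pq: "M = p + II ** q" "p \<in> QQ" "q \<in> QQ" unfolding AA_eq by blast
    have "dagger (II ** q) ** ext_metric g = ext_metric g ** (II ** q)"
    proof -
      have "dagger (II ** q) ** ext_metric g = - (II ** (dagger q ** ext_metric g))"
        by (simp add: dagger_mult dagger_II mat_distrib) (metis II_central matrix_mul_assoc)
      then show ?thesis using QQ_star[OF pq(3)] by (simp add: mat_distrib) (metis II_central matrix_mul_assoc)
    qed
    \<comment> \<open>The contributions of \<open>p\<close> cancel and those of the self-adjoint
      part add up; nondegeneracy of the metric removes \<open>ext_metric g\<close>.\<close>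
    with M pq(1) QQ_star[OF pq(2)] have "2 *\<^sub>R (ext_metric g ** (II ** q)) = 0"
      by (simp add: dagger_add mat_distrib scaleR_2)
    then have "ext_metric g ** (II ** q) = 0" by simp
    then have "(II ** q) *v x = 0" for x
      using ext_metric_injective[OF g_sym invertible_g, of "(II ** q) *v x"] by (simp add: matrix_vector_mul_assoc)
    then have "II ** q = 0" unfolding matrix_eq by simp
    with pq show "M \<in> QQ" by simp
  next
    assume M: "M \<in> QQ"
    then have "M \<in> AA" using QQ_AA by blast
    then show "dagger M ** ext_metric g + ext_metric g ** M = 0 \<and> (\<forall>a. commutator (gamma_upper g a) M = 0)"
      using QQ_star[OF M] commutant gamma_upper_commute by auto
  qed
  then show ?thesis unfolding force_tensors_def by auto
qed

end

section \<open>Invariant subspaces of sums of representations (j, k)\<close>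

text \<open>Raising and lowering operators of the two copies of sl(2), with the bounds \<open>n s\<close> and
  \<open>m s\<close> for the two indices of the summand \<open>s\<close>.\<close>

definition lE :: "(nat \<Rightarrow> nat \<Rightarrow> nat \<Rightarrow> complex) \<Rightarrow> nat \<Rightarrow> nat \<Rightarrow> nat \<Rightarrow> complex" where
  "lE f s a b = of_nat (Suc a) * f s (Suc a) b"

text \<open>On polynomials in x and y with coefficient number \<open>a\<close> at x^(n-a) y^a,
  \<open>lE\<close> is x d/dy and this is y d/dx. The highest weight vector has index 0.\<close>

definition lF :: "(nat \<Rightarrow> nat) \<Rightarrow> (nat \<Rightarrow> nat \<Rightarrow> nat \<Rightarrow> complex) \<Rightarrow> nat \<Rightarrow> nat \<Rightarrow> nat \<Rightarrow> complex" where
  "lF n f s a b = (if a = 0 then 0 else (of_nat (n s) - of_nat a + 1) * f s (a - 1) b)"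

text \<open>Exchanges the two spins, so that results on the left operators transfer to the right
  ones.\<close>

definition flip :: "(nat \<Rightarrow> nat \<Rightarrow> nat \<Rightarrow> complex) \<Rightarrow> nat \<Rightarrow> nat \<Rightarrow> nat \<Rightarrow> complex" where
  "flip f s a b = f s b a"

definition rE :: "(nat \<Rightarrow> nat \<Rightarrow> nat \<Rightarrow> complex) \<Rightarrow> nat \<Rightarrow> nat \<Rightarrow> nat \<Rightarrow> complex" where
  "rE f = flip (lE (flip f))"

definition rF :: "(nat \<Rightarrow> nat) \<Rightarrow> (nat \<Rightarrow> nat \<Rightarrow> nat \<Rightarrow> complex) \<Rightarrow> nat \<Rightarrow> nat \<Rightarrow> nat \<Rightarrow> complex" where
  "rF m f = flip (lF m (flip f))"

lemma flip_flip [simp]: "flip (flip f) = f"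
  by (simp add: flip_def fun_eq_iff)

text \<open>What remains of an invariant complex subspace once the Lie algebra is forgotten. Unlike
  \<open>jk_act\<close>, it is visibly symmetric under \<open>flip\<close>.\<close>

definition ladder :: "nat \<Rightarrow> (nat \<Rightarrow> nat) \<Rightarrow> (nat \<Rightarrow> nat) \<Rightarrow> (nat \<Rightarrow> nat \<Rightarrow> nat \<Rightarrow> complex) set \<Rightarrow> bool" where
  "ladder S n m Y \<longleftrightarrow>
    (\<forall>f\<in>Y. \<forall>s a b. f s a b \<noteq> 0 \<longrightarrow> s < S \<and> a \<le> n s \<and> b \<le> m s) \<and>
    (\<lambda>s a b. 0) \<in> Y \<and>
    (\<forall>f\<in>Y. \<forall>h\<in>Y. (\<lambda>s a b. f s a b + h s a b) \<in> Y) \<and>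
    (\<forall>c. \<forall>f\<in>Y. (\<lambda>s a b. c * f s a b) \<in> Y) \<and>
    (\<forall>f\<in>Y. lE f \<in> Y \<and> lF n f \<in> Y \<and> rE f \<in> Y \<and> rF m f \<in> Y)"

lemma ladder_flip:
  assumes "ladder S n m Y"
  shows "ladder S m n (flip ` Y)"
  unfolding ladder_def
proof (intro conjI ballI allI impI)
  fix f s a b assume "f \<in> flip ` Y"
  then obtain f' where f': "f' \<in> Y" "f = flip f'" by blast
  {
    assume "f s a b \<noteq> 0"
    then have "f' s b a \<noteq> 0" using f' by (simp add: flip_def)
    then show "s < S" "a \<le> m s" "b \<le> n s" using assms f' unfolding ladder_def by blast+
  }
  show "(\<lambda>s a b. c * f s a b) \<in> flip ` Y" for c
  proof -
    have "(\<lambda>s a b. c * f' s a b) \<in> Y" using assms f' unfolding ladder_def by blast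
    moreover have "(\<lambda>s a b. c * f s a b) = flip (\<lambda>s a b. c * f' s a b)" using f' by (simp add: flip_def fun_eq_iff)
    ultimately show ?thesis by blast
  qed
  show "(\<lambda>s a b. f s a b + h s a b) \<in> flip ` Y" if "h \<in> flip ` Y" for h
  proof -
    from that obtain h' where h': "h' \<in> Y" "h = flip h'" by blast
    have "(\<lambda>s a b. f' s a b + h' s a b) \<in> Y" using assms f' h' unfolding ladder_def by blast
    moreover have "(\<lambda>s a b. f s a b + h s a b) = flip (\<lambda>s a b. f' s a b + h' s a b)"
      using f' h' by (simp add: flip_def fun_eq_iff)
    ultimately show ?thesis by blast
  qed
  have Y: "lE f' \<in> Y" "lF n f' \<in> Y" "rE f' \<in> Y" "rF m f' \<in> Y" using assms f' unfolding ladder_def by blast+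
  have "lE f = flip (rE f')" "lF m f = flip (rF m f')" "rE f = flip (lE f')" "rF n f = flip (lF n f')"
    using f' by (simp_all add: rE_def rF_def)
  with Y show "lE f \<in> flip ` Y" "lF m f \<in> flip ` Y" "rE f \<in> flip ` Y" "rF n f \<in> flip ` Y" by blast+
next
  have "(\<lambda>s a b. 0) = flip (\<lambda>s a b. 0)" by (simp add: flip_def fun_eq_iff)
  then show "(\<lambda>s a b. 0) \<in> flip ` Y" using assms unfolding ladder_def by blast
qed

lemma lE_power: "(lE ^^ k) f s a b = (fact (a + k) / fact a) * f s (a + k) b"
proof (induction k arbitrary: a)
  case (Suc k)
  have "(lE ^^ Suc k) f s a b = of_nat (Suc a) * ((lE ^^ k) f s (Suc a) b)"
    by (simp add: lE_def)
  also have "\<dots> = (of_nat (Suc a) * (fact (a + Suc k) / fact (Suc a))) * f s (a + Suc k) b"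
    unfolding Suc by simp
  also have "of_nat (Suc a) * (fact (a + Suc k) / fact (Suc a)) = (fact (a + Suc k) / fact a :: complex)"
    unfolding fact_Suc[of a] of_nat_mult by (simp del: of_nat_Suc fact_Suc)
  finally show ?case .
qed simp

lemma lF_power: "(lF n ^^ k) f s a b =
   (if a < k then 0 else (\<Prod>i<k. of_nat (n s) - of_nat a + of_nat i + 1) * f s (a - k) b)"
proof (induction k arbitrary: a)
  case (Suc k)
  show ?case
  proof (cases a)
    case 0
    then show ?thesis by (simp add: lF_def)
  next
    case (Suc a')
    have "(lF n ^^ Suc k) f s a b = (of_nat (n s) - of_nat a + 1) * ((lF n ^^ k) f s a' b)"
      by (simp add: lF_def Suc)
    also have "\<dots> = (if a < Suc k then 0 else (\<Prod>i<Suc k. of_nat (n s) - of_nat a + of_nat i + 1) * f s (a - Suc k) b)"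
      unfolding Suc.IH prod.lessThan_Suc_shift
      by (auto simp: Suc algebra_simps)
    finally show ?thesis .
  qed
qed simp

lemma lF_coeff_nonzero: "a \<le> n \<Longrightarrow> (\<Prod>i<k. of_nat n - of_nat a + of_nat i + 1 :: complex) \<noteq> 0"
proof -
  assume "a \<le> n"
  then have "(of_nat n - of_nat a + of_nat i + 1 :: complex) = of_nat (n - a + i + 1)" for i
    by (simp add: of_nat_diff)
  then show ?thesis by (simp del: of_nat_Suc of_nat_add)
qed

lemma ladder_power:
  assumes "ladder S n m Y" "f \<in> Y"
  shows "(lE ^^ k) f \<in> Y" "(lF n ^^ k) f \<in> Y" "(rE ^^ k) f \<in> Y" "(rF m ^^ k) f \<in> Y"
proof -
  show "(lE ^^ k) f \<in> Y" by (induction k) (use assms in \<open>auto simp: ladder_def\<close>)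
  show "(lF n ^^ k) f \<in> Y" by (induction k) (use assms in \<open>auto simp: ladder_def\<close>)
  show "(rE ^^ k) f \<in> Y" by (induction k) (use assms in \<open>auto simp: ladder_def\<close>)
  show "(rF m ^^ k) f \<in> Y" by (induction k) (use assms in \<open>auto simp: ladder_def\<close>)
qed

lemma r_power: "(rE ^^ k) f = flip ((lE ^^ k) (flip f))" "(rF m ^^ k) f = flip ((lF m ^^ k) (flip f))"
  by (induction k) (simp_all add: rE_def rF_def)

lemma ladder_sum:
  assumes "ladder S n m Y" "finite K" "\<And>k. k \<in> K \<Longrightarrow> f k \<in> Y"
  shows "(\<lambda>s a b. \<Sum>k\<in>K. c k * f k s a b) \<in> Y"
  using assms(2,3)
proof (induction K rule: finite_induct)
  case empty
  then show ?case using assms(1) by (simp add: ladder_def)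
next
  case (insert k K)
  have "(\<lambda>s a b. c k * f k s a b) \<in> Y" "(\<lambda>s a b. \<Sum>k\<in>K. c k * f k s a b) \<in> Y"
    using insert assms(1) unfolding ladder_def by auto
  then have "(\<lambda>s a b. c k * f k s a b + (\<Sum>k\<in>K. c k * f k s a b)) \<in> Y"
    using assms(1) unfolding ladder_def by (elim conjE) (drule bspec, assumption, drule bspec, assumption, simp)
  then show ?case using insert by simp
qed

text \<open>If the left spin of the summand \<open>s\<close> exceeds all others, lowering to the bottom and then raising
  \<open>n s\<close> times kills the other summands.\<close>

lemma ladder_left_dominant:
  assumes Y: "ladder S n m Y" and s: "s < S" and dom: "\<And>s'. s' < S \<Longrightarrow> s' \<noteq> s \<Longrightarrow> n s' < n s"
    and f: "f \<in> Y" "f s a0 b0 \<noteq> 0"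
    and h: "\<And>s' a b. h s' a b \<noteq> 0 \<Longrightarrow> s' = s \<and> a \<le> n s \<and> b \<le> m s"
  shows "h \<in> Y"
proof -
  have supp: "s' < S \<and> a \<le> n s' \<and> b \<le> m s'" if "k \<in> Y" "k s' a b \<noteq> 0" for k s' a b
    using Y that unfolding ladder_def by blast
  \<comment> \<open>The smallest left index occurring in the summand \<open>s\<close>. Applying
    \<open>lF\<close> exactly \<open>n s - a1\<close> times moves it to the last index
    \<open>n s\<close> and pushes all larger indices out of range.\<close>
  define a1 where "a1 = (LEAST a. \<exists>b. f s a b \<noteq> 0)"
  have "\<exists>b. f s a1 b \<noteq> 0" unfolding a1_def by (rule LeastI_ex) (use f in blast)
  then obtain b1 where b1: "f s a1 b1 \<noteq> 0" by blast
  have below_a1: "f s a b = 0" if "a < a1" for a b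
    using that not_less_Least[of a "\<lambda>a. \<exists>b. f s a b \<noteq> 0"] unfolding a1_def by blast
  have a1: "a1 \<le> n s" using supp[OF f(1) b1] by simp
  define g1 where "g1 = (lF n ^^ (n s - a1)) f"
  \<comment> \<open>Now coordinate \<open>a\<close> is a multiple of coordinate
    \<open>a + n s\<close> of \<open>g1\<close>. That index is out of range for
    \<open>a > 0\<close>, and by dominance for every \<open>a\<close> in the other summands.\<close>
  define g2 where "g2 = (lE ^^ n s) g1"
  have g1Y: "g1 \<in> Y" unfolding g1_def by (rule ladder_power[OF Y f(1)])
  have g2Y: "g2 \<in> Y" unfolding g2_def by (rule ladder_power[OF Y g1Y])
  have g2_other: "g2 s' a b = 0" if "s' \<noteq> s \<or> a \<noteq> 0" for s' a b
  proof (cases "s' < S")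
    case True
    have "n s' < a + n s \<or> s' = s \<and> n s < a + n s" using that dom[OF True] by (cases "s' = s") auto
    then have "g1 s' (a + n s) b = 0" using supp[OF g1Y, of s' "a + n s" b] by fastforce
    then show ?thesis by (simp add: g2_def lE_power)
  qed (use supp[OF g2Y] in blast)
  have g2_0: "g2 s 0 b1 \<noteq> 0"
  proof -
    have "g1 s (n s) b1 \<noteq> 0"
      using lF_coeff_nonzero[of "n s" "n s" "n s - a1"] b1 a1 by (simp add: g1_def lF_power)
    then show ?thesis by (simp add: g2_def lE_power)
  qed
  \<comment> \<open>The same idea in the right spin: raising by the largest right index present
    leaves only the coordinate (0, 0), the highest weight vector.\<close>
  define b2 where "b2 = (GREATEST b. g2 s 0 b \<noteq> 0)"
  have bound: "b \<le> m s" if "g2 s 0 b \<noteq> 0" for b using supp[OF g2Y that] by simp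
  have b2: "g2 s 0 b2 \<noteq> 0" unfolding b2_def by (rule GreatestI_nat[where b = "m s"]) (use g2_0 bound in auto)
  have b2_max: "b \<le> b2" if "g2 s 0 b \<noteq> 0" for b
    unfolding b2_def by (rule Greatest_le_nat[where b = "m s"]) (use that bound in auto)
  define g3 where "g3 = (rE ^^ b2) g2"
  have g3Y: "g3 \<in> Y" unfolding g3_def by (rule ladder_power[OF Y g2Y])
  have g3: "g3 s' a b = (fact (b + b2) / fact b) * g2 s' a (b + b2)" for s' a b
    by (simp add: g3_def r_power lE_power flip_def)
  have g3_0: "g3 s 0 0 \<noteq> 0" using b2 by (simp add: g3)
  have g3_other: "g3 s' a b = 0" if "\<not> (s' = s \<and> a = 0 \<and> b = 0)" for s' a b
    using that g2_other[of s' a] b2_max[of "b + b2"] by (cases "s' = s \<and> a = 0") (auto simp: g3)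
  \<comment> \<open>Lowering the highest weight vector gives each basis vector of the summand, up to
    the non-zero factor \<open>C a b\<close>.\<close>
  define d where "d a b = (rF m ^^ b) ((lF n ^^ a) g3)" for a b
  have dY: "d a b \<in> Y" for a b unfolding d_def by (intro ladder_power[OF Y] g3Y)
  define C where "C a b = (\<Prod>i<b. of_nat (m s) - of_nat b + of_nat i + 1) * (\<Prod>i<a. of_nat (n s) - of_nat a + of_nat i + 1) * g3 s 0 0" for a b
  have d: "d a b s' a' b' = (if s' = s \<and> a' = a \<and> b' = b then C a b else 0)" for a b s' a' b'
    using g3_other[of s' "a' - a" "b' - b"]
    by (auto simp: d_def r_power flip_def lF_power C_def)
  have C: "C a b \<noteq> 0" if "a \<le> n s" "b \<le> m s" for a b
    using that lF_coeff_nonzero[of a "n s" a] lF_coeff_nonzero[of b "m s" b] g3_0 by (simp add: C_def)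
  have "h = (\<lambda>s' a' b'. \<Sum>k\<in>{..n s} \<times> {..m s}. (h s (fst k) (snd k) / C (fst k) (snd k)) * d (fst k) (snd k) s' a' b')"
  proof (intro ext)
    fix s' a' b'
    have "(\<Sum>k\<in>{..n s} \<times> {..m s}. (h s (fst k) (snd k) / C (fst k) (snd k)) * d (fst k) (snd k) s' a' b')
      = (\<Sum>k\<in>{..n s} \<times> {..m s}. if k = (a', b') then (if s' = s then h s a' b' else 0) else 0)"
      by (intro sum.cong refl) (auto simp: d C)
    also have "\<dots> = (if (a', b') \<in> {..n s} \<times> {..m s} then (if s' = s then h s a' b' else 0) else 0)"
      by (rule sum.delta) simp
    also have "\<dots> = h s' a' b'" using h[of s' a' b'] by auto
    finally show "h s' a' b' = (\<Sum>k\<in>{..n s} \<times> {..m s}. (h s (fst k) (snd k) / C (fst k) (snd k)) * d (fst k) (snd k) s' a' b')" ..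
  qed
  also have "\<dots> \<in> Y" by (rule ladder_sum[OF Y]) (use dY in auto)
  finally show ?thesis .
qed

lemma ladder_dominant:
  assumes Y: "ladder S n m Y" and s: "s < S"
    and dom: "(\<forall>s'<S. s' \<noteq> s \<longrightarrow> n s' < n s) \<or> (\<forall>s'<S. s' \<noteq> s \<longrightarrow> m s' < m s)"
    and f: "f \<in> Y" "f s a0 b0 \<noteq> 0"
    and h: "\<And>s' a b. h s' a b \<noteq> 0 \<Longrightarrow> s' = s \<and> a \<le> n s \<and> b \<le> m s"
  shows "h \<in> Y"
  using dom
proof
  assume "\<forall>s'<S. s' \<noteq> s \<longrightarrow> n s' < n s"
  then show ?thesis using ladder_left_dominant[OF Y s _ f h] by blast
next
  assume d: "\<forall>s'<S. s' \<noteq> s \<longrightarrow> m s' < m s"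
  have "flip h \<in> flip ` Y"
  proof (rule ladder_left_dominant[OF ladder_flip[OF Y] s])
    show "flip f \<in> flip ` Y" using f by blast
    show "flip f s b0 a0 \<noteq> 0" using f by (simp add: flip_def)
    show "s' = s \<and> a \<le> m s \<and> b \<le> n s" if "flip h s' a b \<noteq> 0" for s' a b
      using h[of s' b a] that by (auto simp: flip_def)
  qed (use d in blast)
  then obtain h' where "h' \<in> Y" "flip h = flip h'" by blast
  then show ?thesis by (metis flip_flip)
qed

text \<open>Complex combinations of rotations and boosts separate the two copies of sl(2), which makes an
  invariant complex subspace closed under \<open>lE\<close>, \<open>lF\<close>, \<open>rE\<close> and \<open>rF\<close>.\<close>

definition so_elt :: "real \<Rightarrow> real \<Rightarrow> real \<Rightarrow> real \<Rightarrow> real \<Rightarrow> real \<Rightarrow> real^4^4" where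
  "so_elt r1 r2 r3 b1 b2 b3 = (\<chi> i j.
     if i = 0 then (if j = 0 then 0 else if j = 1 then b1 else if j = 2 then b2 else b3)
     else if i = 1 then (if j = 0 then b1 else if j = 1 then 0 else if j = 2 then - r3 else r2)
     else if i = 2 then (if j = 0 then b2 else if j = 1 then r3 else if j = 2 then 0 else - r1)
     else (if j = 0 then b3 else if j = 1 then - r2 else if j = 2 then r1 else 0))"

lemma so_elt_entries:
  "so_elt r1 r2 r3 b1 b2 b3 $ 0 $ 0 = 0" "so_elt r1 r2 r3 b1 b2 b3 $ 0 $ 1 = b1"
  "so_elt r1 r2 r3 b1 b2 b3 $ 0 $ 2 = b2" "so_elt r1 r2 r3 b1 b2 b3 $ 0 $ 3 = b3"
  "so_elt r1 r2 r3 b1 b2 b3 $ 1 $ 0 = b1" "so_elt r1 r2 r3 b1 b2 b3 $ 1 $ 1 = 0"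
  "so_elt r1 r2 r3 b1 b2 b3 $ 1 $ 2 = - r3" "so_elt r1 r2 r3 b1 b2 b3 $ 1 $ 3 = r2"
  "so_elt r1 r2 r3 b1 b2 b3 $ 2 $ 0 = b2" "so_elt r1 r2 r3 b1 b2 b3 $ 2 $ 1 = r3"
  "so_elt r1 r2 r3 b1 b2 b3 $ 2 $ 2 = 0" "so_elt r1 r2 r3 b1 b2 b3 $ 2 $ 3 = - r1"
  "so_elt r1 r2 r3 b1 b2 b3 $ 3 $ 0 = b3" "so_elt r1 r2 r3 b1 b2 b3 $ 3 $ 1 = - r2"
  "so_elt r1 r2 r3 b1 b2 b3 $ 3 $ 2 = r1" "so_elt r1 r2 r3 b1 b2 b3 $ 3 $ 3 = 0"
  by (simp_all add: so_elt_def)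

lemma so_elt_so: "so_elt r1 r2 r3 b1 b2 b3 \<in> so eta"
  unfolding so_def vec_eq_iff all4
  by (simp add: matrix_matrix_mult_def transpose_def sum_UNIV4 so_elt_entries eta_def)

lemma sl2_so_elt:
  "sl2_left (so_elt r1 r2 r3 b1 b2 b3) = sl2_mat (Complex r1 b1) (Complex r2 b2) (Complex r3 b3)"
  "sl2_right (so_elt r1 r2 r3 b1 b2 b3) = sl2_mat (Complex r1 (-b1)) (Complex r2 (-b2)) (Complex r3 (-b3))"
  by (simp_all add: sl2_left_def sl2_right_def so_elt_entries)

lemma sl2_mat_entries:
  "sl2_mat z1 z2 z3 $ 1 $ 1 = - \<i> * z3 / 2" "sl2_mat z1 z2 z3 $ 1 $ 2 = - \<i> * (z1 - \<i> * z2) / 2"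
  "sl2_mat z1 z2 z3 $ 2 $ 1 = - \<i> * (z1 + \<i> * z2) / 2" "sl2_mat z1 z2 z3 $ 2 $ 2 = \<i> * z3 / 2"
  by (simp_all add: sl2_mat_def)

lemma jk_ladder:
  assumes sub: "Y \<subseteq> jk_space l" and z: "(\<lambda>s a b. 0) \<in> Y"
    and add: "\<And>f h. f \<in> Y \<Longrightarrow> h \<in> Y \<Longrightarrow> (\<lambda>s a b. f s a b + h s a b) \<in> Y"
    and scale: "\<And>c f. f \<in> Y \<Longrightarrow> (\<lambda>s a b. c * f s a b) \<in> Y"
    and act: "\<And>L f. L \<in> so eta \<Longrightarrow> f \<in> Y \<Longrightarrow> jk_act l L f \<in> Y"
  shows "ladder (length l) (\<lambda>s. twice (fst (l ! s))) (\<lambda>s. twice (snd (l ! s))) Y" (is "ladder _ ?n ?m _")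
proof -
  have comb: "(\<lambda>s a b. c1 * jk_act l L1 f s a b + (c2 * jk_act l L2 f s a b + (c3 * jk_act l L3 f s a b + c4 * jk_act l L4 f s a b))) \<in> Y"
    if "f \<in> Y" "L1 \<in> so eta" "L2 \<in> so eta" "L3 \<in> so eta" "L4 \<in> so eta" for c1 c2 c3 c4 L1 L2 L3 L4 f
    using that by (intro add scale act)
  let ?R1 = "so_elt 1 0 0 0 0 0" and ?R2 = "so_elt 0 1 0 0 0 0" and ?B1 = "so_elt 0 0 0 1 0 0" and ?B2 = "so_elt 0 0 0 0 1 0"
  have E: "lE f \<in> Y \<and> lF ?n f \<in> Y \<and> rE f \<in> Y \<and> rF ?m f \<in> Y" if f: "f \<in> Y" for f
  proof -
    have 0: "f s a b = 0" if "\<not> s < length l" for s a b using f sub that unfolding jk_space_def by blast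
    \<comment> \<open>With rotations R_i and boosts B_i, the combination (R_i - i B_i)/2 acts as
      \<tau>_i on the left copy alone, and (R_i + i B_i)/2 on the right copy alone. The coefficients
      are those of the raising matrix i \<tau>_1 - \<tau>_2 and the lowering matrix i \<tau>_1 +
      \<tau>_2.\<close>
    have "lE f = (\<lambda>s a b. \<i>/2 * jk_act l ?R1 f s a b + (1/2 * jk_act l ?B1 f s a b + (-1/2 * jk_act l ?R2 f s a b + \<i>/2 * jk_act l ?B2 f s a b)))"
      by (intro ext) (auto simp: lE_def jk_act_def sym_act_def sl2_so_elt sl2_mat_entries complex_eq_iff 0 field_simps)
    moreover have "lF ?n f = (\<lambda>s a b. \<i>/2 * jk_act l ?R1 f s a b + (1/2 * jk_act l ?B1 f s a b + (1/2 * jk_act l ?R2 f s a b + (-\<i>/2) * jk_act l ?B2 f s a b)))"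
      by (intro ext) (auto simp: lF_def jk_act_def sym_act_def sl2_so_elt sl2_mat_entries complex_eq_iff 0 field_simps)
    moreover have "rE f = (\<lambda>s a b. \<i>/2 * jk_act l ?R1 f s a b + (-1/2 * jk_act l ?B1 f s a b + (-1/2 * jk_act l ?R2 f s a b + (-\<i>/2) * jk_act l ?B2 f s a b)))"
      by (intro ext) (auto simp: rE_def flip_def lE_def jk_act_def sym_act_def sl2_so_elt sl2_mat_entries complex_eq_iff 0 field_simps)
    moreover have "rF ?m f = (\<lambda>s a b. \<i>/2 * jk_act l ?R1 f s a b + (-1/2 * jk_act l ?B1 f s a b + (1/2 * jk_act l ?R2 f s a b + \<i>/2 * jk_act l ?B2 f s a b)))"
      by (intro ext) (auto simp: rF_def flip_def lF_def jk_act_def sym_act_def sl2_so_elt sl2_mat_entries complex_eq_iff 0 field_simps)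
    ultimately show ?thesis using f by (simp only:) (intro conjI comb so_elt_so)
  qed
  show ?thesis
    unfolding ladder_def
  proof (intro conjI ballI allI impI)
    fix f s a b assume "f \<in> Y" "f s a b \<noteq> 0"
    then show "s < length l" "a \<le> ?n s" "b \<le> ?m s" using sub unfolding jk_space_def by blast+
  qed (use E z add scale in blast)+
qed


section \<open>Real representations of spinor type\<close>

text \<open>The condition of \<open>has_type\<close> for \<open>eta\<close> and the standard frame.
  Frames enter only when tensor models are carried over to force tensors.\<close>

definition spin_type :: "(real^4^4 \<Rightarrow> 'v::real_vector \<Rightarrow> 'v) \<Rightarrow> 'v set \<Rightarrow> (rat \<times> rat) list \<Rightarrow> bool" where
  "spin_type act W l \<longleftrightarrow> (\<exists>\<Phi>. bij_betw \<Phi> (W \<times> W) (jk_space l) \<and>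
        (\<forall>x\<in>W \<times> W. \<forall>y\<in>W \<times> W. \<Phi> (x + y) = (\<lambda>s a b. \<Phi> x s a b + \<Phi> y s a b)) \<and>
        (\<forall>c. \<forall>x\<in>W \<times> W. \<Phi> (cpx_scale c x) = (\<lambda>s a b. c * \<Phi> x s a b)) \<and>
        (\<forall>L\<in>so eta. \<forall>x\<in>W \<times> W. \<Phi> (cpx_act act L x) = jk_act l L (\<Phi> x)))"

definition dominant :: "(rat \<times> rat) list \<Rightarrow> bool" where
  "dominant l \<longleftrightarrow> (\<forall>s<length l.
     (\<forall>s'<length l. s' \<noteq> s \<longrightarrow> twice (fst (l ! s')) < twice (fst (l ! s))) \<or>
     (\<forall>s'<length l. s' \<noteq> s \<longrightarrow> twice (snd (l ! s')) < twice (snd (l ! s))))"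

text \<open>A non-zero component in a summand, however mixed with others, puts the whole summand
  into \<open>Y\<close> by \<open>ladder_dominant\<close>; the summands then add up.\<close>

lemma invariant_jk_subspace_full:
  assumes sub: "Y \<subseteq> jk_space l" and z: "(\<lambda>s a b. 0) \<in> Y"
    and add: "\<And>f h. f \<in> Y \<Longrightarrow> h \<in> Y \<Longrightarrow> (\<lambda>s a b. f s a b + h s a b) \<in> Y"
    and scale: "\<And>c f. f \<in> Y \<Longrightarrow> (\<lambda>s a b. c * f s a b) \<in> Y"
    and act: "\<And>L f. L \<in> so eta \<Longrightarrow> f \<in> Y \<Longrightarrow> jk_act l L f \<in> Y"
    and dom: "dominant l"
    and ne: "\<And>s. s < length l \<Longrightarrow> \<exists>f\<in>Y. \<exists>a b. f s a b \<noteq> 0"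
  shows "Y = jk_space l"
proof (rule antisym[OF sub], rule subsetI)
  have lad: "ladder (length l) (\<lambda>s. twice (fst (l ! s))) (\<lambda>s. twice (snd (l ! s))) Y"
    using sub z add scale act by (rule jk_ladder)
  fix h assume h: "h \<in> jk_space l"
  have part: "(\<lambda>s' a b. if s' = s then h s a b else 0) \<in> Y" if s: "s < length l" for s
  proof -
    obtain f a b where f: "f \<in> Y" "f s a b \<noteq> 0" using ne[OF s] by blast
    have d: "(\<forall>s'<length l. s' \<noteq> s \<longrightarrow> twice (fst (l ! s')) < twice (fst (l ! s))) \<or>
     (\<forall>s'<length l. s' \<noteq> s \<longrightarrow> twice (snd (l ! s')) < twice (snd (l ! s)))"
      using dom s by (simp add: dominant_def)
    show ?thesis
      by (rule ladder_dominant[OF lad s d f]) (use h in \<open>auto simp: jk_space_def split: if_splits\<close>)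
  qed
  have "h = (\<lambda>s' a b. \<Sum>s<length l. 1 * (if s' = s then h s a b else 0))"
    using h by (auto simp: fun_eq_iff jk_space_def)
  also have "\<dots> \<in> Y" by (rule ladder_sum[OF lad]) (use part in auto)
  finally show "h \<in> Y" .
qed

text \<open>Both conclusions describe the image of \<open>U \<times> U\<close> for a non-zero
  invariant \<open>U\<close> in \<open>M\<close>: it is the whole of \<open>jk_space l\<close>. For
  \<open>U = M\<close> this is surjectivity; for general \<open>U\<close> the images of
  \<open>U \<times> U\<close> and \<open>M \<times> M\<close> agree, and injectivity gives
  \<open>U = M\<close>. Hypothesis \<open>real\<close> demands a component in every summand for real
  vectors only; complex vectors may lie in a single summand.\<close>

lemma spin_type_irreducible:
  fixes M :: "'v::real_vector set" and \<Phi> :: "'v \<times> 'v \<Rightarrow> nat \<Rightarrow> nat \<Rightarrow> nat \<Rightarrow> complex"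
  assumes M: "subspace M" "M \<noteq> {0}" "\<And>L x. L \<in> so eta \<Longrightarrow> x \<in> M \<Longrightarrow> act L x \<in> M"
    and inj: "inj_on \<Phi> (M \<times> M)" and into: "\<Phi> ` (M \<times> M) \<subseteq> jk_space l"
    and add: "\<And>x y. x \<in> M \<times> M \<Longrightarrow> y \<in> M \<times> M \<Longrightarrow> \<Phi> (x + y) = (\<lambda>s a b. \<Phi> x s a b + \<Phi> y s a b)"
    and scale: "\<And>c x. x \<in> M \<times> M \<Longrightarrow> \<Phi> (cpx_scale c x) = (\<lambda>s a b. c * \<Phi> x s a b)"
    and act: "\<And>L x. L \<in> so eta \<Longrightarrow> x \<in> M \<times> M \<Longrightarrow> \<Phi> (cpx_act act L x) = jk_act l L (\<Phi> x)"
    and dom: "dominant l"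
    and real: "\<And>u s. u \<in> M \<Longrightarrow> u \<noteq> 0 \<Longrightarrow> s < length l \<Longrightarrow> \<exists>a b. \<Phi> (u, 0) s a b \<noteq> 0"
  shows "spin_type act M l" "irreducible_subrep (so eta) act M M"
proof -
  have full: "\<Phi> ` (U \<times> U) = jk_space l"
    if U: "subspace U" "U \<subseteq> M" "\<And>L u. L \<in> so eta \<Longrightarrow> u \<in> U \<Longrightarrow> act L u \<in> U" "U \<noteq> {0}" for U
  proof -
    have UM: "U \<times> U \<subseteq> M \<times> M" using U(2) by blast
    obtain u where u: "u \<in> U" "u \<noteq> 0" using U(1,4) subspace_0 by blast
    have u0: "(u, 0) \<in> U \<times> U" using u subspace_0[OF U(1)] by simp
    have cs: "cpx_scale c x \<in> U \<times> U" if "x \<in> U \<times> U" for c x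
      using that U(1) by (auto simp: cpx_scale_def intro!: subspace_add subspace_diff subspace_scale)
    have ca: "cpx_act act L x \<in> U \<times> U" if "L \<in> so eta" "x \<in> U \<times> U" for L x
      using that U(3) by (auto simp: cpx_act_def)
    have pl: "x + y \<in> U \<times> U" if "x \<in> U \<times> U" "y \<in> U \<times> U" for x y
      using that subspace_add[OF U(1)] by auto
    show ?thesis
    proof (rule invariant_jk_subspace_full[OF _ _ _ _ _ dom])
      show "\<Phi> ` (U \<times> U) \<subseteq> jk_space l" using into UM by blast
      have "\<Phi> (cpx_scale 0 (u, 0)) = (\<lambda>s a b. 0)" using scale[OF subsetD[OF UM u0], of 0] by simp
      then show "(\<lambda>s a b. 0) \<in> \<Phi> ` (U \<times> U)" using imageI[OF cs[OF u0, of 0], of \<Phi>] by simp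
    next
      fix f h assume fh: "f \<in> \<Phi> ` (U \<times> U)" "h \<in> \<Phi> ` (U \<times> U)"
      from fh(1) obtain x where x: "x \<in> U \<times> U" "f = \<Phi> x" by (elim imageE)
      from fh(2) obtain y where y: "y \<in> U \<times> U" "h = \<Phi> y" by (elim imageE)
      have "\<Phi> (x + y) = (\<lambda>s a b. f s a b + h s a b)"
        unfolding x(2) y(2) by (rule add[OF subsetD[OF UM x(1)] subsetD[OF UM y(1)]])
      then show "(\<lambda>s a b. f s a b + h s a b) \<in> \<Phi> ` (U \<times> U)"
        using imageI[OF pl[OF x(1) y(1)], of \<Phi>] by simp
    next
      fix c f assume f: "f \<in> \<Phi> ` (U \<times> U)"
      from f obtain x where x: "x \<in> U \<times> U" "f = \<Phi> x" by (elim imageE)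
      have "\<Phi> (cpx_scale c x) = (\<lambda>s a b. c * f s a b)" unfolding x(2) by (rule scale[OF subsetD[OF UM x(1)]])
      then show "(\<lambda>s a b. c * f s a b) \<in> \<Phi> ` (U \<times> U)" using imageI[OF cs[OF x(1), of c], of \<Phi>] by simp
    next
      fix L f assume L: "L \<in> so eta" and f: "f \<in> \<Phi> ` (U \<times> U)"
      from f obtain x where x: "x \<in> U \<times> U" "f = \<Phi> x" by (elim imageE)
      have "\<Phi> (cpx_act act L x) = jk_act l L f" unfolding x(2) by (rule act[OF L subsetD[OF UM x(1)]])
      then show "jk_act l L f \<in> \<Phi> ` (U \<times> U)" using imageI[OF ca[OF L x(1)], of \<Phi>] by simp
    next
      fix s assume "s < length l"
      then obtain a b where "\<Phi> (u, 0) s a b \<noteq> 0" using real[of u s] u U(2) by blast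
      then show "\<exists>f\<in>\<Phi> ` (U \<times> U). \<exists>a b. f s a b \<noteq> 0" using u0 by blast
    qed
  qed
  have "bij_betw \<Phi> (M \<times> M) (jk_space l)"
    using inj full[of M] M unfolding bij_betw_def by auto
  then show "spin_type act M l" unfolding spin_type_def using add scale act by blast
  show "irreducible_subrep (so eta) act M M"
    unfolding irreducible_subrep_def
  proof (intro conjI allI impI)
    show "subrep (so eta) act M M" using M by (simp add: subrep_def)
    show "M \<noteq> {0}" by fact
    fix U assume "subrep (so eta) act M U"
    then have U: "subspace U" "U \<subseteq> M" "\<And>L u. L \<in> so eta \<Longrightarrow> u \<in> U \<Longrightarrow> act L u \<in> U"
      by (auto simp: subrep_def)
    show "U = {0} \<or> U = M"
    proof (cases "U = {0}")
      case False
      note ne = this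
      have "\<Phi> ` (U \<times> U) = \<Phi> ` (M \<times> M)"
        using full[OF U ne] full[of M] M by simp
      then have "U \<times> U = M \<times> M"
        using inj_on_image_eq_iff[OF inj, of "U \<times> U" "M \<times> M"] U(2) by blast
      then have "U = M" by blast
      then show ?thesis ..
    qed simp
  qed
qed

section \<open>Spinor polynomials and complex conjugation\<close>

definition spinor_act :: "nat \<Rightarrow> nat \<Rightarrow> real^4^4 \<Rightarrow> (nat \<Rightarrow> nat \<Rightarrow> complex) \<Rightarrow> nat \<Rightarrow> nat \<Rightarrow> complex" where
  "spinor_act n m L f a b = sym_act n (sl2_left L) (\<lambda>a'. f a' b) a + sym_act m (sl2_right L) (\<lambda>b'. f a b') b"

text \<open>Just above the range, at index \<open>n + 1\<close>, the only neighbour that could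
  contribute carries the factor \<open>n - (n + 1) + 1 = 0\<close>. Equivariance therefore has to be
  checked only at finitely many indices.\<close>

lemma sym_act_outside:
  assumes "\<And>a. n < a \<Longrightarrow> h a = 0" "n < a"
  shows "sym_act n X h a = 0"
proof (cases "a = Suc n")
  case False
  then have "n < a - 1" using assms(2) by simp
  then show ?thesis using assms by (simp add: sym_act_def)
qed (use assms in \<open>simp add: sym_act_def\<close>)

lemma spinor_act_outside:
  assumes supp: "\<And>a b. f a b \<noteq> 0 \<Longrightarrow> a \<le> n \<and> b \<le> m" and ab: "\<not> (a \<le> n \<and> b \<le> m)"
  shows "spinor_act n m L f a b = 0"
proof -
  have 0: "f a b = 0" if "n < a \<or> m < b" for a b using supp[of a b] that by force
  have z: "sym_act k X (\<lambda>a. 0) c = 0" for k X c by (simp add: sym_act_def)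
  have "sym_act n (sl2_left L) (\<lambda>a'. f a' b) a = 0"
  proof (cases "n < a")
    case True then show ?thesis by (intro sym_act_outside) (auto simp: 0)
  next
    case False then show ?thesis using ab by (simp add: 0 z)
  qed
  moreover have "sym_act m (sl2_right L) (\<lambda>b'. f a b') b = 0"
  proof (cases "m < b")
    case True then show ?thesis by (intro sym_act_outside) (auto simp: 0)
  next
    case False then show ?thesis using ab by (simp add: 0 z)
  qed
  ultimately show ?thesis by (simp add: spinor_act_def)
qed

lemma sym_act_add: "sym_act n X (\<lambda>a. f a + h a) a = sym_act n X f a + sym_act n X h a"
  and sym_act_mult: "sym_act n X (\<lambda>a. c * f a) a = c * sym_act n X f a"
  by (simp_all add: sym_act_def algebra_simps)

text \<open>The right matrix is minus the conjugate transpose of the left one. This is the trace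
  left by the reality of \<open>L\<close>, and the reason why complex conjugation exchanges the two
  spins.\<close>

lemma sl2_right_left:
  "sl2_right L $ 1 $ 1 = - cnj (sl2_left L $ 1 $ 1)" "sl2_right L $ 1 $ 2 = - cnj (sl2_left L $ 2 $ 1)"
  "sl2_right L $ 2 $ 1 = - cnj (sl2_left L $ 1 $ 2)" "sl2_right L $ 2 $ 2 = cnj (sl2_left L $ 1 $ 1)"
  "sl2_left L $ 2 $ 2 = - (sl2_left L $ 1 $ 1)"
  by (simp_all add: sl2_right_def sl2_left_def sl2_mat_entries complex_eq_iff)

text \<open>The antilinear map on the \<open>n\<close>-th symmetric power induced by \<open>(v\<^sub>1, v\<^sub>2) \<mapsto> (- cnj v\<^sub>2, cnj v\<^sub>1)\<close>
  on \<open>C\<^sup>2\<close>; it exchanges the two copies of sl(2).\<close>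

lemma sym_act_conj:
  assumes X: "R $ 1 $ 1 = - cnj (X $ 1 $ 1)" "R $ 1 $ 2 = - cnj (X $ 2 $ 1)"
      "R $ 2 $ 1 = - cnj (X $ 1 $ 2)" "R $ 2 $ 2 = cnj (X $ 1 $ 1)" "X $ 2 $ 2 = - (X $ 1 $ 1)"
    and f: "\<And>a. n < a \<Longrightarrow> f a = 0" and m: "m \<le> n"
  shows "sym_act n R (\<lambda>m. if m \<le> n then (-1) ^ (n - m) * cnj (f (n - m)) else 0) m =
    (-1) ^ (n - m) * cnj (sym_act n X f (n - m))"
proof -
  define k where "k = n - m"
  have mk: "m = n - k" "k \<le> n" using m by (auto simp: k_def)
  have nm: "of_nat m = (of_nat n - of_nat k :: complex)" using mk by (simp add: of_nat_diff)
  \<comment> \<open>Reversing the index exchanges the neighbours: the term at \<open>m - 1\<close>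
    becomes the one at \<open>k + 1\<close>, and in \<open>B\<close> the term at
    \<open>m + 1\<close> becomes the one at \<open>k - 1\<close>.\<close>
  have A: "(if m = 0 then 0 else (of_nat n - of_nat m + 1) * R $ 2 $ 1 *
      (if m - 1 \<le> n then (-1) ^ (n - (m - 1)) * cnj (f (n - (m - 1))) else 0)) =
     (-1) ^ k * cnj ((of_nat k + 1) * X $ 1 $ 2 * f (k + 1))"
  proof (cases "m = 0")
    case True
    then have "n < k + 1" using mk by auto
    then show ?thesis using True f by simp
  next
    case False
    then have "n - (m - 1) = Suc k" using m by (simp add: k_def)
    then show ?thesis using False m by (simp add: X nm)
  qed
  have B: "(of_nat m + 1) * R $ 1 $ 2 * (if m + 1 \<le> n then (-1) ^ (n - (m + 1)) * cnj (f (n - (m + 1))) else 0) =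
     (-1) ^ k * cnj (if k = 0 then 0 else (of_nat n - of_nat k + 1) * X $ 2 $ 1 * f (k - 1))"
  proof (cases "k = 0")
    case True
    then show ?thesis using mk by simp
  next
    case False
    then obtain k' where k': "k = Suc k'" using not0_implies_Suc by blast
    then have "n - (m + 1) = k'" "m + 1 \<le> n" using mk by auto
    then show ?thesis using False by (simp add: X nm k')
  qed
  show ?thesis
    unfolding sym_act_def A B k_def[symmetric]
    using m by (simp add: X nm k_def[symmetric]) (simp add: algebra_simps)
qed

text \<open>The map is the complex-linear extension of \<open>\<phi>\<close>. Dominance is vacuous
  for one summand, and the condition on real vectors is \<open>inj\<close> at
  \<open>y = 0\<close>.\<close>

lemma spin_type_single:
  fixes M :: "'v::real_vector set" and \<phi> :: "'v \<Rightarrow> nat \<Rightarrow> nat \<Rightarrow> complex"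
  assumes M: "subspace M" "M \<noteq> {0}" "\<And>L x. L \<in> so eta \<Longrightarrow> x \<in> M \<Longrightarrow> act L x \<in> M"
    and add: "\<And>x y a b. \<phi> (x + y) a b = \<phi> x a b + \<phi> y a b"
    and scale: "\<And>c x a b. \<phi> (c *\<^sub>R x) a b = of_real c * \<phi> x a b"
    and supp: "\<And>x a b. \<phi> x a b \<noteq> 0 \<Longrightarrow> a \<le> twice j \<and> b \<le> twice k"
    and act: "\<And>L x a b. L \<in> so eta \<Longrightarrow> x \<in> M \<Longrightarrow> a \<le> twice j \<Longrightarrow> b \<le> twice k \<Longrightarrow>
         \<phi> (act L x) a b = spinor_act (twice j) (twice k) L (\<phi> x) a b"
    and inj: "\<And>x y. x \<in> M \<Longrightarrow> y \<in> M \<Longrightarrow> (\<And>a b. a \<le> twice j \<Longrightarrow> b \<le> twice k \<Longrightarrow> \<phi> x a b + \<i> * \<phi> y a b = 0) \<Longrightarrow> x = 0 \<and> y = 0"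
  shows "spin_type act M [(j, k)]" "irreducible_subrep (so eta) act M M"
proof -
  define \<Phi> where "\<Phi> p s a b = (if s = (0::nat) then \<phi> (fst p) a b + \<i> * \<phi> (snd p) a b else 0)" for p s a b
  have act': "\<phi> (act L x) a b = spinor_act (twice j) (twice k) L (\<phi> x) a b" if "L \<in> so eta" "x \<in> M" for L x a b
  proof (cases "a \<le> twice j \<and> b \<le> twice k")
    case False
    then have "spinor_act (twice j) (twice k) L (\<phi> x) a b = 0"
      using supp by (intro spinor_act_outside)
    moreover have "\<phi> (act L x) a b = 0" using False supp by blast
    ultimately show ?thesis by simp
  qed (use act that in blast)
  have mat: "\<phi> (x - y) a b = \<phi> x a b - \<phi> y a b" for x y a b
    using add[of "x - y" y a b] by simp
  note lin = add scale mat
  have zero: "\<phi> 0 a b = 0" for a b using scale[of 0 0 a b] by simp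
  have r1: "inj_on \<Phi> (M \<times> M)"
  proof (rule inj_onI)
    fix p q assume p: "p \<in> M \<times> M" "q \<in> M \<times> M" "\<Phi> p = \<Phi> q"
    have "\<phi> (fst p - fst q) a b + \<i> * \<phi> (snd p - snd q) a b = 0" for a b
      using fun_cong[OF fun_cong[OF fun_cong[OF p(3), of 0], of a], of b] by (simp add: \<Phi>_def mat algebra_simps)
    then have "fst p - fst q = 0 \<and> snd p - snd q = 0"
      using p M(1) by (intro inj) (auto intro: subspace_diff)
    then show "p = q" by (simp add: prod_eq_iff)
  qed
  have r2: "\<Phi> ` (M \<times> M) \<subseteq> jk_space [(j, k)]"
  proof -
    have 0: "\<phi> x a b = 0" if "\<not> (a \<le> twice j \<and> b \<le> twice k)" for x a b using supp that by blast
    have "s = 0 \<and> a \<le> twice j \<and> b \<le> twice k" if "\<Phi> p s a b \<noteq> 0" for p s a b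
      using that 0[of a b] by (cases "a \<le> twice j \<and> b \<le> twice k") (auto simp: \<Phi>_def split: if_splits)
    then have "\<Phi> p \<in> jk_space [(j, k)]" for p unfolding jk_space_def by fastforce
    then show ?thesis by blast
  qed
  have r3: "\<Phi> (x + y) = (\<lambda>s a b. \<Phi> x s a b + \<Phi> y s a b)" for x y
    by (simp add: \<Phi>_def fun_eq_iff lin algebra_simps)
  have r4: "\<Phi> (cpx_scale c x) = (\<lambda>s a b. c * \<Phi> x s a b)" for c x
    by (simp add: \<Phi>_def fun_eq_iff lin cpx_scale_def complex_eq_iff algebra_simps)
  have r5: "\<Phi> (cpx_act act L x) = jk_act [(j, k)] L (\<Phi> x)" if "L \<in> so eta" "x \<in> M \<times> M" for L x
    using that act'[OF that(1), of "fst x"] act'[OF that(1), of "snd x"]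
    by (auto simp: \<Phi>_def fun_eq_iff cpx_act_def jk_act_def spinor_act_def sym_act_add sym_act_mult algebra_simps)
  have r6: "dominant [(j, k)]" by (simp add: dominant_def)
  have r7: "\<exists>a b. \<Phi> (u, 0) s a b \<noteq> 0" if "u \<in> M" "u \<noteq> 0" "s < length [(j, k)]" for u s
    using inj[of u 0] that subspace_0[OF M(1)] by (auto simp: \<Phi>_def zero)
  note r = spin_type_irreducible[of M act \<Phi> "[(j, k)]", OF M r1 r2 r3 r4 r5 r6 r7]
  show "spin_type act M [(j, k)]" "irreducible_subrep (so eta) act M M" by (rule r; assumption)+
qed

text \<open>Here \<open>\<phi>\<close> maps to (j, k) only; the component in (k, j) is its conjugate
  \<open>\<psi>\<close>. Injectivity on real vectors suffices, because the two components of a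
  complex vector x + i y determine \<open>\<phi> x + \<i> * \<phi> y\<close> and
  \<open>\<phi> x - \<i> * \<phi> y\<close>. By \<open>jk\<close>, the first summand dominates in
  the left spin and the second in the right spin.\<close>

lemma spin_type_pair:
  fixes M :: "'v::real_vector set" and \<phi> :: "'v \<Rightarrow> nat \<Rightarrow> nat \<Rightarrow> complex"
  assumes M: "subspace M" "M \<noteq> {0}" "\<And>L x. L \<in> so eta \<Longrightarrow> x \<in> M \<Longrightarrow> act L x \<in> M"
    and add: "\<And>x y a b. \<phi> (x + y) a b = \<phi> x a b + \<phi> y a b"
    and scale: "\<And>c x a b. \<phi> (c *\<^sub>R x) a b = of_real c * \<phi> x a b"
    and supp: "\<And>x a b. \<phi> x a b \<noteq> 0 \<Longrightarrow> a \<le> twice j \<and> b \<le> twice k"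
    and act: "\<And>L x a b. L \<in> so eta \<Longrightarrow> x \<in> M \<Longrightarrow> a \<le> twice j \<Longrightarrow> b \<le> twice k \<Longrightarrow>
         \<phi> (act L x) a b = spinor_act (twice j) (twice k) L (\<phi> x) a b"
    and inj: "\<And>x. x \<in> M \<Longrightarrow> (\<And>a b. a \<le> twice j \<Longrightarrow> b \<le> twice k \<Longrightarrow> \<phi> x a b = 0) \<Longrightarrow> x = 0"
    and jk: "twice k < twice j"
  shows "spin_type act M [(j, k), (k, j)]" "irreducible_subrep (so eta) act M M"
proof -
  define n m where "n = twice j" and "m = twice k"
  note supp' = supp[folded n_def m_def] and act0 = act[folded n_def m_def] and inj' = inj[folded n_def m_def]
  \<comment> \<open>The antilinear map of \<open>sym_act_conj\<close> in both indices, with a single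
    conjugation. This form suits an application in \<open>a\<close>; \<open>\<psi>2\<close>
    rearranges it for \<open>b\<close>.\<close>
  define \<psi> where "\<psi> x a b = (if a \<le> m then (-1) ^ (m - a) * cnj (if b \<le> n then (-1) ^ (n - b) * \<phi> x (n - b) (m - a) else 0) else 0)" for x a b
  have \<psi>2: "\<psi> x a b = (if b \<le> n then (-1) ^ (n - b) * cnj (if a \<le> m then (-1) ^ (m - a) * \<phi> x (n - b) (m - a) else 0) else 0)" for x a b
    by (auto simp: \<psi>_def)
  define \<Phi> where "\<Phi> p s a b = (if s = (0::nat) then \<phi> (fst p) a b + \<i> * \<phi> (snd p) a b
     else if s = 1 then \<psi> (fst p) a b + \<i> * \<psi> (snd p) a b else 0)" for p s a b
  have act': "\<phi> (act L x) a b = spinor_act n m L (\<phi> x) a b" if "L \<in> so eta" "x \<in> M" for L x a b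
  proof (cases "a \<le> n \<and> b \<le> m")
    case False
    then have "spinor_act n m L (\<phi> x) a b = 0"
      using supp' by (intro spinor_act_outside)
    moreover have "\<phi> (act L x) a b = 0" using False supp' by blast
    ultimately show ?thesis by simp
  qed (use act0 that in blast)
  have "\<psi> (act L x) a b = spinor_act m n L (\<psi> x) a b" if L: "L \<in> so eta" "x \<in> M" for L x a b
  proof (cases "a \<le> m \<and> b \<le> n")
    case False
    then have "spinor_act m n L (\<psi> x) a b = 0"
      by (intro spinor_act_outside) (auto simp: \<psi>_def split: if_splits)
    then show ?thesis using False by (auto simp: \<psi>_def)
  next
    case True
    have z: "m < b' \<Longrightarrow> \<phi> x a' b' = 0" "n < a' \<Longrightarrow> \<phi> x a' b' = 0" for a' b' using supp'[of x a' b'] by auto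
    have l: "sym_act m (sl2_left L) (\<lambda>a'. \<psi> x a' b) a = (-1) ^ (m - a) * cnj (sym_act m (sl2_right L) (\<lambda>b'. (-1) ^ (n - b) * \<phi> x (n - b) b') (m - a))"
    proof -
      have "(\<lambda>a'. \<psi> x a' b) = (\<lambda>a'. if a' \<le> m then (-1) ^ (m - a') * cnj ((\<lambda>b'. (-1) ^ (n - b) * \<phi> x (n - b) b') (m - a')) else 0)"
        using True by (simp add: \<psi>_def fun_eq_iff)
      then show ?thesis
        by (simp only:) (rule sym_act_conj, use True z sl2_right_left[of L] in auto)
    qed
    have r: "sym_act n (sl2_right L) (\<lambda>b'. \<psi> x a b') b = (-1) ^ (n - b) * cnj (sym_act n (sl2_left L) (\<lambda>a'. (-1) ^ (m - a) * \<phi> x a' (m - a)) (n - b))"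
    proof -
      have "(\<lambda>b'. \<psi> x a b') = (\<lambda>b'. if b' \<le> n then (-1) ^ (n - b') * cnj ((\<lambda>a'. (-1) ^ (m - a) * \<phi> x a' (m - a)) (n - b')) else 0)"
        using True by (simp add: \<psi>2 fun_eq_iff)
      then show ?thesis
        by (simp only:) (rule sym_act_conj, use True z sl2_right_left[of L] in auto)
    qed
    show ?thesis
      unfolding spinor_act_def l r sym_act_mult
      using True by (simp add: \<psi>_def act'[OF L] spinor_act_def algebra_simps)
  qed
  note act\<psi> = this
  have mat: "\<phi> (x - y) a b = \<phi> x a b - \<phi> y a b" for x y a b
    using add[of "x - y" y a b] by simp
  note lin = add scale mat
  have zero: "\<phi> 0 a b = 0" for a b using scale[of 0 0 a b] by simp
  have \<psi>lin: "\<psi> (x + y) a b = \<psi> x a b + \<psi> y a b" "\<psi> (c *\<^sub>R x) a b = of_real c * \<psi> x a b"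
    "\<psi> (x - y) a b = \<psi> x a b - \<psi> y a b" "\<psi> 0 a b = 0" for x y a b c
    by (auto simp: \<psi>_def lin zero algebra_simps)
  have \<psi>\<phi>: "\<phi> x a b = (-1) ^ (a + b) * cnj (\<psi> x (m - b) (n - a))" if "a \<le> n" "b \<le> m" for x a b
    using that by (simp add: \<psi>_def power_add mult.assoc[symmetric] power_mult_distrib[symmetric])
      (simp add: mult_ac power_mult_distrib[symmetric])
  have r1: "inj_on \<Phi> (M \<times> M)"
  proof (rule inj_onI)
    fix p q assume p: "p \<in> M \<times> M" "q \<in> M \<times> M" "\<Phi> p = \<Phi> q"
    let ?x = "fst p - fst q" and ?y = "snd p - snd q"
    have 0: "\<phi> ?x a b + \<i> * \<phi> ?y a b = 0" for a b
      using fun_cong[OF fun_cong[OF fun_cong[OF p(3), of 0], of a], of b] by (simp add: \<Phi>_def mat algebra_simps)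
    have 1: "\<psi> ?x a b + \<i> * \<psi> ?y a b = 0" for a b
      using fun_cong[OF fun_cong[OF fun_cong[OF p(3), of 1], of a], of b] by (simp add: \<Phi>_def \<psi>lin algebra_simps)
    have "\<phi> ?x a b = 0 \<and> \<phi> ?y a b = 0" if "a \<le> n" "b \<le> m" for a b
    proof -
      \<comment> \<open>Conjugating the second component reverses the sign of i, which separates
        \<open>\<phi> ?x\<close> from \<open>\<phi> ?y\<close>.\<close>
      have "\<phi> ?x a b - \<i> * \<phi> ?y a b = (-1) ^ (a + b) * cnj (\<psi> ?x (m - b) (n - a) + \<i> * \<psi> ?y (m - b) (n - a))"
        unfolding \<psi>\<phi>[OF that] by (simp add: algebra_simps)
      then have "\<phi> ?x a b - \<i> * \<phi> ?y a b = 0" by (simp only: 1) simp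
      with 0[of a b] show ?thesis by (simp add: complex_eq_iff)
    qed
    moreover have "?x \<in> M" "?y \<in> M" using p M(1) by (auto intro!: subspace_diff)
    ultimately have "?x = 0" "?y = 0" using inj' by blast+
    then show "p = q" by (simp add: prod_eq_iff)
  qed
  have r2: "\<Phi> ` (M \<times> M) \<subseteq> jk_space [(j, k), (k, j)]"
  proof -
    have \<phi>0: "\<phi> x a b = 0" if "\<not> (a \<le> n \<and> b \<le> m)" for x a b using supp' that by blast
    have \<psi>0: "\<psi> x a b = 0" if "\<not> (a \<le> m \<and> b \<le> n)" for x a b using that by (auto simp: \<psi>_def)
    show ?thesis
      unfolding jk_space_def
    proof (intro subsetI CollectI allI impI)
      fix f s a b assume f: "f \<in> \<Phi> ` (M \<times> M)" "f s a b \<noteq> 0"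
      then obtain p where p: "f = \<Phi> p" by blast
      show "s < length [(j, k), (k, j)] \<and> a \<le> twice (fst ([(j, k), (k, j)] ! s)) \<and> b \<le> twice (snd ([(j, k), (k, j)] ! s))"
      proof (cases "s = 0")
        case True
        have "a \<le> n \<and> b \<le> m"
        proof (rule ccontr)
          assume "\<not> (a \<le> n \<and> b \<le> m)"
          from \<phi>0[OF this] show False using True f(2) p by (simp add: \<Phi>_def)
        qed
        with True show ?thesis by (simp add: n_def m_def)
      next
        case False
        then have "s = 1" using f(2) p by (auto simp: \<Phi>_def split: if_splits)
        moreover have "a \<le> m \<and> b \<le> n"
        proof (rule ccontr)
          assume "\<not> (a \<le> m \<and> b \<le> n)"
          from \<psi>0[OF this] show False using \<open>s = 1\<close> f(2) p by (simp add: \<Phi>_def)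
        qed
        ultimately show ?thesis by (simp add: n_def m_def)
      qed
    qed
  qed
  have r3: "\<Phi> (x + y) = (\<lambda>s a b. \<Phi> x s a b + \<Phi> y s a b)" for x y
    by (simp add: \<Phi>_def fun_eq_iff lin \<psi>lin algebra_simps)
  have r4: "\<Phi> (cpx_scale c x) = (\<lambda>s a b. c * \<Phi> x s a b)" for c x
    by (simp add: \<Phi>_def fun_eq_iff lin \<psi>lin cpx_scale_def complex_eq_iff algebra_simps)
  have r5: "\<Phi> (cpx_act act L x) = jk_act [(j, k), (k, j)] L (\<Phi> x)" if "L \<in> so eta" "x \<in> M \<times> M" for L x
  proof (intro ext)
    fix s a b :: nat
    have x: "fst x \<in> M" "snd x \<in> M" using that by auto
    have \<Phi>': "\<Phi> x 0 a = (\<lambda>b. \<phi> (fst x) a b + \<i> * \<phi> (snd x) a b)"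
      "\<Phi> x (Suc 0) a = (\<lambda>b. \<psi> (fst x) a b + \<i> * \<psi> (snd x) a b)"
      by (simp_all add: \<Phi>_def fun_eq_iff)
    consider "s = 0" | "s = 1" | "s \<ge> 2" by linarith
    then show "\<Phi> (cpx_act act L x) s a b = jk_act [(j, k), (k, j)] L (\<Phi> x) s a b"
      by cases (simp_all add: \<Phi>_def cpx_act_def jk_act_def act'[OF that(1)] act\<psi>[OF that(1)] x
          spinor_act_def sym_act_add sym_act_mult n_def[symmetric] m_def[symmetric], simp_all add: \<Phi>' sym_act_add sym_act_mult algebra_simps)
  qed
  have r6: "dominant [(j, k), (k, j)]"
    using jk by (auto simp: dominant_def less_Suc_eq nth_Cons split: nat.splits)
  have r7: "\<exists>a b. \<Phi> (u, 0) s a b \<noteq> 0" if "u \<in> M" "u \<noteq> 0" "s < length [(j, k), (k, j)]" for u s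
  proof -
    have "\<exists>a b. a \<le> n \<and> b \<le> m \<and> \<phi> u a b \<noteq> 0"
    proof (rule ccontr)
      assume "\<not> (\<exists>a b. a \<le> n \<and> b \<le> m \<and> \<phi> u a b \<noteq> 0)"
      then have "a \<le> n \<Longrightarrow> b \<le> m \<Longrightarrow> \<phi> u a b = 0" for a b by auto
      from inj'[OF that(1) this] that(2) show False by simp
    qed
    then obtain a b where ab: "a \<le> n" "b \<le> m" "\<phi> u a b \<noteq> 0" by (elim exE conjE)
    then have "\<psi> u (m - b) (n - a) \<noteq> 0" using \<psi>\<phi>[OF ab(1,2), of u] by auto
    moreover have "s = 0 \<or> s = 1" using that by auto
    ultimately show ?thesis using ab by (auto simp: \<Phi>_def zero \<psi>lin)
  qed
  note r = spin_type_irreducible[of M act \<Phi> "[(j, k), (k, j)]", OF M r1 r2 r3 r4 r5 r6 r7]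
  show "spin_type act M [(j, k), (k, j)]" "irreducible_subrep (so eta) act M M" by (rule r; assumption)+
qed

section \<open>Tensor models of the summands\<close>

text \<open>The natural action on tensors with two upper indices; \<open>act3\<close> is the same
  with three.\<close>

definition act2 :: "real^4^4 \<Rightarrow> real^4^4 \<Rightarrow> real^4^4" where
  "act2 L X = L ** X + X ** transpose L"

definition act3 :: "real^4^4 \<Rightarrow> real^4^4^4 \<Rightarrow> real^4^4^4" where
  "act3 L F = (\<chi> a. (\<Sum>b\<in>UNIV. L $ a $ b *\<^sub>R F $ b) + act2 L (F $ a))"

definition M6 :: "(real^4^4) set" where
  "M6 = {X. transpose X = - X}"

definition M9 :: "(real^4^4) set" where
  "M9 = {X. transpose X = X \<and> X $ 0 $ 0 - X $ 1 $ 1 - X $ 2 $ 2 - X $ 3 $ 3 = 0}"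

definition A3 :: "(real^4^4^4) set" where
  "A3 = {F. \<forall>a. F $ a \<in> M6}"

definition contr :: "real^4^4^4 \<Rightarrow> 4 \<Rightarrow> real" where
  "contr F s = F $ 0 $ 0 $ s - F $ 1 $ 1 $ s - F $ 2 $ 2 $ s - F $ 3 $ 3 $ s"

text \<open>On tensors antisymmetric in the last two indices this is total antisymmetrization up to
  a factor. The four increasing triples in \<open>M16\<close> amount to the Levi-Civita condition,
  see \<open>levi_civita_cyc\<close>.\<close>

definition cyc :: "real^4^4^4 \<Rightarrow> 4 \<Rightarrow> 4 \<Rightarrow> 4 \<Rightarrow> real" where
  "cyc F a b c = F $ a $ b $ c + F $ b $ c $ a + F $ c $ a $ b"

definition M16 :: "(real^4^4^4) set" where
  "M16 = {F \<in> A3. (\<forall>s. contr F s = 0) \<and> cyc F 0 1 2 = 0 \<and> cyc F 0 1 3 = 0 \<and> cyc F 0 2 3 = 0 \<and> cyc F 1 2 3 = 0}"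

text \<open>Rewrite rules to six independent entries, by which equivariance becomes a finite list of
  polynomial identities.\<close>

lemma M6_entries:
  assumes "X \<in> M6"
  shows "X $ 0 $ 0 = 0" "X $ 1 $ 1 = 0" "X $ 2 $ 2 = 0" "X $ 3 $ 3 = 0"
    "X $ 1 $ 0 = - X $ 0 $ 1" "X $ 2 $ 0 = - X $ 0 $ 2" "X $ 3 $ 0 = - X $ 0 $ 3"
    "X $ 2 $ 1 = - X $ 1 $ 2" "X $ 3 $ 1 = - X $ 1 $ 3" "X $ 3 $ 2 = - X $ 2 $ 3"
proof -
  have "X $ a $ b = - X $ b $ a" for a b
  proof -
    have "transpose X $ b $ a = (- X) $ b $ a" using assms by (simp add: M6_def)
    then show ?thesis by (simp add: transpose_def)
  qed
  from this[of 0 0] this[of 1 1] this[of 2 2] this[of 3 3] this[of 1 0] this[of 2 0] this[of 3 0] this[of 2 1] this[of 3 1] this[of 3 2]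
  show "X $ 0 $ 0 = 0" "X $ 1 $ 1 = 0" "X $ 2 $ 2 = 0" "X $ 3 $ 3 = 0"
    "X $ 1 $ 0 = - X $ 0 $ 1" "X $ 2 $ 0 = - X $ 0 $ 2" "X $ 3 $ 0 = - X $ 0 $ 3"
    "X $ 2 $ 1 = - X $ 1 $ 2" "X $ 3 $ 1 = - X $ 1 $ 3" "X $ 3 $ 2 = - X $ 2 $ 3" by linarith+
qed

lemma M9_entries:
  assumes "X \<in> M9"
  shows "X $ 0 $ 0 = X $ 1 $ 1 + X $ 2 $ 2 + X $ 3 $ 3"
    "X $ 1 $ 0 = X $ 0 $ 1" "X $ 2 $ 0 = X $ 0 $ 2" "X $ 3 $ 0 = X $ 0 $ 3"
    "X $ 2 $ 1 = X $ 1 $ 2" "X $ 3 $ 1 = X $ 1 $ 3" "X $ 3 $ 2 = X $ 2 $ 3"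
proof -
  have s: "X $ a $ b = X $ b $ a" for a b
  proof -
    have "transpose X $ b $ a = X $ b $ a" using assms by (simp add: M9_def)
    then show ?thesis by (simp add: transpose_def)
  qed
  show "X $ 0 $ 0 = X $ 1 $ 1 + X $ 2 $ 2 + X $ 3 $ 3" using assms by (simp add: M9_def)
  show "X $ 1 $ 0 = X $ 0 $ 1" "X $ 2 $ 0 = X $ 0 $ 2" "X $ 3 $ 0 = X $ 0 $ 3"
    "X $ 2 $ 1 = X $ 1 $ 2" "X $ 3 $ 1 = X $ 1 $ 3" "X $ 3 $ 2 = X $ 2 $ 3" by (rule s)+
qed

lemma act2_nth: "act2 L X $ a $ b = (\<Sum>c\<in>UNIV. L $ a $ c * X $ c $ b) + (\<Sum>c\<in>UNIV. X $ a $ c * L $ b $ c)"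
  by (simp add: act2_def matrix_matrix_mult_def transpose_def)

lemma act3_nth: "act3 L F $ a $ r $ s = (\<Sum>b\<in>UNIV. L $ a $ b * F $ b $ r $ s)
   + (\<Sum>b\<in>UNIV. L $ r $ b * F $ a $ b $ s) + (\<Sum>b\<in>UNIV. F $ a $ r $ b * L $ s $ b)"
  by (simp add: act3_def act2_nth)

lemma transpose_add: "transpose (A + B) = transpose A + transpose B"
  and transpose_scale: "transpose (c *\<^sub>R A) = c *\<^sub>R transpose A"
  and transpose_0: "transpose 0 = 0"
  for A B :: "real^'n^'n"
  by (simp_all add: transpose_def vec_eq_iff)

lemma act2_transpose: "transpose (act2 L X) = act2 L (transpose X)"
  by (simp add: act2_def matrix_transpose_mul transpose_add)
 
lemma act2_M6: "X \<in> M6 \<Longrightarrow> act2 L X \<in> M6"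
  by (simp add: M6_def act2_transpose) (simp add: act2_def mat_distrib)

lemma subspace_M6: "subspace M6"
  by (rule subspaceI) (simp_all add: M6_def transpose_add transpose_scale transpose_0)

lemma subspace_M9: "subspace M9"
  by (rule subspaceI)
    (simp_all add: M9_def transpose_add transpose_scale transpose_0 right_diff_distrib[symmetric])

lemma subspace_A3: "subspace A3"
  by (rule subspaceI) (use subspace_M6 in \<open>simp_all add: A3_def subspace_0 subspace_add subspace_scale\<close>)

lemma subspace_M16: "subspace M16"
proof (rule subspaceI)
  show "0 \<in> M16" by (simp add: M16_def subspace_0[OF subspace_A3] contr_def cyc_def)
next
  fix x y assume "x \<in> M16" "y \<in> M16"
  moreover have "contr (x + y) s = contr x s + contr y s" for s by (simp add: contr_def)
  moreover have "cyc (x + y) a b c = cyc x a b c + cyc y a b c" for a b c by (simp add: cyc_def)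
  ultimately show "x + y \<in> M16" by (simp add: M16_def subspace_add[OF subspace_A3])
next
  fix k x assume "x \<in> M16"
  moreover have "contr (k *\<^sub>R x) s = k * contr x s" for s by (simp add: contr_def algebra_simps)
  moreover have "cyc (k *\<^sub>R x) a b c = k * cyc x a b c" for a b c by (simp add: cyc_def algebra_simps)
  ultimately show "k *\<^sub>R x \<in> M16" by (simp add: M16_def subspace_scale[OF subspace_A3])
qed

lemma act2_M9:
  assumes "L \<in> so eta" "X \<in> M9"
  shows "act2 L X \<in> M9"
proof -
  have "transpose (act2 L X) = act2 L X" using assms(2) by (simp add: act2_transpose M9_def)
  moreover have "act2 L X $ 0 $ 0 - act2 L X $ 1 $ 1 - act2 L X $ 2 $ 2 - act2 L X $ 3 $ 3 = 0"
    by (simp add: act2_nth sum_UNIV4 so_eta_entries[OF assms(1)] M9_entries[OF assms(2)] algebra_simps)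
  ultimately show ?thesis by (simp add: M9_def)
qed

lemma act3_A3: "F \<in> A3 \<Longrightarrow> act3 L F \<in> A3"
  using act2_M6 by (auto simp: A3_def act3_def intro!: subspace_add[OF subspace_M6] subspace_sum[OF subspace_M6] subspace_scale[OF subspace_M6])

lemma contr_act3:
  assumes "L \<in> so eta" 
  shows "contr (act3 L F) s = (\<Sum>b\<in>UNIV. L $ s $ b * contr F b)"
  by (simp add: contr_def act3_nth sum_UNIV4 so_eta_entries[OF assms] algebra_simps)

lemma A3_entries: "F \<in> A3 \<Longrightarrow> F $ a \<in> M6"
  by (simp add: A3_def)

lemma act3_M16:
  assumes "L \<in> so eta" "F \<in> M16"
  shows "act3 L F \<in> M16"
proof -
  have F: "F \<in> A3" "\<And>s. contr F s = 0" and c: "cyc F 0 1 2 = 0" "cyc F 0 1 3 = 0" "cyc F 0 2 3 = 0" "cyc F 1 2 3 = 0"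
    using assms(2) by (auto simp: M16_def)
  note e = M6_entries[OF A3_entries[OF F(1)]]
  \<comment> \<open>Each cyclic condition is solved for one entry, so that the simplifier can
    eliminate it.\<close>
  have e1: "F $ 0 $ 1 $ 2 = F $ 1 $ 0 $ 2 - F $ 2 $ 0 $ 1" "F $ 0 $ 1 $ 3 = F $ 1 $ 0 $ 3 - F $ 3 $ 0 $ 1"
    "F $ 0 $ 2 $ 3 = F $ 2 $ 0 $ 3 - F $ 3 $ 0 $ 2" "F $ 1 $ 2 $ 3 = F $ 2 $ 1 $ 3 - F $ 3 $ 1 $ 2"
    using c by (simp_all add: cyc_def e)
  have "cyc (act3 L F) 0 1 2 = 0" "cyc (act3 L F) 0 1 3 = 0" "cyc (act3 L F) 0 2 3 = 0" "cyc (act3 L F) 1 2 3 = 0"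
    by (simp_all add: cyc_def act3_nth sum_UNIV4 so_eta_entries[OF assms(1)] e e1 algebra_simps)
  then show ?thesis
    using act3_A3[OF F(1)] by (simp add: M16_def contr_act3[OF assms(1)] F(2))
qed

subsection \<open>Spinor coordinates\<close>

text \<open>The coordinates of the vector \<open>e\<^sub>a\<close> in (1/2, 1/2): with Pauli matrices \<open>\<sigma>\<close>, these are the entries of
  \<open>\<sigma>\<^sub>a\<close> times the matrix with rows (0, 1) and (-1, 0).\<close>

definition spin_vec :: "nat \<Rightarrow> nat \<Rightarrow> (4 \<Rightarrow> complex) \<Rightarrow> complex" where
  "spin_vec i j z = (if i = 0 then (if j = 0 then - z 1 + \<i> * z 2 else if j = 1 then z 0 + z 3 else 0)
     else if i = 1 then (if j = 0 then - z 0 + z 3 else if j = 1 then z 1 + \<i> * z 2 else 0) else 0)"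

definition phi4 :: "real^4 \<Rightarrow> nat \<Rightarrow> nat \<Rightarrow> complex" where
  "phi4 x i j = spin_vec i j (\<lambda>a. of_real (x $ a))"

text \<open>The adjoint representation: an antisymmetric \<open>X\<close> is \<open>L\<eta>\<close> with \<open>L \<in> so(\<eta>)\<close>, and \<open>sl2_left L\<close> is
  identified with a binary quadratic form.\<close>

definition quad :: "real^4^4 \<Rightarrow> nat \<Rightarrow> complex" where
  "quad X k = (let z1 = Complex (X $ 2 $ 3) (- X $ 0 $ 1); z2 = Complex (- X $ 1 $ 3) (- X $ 0 $ 2);
      z3 = Complex (X $ 1 $ 2) (- X $ 0 $ 3)
    in if k = 0 then z1 - \<i> * z2 else if k = 1 then - 2 * z3 else if k = 2 then - z1 - \<i> * z2 else 0)"

definition phi6 :: "real^4^4 \<Rightarrow> nat \<Rightarrow> nat \<Rightarrow> complex" where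
  "phi6 X i j = (if j = 0 then quad X i else 0)"

text \<open>Coordinates of a vector form a polynomial linear in each of two pairs of variables.
  Multiplying two such polynomials, hence the convolution in both indices, projects the tensor
  product to (1, 1).\<close>

definition phi9 :: "real^4^4 \<Rightarrow> nat \<Rightarrow> nat \<Rightarrow> complex" where
  "phi9 X m n = (\<Sum>i\<le>m. \<Sum>j\<le>n. spin_vec i j (\<lambda>a. spin_vec (m - i) (n - j) (\<lambda>b. of_real (X $ a $ b))))"

text \<open>The product of a vector polynomial with a quadratic form in the left variables, which
  projects (1/2, 1/2) tensor (1, 0) to (3/2, 1/2).\<close>

definition spin16 :: "(4 \<Rightarrow> nat \<Rightarrow> complex) \<Rightarrow> nat \<Rightarrow> nat \<Rightarrow> complex" where
  "spin16 Q m n = (\<Sum>i\<le>m. spin_vec i n (\<lambda>a. Q a (m - i)))"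

definition phi16 :: "real^4^4^4 \<Rightarrow> nat \<Rightarrow> nat \<Rightarrow> complex" where
  "phi16 F m n = spin16 (\<lambda>a. quad (F $ a)) m n"

lemma twice_values: "twice (1/2) = 1" "twice 1 = 2" "twice 0 = 0" "twice (3/2) = 3"
  by (simp_all add: twice_def)

lemma sl2_left_entries:
  "sl2_left L $ 1 $ 1 = - \<i> * Complex (L $ 2 $ 1) (L $ 3 $ 0) / 2"
  "sl2_left L $ 1 $ 2 = - \<i> * (Complex (L $ 3 $ 2) (L $ 1 $ 0) - \<i> * Complex (L $ 1 $ 3) (L $ 2 $ 0)) / 2"
  "sl2_left L $ 2 $ 1 = - \<i> * (Complex (L $ 3 $ 2) (L $ 1 $ 0) + \<i> * Complex (L $ 1 $ 3) (L $ 2 $ 0)) / 2"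
  "sl2_left L $ 2 $ 2 = \<i> * Complex (L $ 2 $ 1) (L $ 3 $ 0) / 2"
  by (simp_all add: sl2_left_def sl2_mat_entries)

lemma le1_cases: "a \<le> 1 \<Longrightarrow> a = 0 \<or> a = (1::nat)" by auto
lemma le2_cases: "a \<le> 2 \<Longrightarrow> a = 0 \<or> a = 1 \<or> a = (2::nat)" by auto
lemma le3_cases: "a \<le> 3 \<Longrightarrow> a = 0 \<or> a = 1 \<or> a = 2 \<or> a = (3::nat)" by auto

lemma spin_type_4:
  "spin_type (*v) (UNIV :: (real^4) set) [(1/2, 1/2)]" "irreducible_subrep (so eta) (*v) (UNIV :: (real^4) set) UNIV"
proof -
  have ne: "(UNIV :: (real^4) set) \<noteq> {0}"
    by (metis UNIV_I singletonD zero_neq_one)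
  have eq: "phi4 (L *v x) a b = spinor_act (twice (1/2)) (twice (1/2)) L (phi4 x) a b"
    if "L \<in> so eta" "x \<in> UNIV" "a \<le> twice (1/2)" "b \<le> twice (1/2)" for L x a b
    using le1_cases[OF that(3)[unfolded twice_values]] le1_cases[OF that(4)[unfolded twice_values]]
    by (elim disjE)
      (simp_all add: twice_values spinor_act_def sym_act_def phi4_def spin_vec_def sl2_right_left sl2_left_entries
       matrix_vector_mult_def sum_UNIV4 so_eta_entries[OF that(1)] complex_eq_iff, simp_all add: field_simps)
  have inj: "x = 0 \<and> y = 0" if "\<And>a b. a \<le> twice (1/2) \<Longrightarrow> b \<le> twice (1/2) \<Longrightarrow> phi4 x a b + \<i> * phi4 y a b = 0" for x y
    using that[of 0 0] that[of 0 1] that[of 1 0] that[of 1 1]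
    unfolding vec_eq_iff all4 by (simp add: twice_values phi4_def spin_vec_def complex_eq_iff)
  note r = spin_type_single[of "UNIV :: (real^4) set" "(*v)" phi4 "1/2" "1/2", OF subspace_UNIV ne UNIV_I _ _ _ eq inj]
  show "spin_type (*v) (UNIV :: (real^4) set) [(1/2, 1/2)]" "irreducible_subrep (so eta) (*v) (UNIV :: (real^4) set) UNIV"
    by (rule r; simp add: phi4_def spin_vec_def twice_values algebra_simps split: if_splits)+
qed

lemma quad_act2:
  assumes "L \<in> so eta" "X \<in> M6" "k \<le> 2"
  shows "quad (act2 L X) k = sym_act 2 (sl2_left L) (quad X) k"
  using le2_cases[OF assms(3)]
  by (elim disjE)
    (simp_all add: quad_def sym_act_def sl2_left_entries act2_nth sum_UNIV4 so_eta_entries[OF assms(1)]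
      M6_entries[OF assms(2)] complex_eq_iff, simp_all add: field_simps)

lemma quad_outside: "2 < k \<Longrightarrow> quad X k = 0"
  by (simp add: quad_def)

lemma quad_linear: "quad (X + Y) k = quad X k + quad Y k" "quad (c *\<^sub>R X) k = of_real c * quad X k"
  by (simp_all add: quad_def Let_def complex_eq_iff algebra_simps)

lemma quad_sum: "quad (sum f S) k = (\<Sum>i\<in>S. quad (f i) k)"
  by (induction S rule: infinite_finite_induct) (simp_all add: quad_linear quad_linear(2)[of 0 0, simplified])

lemma sym_act_0: "sym_act 0 X f 0 = X $ 1 $ 2 * f 1"
  by (simp add: sym_act_def)

lemma spin_type_6:
  "spin_type act2 M6 [(1, 0), (0, 1)]" "irreducible_subrep (so eta) act2 M6 M6"
proof -
  have "(\<chi> a b. if a = 0 \<and> b = 1 then 1 else if a = 1 \<and> b = 0 then -1 else 0) \<in> M6 - {0}"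
    unfolding M6_def transpose_def by (auto simp: vec_eq_iff)
  then have ne: "M6 \<noteq> {0}" by blast
  have eq: "phi6 (act2 L x) a b = spinor_act (twice 1) (twice 0) L (phi6 x) a b"
    if "L \<in> so eta" "x \<in> M6" "a \<le> twice 1" "b \<le> twice 0" for L x a b
  proof -
    have "sym_act 0 (sl2_right L) (\<lambda>b'. phi6 x a b') 0 = 0" by (simp add: sym_act_0 phi6_def)
    then show ?thesis using that quad_act2[OF that(1,2), of a] by (simp add: twice_values spinor_act_def phi6_def)
  qed
  have inj: "x = 0" if "x \<in> M6" "\<And>a b. a \<le> twice 1 \<Longrightarrow> b \<le> twice 0 \<Longrightarrow> phi6 x a b = 0" for x
    using that(2)[of 0 0] that(2)[of 1 0] that(2)[of 2 0]
    unfolding vec_eq_iff all4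
    by (simp add: twice_values phi6_def quad_def complex_eq_iff M6_entries[OF that(1)])
  have lt: "twice 0 < twice 1" by (simp add: twice_values)
  have l: "phi6 (x + y) a b = phi6 x a b + phi6 y a b" "phi6 (c *\<^sub>R x) a b = of_real c * phi6 x a b" for x y a b c
    by (simp_all add: phi6_def quad_linear)
  have s: "phi6 x a b \<noteq> 0 \<Longrightarrow> a \<le> twice 1 \<and> b \<le> twice 0" for x a b
    using quad_outside[of a x] by (cases "a \<le> 2") (auto simp: phi6_def twice_values split: if_splits)
  note r = spin_type_pair[of M6 act2 phi6 1 0, OF subspace_M6 ne act2_M6 _ _ _ eq inj lt]
  show "spin_type act2 M6 [(1, 0), (0, 1)]" "irreducible_subrep (so eta) act2 M6 M6"
    by (rule r; (rule l | erule s | assumption))+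
qed

lemma spin_vec_linear:
  "spin_vec i j (\<lambda>a. f a + h a) = spin_vec i j f + spin_vec i j h"
  "spin_vec i j (\<lambda>a. c * f a) = c * spin_vec i j f"
  by (simp_all add: spin_vec_def algebra_simps)

lemma spin_vec_outside: "1 < i \<or> 1 < j \<Longrightarrow> spin_vec i j z = 0"
  by (auto simp: spin_vec_def)

lemma spin_vec_0: "spin_vec i j (\<lambda>a. 0) = 0"
  by (simp add: spin_vec_def)

lemma spin_type_9:
  "spin_type act2 M9 [(1, 1)]" "irreducible_subrep (so eta) act2 M9 M9"
proof -
  have "(\<chi> a b. if a = 0 \<and> b = 1 \<or> a = 1 \<and> b = 0 then 1 else 0) \<in> M9 - {0}"
    unfolding M9_def transpose_def by (auto simp: vec_eq_iff)
  then have ne: "M9 \<noteq> {0}" by blast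
  have supp: "phi9 X a b = 0" if "\<not> (a \<le> 2 \<and> b \<le> 2)" for X a b
    unfolding phi9_def
  proof (intro sum.neutral ballI)
    fix i j assume "i \<in> {..a}" "j \<in> {..b}"
    then have "1 < i \<or> 1 < j \<or> 1 < a - i \<or> 1 < b - j" using that by auto
    then show "spin_vec i j (\<lambda>c. spin_vec (a - i) (b - j) (\<lambda>d. of_real (X $ c $ d))) = 0"
      by (elim disjE) (simp_all add: spin_vec_outside spin_vec_0)
  qed
  have eq: "phi9 (act2 L x) a b = spinor_act (twice 1) (twice 1) L (phi9 x) a b"
    if "L \<in> so eta" "x \<in> M9" "a \<le> twice 1" "b \<le> twice 1" for L x a b
    using le2_cases[OF that(3)[unfolded twice_values]] le2_cases[OF that(4)[unfolded twice_values]]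
    by (elim disjE)
      (simp_all add: twice_values spinor_act_def sym_act_def phi9_def spin_vec_def sl2_right_left sl2_left_entries
       act2_nth sum_UNIV4 so_eta_entries[OF that(1)] M9_entries[OF that(2)] complex_eq_iff numeral_2_eq_2, simp_all add: field_simps)
  have inj: "x = 0 \<and> y = 0" if "x \<in> M9" "y \<in> M9" "\<And>a b. a \<le> twice 1 \<Longrightarrow> b \<le> twice 1 \<Longrightarrow> phi9 x a b + \<i> * phi9 y a b = 0" for x y
    \<comment> \<open>Nine complex equations for the nine independent entries of x + i y.\<close>
    using that(3)[of 0 0] that(3)[of 0 1] that(3)[of 0 2] that(3)[of 1 0] that(3)[of 1 1] that(3)[of 1 2]
       that(3)[of 2 0] that(3)[of 2 1] that(3)[of 2 2]
    unfolding vec_eq_iff all4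
    by (simp add: twice_values phi9_def spin_vec_def complex_eq_iff M9_entries[OF that(1)] M9_entries[OF that(2)] numeral_2_eq_2)
  note r = spin_type_single[of M9 act2 phi9 1 1, OF subspace_M9 ne act2_M9 _ _ _ eq inj]
  have l: "phi9 (x + y) a b = phi9 x a b + phi9 y a b" "phi9 (c *\<^sub>R x) a b = of_real c * phi9 x a b" for x y a b c
    by (simp_all add: phi9_def spin_vec_linear sum.distrib sum_distrib_left)
  have s: "phi9 x a b \<noteq> 0 \<Longrightarrow> a \<le> twice 1 \<and> b \<le> twice 1" for x a b
    using supp[of a b x] by (auto simp: twice_values)
  show "spin_type act2 M9 [(1, 1)]" "irreducible_subrep (so eta) act2 M9 M9"
    by (rule r; (rule l | erule s | assumption))+
qed

text \<open>Keeping the quadratic forms \<open>Q\<close> abstract separates this check from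
  \<open>quad_act2\<close>; expanding all entries of a three-index tensor at once would be far
  larger.\<close>

lemma spin16_act:
  assumes L: "L \<in> so eta" and Q: "\<And>a k. 2 < k \<Longrightarrow> Q a k = 0" and "m \<le> 3" "n \<le> 1"
  shows "spin16 (\<lambda>a k. (\<Sum>b\<in>UNIV. of_real (L $ a $ b) * Q b k) + sym_act 2 (sl2_left L) (Q a) k) m n
    = spinor_act 3 1 L (spin16 Q) m n"
proof -
  \<comment> \<open>Shifted terms reach the indices 3 and 4, which occur both as numerals and as
    successors.\<close>
  have [simp]: "Q a 3 = 0" "Q a 4 = 0" "Q a (Suc (Suc (Suc 0))) = 0" "Q a (Suc (Suc (Suc (Suc 0)))) = 0" for a
    by (rule Q, simp)+
  show ?thesis
    using le3_cases[OF assms(3)] le1_cases[OF assms(4)]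
    by (elim disjE)
      (simp_all add: spinor_act_def sym_act_def spin16_def spin_vec_def sl2_right_left sl2_left_entries
       sum_UNIV4 so_eta_entries[OF L] Complex_eq numeral_3_eq_3 numeral_2_eq_2, simp_all add: field_simps)
qed

lemma spin_type_16:
  "spin_type act3 M16 [(3/2, 1/2), (1/2, 3/2)]" "irreducible_subrep (so eta) act3 M16 M16"
proof -
  \<comment> \<open>A non-zero element: every non-zero entry has a repeated index, so the cyclic
    sums vanish, and the entries at 0, 0, 1 and 2, 2, 1 cancel in the trace.\<close>
  have "(\<chi> a r s. if a = 0 \<and> r = 0 \<and> s = 1 \<or> a = 2 \<and> r = 2 \<and> s = 1 then 1 
       else if a = 0 \<and> r = 1 \<and> s = 0 \<or> a = 2 \<and> r = 1 \<and> s = 2 then -1 else 0) \<in> M16 - {0}"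
    unfolding M16_def A3_def M6_def transpose_def by (auto simp: vec_eq_iff all4 contr_def cyc_def)
  then have ne: "M16 \<noteq> {0}" by blast
  have eq: "phi16 (act3 L x) a b = spinor_act (twice (3/2)) (twice (1/2)) L (phi16 x) a b"
    if "L \<in> so eta" "x \<in> M16" "a \<le> twice (3/2)" "b \<le> twice (1/2)" for L x a b
  proof -
    have x: "x $ c \<in> M6" for c using that(2) by (simp add: M16_def A3_def)
    have "quad (act3 L x $ c) k = (\<Sum>b\<in>UNIV. of_real (L $ c $ b) * quad (x $ b) k) + sym_act 2 (sl2_left L) (quad (x $ c)) k" for c k
    proof (cases "k \<le> 2")
      case True
      then show ?thesis by (simp add: act3_def quad_linear quad_sum quad_act2[OF that(1) x])
    next
      case False
      then show ?thesis by (simp add: quad_outside sym_act_outside[of 2 "quad (x $ c)"])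
    qed
    then have "(\<lambda>c. quad (act3 L x $ c)) = (\<lambda>c k. (\<Sum>b\<in>UNIV. of_real (L $ c $ b) * quad (x $ b) k) + sym_act 2 (sl2_left L) (quad (x $ c)) k)"
      by (simp add: fun_eq_iff)
    moreover have "phi16 x = spin16 (\<lambda>c. quad (x $ c))" by (simp add: fun_eq_iff phi16_def)
    ultimately show ?thesis
      using spin16_act[OF that(1), of "\<lambda>c. quad (x $ c)" a b] that(3,4)
      by (simp add: twice_values quad_outside phi16_def)
  qed
  have inj: "x = 0" if "x \<in> M16" "\<And>a b. a \<le> twice (3/2) \<Longrightarrow> b \<le> twice (1/2) \<Longrightarrow> phi16 x a b = 0" for x
  proof -
    have x: "x $ c \<in> M6" for c using that(1) by (simp add: M16_def A3_def)
    \<comment> \<open>Eight complex equations count as sixteen real ones; with four trace and four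
      cyclic conditions they determine the 24 independent entries.\<close>
    have 1: "phi16 x 0 0 = 0" "phi16 x 1 0 = 0" "phi16 x 2 0 = 0" "phi16 x 3 0 = 0"
      "phi16 x 0 1 = 0" "phi16 x 1 1 = 0" "phi16 x 2 1 = 0" "phi16 x 3 1 = 0"
      by (rule that(2), simp add: twice_values, simp add: twice_values)+
    have 2: "contr x 0 = 0" "contr x 1 = 0" "contr x 2 = 0" "contr x 3 = 0" "cyc x 0 1 2 = 0" "cyc x 0 1 3 = 0"
       "cyc x 0 2 3 = 0" "cyc x 1 2 3 = 0" using that(1) by (simp_all add: M16_def)
    note e = M6_entries[OF x]
    show ?thesis
      unfolding vec_eq_iff all4
      using 1 2
      by (simp add: phi16_def spin16_def spin_vec_def quad_def contr_def cyc_def complex_eq_iff e numeral_3_eq_3 numeral_2_eq_2)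
  qed
  have lt: "twice (1/2) < twice (3/2)" by (simp add: twice_values)
  have l: "phi16 (x + y) a b = phi16 x a b + phi16 y a b" "phi16 (c *\<^sub>R x) a b = of_real c * phi16 x a b" for x y a b c
    by (simp_all add: phi16_def spin16_def quad_linear spin_vec_linear sum.distrib sum_distrib_left)
  have supp: "phi16 X a b = 0" if "\<not> (a \<le> 3 \<and> b \<le> 1)" for X a b
    unfolding phi16_def spin16_def
  proof (intro sum.neutral ballI)
    fix i assume "i \<in> {..a}"
    then have "1 < i \<or> 1 < b \<or> 2 < a - i" using that by auto
    then show "spin_vec i b (\<lambda>c. quad (X $ c) (a - i)) = 0"
      by (elim disjE) (simp_all add: spin_vec_outside spin_vec_0 quad_outside)
  qed
  have s: "phi16 x a b \<noteq> 0 \<Longrightarrow> a \<le> twice (3/2) \<and> b \<le> twice (1/2)" for x a b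
    using supp[of a b x] by (auto simp: twice_values)
  note r = spin_type_pair[of M16 act3 phi16 "3/2" "1/2", OF subspace_M16 ne act3_M16 _ _ _ eq inj lt]
  show "spin_type act3 M16 [(3/2, 1/2), (1/2, 3/2)]" "irreducible_subrep (so eta) act3 M16 M16"
    by (rule r; (rule l | erule s | assumption))+
qed

section \<open>Direct sums and Schur's lemma\<close>

definition sum_space :: "'v::real_vector set list \<Rightarrow> 'v set" where
  "sum_space Us = {sum_list us | us. list_all2 (\<in>) us Us}"

definition indep_spaces :: "'v::real_vector set list \<Rightarrow> bool" where
  "indep_spaces Us \<longleftrightarrow> (\<forall>us. list_all2 (\<in>) us Us \<longrightarrow> sum_list us = 0 \<longrightarrow> (\<forall>u\<in>set us. u = 0))"

lemma sum_list_map2_diff: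
  "length us = length vs \<Longrightarrow> sum_list (map2 (-) us vs) = sum_list us - sum_list (vs :: 'v::ab_group_add list)"
  by (induction us vs rule: list_induct2) simp_all

lemma sum_list_map2_add:
  "length us = length vs \<Longrightarrow> sum_list (map2 (+) us vs) = sum_list us + sum_list (vs :: 'v::ab_group_add list)"
  by (induction us vs rule: list_induct2) simp_all

lemma list_all2_map2:
  assumes "list_all2 (\<in>) us Us" "list_all2 (\<in>) vs Us" "\<And>U x y. U \<in> set Us \<Longrightarrow> x \<in> U \<Longrightarrow> y \<in> U \<Longrightarrow> f x y \<in> U"
  shows "list_all2 (\<in>) (map2 f us vs) Us"
  using assms by (auto simp: list_all2_conv_all_nth)

text \<open>Uniqueness of all representations reduces to uniqueness for the zero vector, a condition
  that can be split along the list.\<close>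

lemma is_direct_sum_alt:
  "is_direct_sum V Us \<longleftrightarrow> (\<forall>U\<in>set Us. subspace U) \<and> V = sum_space Us \<and> indep_spaces Us"
proof (intro iffI conjI)
  assume d: "is_direct_sum V Us"
  then show s: "\<forall>U\<in>set Us. subspace U" and "V = sum_space Us" by (auto simp: is_direct_sum_def sum_space_def)
  show "indep_spaces Us"
    unfolding indep_spaces_def
  proof (intro allI impI)
    fix us assume us: "list_all2 (\<in>) us Us" "sum_list us = 0"
    let ?z = "map (\<lambda>_. 0) Us"
    have z: "list_all2 (\<in>) ?z Us" using s by (auto simp: list_all2_conv_all_nth subspace_0)
    have z0: "sum_list ?z = 0" by (induction Us) auto
    then have "0 \<in> V" using z d unfolding is_direct_sum_def by (metis (mono_tags, lifting) CollectI)
    then have "\<exists>!us. list_all2 (\<in>) us Us \<and> 0 = sum_list us" using d unfolding is_direct_sum_def by blast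
    then have "us = ?z" using us z z0 by metis
    then show "\<forall>u\<in>set us. u = 0" by auto
  qed
next
  assume a: "(\<forall>U\<in>set Us. subspace U) \<and> V = sum_space Us \<and> indep_spaces Us"
  show "is_direct_sum V Us"
    unfolding is_direct_sum_def
  proof (intro conjI ballI)
    fix v assume "v \<in> V"
    then obtain us where us: "list_all2 (\<in>) us Us" "v = sum_list us" using a by (auto simp: sum_space_def)
    show "\<exists>!us. list_all2 (\<in>) us Us \<and> v = sum_list us"
    proof (rule ex1I[of _ us])
      fix vs assume vs: "list_all2 (\<in>) vs Us \<and> v = sum_list vs"
      have len: "length vs = length us" using us vs by (metis list_all2_lengthD)
      have "list_all2 (\<in>) (map2 (-) vs us) Us"
        using vs us a by (intro list_all2_map2) (auto intro: subspace_diff)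
      moreover have "sum_list (map2 (-) vs us) = 0" using vs us len by (simp add: sum_list_map2_diff)
      ultimately have z: "\<forall>u\<in>set (map2 (-) vs us). u = 0" using a unfolding indep_spaces_def by blast
      show "vs = us"
      proof (rule nth_equalityI[OF len])
        fix i assume "i < length vs"
        then have "i < length (map2 (-) vs us)" "map2 (-) vs us ! i = vs ! i - us ! i" using len by auto
        with z show "vs ! i = us ! i" by (metis nth_mem right_minus_eq)
      qed
    qed (use us in auto)
  qed (use a in \<open>auto simp: sum_space_def\<close>)
qed

lemma sum_space_Nil [simp]: "sum_space [] = {0}"
  by (auto simp: sum_space_def)

lemma sum_space_Cons: "sum_space (U # Us) = {u + w | u w. u \<in> U \<and> w \<in> sum_space Us}"
proof (intro set_eqI iffI)
  fix x assume "x \<in> sum_space (U # Us)"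
  then obtain us where "list_all2 (\<in>) us (U # Us)" "x = sum_list us" by (auto simp: sum_space_def)
  then show "x \<in> {u + w | u w. u \<in> U \<and> w \<in> sum_space Us}"
    by (auto simp: sum_space_def list_all2_Cons2) blast
next
  fix x assume "x \<in> {u + w | u w. u \<in> U \<and> w \<in> sum_space Us}"
  then obtain u us where "u \<in> U" "list_all2 (\<in>) us Us" "x = u + sum_list us" by (auto simp: sum_space_def)
  then show "x \<in> sum_space (U # Us)"
    unfolding sum_space_def by (intro CollectI exI[of _ "u # us"]) simp
qed

lemma subspace_sum_space: "\<forall>U\<in>set Us. subspace U \<Longrightarrow> subspace (sum_space Us)"
proof (induction Us)
  case (Cons U Us)
  then show ?case using subspace_sums[of U "sum_space Us"] by (simp add: sum_space_Cons)
qed (simp add: subspace_def)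

lemma indep_spaces_Nil [simp]: "indep_spaces []"
  by (simp add: indep_spaces_def)

lemma indep_spaces_Cons:
  assumes "\<forall>W\<in>set (U # Us). subspace W"
  shows "indep_spaces (U # Us) \<longleftrightarrow> indep_spaces Us \<and> U \<inter> sum_space Us = {0}"
proof (intro iffI conjI)
  assume i: "indep_spaces (U # Us)"
  have U: "subspace U" using assms by simp
  show "indep_spaces Us"
    unfolding indep_spaces_def
  proof (intro allI impI)
    fix us assume "list_all2 (\<in>) us Us" "sum_list us = 0"
    then have "list_all2 (\<in>) (0 # us) (U # Us)" "sum_list (0 # us) = 0" using subspace_0[OF U] by auto
    then show "\<forall>u\<in>set us. u = 0" using i unfolding indep_spaces_def by (metis list.set_intros(2))
  qed
  show "U \<inter> sum_space Us = {0}"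
  proof (intro equalityI subsetI)
    fix x assume x: "x \<in> U \<inter> sum_space Us"
    then obtain us where us: "list_all2 (\<in>) us Us" "x = sum_list us" by (auto simp: sum_space_def)
    then have "list_all2 (\<in>) ((- x) # us) (U # Us)" "sum_list ((- x) # us) = 0" using x subspace_neg[OF U] by auto
    then have "- x = 0" using i unfolding indep_spaces_def by (metis list.set_intros(1))
    then show "x \<in> {0}" by simp
  qed (use assms subspace_0 subspace_sum_space[of Us] in auto)
next
  assume i: "indep_spaces Us \<and> U \<inter> sum_space Us = {0}"
  show "indep_spaces (U # Us)"
    unfolding indep_spaces_def
  proof (intro allI impI)
    fix us assume us: "list_all2 (\<in>) us (U # Us)" "sum_list us = 0"
    then obtain v vs where v: "us = v # vs" "v \<in> U" "list_all2 (\<in>) vs Us" by (auto simp: list_all2_Cons2)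
    then have "v = - sum_list vs" using us by (simp add: eq_neg_iff_add_eq_0)
    moreover have "sum_list vs \<in> sum_space Us" using v by (auto simp: sum_space_def)
    ultimately have "v \<in> U \<inter> sum_space Us" using v assms subspace_neg[OF subspace_sum_space[of Us]] by auto
    then have "v = 0" using i by auto
    then show "\<forall>u\<in>set us. u = 0" using v us i unfolding indep_spaces_def by auto
  qed
qed

lemma sum_space_append: "sum_space (Us @ Vs) = {u + w | u w. u \<in> sum_space Us \<and> w \<in> sum_space Vs}"
proof (induction Us)
  case (Cons U Us)
  show ?case unfolding append_Cons sum_space_Cons Cons
    by (auto; metis add.assoc)
qed simp

lemma indep_spaces_append:
  assumes "\<forall>W\<in>set (Us @ Vs). subspace W"
  shows "indep_spaces (Us @ Vs) \<longleftrightarrow> indep_spaces Us \<and> indep_spaces Vs \<and> sum_space Us \<inter> sum_space Vs = {0}"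
  using assms
proof (induction Us)
  case Nil
  then have "0 \<in> sum_space Vs" using subspace_0[OF subspace_sum_space[of Vs]] by simp
  then show ?case by auto
next
  case (Cons U Us)
  have sub: "subspace U" "subspace (sum_space Us)" "subspace (sum_space Vs)"
    using Cons.prems subspace_sum_space[of Us] subspace_sum_space[of Vs] by auto
  have "subspace (sum_space (U # Us))" "subspace (sum_space (Us @ Vs))"
    by (rule subspace_sum_space, use Cons.prems in auto)+
  note z = subspace_0[OF sub(1)] subspace_0[OF sub(2)] subspace_0[OF sub(3)] this[THEN subspace_0]
  have IH: "indep_spaces (Us @ Vs) \<longleftrightarrow> indep_spaces Us \<and> indep_spaces Vs \<and> sum_space Us \<inter> sum_space Vs = {0}"
    using Cons by simp
  have 1: "indep_spaces (U # Us @ Vs) \<longleftrightarrow> indep_spaces (Us @ Vs) \<and> U \<inter> sum_space (Us @ Vs) = {0}"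
    by (rule indep_spaces_Cons) (use Cons.prems in auto)
  have 2: "indep_spaces (U # Us) \<longleftrightarrow> indep_spaces Us \<and> U \<inter> sum_space Us = {0}"
    by (rule indep_spaces_Cons) (use Cons.prems in auto)
  \<comment> \<open>Both sides express that no relation mixes \<open>U\<close>,
    \<open>sum_space Us\<close> and \<open>sum_space Vs\<close>; they differ in the term of the
    relation that is isolated.\<close>
  have 3: "(sum_space Us \<inter> sum_space Vs = {0} \<and> U \<inter> sum_space (Us @ Vs) = {0}) \<longleftrightarrow>
    (U \<inter> sum_space Us = {0} \<and> sum_space (U # Us) \<inter> sum_space Vs = {0})" (is "?l \<longleftrightarrow> ?r")
  proof
    assume l: ?l
    have "U \<inter> sum_space Us \<subseteq> U \<inter> sum_space (Us @ Vs)" unfolding sum_space_append using z by force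
    then have a: "U \<inter> sum_space Us = {0}" using l z by auto
    have "sum_space (U # Us) \<inter> sum_space Vs \<subseteq> {0}"
    proof
      fix x assume x: "x \<in> sum_space (U # Us) \<inter> sum_space Vs"
      then obtain u w where uw: "u \<in> U" "w \<in> sum_space Us" "x = u + w" by (auto simp: sum_space_Cons)
      have "u = - w + x" using uw by simp
      moreover have "- w \<in> sum_space Us" using uw subspace_neg[OF sub(2)] by blast
      ultimately have "u \<in> U \<inter> sum_space (Us @ Vs)" using uw x unfolding sum_space_append by blast
      then have "u = 0" using l by auto
      then show "x \<in> {0}" using uw x l by auto
    qed
    then show ?r using a z by blast
  next
    assume r: ?r
    have "sum_space Us \<inter> sum_space Vs \<subseteq> sum_space (U # Us) \<inter> sum_space Vs" unfolding sum_space_Cons using z by force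
    then have a: "sum_space Us \<inter> sum_space Vs = {0}" using r z by auto
    have "U \<inter> sum_space (Us @ Vs) \<subseteq> {0}"
    proof
      fix x assume x: "x \<in> U \<inter> sum_space (Us @ Vs)"
      then obtain u w where uw: "u \<in> sum_space Us" "w \<in> sum_space Vs" "x = u + w" by (auto simp: sum_space_append)
      have "w = x + (- u)" using uw by simp
      moreover have "- u \<in> sum_space Us" using uw subspace_neg[OF sub(2)] by blast
      ultimately have "w \<in> sum_space (U # Us) \<inter> sum_space Vs" using uw x unfolding sum_space_Cons by blast
      then have "w = 0" using r by auto
      then show "x \<in> {0}" using uw x r by auto
    qed
    then show ?l using a z by blast
  qed
  show ?case using IH 1 2 3 by auto
qed

lemma is_direct_sum_append:
  assumes "is_direct_sum V [A, B]" "is_direct_sum A Us" "is_direct_sum B Vs"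
  shows "is_direct_sum V (Us @ Vs)"
proof -
  have V: "V = {u + w | u w. u \<in> A \<and> w \<in> B}" and AB: "A \<inter> B = {0}"
    using assms(1) indep_spaces_Cons[of A "[B]"] unfolding is_direct_sum_alt by (auto simp: sum_space_Cons)
  have s: "\<forall>W\<in>set (Us @ Vs). subspace W" using assms(2,3) unfolding is_direct_sum_alt by auto
  show ?thesis
    unfolding is_direct_sum_alt indep_spaces_append[OF s]
    using assms(2,3) V AB s unfolding is_direct_sum_alt by (simp add: sum_space_append)
qed

text \<open>Since direct sums are indexed by lists, reordering means carrying component lists along
  a permutation of positions, which equality of multisets provides.\<close>

lemma indep_spaces_perm:
  assumes "mset Us = mset Vs" "indep_spaces Us"
  shows "indep_spaces Vs" "sum_space Us = sum_space Vs"
proof -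
  obtain p where p: "p permutes {..<length Vs}" "permute_list p Vs = Us"
    using mset_eq_permutation[OF assms(1)] by blast
  have *: "list_all2 (\<in>) (permute_list p us) Us \<and> sum_list (permute_list p us) = sum_list us \<and> set (permute_list p us) = set us"
    if "list_all2 (\<in>) us Vs" for us
  proof (intro conjI)
    have len: "length us = length Vs" using that by (rule list_all2_lengthD)
    show "list_all2 (\<in>) (permute_list p us) Us"
      using that len permutes_in_image[OF p(1)]
      by (auto simp: list_all2_conv_all_nth p(2)[symmetric] permute_list_nth[OF p(1)] permute_list_nth[of p us] p(1))
    have "mset (permute_list p us) = mset us" using p(1) len by simp
    then show "sum_list (permute_list p us) = sum_list us" "set (permute_list p us) = set us"
      by (metis sum_mset_sum_list, metis set_mset_mset)
  qed
  show "indep_spaces Vs"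
    unfolding indep_spaces_def using * assms(2) unfolding indep_spaces_def by metis
  obtain q where q: "q permutes {..<length Us}" "permute_list q Us = Vs"
    using mset_eq_permutation[OF assms(1)[symmetric]] by blast
  have **: "list_all2 (\<in>) (permute_list q us) Vs \<and> sum_list (permute_list q us) = sum_list us"
    if "list_all2 (\<in>) us Us" for us
  proof (intro conjI)
    have len: "length us = length Us" using that by (rule list_all2_lengthD)
    show "list_all2 (\<in>) (permute_list q us) Vs"
      using that len permutes_in_image[OF q(1)]
      by (auto simp: list_all2_conv_all_nth q(2)[symmetric] permute_list_nth[OF q(1)] permute_list_nth[of q us] q(1))
    have "mset (permute_list q us) = mset us" using q(1) len by simp
    then show "sum_list (permute_list q us) = sum_list us" by (metis sum_mset_sum_list)
  qed
  show "sum_space Us = sum_space Vs"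
    unfolding sum_space_def using * ** by (intro equalityI subsetI) (smt (verit) mem_Collect_eq)+
qed

lemma is_direct_sum_perm:
  assumes "is_direct_sum V Us" "mset Us = mset Vs"
  shows "is_direct_sum V Vs"
proof -
  have "set Us = set Vs" using assms(2) by (metis set_mset_mset)
  then show ?thesis using assms(1) indep_spaces_perm[OF assms(2)] unfolding is_direct_sum_alt by auto
qed

lemma sum_space_image: "linear f \<Longrightarrow> sum_space (map ((`) f) Us) = f ` sum_space Us"
proof (induction Us)
  case (Cons U Us)
  then show ?case by (auto simp: sum_space_Cons linear_add image_iff) (metis linear_add)+
qed (simp add: linear_0)

lemma is_direct_sum_image:
  assumes f: "linear f" "inj_on f V" and d: "is_direct_sum V Us"
  shows "is_direct_sum (f ` V) (map ((`) f) Us)"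
proof -
  have V: "V = sum_space Us" "\<forall>U\<in>set Us. subspace U" "indep_spaces Us" using d unfolding is_direct_sum_alt by auto
  have sub: "\<forall>U\<in>set (map ((`) f) Us). subspace U" using V(2) linear_subspace_image[OF f(1)] by auto
  have "indep_spaces (map ((`) f) Us)"
    using V(2,3) f(2)[unfolded V(1)]
  proof (induction Us)
    case (Cons U Us)
    have sp: "subspace U" "\<forall>U\<in>set Us. subspace U" using Cons.prems by auto
    have 1: "indep_spaces Us" "U \<inter> sum_space Us = {0}" using Cons.prems(1,2) indep_spaces_Cons[of U Us] by auto
    have z: "0 \<in> U" "0 \<in> sum_space Us" using sp subspace_0 subspace_sum_space by blast+
    have i: "U \<subseteq> sum_space (U # Us)" "sum_space Us \<subseteq> sum_space (U # Us)"
      unfolding sum_space_Cons using z by force+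
    have "indep_spaces (map ((`) f) Us)"
      using Cons.IH sp 1 inj_on_subset[OF Cons.prems(3) i(2)] by blast
    moreover have "f ` U \<inter> f ` sum_space Us = f ` (U \<inter> sum_space Us)"
      using inj_on_image_Int[OF Cons.prems(3) i] by simp
    ultimately show ?case
      using linear_subspace_image[OF f(1)] sp
      by (simp add: indep_spaces_Cons sum_space_image[OF f(1)] 1 linear_0[OF f(1)])
  qed simp
  then show ?thesis unfolding is_direct_sum_alt using sub V(1) sum_space_image[OF f(1)] by auto
qed

lemma dim_is_direct_sum:
  fixes V :: "'v::euclidean_space set"
  assumes "is_direct_sum V Us"
  shows "dim V = sum_list (map dim Us)"
proof -
  have "V = sum_space Us" "\<forall>U\<in>set Us. subspace U" "indep_spaces Us" using assms unfolding is_direct_sum_alt by auto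
  then show ?thesis
  proof (induction Us arbitrary: V)
    case (Cons U Us)
    have sp: "subspace U" "subspace (sum_space Us)" using Cons.prems subspace_sum_space by auto
    have 1: "indep_spaces Us" "U \<inter> sum_space Us = {0}" using Cons.prems indep_spaces_Cons[of U Us] by auto
    have "dim {x + y |x y. x \<in> U \<and> y \<in> sum_space Us} + dim (U \<inter> sum_space Us) = dim U + dim (sum_space Us)"
      by (rule dim_sums_Int[OF sp])
    then show ?case using Cons.IH[of "sum_space Us"] Cons.prems 1 by (simp add: sum_space_Cons)
  qed simp
qed

text \<open>\<open>rep_iso\<close> asks for a map linear on the whole ambient space, whereas the
  isomorphisms constructed here are given on a subspace.\<close>

lemma linear_extension:
  fixes f :: "'a::real_vector \<Rightarrow> 'b::real_vector"
  assumes S: "subspace S" and add: "\<And>x y. x \<in> S \<Longrightarrow> y \<in> S \<Longrightarrow> f (x + y) = f x + f y"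
    and scale: "\<And>c x. x \<in> S \<Longrightarrow> f (c *\<^sub>R x) = c *\<^sub>R f x"
  obtains h where "linear h" "\<And>x. x \<in> S \<Longrightarrow> h x = f x"
proof -
  obtain B where B: "B \<subseteq> S" "independent B" "S \<subseteq> span B" by (rule basis_exists[of S])
  obtain h where h: "linear h" "\<forall>x\<in>B. h x = f x" using linear_independent_extend[OF B(2), of f] by blast
  have z: "f 0 = 0" using scale[OF subspace_0[OF S], of 0] by simp
  have "h x = f x \<and> x \<in> S" if "x \<in> span B" for x
    using that
  proof (induction rule: span_induct_alt)
    case base
    then show ?case using z linear_0[OF h(1)] subspace_0[OF S] by simp
  next
    case (step c x y)
    have "x \<in> S" using step B by blast
    then have "c *\<^sub>R x \<in> S" "y \<in> S" using step subspace_scale[OF S] by auto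
    then show ?case using step h(2) \<open>x \<in> S\<close> add[of "c *\<^sub>R x" y] scale[of x c]
      by (auto simp: linear_add[OF h(1)] linear_scale[OF h(1)] intro: subspace_add[OF S])
  qed
  then show ?thesis using that[OF h(1)] B(3) by blast
qed

lemma rep_isoI:
  assumes W: "subspace W" and add: "\<And>x y. x \<in> W \<Longrightarrow> y \<in> W \<Longrightarrow> f (x + y) = f x + f y"
    and scale: "\<And>c x. x \<in> W \<Longrightarrow> f (c *\<^sub>R x) = c *\<^sub>R f x"
    and bij: "bij_betw f W W'" and eq: "\<And>L v. L \<in> G \<Longrightarrow> v \<in> W \<Longrightarrow> act L v \<in> W \<and> f (act L v) = act L (f v)"
  shows "rep_iso G act W W'"
proof -
  obtain h where h: "linear h" "\<And>x. x \<in> W \<Longrightarrow> h x = f x" using linear_extension[OF W add scale] by blast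
  have "bij_betw h W W'" using bij bij_betw_cong[of W h f W'] h(2) by blast
  then show ?thesis unfolding rep_iso_def using h eq by metis
qed

text \<open>Some component projection is non-zero on \<open>W\<close>. It commutes with the action
  because components are unique, so its kernel in \<open>W\<close> and its image in the summand are
  subrepresentations, and irreducibility of both makes it bijective.\<close>

lemma schur_direct_sum:
  fixes V :: "'v::real_vector set"
  assumes V: "is_direct_sum V Us" and U: "\<And>U. U \<in> set Us \<Longrightarrow> irreducible_subrep G act V U"
    and add: "\<And>L x y. L \<in> G \<Longrightarrow> x \<in> V \<Longrightarrow> y \<in> V \<Longrightarrow> act L (x + y) = act L x + act L y"
    and W: "irreducible_subrep G act V W"
  obtains U where "U \<in> set Us" "rep_iso G act W U"
proof -
  \<comment> \<open>The list of components of \<open>v\<close>; \<open>us_eq\<close> is the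
    uniqueness from which additivity, homogeneity and equivariance follow.\<close>
  define us where "us v = (THE us. list_all2 (\<in>) us Us \<and> v = sum_list us)" for v
  have us: "list_all2 (\<in>) (us v) Us \<and> v = sum_list (us v)" if "v \<in> V" for v
    unfolding us_def by (rule theI') (use V that in \<open>simp add: is_direct_sum_def\<close>)
  have us_eq: "us v = ws" if "list_all2 (\<in>) ws Us" "v = sum_list ws" for v ws
  proof -
    have "v \<in> V" using that V unfolding is_direct_sum_def by blast
    then show ?thesis using us[of v] that V unfolding is_direct_sum_def by blast
  qed
  have Us: "subspace U" "U \<subseteq> V" "\<And>L u. L \<in> G \<Longrightarrow> u \<in> U \<Longrightarrow> act L u \<in> U" if "U \<in> set Us" for U
    using U[OF that] by (auto simp: irreducible_subrep_def subrep_def)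
  have W': "subspace W" "W \<subseteq> V" "\<And>L u. L \<in> G \<Longrightarrow> u \<in> W \<Longrightarrow> act L u \<in> W" "W \<noteq> {0}"
     "\<And>X. subrep G act W X \<Longrightarrow> X = {0} \<or> X = W"
    using W by (auto simp: irreducible_subrep_def subrep_def)
  have us_add: "us (x + y) = map2 (+) (us x) (us y)" if "x \<in> V" "y \<in> V" for x y
  proof (rule us_eq)
    show "list_all2 (\<in>) (map2 (+) (us x) (us y)) Us"
      using us[OF that(1)] us[OF that(2)] Us(1) by (intro list_all2_map2) (auto intro: subspace_add)
    show "x + y = sum_list (map2 (+) (us x) (us y))"
      using us[OF that(1)] us[OF that(2)] by (subst sum_list_map2_add) (auto dest!: list_all2_lengthD)
  qed
  have us_scale: "us (c *\<^sub>R x) = map ((*\<^sub>R) c) (us x)" if "x \<in> V" for c x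
  proof (rule us_eq)
    show "list_all2 (\<in>) (map ((*\<^sub>R) c) (us x)) Us"
      using us[OF that] Us(1) by (auto simp: list_all2_conv_all_nth intro!: subspace_scale)
    have "c *\<^sub>R sum_list xs = sum_list (map ((*\<^sub>R) c) xs)" for xs :: "'v list"
      by (induction xs) (simp_all add: scaleR_add_right)
    then show "c *\<^sub>R x = sum_list (map ((*\<^sub>R) c) (us x))" using us[OF that] by metis
  qed
  have us_act: "us (act L x) = map (act L) (us x)" if L: "L \<in> G" and "x \<in> V" for L x
  proof (rule us_eq)
    show "list_all2 (\<in>) (map (act L) (us x)) Us"
      using us[OF that(2)] Us(3)[OF _ L] by (auto simp: list_all2_conv_all_nth)
    have "sum_list (map (act L) xs) = act L (sum_list xs) \<and> sum_list xs \<in> V"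
      if "list_all2 (\<in>) xs Vs" "set Vs \<subseteq> set Us" for xs Vs
      using that
    proof (induction xs Vs rule: list_all2_induct)
      case Nil
      have "subspace V" using V subspace_sum_space unfolding is_direct_sum_alt by blast
      then have z: "0 \<in> V" by (rule subspace_0)
      then have "act L 0 = 0" using add[OF L z z] by simp
      then show ?case using z by simp
    next
      case (Cons x xs V' Vs)
      have "subspace V" using V subspace_sum_space unfolding is_direct_sum_alt by blast
      moreover have "x \<in> V" using Cons Us(2) by auto
      ultimately show ?case using Cons add[OF L] by (auto intro: subspace_add)
    qed
    then show "act L x = sum_list (map (act L) (us x))" using us[OF that(2)] by (metis order_refl)
  qed
  obtain w where w: "w \<in> W" "w \<noteq> 0" using W'(1,4) subspace_0 by blast
  have "\<exists>i<length Us. us w ! i \<noteq> 0"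
  proof (rule ccontr)
    assume n: "\<not> ?thesis"
    have wV: "w \<in> V" using w W'(2) by blast
    have "length (us w) = length Us" using us[OF wV] list_all2_lengthD by blast
    then have "\<forall>u\<in>set (us w). u = 0"
      using n by (auto simp: in_set_conv_nth)
    moreover have "(\<forall>x\<in>set xs. x = 0) \<Longrightarrow> sum_list xs = 0" for xs :: "'v list" by (induction xs) auto
    ultimately show False using us[OF wV] w by auto
  qed
  then obtain i where i: "i < length Us" "us w ! i \<noteq> 0" by blast
  define p where "p v = us v ! i" for v
  have len: "length (us v) = length Us" if "v \<in> V" for v using us[OF that] list_all2_lengthD by blast
  have p_in: "p v \<in> Us ! i" if "v \<in> V" for v
    using us[OF that] i(1) by (simp add: p_def list_all2_conv_all_nth)
  have p_add: "p (x + y) = p x + p y" if "x \<in> V" "y \<in> V" for x y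
    using that i(1) by (simp add: p_def us_add len)
  have p_scale: "p (c *\<^sub>R x) = c *\<^sub>R p x" if "x \<in> V" for c x
    using that i(1) by (simp add: p_def us_scale len)
  have p_act: "p (act L x) = act L (p x)" if "L \<in> G" "x \<in> V" for L x
    using that i(1) by (simp add: p_def us_act len)
  have WV: "x \<in> W \<Longrightarrow> x \<in> V" for x using W'(2) by blast
  have p0: "p 0 = 0" using p_scale[OF WV[OF w(1)], of 0] by simp
  have Ui: "Us ! i \<in> set Us" using i(1) by simp
  have irr: "\<And>X. subrep G act (Us ! i) X \<Longrightarrow> X = {0} \<or> X = Us ! i"
    using U[OF Ui] by (auto simp: irreducible_subrep_def)
  have "subrep G act (Us ! i) (p ` W)"
    unfolding subrep_def
  proof (intro conjI ballI)
    show "subspace (p ` W)"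
    proof (rule subspaceI)
      show "0 \<in> p ` W" using p0 subspace_0[OF W'(1)] by (metis imageI)
    next
      fix x y assume "x \<in> p ` W" "y \<in> p ` W"
      then obtain x' y' where "x = p x'" "y = p y'" "x' \<in> W" "y' \<in> W" by blast
      then show "x + y \<in> p ` W" using p_add[of x' y'] WV subspace_add[OF W'(1), of x' y'] by (metis imageI)
    next
      fix c x assume "x \<in> p ` W"
      then obtain x' where "x = p x'" "x' \<in> W" by blast
      then show "c *\<^sub>R x \<in> p ` W" using p_scale[of x' c] WV subspace_scale[OF W'(1), of x' c] by (metis imageI)
    qed
    show "p ` W \<subseteq> Us ! i" using p_in WV by blast
    fix L u assume L: "L \<in> G" "u \<in> p ` W"
    then obtain x where "u = p x" "x \<in> W" by blast
    then show "act L u \<in> p ` W" using p_act[OF L(1), of x] WV W'(3)[OF L(1), of x] by (metis imageI)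
  qed
  moreover have "p ` W \<noteq> {0}" using w i(2) unfolding p_def by blast
  ultimately have surj: "p ` W = Us ! i" using irr by blast
  have "subrep G act W {x \<in> W. p x = 0}"
    unfolding subrep_def
  proof (intro conjI ballI)
    show "subspace {x \<in> W. p x = 0}"
      using W'(1) p_add p_scale p0 WV by (intro subspaceI) (auto intro: subspace_0 subspace_add subspace_scale)
    fix L u assume L: "L \<in> G" "u \<in> {x \<in> W. p x = 0}"
    have "act L 0 = 0" 
    proof -
      have "0 \<in> V" using WV subspace_0[OF W'(1)] by blast
      from add[OF L(1) this this] show ?thesis by simp
    qed
    then show "act L u \<in> {x \<in> W. p x = 0}" using L p_act[OF L(1), of u] WV W'(3) by simp
  qed auto
  then have "{x \<in> W. p x = 0} = {0} \<or> {x \<in> W. p x = 0} = W" by (rule W'(5))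
  moreover have "{x \<in> W. p x = 0} \<noteq> W" using w i(2) unfolding p_def by blast
  ultimately have ker: "{x \<in> W. p x = 0} = {0}" by blast
  have "inj_on p W"
  proof (rule inj_onI)
    fix x y assume xy: "x \<in> W" "y \<in> W" "p x = p y"
    have d: "x - y \<in> W" using xy subspace_diff[OF W'(1)] by blast
    have "p ((x - y) + y) = p (x - y) + p y" using d xy WV by (intro p_add) auto
    then have "x - y \<in> {x \<in> W. p x = 0}" using d xy by simp
    then show "x = y" using ker by auto
  qed
  then have "bij_betw p W (Us ! i)" using surj by (simp add: bij_betw_def)
  then have "rep_iso G act W (Us ! i)"
    using W'(1) W'(3) p_add p_scale p_act WV by (intro rep_isoI[where f = p]) auto
  then show ?thesis using that Ui by blast
qed

section \<open>Transport of irreducibility and type\<close>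

text \<open>The type relative to one frame, separated because a decomposition built from a frame
  first yields the type for that frame only.\<close>

definition htype :: "real^4^4 \<Rightarrow> real^4^4 \<Rightarrow> (real^4^4 \<Rightarrow> 'v::real_vector \<Rightarrow> 'v) \<Rightarrow> 'v set \<Rightarrow>
    (rat \<times> rat) list \<Rightarrow> bool" where
  "htype g P act W l \<longleftrightarrow>
     (\<exists>\<Phi>. bij_betw \<Phi> (W \<times> W) (jk_space l) \<and>
        (\<forall>x\<in>W \<times> W. \<forall>y\<in>W \<times> W. \<Phi> (x + y) = (\<lambda>s a b. \<Phi> x s a b + \<Phi> y s a b)) \<and>
        (\<forall>c. \<forall>x\<in>W \<times> W. \<Phi> (cpx_scale c x) = (\<lambda>s a b. c * \<Phi> x s a b)) \<and>
        (\<forall>L\<in>so g. \<forall>x\<in>W \<times> W.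
           \<Phi> (cpx_act act L x) = jk_act l (matrix_inv P ** L ** P) (\<Phi> x)))"

lemma has_type_htype: "has_type g act W l \<longleftrightarrow> (\<forall>P. orthonormal_frame g P \<longrightarrow> htype g P act W l)"
  by (simp add: has_type_def htype_def)

text \<open>The two actions may differ, so that a type can be carried from a tensor model to a space
  of collections.\<close>

lemma htype_pullback:
  assumes "htype g P act W' l" "bij_betw f W W'"
    and add: "\<And>x y. x \<in> W \<Longrightarrow> y \<in> W \<Longrightarrow> f (x + y) = f x + f y"
    and scale: "\<And>c x. x \<in> W \<Longrightarrow> f (c *\<^sub>R x) = c *\<^sub>R f x"
    and W: "subspace W"
    and eq: "\<And>L v. L \<in> so g \<Longrightarrow> v \<in> W \<Longrightarrow> f (act' L v) = act L (f v)"
  shows "htype g P act' W l"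
proof -
  obtain \<Phi> where \<Phi>: "bij_betw \<Phi> (W' \<times> W') (jk_space l)"
    "\<And>x y. x\<in>W' \<times> W' \<Longrightarrow> y\<in>W' \<times> W' \<Longrightarrow> \<Phi> (x + y) = (\<lambda>s a b. \<Phi> x s a b + \<Phi> y s a b)"
    "\<And>c x. x\<in>W' \<times> W' \<Longrightarrow> \<Phi> (cpx_scale c x) = (\<lambda>s a b. c * \<Phi> x s a b)"
    "\<And>L x. L\<in>so g \<Longrightarrow> x\<in>W' \<times> W' \<Longrightarrow> \<Phi> (cpx_act act L x) = jk_act l (matrix_inv P ** L ** P) (\<Phi> x)"
    using assms(1) unfolding htype_def by blast
  have mem: "map_prod f f x \<in> W' \<times> W'" if "x \<in> W \<times> W" for x
    using that assms(2) by (auto simp: bij_betw_def)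
  have "bij_betw (map_prod f f) (W \<times> W) (W' \<times> W')"
    using assms(2) by (simp add: bij_betw_map_prod)
  then have 1: "bij_betw (\<Phi> \<circ> map_prod f f) (W \<times> W) (jk_space l)" using \<Phi>(1) bij_betw_trans by blast
  have 2: "(\<Phi> \<circ> map_prod f f) (x + y) = (\<lambda>s a b. (\<Phi> \<circ> map_prod f f) x s a b + (\<Phi> \<circ> map_prod f f) y s a b)"
    if "x \<in> W \<times> W" "y \<in> W \<times> W" for x y
  proof -
    have "map_prod f f (x + y) = map_prod f f x + map_prod f f y"
      using that by (auto simp: add)
    then show ?thesis using \<Phi>(2)[OF mem[OF that(1)] mem[OF that(2)]] by simp
  qed
  have 3: "(\<Phi> \<circ> map_prod f f) (cpx_scale c x) = (\<lambda>s a b. c * (\<Phi> \<circ> map_prod f f) x s a b)"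
    if "x \<in> W \<times> W" for x c
  proof -
    have d: "f (u - v) = f u - f v" if "u \<in> W" "v \<in> W" for u v
      using add[of "u - v" v] subspace_diff[OF W that] that by simp
    have "map_prod f f (cpx_scale c x) = cpx_scale c (map_prod f f x)"
      using that by (auto simp: cpx_scale_def add scale d subspace_scale[OF W])
    then show ?thesis using \<Phi>(3)[OF mem[OF that(1)]] by simp
  qed
  have 4: "(\<Phi> \<circ> map_prod f f) (cpx_act act' L x) = jk_act l (matrix_inv P ** L ** P) ((\<Phi> \<circ> map_prod f f) x)"
    if "L \<in> so g" "x \<in> W \<times> W" for L x
  proof -
    have "map_prod f f (cpx_act act' L x) = cpx_act act L (map_prod f f x)"
      using that by (auto simp: cpx_act_def eq)
    then show ?thesis using \<Phi>(4)[OF that(1) mem[OF that(2)]] by simp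
  qed
  show ?thesis unfolding htype_def using 1 2 3 4 by blast
qed

lemma rep_iso_htype:
  assumes "rep_iso (so g) act W W'" "htype g P act W' l" "subspace W"
  shows "htype g P act W l"
proof -
  obtain T where T: "linear T" "bij_betw T W W'" "\<And>L v. L \<in> so g \<Longrightarrow> v \<in> W \<Longrightarrow> T (act L v) = act L (T v)"
    using assms(1) unfolding rep_iso_def by blast
  show ?thesis
    by (rule htype_pullback[OF assms(2) T(2)]) (simp_all add: linear_add[OF T(1)] linear_scale[OF T(1)] assms(3) T(3))
qed

lemma rep_iso_dim:
  fixes W W' :: "'v::euclidean_space set"
  assumes "rep_iso G act W W'" "subspace W"
  shows "dim W = dim W'"
proof -
  obtain T where T: "linear T" "bij_betw T W W'" using assms(1) unfolding rep_iso_def by blast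
  have "dim (T ` W) = dim W" using T assms(2) by (intro dim_image_eq) (auto simp: bij_betw_def span_eq_iff[THEN iffD2])
  then show ?thesis using T(2) by (simp add: bij_betw_def)
qed

lemma jk_act_summand: "(\<And>a b. f s a b = 0) \<Longrightarrow> jk_act l L f s a b = 0"
  by (simp add: jk_act_def sym_act_def)

text \<open>The preimage \<open>U\<close> of the first summand is invariant. The basis vectors
  \<open>\<delta> 0\<close> and \<open>\<delta> 1\<close> show that it is neither zero nor
  everything.\<close>

lemma htype_cpx_reducible:
  assumes "htype g P act W l" "2 \<le> length l" and W: "subspace W" "\<And>L u. L \<in> so g \<Longrightarrow> u \<in> W \<Longrightarrow> act L u \<in> W"
  shows "cpx_reducible (so g) act W"
proof -
  obtain \<Phi> where \<Phi>: "bij_betw \<Phi> (W \<times> W) (jk_space l)"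
    "\<And>x y. x\<in>W \<times> W \<Longrightarrow> y\<in>W \<times> W \<Longrightarrow> \<Phi> (x + y) = (\<lambda>s a b. \<Phi> x s a b + \<Phi> y s a b)"
    "\<And>c x. x\<in>W \<times> W \<Longrightarrow> \<Phi> (cpx_scale c x) = (\<lambda>s a b. c * \<Phi> x s a b)"
    "\<And>L x. L\<in>so g \<Longrightarrow> x\<in>W \<times> W \<Longrightarrow> \<Phi> (cpx_act act L x) = jk_act l (matrix_inv P ** L ** P) (\<Phi> x)"
    using assms(1) unfolding htype_def by blast
  define U where "U = {p \<in> W \<times> W. \<forall>s a b. s \<noteq> 0 \<longrightarrow> \<Phi> p s a b = 0}"
  have z: "0 \<in> W \<times> W" using subspace_0[OF W(1)] by (simp add: zero_prod_def)
  have \<Phi>0: "\<Phi> 0 = (\<lambda>s a b. 0)" using \<Phi>(3)[OF z, of 0] by (simp add: cpx_scale_def zero_prod_def)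
  have cs: "cpx_scale c x \<in> W \<times> W" if "x \<in> W \<times> W" for c x
    using that W(1) by (auto simp: cpx_scale_def intro!: subspace_add subspace_diff subspace_scale)
  have ca: "cpx_act act L x \<in> W \<times> W" if "L \<in> so g" "x \<in> W \<times> W" for L x
    using that W(2) by (auto simp: cpx_act_def)
  have pl: "x + y \<in> W \<times> W" if "x \<in> W \<times> W" "y \<in> W \<times> W" for x y
    using that subspace_add[OF W(1)] by auto
  define \<delta> where "\<delta> k = (\<lambda>s a b. if s = (k::nat) \<and> a = (0::nat) \<and> b = (0::nat) then (1::complex) else 0)" for k
  have \<delta>: "\<exists>p\<in>W \<times> W. \<Phi> p = \<delta> k" if "k < 2" for k
  proof -
    have "\<delta> k \<in> jk_space l" using that assms(2) by (auto simp: \<delta>_def jk_space_def)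
    then show ?thesis using \<Phi>(1) unfolding bij_betw_def by (metis imageE)
  qed
  show ?thesis
    unfolding cpx_reducible_def
  proof (intro exI[of _ U] conjI ballI)
    show "cpx_subspace U"
      unfolding cpx_subspace_def
    proof (intro conjI ballI allI)
      show "0 \<in> U" using z \<Phi>0 by (simp add: U_def)
      show "x + y \<in> U" if "x \<in> U" "y \<in> U" for x y
      proof -
        have "x \<in> W \<times> W" "y \<in> W \<times> W" using that by (simp_all add: U_def)
        then show ?thesis using that pl \<Phi>(2) by (simp add: U_def)
      qed
      show "cpx_scale c x \<in> U" if "x \<in> U" for c x
      proof -
        have "x \<in> W \<times> W" using that by (simp add: U_def)
        then show ?thesis using that cs \<Phi>(3) by (simp add: U_def)
      qed
    qed
    show "U \<subseteq> W \<times> W" by (auto simp: U_def)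
    show "cpx_act act L u \<in> U" if "L \<in> so g" "u \<in> U" for L u
    proof -
      have "u \<in> W \<times> W" using that by (simp add: U_def)
      then show ?thesis using that ca[OF that(1)] \<Phi>(4)[OF that(1)] by (simp add: U_def jk_act_summand)
    qed
    obtain p0 where p0: "p0 \<in> W \<times> W" "\<Phi> p0 = \<delta> 0" using \<delta>[of 0] by auto
    obtain p1 where p1: "p1 \<in> W \<times> W" "\<Phi> p1 = \<delta> 1" using \<delta>[of 1] by auto
    have "p0 \<in> U" using p0 by (simp add: U_def \<delta>_def)
    moreover have "p0 \<noteq> 0"
    proof
      assume "p0 = 0"
      then have "\<delta> 0 = (\<lambda>s a b. 0)" using p0 \<Phi>0 by metis
      then have "\<delta> 0 0 0 0 = 0" by (rule ssubst) (rule refl)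
      then show False by (simp add: \<delta>_def)
    qed
    ultimately show "U \<noteq> {0}" by blast
    have "p1 \<notin> U"
    proof
      assume "p1 \<in> U"
      then have "\<delta> 1 1 0 0 = 0" using p1 by (simp add: U_def)
      then show False by (simp add: \<delta>_def)
    qed
    then show "U \<noteq> W \<times> W" using p1 by blast
  qed
qed

section \<open>The representation on force tensors\<close>

lemma hatm_add: "hatm (L + M) = hatm L + hatm M"
  and hatm_scale: "hatm (c *\<^sub>R L) = c *\<^sub>R hatm L"
  by (simp_all add: hatm_def scaleR_add_left sum.distrib scaleR_sum_right)

text \<open>By the Leibniz rule \<open>hatm_cre\<close>, the difference \<open>D\<close> commutes
  with every \<open>cre c\<close>; it kills 1 as well, hence every e_I.\<close>

lemma hatm_commutator: "hatm (commutator L M) = commutator (hatm L) (hatm M)"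
proof -
  define D where "D = commutator (hatm L) (hatm M) - hatm (commutator L M)"
  define C where "C L c = (\<Sum>b\<in>UNIV. L $ b $ c *\<^sub>R cre b)" for L :: "real^4^4" and c :: 4
  have h: "hatm L ** cre c = cre c ** hatm L + C L c" for L c by (simp add: hatm_cre C_def)
  have CC: "hatm L ** C M c = C M c ** hatm L + C (L ** M) c" for L M c
    unfolding C_def[of M] matrix_mul_rsum matrix_mul_lsum matrix_scaleR_right matrix_scaleR_left h scaleR_add_right sum.distrib
    unfolding C_def by (simp add: sum_matrix_action')
  have "C (commutator L M) c = C (L ** M) c - C (M ** L) c" for c
    by (simp add: C_def commutator_def scaleR_diff_left sum_subtractf)
  moreover have LM: "hatm L ** hatm M ** cre c = cre c ** (hatm L ** hatm M) + C L c ** hatm M + C M c ** hatm L + C (L ** M) c" for L M c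
  proof -
    have "hatm L ** hatm M ** cre c = hatm L ** (cre c ** hatm M + C M c)" by (simp add: matrix_mul_assoc[symmetric] h)
    also have "\<dots> = (hatm L ** cre c) ** hatm M + hatm L ** C M c" by (simp add: mat_distrib matrix_mul_assoc)
    finally show ?thesis by (simp add: h CC mat_distrib matrix_mul_assoc)
  qed
  ultimately have Dc: "D ** cre c = cre c ** D" for c
    by (simp add: D_def commutator_def[of "hatm L"] mat_distrib h LM)
  have "D *v ext_one = 0"
    by (simp add: D_def commutator_def[of "hatm L"] matvec_distrib matrix_vector_mul_assoc[symmetric] hatm_one)
  then have "D *v eI I = 0 *v eI I" for I
    by (induction I) (simp_all add: matrix_vector_mul_assoc Dc, simp add: matrix_vector_mul_assoc[symmetric])
  then have "D = 0" by (rule matrix_eq_on_eI)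
  then show ?thesis by (simp add: D_def)
qed

lemma commutator_linear:
  "commutator A (B + C) = commutator A B + commutator A C" "commutator (A + B) C = commutator A C + commutator B C"
  "commutator A (B - C) = commutator A B - commutator A C"
  "commutator A (c *\<^sub>R B) = c *\<^sub>R commutator A B" "commutator (c *\<^sub>R A) B = c *\<^sub>R commutator A B"
  "commutator A (sum f S) = (\<Sum>i\<in>S. commutator A (f i))"
  for A B C :: extop
  by (simp_all add: commutator_def mat_distrib algebra_simps scaleR_diff_right matrix_mul_lsum matrix_mul_rsum sum_subtractf)

lemma commutator_jacobi:
  "commutator (commutator A B) C = commutator A (commutator B C) - commutator B (commutator A C)" for A B C :: extop
  by (simp add: commutator_def mat_distrib matrix_mul_assoc)

lemma force_act_linear:
  "force_act L (x + y) = force_act L x + force_act L y"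
  "force_act L (c *\<^sub>R x) = c *\<^sub>R force_act L x"
  "force_act (L + M) x = force_act L x + force_act M x"
  "force_act (c *\<^sub>R L) x = c *\<^sub>R force_act L x"
  by (simp_all add: vec_eq_iff[of _ "_ :: coll"] force_act_def commutator_linear hat_op_eq hatm_add hatm_scale
      scaleR_add_right scaleR_add_left sum.distrib scaleR_sum_right scaleR_diff_right mult.commute)

text \<open>The mixed terms cancel in the commutator. The lower index composes in the order
  \<open>M ** L\<close>, and the minus sign in front of it in \<open>force_act\<close> restores the
  bracket.\<close>

lemma force_act_bracket: "force_act (commutator L M) x = force_act L (force_act M x) - force_act M (force_act L x)"
proof -
  have "force_act (commutator L M) x $ a = (force_act L (force_act M x) - force_act M (force_act L x)) $ a" for a
  proof -
    have 1: "(\<Sum>b\<in>UNIV. L $ b $ a *\<^sub>R (\<Sum>c\<in>UNIV. M $ c $ b *\<^sub>R x $ c)) = (\<Sum>c\<in>UNIV. (M ** L) $ c $ a *\<^sub>R x $ c)" for L M :: "real^4^4"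
      by (rule sum_matrix_action')
    have 2: "force_act L (force_act M x) $ a = commutator (hatm L) (commutator (hatm M) (x $ a))
      - (\<Sum>b\<in>UNIV. M $ b $ a *\<^sub>R commutator (hatm L) (x $ b)) - (\<Sum>b\<in>UNIV. L $ b $ a *\<^sub>R commutator (hatm M) (x $ b))
      + (\<Sum>c\<in>UNIV. (M ** L) $ c $ a *\<^sub>R x $ c)" for L M :: "real^4^4"
      by (simp add: force_act_def hat_op_eq commutator_linear scaleR_diff_right sum_subtractf 1)
    have 3: "(\<Sum>b\<in>UNIV. commutator L M $ b $ a *\<^sub>R x $ b) = (\<Sum>c\<in>UNIV. (L ** M) $ c $ a *\<^sub>R x $ c) - (\<Sum>c\<in>UNIV. (M ** L) $ c $ a *\<^sub>R x $ c)"
      by (simp add: commutator_def scaleR_diff_left sum_subtractf)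
    show ?thesis
      unfolding vector_minus_component 2
      by (simp add: force_act_def hat_op_eq hatm_commutator commutator_jacobi 3)
  qed
  then show ?thesis by (simp add: vec_eq_iff[of _ "_ :: coll"])
qed

lemma op_coll_linear: "linear (op_coll M)"
  by (rule linearI) (simp_all add: op_coll_def vec_eq_iff[of _ "_ :: coll"] mat_distrib)

lemma force_act_op_coll:
  assumes "hatm L ** M = M ** hatm L"
  shows "force_act L (op_coll M \<theta>) = op_coll M (force_act L \<theta>)"
proof -
  have "hatm L ** (M ** X) = M ** (hatm L ** X)" for X :: extop using assms by (simp add: matrix_mul_assoc)
  then show ?thesis
    by (simp add: vec_eq_iff[of _ "_ :: coll"] force_act_def op_coll_def hat_op_eq commutator_def mat_distrib
      matrix_mul_rsum matrix_mul_assoc[symmetric])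
qed

lemma imul_op_coll: "imul = op_coll II"
  by (rule ext) (auto simp: imul_def op_coll_def vec_eq_iff II_def mat_def matrix_matrix_mult_def if_distrib if_distribR cong: if_cong)

context lorentz_frame
begin

definition kap :: "real^4^4 \<Rightarrow> real^4^4" where
  "kap L = Pi ** L ** P"

lemma P_left: "P ** (Pi ** X) = X" "Pi ** (P ** X) = X" for X :: "real^'n^4"
  by (simp_all add: matrix_mul_assoc P_inv)

lemma P_left_transpose: "transpose Pi ** (transpose P ** X) = X" for X :: "real^'n^4"
  by (simp add: matrix_mul_assoc matrix_transpose_mul[symmetric] P_inv transpose_mat)

lemma kap_so: "L \<in> so g \<Longrightarrow> kap L \<in> so eta"
proof -
  assume "L \<in> so g"
  then have "transpose P ** (transpose L ** g + g ** L) ** P = 0" by (simp add: so_def)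
  moreover have "transpose (kap L) ** eta + eta ** kap L = transpose P ** (transpose L ** g + g ** L) ** P"
  proof -
    have "transpose (kap L) ** eta = transpose P ** (transpose L ** (transpose Pi ** (transpose P ** (g ** P))))"
      by (simp add: kap_def P_eta[symmetric] matrix_transpose_mul matrix_mul_assoc)
    moreover have "eta ** kap L = transpose P ** (g ** (P ** (Pi ** (L ** P))))"
      by (simp add: kap_def P_eta[symmetric] matrix_mul_assoc)
    ultimately show ?thesis by (simp add: P_left P_left_transpose mat_distrib matrix_mul_assoc[symmetric])
  qed
  ultimately show ?thesis by (simp add: so_def)
qed

lemma kap_surj:
  assumes "M \<in> so eta"
  obtains L where "L \<in> so g" "kap L = M"
proof -
  define L where "L = P ** M ** Pi"
  have k: "kap L = M" by (simp add: kap_def L_def matrix_mul_assoc[symmetric] P_left P_inv)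
  have g: "g = transpose Pi ** eta ** Pi"
    by (simp add: P_eta[symmetric] matrix_mul_assoc[symmetric] P_inv) (simp add: P_left_transpose)
  have "transpose L ** g + g ** L = transpose Pi ** (transpose M ** eta + eta ** M) ** Pi"
  proof -
    have "transpose L ** g = transpose Pi ** (transpose M ** (eta ** Pi))"
    proof -
      have "transpose P ** (transpose Pi ** X) = X" for X :: "real^4^4"
        by (simp add: matrix_mul_assoc matrix_transpose_mul[symmetric] P_inv transpose_mat)
      then show ?thesis by (simp add: L_def g matrix_transpose_mul matrix_mul_assoc[symmetric])
    qed
    moreover have "g ** L = transpose Pi ** (eta ** (Pi ** (P ** (M ** Pi))))"
      by (simp add: L_def g matrix_mul_assoc)
    ultimately show ?thesis by (simp add: P_left mat_distrib matrix_mul_assoc[symmetric])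
  qed
  then have "L \<in> so g" using assms by (simp add: so_def)
  then show ?thesis using that k by blast
qed

definition intertw :: "(real^4^4 \<Rightarrow> 'a::real_vector \<Rightarrow> 'a) \<Rightarrow> 'a set \<Rightarrow> ('a \<Rightarrow> coll) \<Rightarrow> bool" where
  "intertw a M \<tau> \<longleftrightarrow> linear \<tau> \<and> inj_on \<tau> M \<and> subspace M \<and>
    (\<forall>L\<in>so g. \<forall>x\<in>M. a (kap L) x \<in> M \<and> force_act L (\<tau> x) = \<tau> (a (kap L) x))"

text \<open>Invariant subspaces are pulled back to the model. Surjectivity of \<open>kap\<close> is
  what turns invariance under \<open>so g\<close> into invariance under all of
  \<open>so eta\<close>.\<close>

lemma intertw_irreducible:
  assumes \<tau>: "intertw a M \<tau>" and M: "irreducible_subrep (so eta) a M M" and V: "\<tau> ` M \<subseteq> V"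
  shows "irreducible_subrep (so g) force_act V (\<tau> ` M)"
proof -
  have lin: "linear \<tau>" and inj: "inj_on \<tau> M" and M': "subspace M" "M \<noteq> {0}"
    and eq: "\<And>L x. L \<in> so g \<Longrightarrow> x \<in> M \<Longrightarrow> a (kap L) x \<in> M \<and> force_act L (\<tau> x) = \<tau> (a (kap L) x)"
    and irr: "\<And>U. subrep (so eta) a M U \<Longrightarrow> U = {0} \<or> U = M"
    using assms by (auto simp: intertw_def irreducible_subrep_def)
  show ?thesis
    unfolding irreducible_subrep_def
  proof (intro conjI allI impI)
    show "subrep (so g) force_act V (\<tau> ` M)"
      using linear_subspace_image[OF lin M'(1)] V eq by (auto simp: subrep_def)
    obtain x where "x \<in> M" "x \<noteq> 0" using M' subspace_0 by blast
    then have "\<tau> x \<noteq> 0" using inj_onD[OF inj, of x 0] subspace_0[OF M'(1)] linear_0[OF lin] by auto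
    then show "\<tau> ` M \<noteq> {0}" using \<open>x \<in> M\<close> by blast
    fix U assume U: "subrep (so g) force_act (\<tau> ` M) U"
    define U' where "U' = {x \<in> M. \<tau> x \<in> U}"
    have U_eq: "U = \<tau> ` U'" using U by (auto simp: U'_def subrep_def)
    have "subrep (so eta) a M U'"
      unfolding subrep_def
    proof (intro conjI ballI)
      show "subspace U'"
        using U M'(1) lin unfolding U'_def subrep_def
        by (intro subspaceI) (auto simp: linear_0 linear_add linear_scale intro: subspace_0 subspace_add subspace_scale)
      show "U' \<subseteq> M" by (auto simp: U'_def)
      fix K u assume K: "K \<in> so eta" "u \<in> U'"
      obtain L where "L \<in> so g" "kap L = K" using kap_surj[OF K(1)] .
      moreover from this have "force_act L (\<tau> u) \<in> U" using K(2) U by (auto simp: U'_def subrep_def)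
      ultimately show "a K u \<in> U'" using eq[of L u] K(2) by (simp add: U'_def)
    qed
    then have "U' = {0} \<or> U' = M" by (rule irr)
    then show "U = {0} \<or> U = \<tau> ` M" unfolding U_eq using linear_0[OF lin] by auto
  qed
qed

lemma intertw_htype:
  assumes \<tau>: "intertw a M \<tau>" and M: "spin_type a M l"
  shows "htype g P force_act (\<tau> ` M) l"
proof -
  have lin: "linear \<tau>" and inj: "inj_on \<tau> M" and M': "subspace M"
    and eq: "\<And>L x. L \<in> so g \<Longrightarrow> x \<in> M \<Longrightarrow> a (kap L) x \<in> M \<and> force_act L (\<tau> x) = \<tau> (a (kap L) x)"
    using \<tau> by (auto simp: intertw_def)
  define f where "f = inv_into M \<tau>"
  have f: "f (\<tau> x) = x" if "x \<in> M" for x using inj that by (simp add: f_def)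
  have h: "htype g P (\<lambda>L. a (kap L)) M l"
    using M kap_so unfolding spin_type_def htype_def kap_def Pi_def cpx_act_def by blast
  show ?thesis
  proof (rule htype_pullback[OF h, where f = f])
    show "bij_betw f (\<tau> ` M) M" unfolding f_def using inj by (simp add: bij_betw_inv_into inj_on_imp_bij_betw)
    show "f (x + y) = f x + f y" if xy: "x \<in> \<tau> ` M" "y \<in> \<tau> ` M" for x y
    proof -
      obtain u v where "x = \<tau> u" "y = \<tau> v" "u \<in> M" "v \<in> M" using xy by blast
      then show ?thesis using f[of "u + v"] f subspace_add[OF M'] by (simp add: linear_add[OF lin])
    qed
    show "f (c *\<^sub>R x) = c *\<^sub>R f x" if x: "x \<in> \<tau> ` M" for c x
    proof -
      obtain u where "x = \<tau> u" "u \<in> M" using x by blast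
      then show ?thesis using f[of "c *\<^sub>R u"] f subspace_scale[OF M'] by (simp add: linear_scale[OF lin])
    qed
    show "subspace (\<tau> ` M)" using linear_subspace_image[OF lin M'] .
    show "f (force_act L x) = a (kap L) (f x)" if "L \<in> so g" "x \<in> \<tau> ` M" for L x
      using that eq f by auto
  qed
qed

lemma intertw_iso:
  assumes \<tau>: "intertw a M \<tau>" and \<sigma>: "intertw a M \<sigma>"
  shows "rep_iso (so g) force_act (\<tau> ` M) (\<sigma> ` M)"
proof -
  have lin: "linear \<tau>" "linear \<sigma>" and inj: "inj_on \<tau> M" "inj_on \<sigma> M" and M: "subspace M"
    and eq: "\<And>L x. L \<in> so g \<Longrightarrow> x \<in> M \<Longrightarrow> a (kap L) x \<in> M \<and> force_act L (\<tau> x) = \<tau> (a (kap L) x)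
      \<and> force_act L (\<sigma> x) = \<sigma> (a (kap L) x)"
    using \<tau> \<sigma> by (auto simp: intertw_def)
  define f where "f = inv_into M \<tau>"
  have f: "f (\<tau> x) = x" if "x \<in> M" for x using inj that by (simp add: f_def)
  show ?thesis
  proof (rule rep_isoI[where f = "\<sigma> \<circ> f"])
    show "subspace (\<tau> ` M)" using linear_subspace_image[OF lin(1) M] .
    show "bij_betw (\<sigma> \<circ> f) (\<tau> ` M) (\<sigma> ` M)"
      by (rule bij_betw_trans[of f _ M]) (simp_all add: f_def inj bij_betw_inv_into inj_on_imp_bij_betw)
    show "(\<sigma> \<circ> f) (x + y) = (\<sigma> \<circ> f) x + (\<sigma> \<circ> f) y" if xy: "x \<in> \<tau> ` M" "y \<in> \<tau> ` M" for x y
    proof -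
      obtain u v where "x = \<tau> u" "y = \<tau> v" "u \<in> M" "v \<in> M" using xy by blast
      then show ?thesis using f[of "u + v"] f subspace_add[OF M] by (simp add: linear_add[OF lin(1), symmetric] linear_add[OF lin(2)])
    qed
    show "(\<sigma> \<circ> f) (c *\<^sub>R x) = c *\<^sub>R (\<sigma> \<circ> f) x" if x: "x \<in> \<tau> ` M" for c x
    proof -
      obtain u where "x = \<tau> u" "u \<in> M" using x by blast
      then show ?thesis using f[of "c *\<^sub>R u"] f subspace_scale[OF M] by (simp add: linear_scale[OF lin(1), symmetric] linear_scale[OF lin(2)])
    qed
    show "force_act L v \<in> \<tau> ` M \<and> (\<sigma> \<circ> f) (force_act L v) = force_act L ((\<sigma> \<circ> f) v)"
      if L: "L \<in> so g" "v \<in> \<tau> ` M" for L v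
    proof -
      obtain u where u: "v = \<tau> u" "u \<in> M" using L(2) by blast
      then show ?thesis using eq[OF L(1) u(2)] f by auto
    qed
  qed
qed

lemma intertw_dim:
  fixes M :: "'a::euclidean_space set"
  assumes "intertw a M \<tau>"
  shows "dim (\<tau> ` M) = dim M"
  using assms unfolding intertw_def by (intro dim_image_eq) (auto simp: span_eq_iff[THEN iffD2])

subsection \<open>Parametrization of force tensors by tensors\<close>

text \<open>The index of a collection is covariant, so frame components return to the given basis
  through the inverse matrix.\<close>

definition KK :: "(4 \<Rightarrow> extop) \<Rightarrow> coll" where
  "KK q = (\<chi> a. \<Sum>\<alpha>\<in>UNIV. Pi $ \<alpha> $ a *\<^sub>R q \<alpha>)"

lemma KK_inverse: "(\<Sum>a\<in>UNIV. P $ a $ \<alpha> *\<^sub>R KK q $ a) = q \<alpha>"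
proof -
  have "(\<Sum>a\<in>UNIV. P $ a $ \<alpha> *\<^sub>R KK q $ a) = (\<Sum>c\<in>UNIV. (Pi ** P) $ c $ \<alpha> *\<^sub>R q c)"
    unfolding KK_def by (simp add: sum_matrix_action')
  also have "\<dots> = (\<Sum>c\<in>UNIV. (mat 1 :: real^4^4) $ \<alpha> $ c *\<^sub>R q c)" by (simp add: P_inv mat_def eq_commute)
  finally show ?thesis by (simp add: sum_mat_one)
qed

lemma KK_inject: "KK q = KK q' \<longleftrightarrow> q = q'"
proof
  assume "KK q = KK q'"
  then have "q \<alpha> = q' \<alpha>" for \<alpha>
    unfolding KK_inverse[of \<alpha> q, symmetric] KK_inverse[of \<alpha> q', symmetric] by simp
  then show "q = q'" by (rule ext)
qed simp

lemma KK_surj: "KK (\<lambda>\<alpha>. \<Sum>a\<in>UNIV. P $ a $ \<alpha> *\<^sub>R \<theta> $ a) = \<theta>"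
proof -
  have "KK (\<lambda>\<alpha>. \<Sum>a\<in>UNIV. P $ a $ \<alpha> *\<^sub>R \<theta> $ a) $ b = (\<Sum>c\<in>UNIV. (P ** Pi) $ c $ b *\<^sub>R \<theta> $ c)" for b
    unfolding KK_def by (simp add: sum_matrix_action')
  also have "\<dots> b = (\<Sum>c\<in>UNIV. (mat 1 :: real^4^4) $ b $ c *\<^sub>R \<theta> $ c)" for b
    by (simp add: P_inv mat_def eq_commute)
  finally show ?thesis by (simp add: sum_mat_one vec_eq_iff[of _ "_ :: coll"])
qed

lemma KK_linear: "KK (\<lambda>a. f a + h a) = KK f + KK h" "KK (\<lambda>a. c *\<^sub>R f a) = c *\<^sub>R KK f"
  "op_coll M (KK f) = KK (\<lambda>a. M ** f a)"
  by (simp_all add: KK_def op_coll_def vec_eq_iff[of _ "_ :: coll"] scaleR_add_right sum.distrib scaleR_sum_right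
      matrix_mul_rsum mat_distrib mult.commute)

lemma force_act_KK:
  "force_act L (KK q) = KK (\<lambda>\<alpha>. commutator (hatm L) (q \<alpha>) - (\<Sum>\<beta>\<in>UNIV. kap L $ \<beta> $ \<alpha> *\<^sub>R q \<beta>))"
proof -
  have "force_act L (KK q) $ a = KK (\<lambda>\<alpha>. commutator (hatm L) (q \<alpha>) - (\<Sum>\<beta>\<in>UNIV. kap L $ \<beta> $ \<alpha> *\<^sub>R q \<beta>)) $ a" for a
  proof -
    have "(\<Sum>b\<in>UNIV. L $ b $ a *\<^sub>R KK q $ b) = (\<Sum>\<alpha>\<in>UNIV. (Pi ** L) $ \<alpha> $ a *\<^sub>R q \<alpha>)"
      unfolding KK_def by (simp add: sum_matrix_action')
    moreover have "(\<Sum>\<alpha>\<in>UNIV. Pi $ \<alpha> $ a *\<^sub>R (\<Sum>\<beta>\<in>UNIV. kap L $ \<beta> $ \<alpha> *\<^sub>R q \<beta>)) = (\<Sum>\<beta>\<in>UNIV. (kap L ** Pi) $ \<beta> $ a *\<^sub>R q \<beta>)"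
      by (rule sum_matrix_action')
    moreover have "kap L ** Pi = Pi ** L" by (simp add: kap_def matrix_mul_assoc[symmetric] P_inv)
    ultimately show ?thesis
      by (simp add: force_act_def hat_op_eq, simp add: KK_def commutator_linear scaleR_diff_right sum_subtractf)
  qed
  then show ?thesis by (simp add: vec_eq_iff[of _ "_ :: coll"])
qed

text \<open>Contractions transform like creation operators exactly because \<open>g ** L\<close> is
  minus its transpose; the parity operator commutes with \<open>hatm L\<close>. So the frame
  operators form a vector.\<close>

lemma hatm_rho:
  assumes "L \<in> so g"
  shows "hatm L ** rho a = rho a ** hatm L + (\<Sum>b\<in>UNIV. kap L $ b $ a *\<^sub>R rho b)"
proof -
  have gL: "(g ** L) $ a $ c = - (transpose L ** g) $ a $ c" for a c
  proof -
    have "transpose L ** g + g ** L = 0" using assms by (simp add: so_def)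
    then have "(transpose L ** g + g ** L) $ a $ c = 0" by simp
    then show ?thesis unfolding vector_add_component by linarith
  qed
  have h_iota: "hatm L ** iota g a = iota g a ** hatm L + (\<Sum>b\<in>UNIV. L $ b $ a *\<^sub>R iota g b)" for a
  proof -
    have "hatm L ** iota g a = iota g a ** hatm L - (\<Sum>b\<in>UNIV. g $ a $ b *\<^sub>R (\<Sum>c\<in>UNIV. L $ b $ c *\<^sub>R ann c))"
      by (simp add: iota_def matrix_mul_lsum matrix_mul_rsum mat_distrib hatm_ann scaleR_diff_right sum_subtractf)
    also have "(\<Sum>b\<in>UNIV. g $ a $ b *\<^sub>R (\<Sum>c\<in>UNIV. L $ b $ c *\<^sub>R ann c)) = (\<Sum>c\<in>UNIV. (g ** L) $ a $ c *\<^sub>R ann c)"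
      by (rule sum_matrix_action)
    also have "\<dots> = - (\<Sum>c\<in>UNIV. (transpose L ** g) $ a $ c *\<^sub>R ann c)" by (simp add: gL sum_negf)
    also have "(\<Sum>c\<in>UNIV. (transpose L ** g) $ a $ c *\<^sub>R ann c) = (\<Sum>b\<in>UNIV. transpose L $ a $ b *\<^sub>R iota g b)"
      unfolding iota_def by (rule sum_matrix_action[symmetric])
    finally show ?thesis by (simp add: transpose_def)
  qed
  have h_rr: "hatm L ** rr a = rr a ** hatm L + (\<Sum>b\<in>UNIV. L $ b $ a *\<^sub>R rr b)" for a
  proof -
    have "hatm L ** rr a = (hatm L ** (cre a + iota g a)) ** parity_op" by (simp add: rr_def matrix_mul_assoc)
    also have "\<dots> = (cre a + iota g a) ** (hatm L ** parity_op) + (\<Sum>b\<in>UNIV. L $ b $ a *\<^sub>R rr b)"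
      by (simp add: mat_distrib hatm_cre h_iota rr_def matrix_mul_lsum matrix_mul_assoc scaleR_add_right sum.distrib)
    finally show ?thesis by (simp add: rr_def parity_hatm[symmetric] matrix_mul_assoc)
  qed
  have "hatm L ** rho a = rho a ** hatm L + (\<Sum>c\<in>UNIV. P $ c $ a *\<^sub>R (\<Sum>b\<in>UNIV. L $ b $ c *\<^sub>R rr b))"
    by (simp add: rho_def matrix_mul_lsum matrix_mul_rsum mat_distrib h_rr scaleR_add_right sum.distrib)
  also have "(\<Sum>c\<in>UNIV. P $ c $ a *\<^sub>R (\<Sum>b\<in>UNIV. L $ b $ c *\<^sub>R rr b)) = (\<Sum>b\<in>UNIV. (L ** P) $ b $ a *\<^sub>R (\<Sum>\<alpha>\<in>UNIV. Pi $ \<alpha> $ b *\<^sub>R rho \<alpha>))"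
    by (simp add: sum_matrix_action' rr_rho[symmetric])
  also have "\<dots> = (\<Sum>b\<in>UNIV. kap L $ b $ a *\<^sub>R rho b)"
    by (simp add: sum_matrix_action' kap_def matrix_mul_assoc)
  finally show ?thesis .
qed

lemma hatm_II: "hatm L ** II = II ** hatm L"
  by (rule II_central[symmetric])

text \<open>Infinitesimal invariance of the volume element. Diagonal entries of \<open>kap L\<close>
  are zero, and the remaining terms cancel in pairs by the symmetries of
  \<open>so eta\<close>.\<close>

lemma hatm_JO:
  assumes "L \<in> so g"
  shows "hatm L ** JO = JO ** hatm L"
proof -
  have r: "hatm L ** rho a = rho a ** hatm L + (kap L $ 0 $ a *\<^sub>R rho 0 + kap L $ 1 $ a *\<^sub>R rho 1 + kap L $ 2 $ a *\<^sub>R rho 2 + kap L $ 3 $ a *\<^sub>R rho 3)" for a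
    unfolding hatm_rho[OF assms] by (simp add: sum_UNIV4)
  have rl: "hatm L ** (rho a ** M) = rho a ** (hatm L ** M) + (kap L $ 0 $ a *\<^sub>R rho 0 + kap L $ 1 $ a *\<^sub>R rho 1 + kap L $ 2 $ a *\<^sub>R rho 2 + kap L $ 3 $ a *\<^sub>R rho 3) ** M" for a and M :: extop
    by (simp add: matrix_mul_assoc r mat_distrib)
  show ?thesis
    unfolding JO_normal
    by (simp add: r rl rho_normal so_eta_entries[OF kap_so[OF assms]])
qed

definition R1 :: "real^4 \<Rightarrow> extop" where
  "R1 x = (\<Sum>a\<in>UNIV. x $ a *\<^sub>R rho a)"

definition R2 :: "real^4^4 \<Rightarrow> extop" where
  "R2 X = (\<Sum>r\<in>UNIV. \<Sum>s\<in>UNIV. X $ r $ s *\<^sub>R rho2 r s)"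

lemma linear_R1: "linear R1"
  by (rule linearI) (simp_all add: R1_def scaleR_add_left sum.distrib scaleR_sum_right)

lemma linear_R2: "linear R2"
  by (rule linearI) (simp_all add: R2_def scaleR_add_left sum.distrib scaleR_sum_right)

lemma hatm_R1: "L \<in> so g \<Longrightarrow> commutator (hatm L) (R1 x) = R1 (kap L *v x)"
proof -
  assume L: "L \<in> so g"
  have "commutator (hatm L) (R1 x) = (\<Sum>a\<in>UNIV. x $ a *\<^sub>R (\<Sum>b\<in>UNIV. kap L $ b $ a *\<^sub>R rho b))"
    by (simp add: R1_def commutator_linear) (simp add: commutator_def hatm_rho[OF L])
  also have "\<dots> = (\<Sum>b\<in>UNIV. \<Sum>a\<in>UNIV. (x $ a * kap L $ b $ a) *\<^sub>R rho b)"
    by (simp add: scaleR_sum_right) (rule sum.swap)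
  finally show ?thesis by (simp add: R1_def matrix_vector_mult_def scaleR_sum_left mult.commute)
qed

lemma hatm_rho2:
  assumes "L \<in> so g"
  shows "commutator (hatm L) (rho2 a b) = (\<Sum>c\<in>UNIV. kap L $ c $ a *\<^sub>R rho2 c b) + (\<Sum>c\<in>UNIV. kap L $ c $ b *\<^sub>R rho2 a c)"
proof -
  have d: "commutator A (B ** C) = commutator A B ** C + B ** commutator A C" for A B C :: extop
    by (simp add: commutator_def mat_distrib matrix_mul_assoc)
  have r: "commutator (hatm L) (rho a) = (\<Sum>c\<in>UNIV. kap L $ c $ a *\<^sub>R rho c)" for a
    by (simp add: commutator_def hatm_rho[OF assms])
  show ?thesis
    by (simp add: rho2_def commutator_linear d r matrix_mul_lsum matrix_mul_rsum mat_distrib scaleR_sum_right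
        sum.distrib sum_subtractf scaleR_diff_right scaleR_add_right algebra_simps)
qed

lemma hatm_R2: "L \<in> so g \<Longrightarrow> commutator (hatm L) (R2 X) = R2 (act2 (kap L) X)"
proof -
  assume L: "L \<in> so g"
  let ?k = "kap L"
  have "commutator (hatm L) (R2 X) = (\<Sum>r\<in>UNIV. \<Sum>s\<in>UNIV. X $ r $ s *\<^sub>R ((\<Sum>c\<in>UNIV. ?k $ c $ r *\<^sub>R rho2 c s) + (\<Sum>c\<in>UNIV. ?k $ c $ s *\<^sub>R rho2 r c)))"
    by (simp add: R2_def commutator_linear hatm_rho2[OF L])
  also have "\<dots> = (\<Sum>r\<in>UNIV. \<Sum>s\<in>UNIV. \<Sum>c\<in>UNIV. (X $ r $ s * ?k $ c $ r) *\<^sub>R rho2 c s) +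
     (\<Sum>r\<in>UNIV. \<Sum>s\<in>UNIV. \<Sum>c\<in>UNIV. (X $ r $ s * ?k $ c $ s) *\<^sub>R rho2 r c)"
    by (simp add: scaleR_add_right scaleR_sum_right sum.distrib)
  also have "(\<Sum>r\<in>UNIV. \<Sum>s\<in>UNIV. \<Sum>c\<in>UNIV. (X $ r $ s * ?k $ c $ r) *\<^sub>R rho2 c s)
    = (\<Sum>c\<in>UNIV. \<Sum>s\<in>UNIV. \<Sum>r\<in>UNIV. (?k $ c $ r * X $ r $ s) *\<^sub>R rho2 c s)"
  proof -
    have "(\<Sum>r\<in>UNIV. \<Sum>s\<in>UNIV. \<Sum>c\<in>UNIV. (X $ r $ s * ?k $ c $ r) *\<^sub>R rho2 c s)
      = (\<Sum>s\<in>UNIV. \<Sum>r\<in>UNIV. \<Sum>c\<in>UNIV. (X $ r $ s * ?k $ c $ r) *\<^sub>R rho2 c s)" by (rule sum.swap)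
    also have "\<dots> = (\<Sum>s\<in>UNIV. \<Sum>c\<in>UNIV. \<Sum>r\<in>UNIV. (X $ r $ s * ?k $ c $ r) *\<^sub>R rho2 c s)"
      by (rule sum.cong[OF refl], rule sum.swap)
    also have "\<dots> = (\<Sum>c\<in>UNIV. \<Sum>s\<in>UNIV. \<Sum>r\<in>UNIV. (X $ r $ s * ?k $ c $ r) *\<^sub>R rho2 c s)" by (rule sum.swap)
    finally show ?thesis by (simp add: mult.commute)
  qed
  also have "(\<Sum>r\<in>UNIV. \<Sum>s\<in>UNIV. \<Sum>c\<in>UNIV. (X $ r $ s * ?k $ c $ s) *\<^sub>R rho2 r c)
    = (\<Sum>r\<in>UNIV. \<Sum>c\<in>UNIV. \<Sum>s\<in>UNIV. (X $ r $ s * ?k $ c $ s) *\<^sub>R rho2 r c)"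
    by (rule sum.cong[OF refl], rule sum.swap)
  also have "(\<Sum>c\<in>UNIV. \<Sum>s\<in>UNIV. \<Sum>r\<in>UNIV. (?k $ c $ r * X $ r $ s) *\<^sub>R rho2 c s)
     + (\<Sum>r\<in>UNIV. \<Sum>c\<in>UNIV. \<Sum>s\<in>UNIV. (X $ r $ s * ?k $ c $ s) *\<^sub>R rho2 r c) = R2 (act2 ?k X)"
    by (simp add: R2_def act2_nth scaleR_add_left scaleR_sum_left sum.distrib)
  finally show ?thesis .
qed

text \<open>The sign lowers the first tensor index. It is kept upper in the models, so that all
  indices there transform alike, whereas the index of a collection is lower.\<close>

definition LT :: "('a::real_vector \<Rightarrow> extop) \<Rightarrow> 'a^4 \<Rightarrow> coll" where
  "LT R X = KK (\<lambda>\<alpha>. eta $ \<alpha> $ \<alpha> *\<^sub>R R (X $ \<alpha>))"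

lemma linear_LT: "linear R \<Longrightarrow> linear (LT R)"
  by (rule linearI) (simp_all add: LT_def linear_add linear_scale KK_linear[symmetric] scaleR_add_right mult.commute)

lemma op_coll_LT: "op_coll M (LT R X) = LT (\<lambda>x. M ** R x) X"
  by (simp add: LT_def KK_linear mat_distrib)

lemma LT_equivariant:
  assumes L: "L \<in> so g" and R: "linear R" "\<And>a. commutator (hatm L) (R (X $ a)) = R (A (X $ a))"
  shows "force_act L (LT R X) = LT R (\<chi> a. A (X $ a) + (\<Sum>b\<in>UNIV. kap L $ a $ b *\<^sub>R X $ b))"
proof -
  \<comment> \<open>Lowering with \<open>eta\<close> turns minus the transposed matrix, by which a
    lower index transforms, into the matrix itself.\<close>
  have k: "kap L $ b $ a * eta $ b $ b = - (eta $ a $ a * kap L $ a $ b)" for a b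
  proof -
    have "\<forall>a b. kap L $ b $ a * eta $ b $ b = - (eta $ a $ a * kap L $ a $ b)"
      unfolding all4 by (simp add: eta_def so_eta_entries[OF kap_so[OF L]])
    then show ?thesis by blast
  qed
  show ?thesis
    unfolding LT_def force_act_KK KK_inject
    by (simp add: fun_eq_iff commutator_linear R(2) linear_add[OF R(1)] linear_sum[OF R(1)] linear_scale[OF R(1)]
        scaleR_add_right k scaleR_sum_right sum_negf)
qed

end

lemma is_direct_sum_refine:
  assumes "is_direct_sum V (A # Bs)" "is_direct_sum A Us"
  shows "is_direct_sum V (Us @ Bs)"
proof -
  have s: "\<forall>W\<in>set (A # Bs). subspace W" "\<forall>W\<in>set (Us @ Bs). subspace W" "A = sum_space Us"
    using assms unfolding is_direct_sum_alt by auto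
  show ?thesis
    using assms s(2,3) indep_spaces_Cons[OF s(1)]
    unfolding is_direct_sum_alt indep_spaces_append[OF s(2)] sum_space_append sum_space_Cons by simp
qed

lemma is_direct_sum3I:
  assumes "subspace A" "subspace B" "subspace C" "V = {a + b + c | a b c. a \<in> A \<and> b \<in> B \<and> c \<in> C}"
    "\<And>a b c. a \<in> A \<Longrightarrow> b \<in> B \<Longrightarrow> c \<in> C \<Longrightarrow> a + b + c = 0 \<Longrightarrow> a = 0 \<and> b = 0 \<and> c = 0"
  shows "is_direct_sum V [A, B, C]"
proof -
  have "sum_space [A, B, C] = {a + b + c | a b c. a \<in> A \<and> b \<in> B \<and> c \<in> C}"
  proof (intro equalityI subsetI)
    fix x assume "x \<in> sum_space [A, B, C]"
    then obtain a b c where "a \<in> A" "b \<in> B" "c \<in> C" "x = a + b + c" by (auto simp: sum_space_Cons add.assoc)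
    then show "x \<in> {a + b + c | a b c. a \<in> A \<and> b \<in> B \<and> c \<in> C}" by blast
  next
    fix x assume "x \<in> {a + b + c | a b c. a \<in> A \<and> b \<in> B \<and> c \<in> C}"
    then obtain a b c where "list_all2 (\<in>) [a, b, c] [A, B, C]" "x = sum_list [a, b, c]" by (auto simp: add.assoc)
    then show "x \<in> sum_space [A, B, C]" unfolding sum_space_def by blast
  qed
  moreover have "indep_spaces [A, B, C]"
    unfolding indep_spaces_def using assms(5) by (auto simp: list_all2_Cons2 add.assoc[symmetric])
  ultimately show ?thesis using assms by (simp add: is_direct_sum_alt)
qed

section \<open>Decomposition of the tensor models\<close>

text \<open>The factor 1/2 compensates for \<open>R2\<close> summing over ordered pairs: the
  arguments become the coefficients of the six \<open>rho2\<close>, see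
  \<open>R2_biv\<close>.\<close>

definition biv :: "real \<times> real \<times> real \<times> real \<times> real \<times> real \<Rightarrow> real^4^4" where
  "biv = (\<lambda>(e1, e2, e3, b1, b2, b3). (1/2) *\<^sub>R (\<chi> i j.
     if i = 0 then (if j = 0 then 0 else if j = 1 then e1 else if j = 2 then e2 else e3)
     else if i = 1 then (if j = 0 then - e1 else if j = 1 then 0 else if j = 2 then b3 else - b2)
     else if i = 2 then (if j = 0 then - e2 else if j = 1 then - b3 else if j = 2 then 0 else b1)
     else (if j = 0 then - e3 else if j = 1 then b2 else if j = 2 then - b1 else 0)))"

lemma biv_entries:
  "biv (e1, e2, e3, b1, b2, b3) $ 0 $ 0 = 0" "biv (e1, e2, e3, b1, b2, b3) $ 0 $ 1 = e1 / 2"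
  "biv (e1, e2, e3, b1, b2, b3) $ 0 $ 2 = e2 / 2" "biv (e1, e2, e3, b1, b2, b3) $ 0 $ 3 = e3 / 2"
  "biv (e1, e2, e3, b1, b2, b3) $ 1 $ 0 = - e1 / 2" "biv (e1, e2, e3, b1, b2, b3) $ 1 $ 1 = 0"
  "biv (e1, e2, e3, b1, b2, b3) $ 1 $ 2 = b3 / 2" "biv (e1, e2, e3, b1, b2, b3) $ 1 $ 3 = - b2 / 2"
  "biv (e1, e2, e3, b1, b2, b3) $ 2 $ 0 = - e2 / 2" "biv (e1, e2, e3, b1, b2, b3) $ 2 $ 1 = - b3 / 2"
  "biv (e1, e2, e3, b1, b2, b3) $ 2 $ 2 = 0" "biv (e1, e2, e3, b1, b2, b3) $ 2 $ 3 = b1 / 2"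
  "biv (e1, e2, e3, b1, b2, b3) $ 3 $ 0 = - e3 / 2" "biv (e1, e2, e3, b1, b2, b3) $ 3 $ 1 = b2 / 2"
  "biv (e1, e2, e3, b1, b2, b3) $ 3 $ 2 = - b1 / 2" "biv (e1, e2, e3, b1, b2, b3) $ 3 $ 3 = 0"
  by (simp_all add: biv_def)

definition tup :: "real^4^4 \<Rightarrow> real \<times> real \<times> real \<times> real \<times> real \<times> real" where
  "tup X = (2 * X $ 0 $ 1, 2 * X $ 0 $ 2, 2 * X $ 0 $ 3, 2 * X $ 2 $ 3, 2 * X $ 3 $ 1, 2 * X $ 1 $ 2)"

lemma biv_M6: "biv p \<in> M6"
  by (cases p) (simp add: M6_def transpose_def vec_eq_iff all4 biv_entries)

lemma tup_biv: "tup (biv p) = p"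
  by (cases p) (simp add: tup_def biv_entries)

lemma biv_tup: "X \<in> M6 \<Longrightarrow> biv (tup X) = X"
  by (simp add: vec_eq_iff all4 biv_entries tup_def M6_entries)

lemma linear_biv: "linear biv"
  by (rule linearI) (auto simp: vec_eq_iff all4 biv_entries field_simps)

lemma M6_eq: "M6 = range biv"
  using biv_M6 biv_tup by (metis UNIV_I image_eqI subsetI subset_antisym image_subsetI)

lemma dim_M6: "dim M6 = 6"
proof -
  have "inj biv" by (metis tup_biv injI)
  then have "dim (range biv) = dim (UNIV :: (real \<times> real \<times> real \<times> real \<times> real \<times> real) set)"
    by (intro dim_image_eq linear_biv) simp
  then show ?thesis by (simp add: M6_eq)
qed

lemma dim_A3: "dim A3 = 24"
proof -
  define h :: "(real \<times> real \<times> real \<times> real \<times> real \<times> real)^4 \<Rightarrow> real^4^4^4" where "h v = (\<chi> a. biv (v $ a))" for v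
  have l: "linear h"
    by (rule linearI) (simp_all add: h_def vec_eq_iff[of _ "_ :: real^4^4^4"] linear_add[OF linear_biv] linear_scale[OF linear_biv])
  have i: "inj h"
  proof (rule injI)
    fix u v assume "h u = h v"
    then have "biv (u $ a) = biv (v $ a)" for a by (metis h_def vec_lambda_beta)
    then have "u $ a = v $ a" for a by (metis tup_biv)
    then show "u = v" by (simp add: vec_eq_iff)
  qed
  have "A3 = range h"
  proof (intro equalityI subsetI)
    fix F assume "F \<in> A3"
    then have "F = h (\<chi> a. tup (F $ a))" by (simp add: h_def vec_eq_iff[of _ "_ :: real^4^4^4"] biv_tup A3_def)
    then show "F \<in> range h" by blast
  qed (auto simp: A3_def h_def biv_M6)
  moreover have "dim (range h) = dim (UNIV :: ((real \<times> real \<times> real \<times> real \<times> real \<times> real)^4) set)"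
    using i by (intro dim_image_eq l) simp
  ultimately show ?thesis by simp
qed

text \<open>The trace part, normalized so that \<open>T2 (tr x)\<close> is the combination of the
  \<open>v_vec s\<close> with coefficients \<open>x $ s\<close>.\<close>

definition tr :: "real^4 \<Rightarrow> real^4^4^4" where
  "tr x = (\<chi> a r s. (eta $ a $ r * x $ s - eta $ a $ s * x $ r) / 2)"

text \<open>The totally antisymmetric part. Each row is the dual of the corresponding row of
  \<open>tr x\<close>, that is, (e, b) is replaced by (-b, e); this makes it the image of the trace
  part under \<open>JO\<close>.\<close>

definition ep :: "real^4 \<Rightarrow> real^4^4^4" where
  "ep x = (\<chi> a. if a = 0 then biv (0, 0, 0, x $ 1, x $ 2, x $ 3)
     else if a = 1 then biv (0, - x $ 3, x $ 2, x $ 0, 0, 0)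
     else if a = 2 then biv (x $ 3, 0, - x $ 1, 0, x $ 0, 0)
     else biv (- x $ 2, x $ 1, 0, 0, 0, x $ 0))"

lemma ep_entries: "ep x $ 0 = biv (0, 0, 0, x $ 1, x $ 2, x $ 3)" "ep x $ 1 = biv (0, - x $ 3, x $ 2, x $ 0, 0, 0)"
  "ep x $ 2 = biv (x $ 3, 0, - x $ 1, 0, x $ 0, 0)" "ep x $ 3 = biv (- x $ 2, x $ 1, 0, 0, 0, x $ 0)"
  by (simp_all add: ep_def)

lemma eta_all: "eta $ 0 $ 0 = 1" "eta $ 0 $ 1 = 0" "eta $ 0 $ 2 = 0" "eta $ 0 $ 3 = 0"
  "eta $ 1 $ 0 = 0" "eta $ 1 $ 1 = -1" "eta $ 1 $ 2 = 0" "eta $ 1 $ 3 = 0"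
  "eta $ 2 $ 0 = 0" "eta $ 2 $ 1 = 0" "eta $ 2 $ 2 = -1" "eta $ 2 $ 3 = 0"
  "eta $ 3 $ 0 = 0" "eta $ 3 $ 1 = 0" "eta $ 3 $ 2 = 0" "eta $ 3 $ 3 = -1"
  by (simp_all add: eta_def)

lemma tr_entries: "tr x $ 0 = biv (x $ 1, x $ 2, x $ 3, 0, 0, 0)" "tr x $ 1 = biv (x $ 0, 0, 0, 0, x $ 3, - x $ 2)"
  "tr x $ 2 = biv (0, x $ 0, 0, - x $ 3, 0, x $ 1)" "tr x $ 3 = biv (0, 0, x $ 0, x $ 2, - x $ 1, 0)"
  unfolding vec_eq_iff all4 by (simp_all add: tr_def eta_all biv_entries)

lemma linear_tr: "linear tr"
  by (rule linearI) (simp_all add: tr_def vec_eq_iff field_simps)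

lemma linear_ep: "linear ep"
  by (rule linearI) (simp_all add: vec_eq_iff all4 ep_entries biv_entries field_simps)

lemma act3_tr:
  assumes "L \<in> so eta"
  shows "act3 L (tr x) = tr (L *v x)"
  unfolding vec_eq_iff all4
  by (simp add: act3_nth sum_UNIV4 tr_entries biv_entries so_eta_entries[OF assms] matrix_vector_mult_def)

lemma act2_eta:
  assumes "L \<in> so eta"
  shows "act2 L (c *\<^sub>R eta) = 0"
  unfolding vec_eq_iff all4
  by (simp add: act2_nth sum_UNIV4 eta_all so_eta_entries[OF assms])

lemma tr_A3: "tr x \<in> A3" and ep_A3: "ep x \<in> A3"
  unfolding A3_def by (auto simp: all4 tr_entries ep_entries biv_M6)

lemma contr_values: "contr (tr x) 0 = 3/2 * x $ 0" "contr (tr x) 1 = 3/2 * x $ 1" "contr (tr x) 2 = 3/2 * x $ 2"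
  "contr (tr x) 3 = 3/2 * x $ 3" "contr (ep x) 0 = 0" "contr (ep x) 1 = 0" "contr (ep x) 2 = 0" "contr (ep x) 3 = 0"
  by (simp_all add: contr_def tr_entries ep_entries biv_entries)

lemma cyc_values: "cyc (tr x) 0 1 2 = 0" "cyc (tr x) 0 1 3 = 0" "cyc (tr x) 0 2 3 = 0" "cyc (tr x) 1 2 3 = 0"
  "cyc (ep x) 0 1 2 = 3/2 * x $ 3" "cyc (ep x) 0 1 3 = - (3/2 * x $ 2)" "cyc (ep x) 0 2 3 = 3/2 * x $ 1" "cyc (ep x) 1 2 3 = 3/2 * x $ 0"
  by (simp_all add: cyc_def tr_entries ep_entries biv_entries)

lemma contr_cyc_linear: "contr (F + G) s = contr F s + contr G s" "contr (F - G) s = contr F s - contr G s"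
  "cyc (F + G) a b c = cyc F a b c + cyc G a b c" "cyc (F - G) a b c = cyc F a b c - cyc G a b c"
  "contr 0 s = 0" "cyc 0 a b c = 0"
  by (simp_all add: contr_def cyc_def)

lemma M16_alt: "F \<in> M16 \<longleftrightarrow> F \<in> A3 \<and> contr F 0 = 0 \<and> contr F 1 = 0 \<and> contr F 2 = 0 \<and> contr F 3 = 0
   \<and> cyc F 0 1 2 = 0 \<and> cyc F 0 1 3 = 0 \<and> cyc F 0 2 3 = 0 \<and> cyc F 1 2 3 = 0"
  by (simp add: M16_def all4)

lemma A3_decomposition: "is_direct_sum A3 [range tr, range ep, M16]"
proof (rule is_direct_sum3I)
  show "subspace (range tr)" "subspace (range ep)"
    by (intro linear_subspace_image linear_tr linear_ep subspace_UNIV)+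
  show "subspace M16" by (rule subspace_M16)
  show "A3 = {a + b + c |a b c. a \<in> range tr \<and> b \<in> range ep \<and> c \<in> M16}"
  proof (intro equalityI subsetI)
    fix F assume F: "F \<in> A3"
    \<comment> \<open>The factors 2/3 invert the 3/2 in \<open>contr_values\<close> and
      \<open>cyc_values\<close>; indices and signs in \<open>y\<close> are read off from the
      latter.\<close>
    define x :: "real^4" where "x = (\<chi> a. 2/3 * contr F a)"
    define y :: "real^4" where "y = (\<chi> a. if a = 0 then 2/3 * cyc F 1 2 3 else if a = 1 then 2/3 * cyc F 0 2 3
       else if a = 2 then - (2/3 * cyc F 0 1 3) else 2/3 * cyc F 0 1 2)"
    have "F - tr x - ep y \<in> M16"
      unfolding M16_alt contr_cyc_linear contr_values cyc_values
      using F tr_A3 ep_A3 by (auto simp: x_def y_def intro!: subspace_diff[OF subspace_A3])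
    moreover have "F = tr x + ep y + (F - tr x - ep y)" by simp
    ultimately show "F \<in> {a + b + c |a b c. a \<in> range tr \<and> b \<in> range ep \<and> c \<in> M16}" by blast
  next
    fix F assume "F \<in> {a + b + c |a b c. a \<in> range tr \<and> b \<in> range ep \<and> c \<in> M16}"
    then show "F \<in> A3" using tr_A3 ep_A3 by (auto simp: M16_alt intro!: subspace_add[OF subspace_A3])
  qed
  fix a b c assume "a \<in> range tr" "b \<in> range ep" and c: "c \<in> M16" and s: "a + b + c = 0"
  then obtain x y where a: "a = tr x" and b: "b = ep y" by blast
  have "contr (tr x + ep y + c) s = 0" "cyc (tr x + ep y + c) p q r = 0" for s p q r
    using s unfolding a b by (simp_all add: contr_cyc_linear)
  note e = this(1)[of 0] this(1)[of 1] this(1)[of 2] this(1)[of 3] this(2)[of 0 1 2] this(2)[of 0 1 3] this(2)[of 0 2 3] this(2)[of 1 2 3]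
  have "x = 0" "y = 0" unfolding vec_eq_iff all4
    using e c[unfolded M16_alt] by (simp_all add: contr_cyc_linear contr_values cyc_values)
  then show "a = 0 \<and> b = 0 \<and> c = 0" using s a b by (simp add: linear_0 linear_tr linear_ep)
qed

lemma linear_eta: "linear (\<lambda>c. c *\<^sub>R eta)"
  by (rule linearI) (simp_all add: scaleR_add_left)

lemma square_decomposition: "is_direct_sum (UNIV :: (real^4^4) set) [range (\<lambda>c. c *\<^sub>R eta), M6, M9]"
proof (rule is_direct_sum3I)
  show "subspace (range (\<lambda>c. c *\<^sub>R eta))" by (intro linear_subspace_image linear_eta subspace_UNIV)
  show "subspace M6" "subspace M9" by (rule subspace_M6, rule subspace_M9)
  show "(UNIV :: (real^4^4) set) = {a + b + c |a b c. a \<in> range (\<lambda>c. c *\<^sub>R eta) \<and> b \<in> M6 \<and> c \<in> M9}"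
  proof (intro equalityI subsetI)
    fix X :: "real^4^4"
    \<comment> \<open>The trace of \<open>eta\<close> with respect to itself is 4.\<close>
    define k where "k = (X $ 0 $ 0 - X $ 1 $ 1 - X $ 2 $ 2 - X $ 3 $ 3) / 4"
    have e: "transpose eta = eta" by (simp add: transpose_def eta_def vec_eq_iff)
    have n: "transpose (A - B) = transpose A - transpose B" for A B :: "real^4^4"
      by (simp add: transpose_def vec_eq_iff)
    have 1: "(1/2) *\<^sub>R (X - transpose X) \<in> M6"
      by (simp add: M6_def transpose_scale n transpose_transpose) (simp add: scaleR_minus_right[symmetric])
    have 2: "(1/2) *\<^sub>R (X + transpose X) - k *\<^sub>R eta \<in> M9"
    proof -
      have "transpose ((1/2) *\<^sub>R (X + transpose X) - k *\<^sub>R eta) = (1/2) *\<^sub>R (X + transpose X) - k *\<^sub>R eta"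
        by (simp add: n transpose_scale transpose_add e transpose_transpose add.commute)
      then show ?thesis by (simp add: M9_def) (simp add: transpose_def eta_all k_def field_simps)
    qed
    have "X = k *\<^sub>R eta + (1/2) *\<^sub>R (X - transpose X) + ((1/2) *\<^sub>R (X + transpose X) - k *\<^sub>R eta)"
      by (simp add: scaleR_add_right scaleR_diff_right scaleR_add_left[symmetric])
    then show "X \<in> {a + b + c |a b c. a \<in> range (\<lambda>c. c *\<^sub>R eta) \<and> b \<in> M6 \<and> c \<in> M9}" using 1 2 by blast
  qed simp
  fix a b c assume "a \<in> range (\<lambda>c. c *\<^sub>R eta)" and bc: "b \<in> M6" "c \<in> M9" and s: "a + b + c = 0"
  then obtain k where a: "a = k *\<^sub>R eta" by blast
  have e: "k * eta $ i $ j + b $ i $ j + c $ i $ j = 0" for i j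
    using arg_cong[OF s, of "\<lambda>m. m $ i $ j"] by (simp add: a)
  note ee = e[of 0 0] e[of 1 1] e[of 2 2] e[of 3 3] e[of 0 1] e[of 0 2] e[of 0 3] e[of 1 2] e[of 1 3] e[of 2 3]
     e[of 1 0] e[of 2 0] e[of 3 0] e[of 2 1] e[of 3 1] e[of 3 2]
  note ee' = ee[unfolded eta_all M6_entries[OF bc(1)] M9_entries[OF bc(2)]]
  have "k = 0" using ee' by linarith
  moreover have "b = 0" unfolding vec_eq_iff all4 using ee' by (simp add: M6_entries[OF bc(1)])
  ultimately show "a = 0 \<and> b = 0 \<and> c = 0" using s a by simp
qed

text \<open>By subtraction: 16 - 1 - 6.\<close>

lemma dim_M9: "dim M9 = 9"
proof -
  have "dim (range (\<lambda>c. c *\<^sub>R eta)) = dim (UNIV :: real set)"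
  proof (intro dim_image_eq linear_eta)
    have "eta \<noteq> 0" using eta_all(1) by (metis zero_index zero_neq_one)
    then show "inj_on (\<lambda>c. c *\<^sub>R eta) (span UNIV)" by (simp add: inj_on_def)
  qed
  then show ?thesis using dim_is_direct_sum[OF square_decomposition] by (simp add: dim_M6)
qed

lemma inj_tr: "inj tr" and inj_ep: "inj ep"
proof -
  have "tr x = 0 \<Longrightarrow> x = 0" "ep x = 0 \<Longrightarrow> x = 0" for x
  proof -
    show "x = 0" if "tr x = 0" unfolding vec_eq_iff all4
      using contr_values(1-4)[of x] that by (simp add: contr_cyc_linear)
    show "x = 0" if "ep x = 0" unfolding vec_eq_iff all4
      using cyc_values(5-8)[of x] that by (simp add: contr_cyc_linear)
  qed
  then show "inj tr" "inj ep" by (simp_all add: linear_injective_0[OF linear_tr] linear_injective_0[OF linear_ep])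
qed

text \<open>By subtraction from the 24 dimensions of \<open>A3\<close>; the trace and the
  antisymmetric part take four each.\<close>

lemma dim_M16: "dim M16 = 16"
proof -
  have "dim (range tr) = dim (UNIV :: (real^4) set)" "dim (range ep) = dim (UNIV :: (real^4) set)"
    using dim_image_eq[OF linear_tr, of UNIV] dim_image_eq[OF linear_ep, of UNIV] inj_tr inj_ep by simp_all
  then show ?thesis using dim_is_direct_sum[OF A3_decomposition] by (simp add: dim_A3)
qed

lemma is_direct_sum2I:
  assumes "subspace A" "subspace B" "V = {a + b | a b. a \<in> A \<and> b \<in> B}"
    "\<And>a b. a \<in> A \<Longrightarrow> b \<in> B \<Longrightarrow> a + b = 0 \<Longrightarrow> a = 0 \<and> b = 0"
  shows "is_direct_sum V [A, B]"
proof -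
  have "sum_space [A, B] = {a + b | a b. a \<in> A \<and> b \<in> B}" by (simp add: sum_space_Cons)
  moreover have "indep_spaces [A, B]"
    unfolding indep_spaces_def using assms(4) by (auto simp: list_all2_Cons2)
  ultimately show ?thesis using assms by (simp add: is_direct_sum_alt)
qed

lemma is_direct_sum_subspace: "is_direct_sum V Us \<Longrightarrow> subspace V"
  using subspace_sum_space unfolding is_direct_sum_alt by blast

lemma is_direct_sum_member: "is_direct_sum V Us \<Longrightarrow> U \<in> set Us \<Longrightarrow> U \<subseteq> V"
proof -
  assume d: "is_direct_sum V Us" and "U \<in> set Us"
  then obtain As Bs where Us: "Us = As @ U # Bs" by (meson split_list)
  have s: "\<forall>W\<in>set Us. subspace W" "V = sum_space Us" using d by (auto simp: is_direct_sum_alt)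
  have "0 \<in> sum_space As" "0 \<in> sum_space Bs"
    using s(1) Us by (auto intro!: subspace_0 subspace_sum_space)
  then show "U \<subseteq> V" unfolding s(2) Us sum_space_append sum_space_Cons by force
qed

lemma irreducible_trivial_line:
  "irreducible_subrep G (\<lambda>L c. 0) (UNIV :: real set) UNIV"
  unfolding irreducible_subrep_def
proof (intro conjI allI impI)
  show "subrep G (\<lambda>L c. 0) UNIV (UNIV :: real set)" by (simp add: subrep_def)
  show "UNIV \<noteq> {0 :: real}" by (metis UNIV_I singletonD zero_neq_one)
  fix U :: "real set" assume "subrep G (\<lambda>L c. 0) UNIV U"
  then have U: "subspace U" by (simp add: subrep_def)
  show "U = {0} \<or> U = UNIV"
  proof (cases "U = {0}")
    case False
    then obtain u where u: "u \<in> U" "u \<noteq> 0" using subspace_0[OF U] by blast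
    have "x \<in> U" for x using subspace_scale[OF U u(1), of "x / u"] u(2) by simp
    then show ?thesis by blast
  qed simp
qed

section \<open>The eleven summands of the force tensors\<close>

context lorentz_frame
begin

definition T1 :: "real^4^4 \<Rightarrow> coll" where "T1 = LT R1"

definition T2 :: "real^4^4^4 \<Rightarrow> coll" where "T2 = LT R2"

definition C0 :: "real^4 \<Rightarrow> coll" where "C0 = LT (\<lambda>c. c *\<^sub>R mat 1)"

lemma linear_T: "linear T1" "linear T2" "linear C0"
proof -
  have "linear (\<lambda>c. c *\<^sub>R mat 1 :: extop)" by (rule linearI) (simp_all add: scaleR_add_left)
  then show "linear T1" "linear T2" "linear C0"
    unfolding T1_def T2_def C0_def by (intro linear_LT linear_R1 linear_R2; assumption)+
qed

lemma R2_biv: "R2 (biv (e1, e2, e3, b1, b2, b3)) = e1 *\<^sub>R rho2 0 1 + e2 *\<^sub>R rho2 0 2 + e3 *\<^sub>R rho2 0 3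
   + b1 *\<^sub>R rho2 2 3 + b2 *\<^sub>R rho2 3 1 + b3 *\<^sub>R rho2 1 2"
proof -
  have h: "(c / 2) *\<^sub>R x + (c / 2) *\<^sub>R x = c *\<^sub>R x" for c and x :: extop
    by (simp add: scaleR_add_left[symmetric])
  have "R2 (biv (e1, e2, e3, b1, b2, b3)) = ((e1/2) *\<^sub>R rho2 0 1 + (e1/2) *\<^sub>R rho2 0 1) + ((e2/2) *\<^sub>R rho2 0 2 + (e2/2) *\<^sub>R rho2 0 2)
    + ((e3/2) *\<^sub>R rho2 0 3 + (e3/2) *\<^sub>R rho2 0 3) + ((b1/2) *\<^sub>R rho2 2 3 + (b1/2) *\<^sub>R rho2 2 3)
    + ((b2/2) *\<^sub>R rho2 3 1 + (b2/2) *\<^sub>R rho2 3 1) + ((b3/2) *\<^sub>R rho2 1 2 + (b3/2) *\<^sub>R rho2 1 2)"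
    by (simp add: R2_def sum_UNIV4 biv_entries rho2_swap[of 1 0] rho2_swap[of 2 0] rho2_swap[of 3 0]
            rho2_swap[of 3 2] rho2_swap[of 1 3] rho2_swap[of 2 1])
  then show ?thesis by (simp only: h)
qed

lemma qq_R: "F \<in> M6 \<Longrightarrow> qq (s, x, tup F, y, t) = s *\<^sub>R II + R1 x + R2 F + II ** (JO ** R1 y) + t *\<^sub>R (II ** JO)"
proof -
  assume F: "F \<in> M6"
  have "R2 F = R2 (biv (tup F))" by (simp add: biv_tup F)
  then show ?thesis
    by (simp add: qq_def tup_def R2_biv) (simp add: R1_def matrix_mul_rsum mat_distrib)
qed

definition tot :: "real^4 \<Rightarrow> real^4^4 \<Rightarrow> real^4^4^4 \<Rightarrow> real^4^4 \<Rightarrow> real^4 \<Rightarrow> coll" where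
  "tot s X F Y t = op_coll II (C0 s) + T1 X + T2 F + op_coll II (op_coll JO (T1 Y)) + op_coll II (op_coll JO (C0 t))"

lemma tot_KK:
  assumes "F \<in> A3"
  shows "tot s X F Y t = KK (\<lambda>\<alpha>. eta $ \<alpha> $ \<alpha> *\<^sub>R qq (s $ \<alpha>, X $ \<alpha>, tup (F $ \<alpha>), Y $ \<alpha>, t $ \<alpha>))"
  unfolding tot_def T1_def T2_def C0_def op_coll_LT
  unfolding LT_def KK_linear(1)[symmetric] scaleR_add_right[symmetric]
  by (simp add: qq_R A3_entries[OF assms] mat_distrib)

lemma eta_diag: "eta $ a $ a * eta $ a $ a = 1" "eta $ a $ a \<noteq> 0"
  by (auto simp: eta_def)

lemma KK_force_tensors: "KK q \<in> force_tensors g \<longleftrightarrow> (\<forall>\<alpha>. q \<alpha> \<in> QQ)"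
proof -
  have s: "subspace QQ" unfolding QQ_def by (rule subspace_span)
  show ?thesis
    unfolding force_tensors_eq
  proof (intro iffI allI CollectI)
    fix \<alpha> assume "KK q \<in> {\<theta>. \<forall>a. \<theta> $ a \<in> QQ}"
    then have "(\<Sum>a\<in>UNIV. P $ a $ \<alpha> *\<^sub>R KK q $ a) \<in> QQ" by (intro subspace_sum[OF s] subspace_scale[OF s]) simp
    then show "q \<alpha> \<in> QQ" by (simp only: KK_inverse)
  next
    fix a assume "\<forall>\<alpha>. q \<alpha> \<in> QQ"
    then show "KK q $ a \<in> QQ" unfolding KK_def by (auto intro!: subspace_sum[OF s] subspace_scale[OF s])
  qed
qed

lemma tot_in: "F \<in> A3 \<Longrightarrow> tot s X F Y t \<in> force_tensors g"
proof -
  have "c *\<^sub>R qq d \<in> QQ" for c d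
    unfolding QQ_eq by (metis linear_qq linear_scale rangeI)
  then show "F \<in> A3 \<Longrightarrow> tot s X F Y t \<in> force_tensors g" by (simp add: tot_KK KK_force_tensors)
qed

lemma tot_surj:
  assumes "\<theta> \<in> force_tensors g"
  obtains s X F Y t where "F \<in> A3" "\<theta> = tot s X F Y t"
proof -
  obtain q where q: "\<theta> = KK q" by (rule that, rule KK_surj[symmetric])
  then have "\<forall>\<alpha>. \<exists>d. q \<alpha> = qq d" using assms KK_force_tensors unfolding QQ_eq by blast
  then obtain d where d: "\<And>\<alpha>. q \<alpha> = qq (d \<alpha>)" by metis
  \<comment> \<open>The sign by which \<open>LT\<close> lowers the index is its own inverse.\<close>
  define d' where "d' \<alpha> = eta $ \<alpha> $ \<alpha> *\<^sub>R d \<alpha>" for \<alpha>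
  have q': "q \<alpha> = eta $ \<alpha> $ \<alpha> *\<^sub>R qq (d' \<alpha>)" for \<alpha>
    by (simp add: d'_def linear_scale[OF linear_qq] d eta_diag)
  define F :: "real^4^4^4" where "F = (\<chi> \<alpha>. biv (fst (snd (snd (d' \<alpha>)))))"
  have F: "F \<in> A3" by (simp add: F_def A3_def biv_M6)
  show ?thesis
  proof (rule that[OF F])
    show "\<theta> = tot (\<chi> \<alpha>. fst (d' \<alpha>)) (\<chi> \<alpha>. fst (snd (d' \<alpha>))) F (\<chi> \<alpha>. fst (snd (snd (snd (d' \<alpha>))))) (\<chi> \<alpha>. snd (snd (snd (snd (d' \<alpha>)))))"
      unfolding tot_KK[OF F] q KK_inject by (simp add: fun_eq_iff q' F_def tup_biv)
  qed
qed

lemma tot_inj: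
  assumes "F \<in> A3" "tot s X F Y t = 0"
  shows "s = 0" "X = 0" "F = 0" "Y = 0" "t = 0"
proof -
  have k0: "KK (\<lambda>_. 0) = 0" by (simp add: KK_def vec_eq_iff[of _ "_ :: coll"])
  have "KK (\<lambda>\<alpha>. eta $ \<alpha> $ \<alpha> *\<^sub>R qq (s $ \<alpha>, X $ \<alpha>, tup (F $ \<alpha>), Y $ \<alpha>, t $ \<alpha>)) = KK (\<lambda>_. 0)"
    using assms(2) by (simp add: tot_KK[OF assms(1)] k0)
  then have "eta $ \<alpha> $ \<alpha> *\<^sub>R qq (s $ \<alpha>, X $ \<alpha>, tup (F $ \<alpha>), Y $ \<alpha>, t $ \<alpha>) = 0" for \<alpha>
    unfolding KK_inject fun_eq_iff by blast
  then have "qq (s $ \<alpha>, X $ \<alpha>, tup (F $ \<alpha>), Y $ \<alpha>, t $ \<alpha>) = qq 0" for \<alpha>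
    using eta_diag by (simp add: linear_0[OF linear_qq])
  then have z: "(s $ \<alpha>, X $ \<alpha>, tup (F $ \<alpha>), Y $ \<alpha>, t $ \<alpha>) = 0" for \<alpha> using injD[OF inj_qq] by blast
  show "s = 0" "X = 0" "Y = 0" "t = 0" using z by (simp_all add: vec_eq_iff[of _ "0 :: real^4"] vec_eq_iff[of _ "0 :: real^4^4"] zero_prod_def)
  have "F $ \<alpha> = 0" for \<alpha>
  proof -
    have "tup (F $ \<alpha>) = 0" using z[of \<alpha>] by (simp add: zero_prod_def)
    then have "biv (tup (F $ \<alpha>)) = 0" by (simp add: linear_0[OF linear_biv])
    then show ?thesis by (simp add: biv_tup A3_entries[OF assms(1)])
  qed
  then show "F = 0" by (simp add: vec_eq_iff[of _ "0 :: real^4^4^4"])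
qed

lemma op_inverse: "op_coll JO (op_coll JO x) = - x" "op_coll II (op_coll II x) = - x"
  by (simp_all add: op_coll_def vec_eq_iff[of _ "_ :: coll"] matrix_mul_assoc JO_JO II_II mat_distrib)

lemma inj_op: "inj (op_coll JO)" "inj (op_coll II)"
  by (rule injI, metis op_inverse minus_equation_iff)+

lemma T_zero: "T1 0 = 0" "T2 0 = 0" "C0 0 = 0" "op_coll M 0 = 0"
  using linear_0 linear_T op_coll_linear by blast+

text \<open>For \<open>eta\<close> this will be \<open>Vr\<close>, and \<open>Vc'\<close> below will
  be \<open>Vc\<close>, before multiplication by \<open>II\<close>.\<close>

definition Vr' :: "coll set" where "Vr' = {T1 X + T2 F | X F. F \<in> A3}"

definition Vc' :: "coll set" where "Vc' = {op_coll JO (T1 Y) + C0 s + op_coll JO (C0 t) | Y s t. True}"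

lemma Vr'_sum: "is_direct_sum Vr' [range T1, T2 ` A3]"
proof (rule is_direct_sum2I)
  show "subspace (range T1)" "subspace (T2 ` A3)"
    by (intro linear_subspace_image linear_T subspace_UNIV subspace_A3)+
  show "Vr' = {a + b |a b. a \<in> range T1 \<and> b \<in> T2 ` A3}" unfolding Vr'_def by blast
  fix a b assume "a \<in> range T1" "b \<in> T2 ` A3" and s: "a + b = 0"
  then obtain X F where ab: "a = T1 X" "b = T2 F" "F \<in> A3" by blast
  then have "tot 0 X F 0 0 = 0" using s by (simp add: tot_def T_zero)
  from tot_inj[OF ab(3) this] show "a = 0 \<and> b = 0" using ab by (simp add: T_zero)
qed

lemma Vc'_sum: "is_direct_sum Vc' [op_coll JO ` range T1, range C0, op_coll JO ` range C0]"
proof (rule is_direct_sum3I)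
  show "subspace (op_coll JO ` range T1)" "subspace (range C0)" "subspace (op_coll JO ` range C0)"
    by (intro linear_subspace_image linear_T subspace_UNIV op_coll_linear)+
  show "Vc' = {a + b + c |a b c. a \<in> op_coll JO ` range T1 \<and> b \<in> range C0 \<and> c \<in> op_coll JO ` range C0}"
    unfolding Vc'_def by blast
  fix a b c assume "a \<in> op_coll JO ` range T1" "b \<in> range C0" "c \<in> op_coll JO ` range C0" and s: "a + b + c = 0"
  then obtain Y p t where abc: "a = op_coll JO (T1 Y)" "b = C0 p" "c = op_coll JO (C0 t)" by blast
  have "tot p 0 0 Y t = op_coll II (a + b + c)"
    by (simp add: tot_def T_zero abc linear_add[OF op_coll_linear])
  then have "tot p 0 0 Y t = 0" using s by (simp add: T_zero)
  from tot_inj[OF subspace_0[OF subspace_A3] this] show "a = 0 \<and> b = 0 \<and> c = 0" using abc by (simp add: T_zero)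
qed

lemma V_sum: "is_direct_sum (force_tensors g) [Vr', op_coll II ` Vc']"
proof (rule is_direct_sum2I)
  show "subspace Vr'" "subspace (op_coll II ` Vc')"
    using is_direct_sum_subspace[OF Vr'_sum] is_direct_sum_subspace[OF Vc'_sum]
    by (auto intro: linear_subspace_image op_coll_linear)
  have e: "tot s X F Y t = (T1 X + T2 F) + op_coll II (op_coll JO (T1 Y) + C0 s + op_coll JO (C0 t))" for s X F Y t
    by (simp add: tot_def linear_add[OF op_coll_linear])
  show "force_tensors g = {a + b |a b. a \<in> Vr' \<and> b \<in> op_coll II ` Vc'}"
  proof (intro equalityI subsetI)
    fix \<theta> assume "\<theta> \<in> force_tensors g"
    then obtain s X F Y t where "F \<in> A3" "\<theta> = tot s X F Y t" by (rule tot_surj)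
    then show "\<theta> \<in> {a + b |a b. a \<in> Vr' \<and> b \<in> op_coll II ` Vc'}" unfolding e Vr'_def Vc'_def by blast
  next
    fix \<theta> assume "\<theta> \<in> {a + b |a b. a \<in> Vr' \<and> b \<in> op_coll II ` Vc'}"
    then obtain s X F Y t where "F \<in> A3" "\<theta> = tot s X F Y t" unfolding e Vr'_def Vc'_def by blast
    then show "\<theta> \<in> force_tensors g" using tot_in by blast
  qed
  fix a b assume ab: "a \<in> Vr'" "b \<in> op_coll II ` Vc'" and s: "a + b = 0"
  then obtain X F p Y t where h: "F \<in> A3" "a = T1 X + T2 F" "b = op_coll II (op_coll JO (T1 Y) + C0 p + op_coll JO (C0 t))"
    unfolding Vr'_def Vc'_def by blast
  then have "tot p X F Y t = 0" using s by (simp add: e)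
  from tot_inj[OF h(1) this] show "a = 0 \<and> b = 0" using h by (simp add: T_zero)
qed

lemma inj_T: "inj T1" "inj_on T2 A3" "inj C0"
proof -
  have "X = 0" if "T1 X = 0" for X
    using tot_inj(2)[OF subspace_0[OF subspace_A3], of 0 X 0 0] that by (simp add: tot_def T_zero)
  then show "inj T1" by (simp add: linear_injective_0[OF linear_T(1)])
  have "s = 0" if "C0 s = 0" for s
    using tot_inj(1)[OF subspace_0[OF subspace_A3], of s 0 0 0] that by (simp add: tot_def T_zero)
  then show "inj C0" by (simp add: linear_injective_0[OF linear_T(3)])
  show "inj_on T2 A3"
  proof (rule inj_onI)
    fix F G assume FG: "F \<in> A3" "G \<in> A3" "T2 F = T2 G"
    then have "tot 0 0 (F - G) 0 0 = 0" by (simp add: tot_def T_zero linear_diff[OF linear_T(2)])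
    then have "F - G = 0" using tot_inj(3)[OF subspace_diff[OF subspace_A3 FG(1,2)]] by blast
    then show "F = G" by simp
  qed
qed

lemma JO_R2_biv: "JO ** R2 (biv (e1, e2, e3, b1, b2, b3)) = R2 (biv (- b1, - b2, - b3, e1, e2, e3))"
  by (simp add: R2_biv mat_distrib JO_rho2)

text \<open>Because of this the totally antisymmetric part appears among the summands as the image
  of the trace part under \<open>JO\<close>.\<close>

lemma JO_T2_tr: "op_coll JO (T2 (tr x)) = T2 (ep x)"
proof -
  have "\<forall>\<alpha>. JO ** R2 (tr x $ \<alpha>) = R2 (ep x $ \<alpha>)"
    unfolding all4 tr_entries ep_entries JO_R2_biv by simp
  then show ?thesis by (simp add: T2_def op_coll_LT) (simp add: LT_def)
qed

lemma T1_sum: "is_direct_sum (range T1) [range (\<lambda>c. T1 (c *\<^sub>R eta)), T1 ` M6, T1 ` M9]"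
  using is_direct_sum_image[OF linear_T(1) inj_T(1) square_decomposition]
  by (simp add: image_image)

lemma T2_sum: "is_direct_sum (T2 ` A3) [range (\<lambda>x. T2 (tr x)), op_coll JO ` range (\<lambda>x. T2 (tr x)), T2 ` M16]"
  using is_direct_sum_image[OF linear_T(2) inj_T(2) A3_decomposition]
  by (simp add: image_image JO_T2_tr)

lemma Vr'_decomposition:
  "is_direct_sum Vr' [range (\<lambda>c. T1 (c *\<^sub>R eta)), range (\<lambda>x. T2 (tr x)), op_coll JO ` range (\<lambda>x. T2 (tr x)),
     T1 ` M6, T1 ` M9, T2 ` M16]"
proof -
  have "is_direct_sum Vr' [T2 ` A3, range (\<lambda>c. T1 (c *\<^sub>R eta)), T1 ` M6, T1 ` M9]"
    by (rule is_direct_sum_perm[OF is_direct_sum_refine[OF Vr'_sum T1_sum]]) simp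
  from is_direct_sum_refine[OF this T2_sum] show ?thesis
    by (rule is_direct_sum_perm) simp
qed

lemma Vc'_decomposition:
  "is_direct_sum Vc' [op_coll JO ` range (\<lambda>c. T1 (c *\<^sub>R eta)), range C0, op_coll JO ` range C0,
     op_coll JO ` T1 ` M6, op_coll JO ` T1 ` M9]"
proof -
  have "is_direct_sum (op_coll JO ` range T1) [op_coll JO ` range (\<lambda>c. T1 (c *\<^sub>R eta)), op_coll JO ` T1 ` M6, op_coll JO ` T1 ` M9]"
    using is_direct_sum_image[OF op_coll_linear _ T1_sum, of JO] inj_on_subset[OF inj_op(1)] by simp
  from is_direct_sum_refine[OF Vc'_sum this] show ?thesis
    by (rule is_direct_sum_perm) simp
qed

definition Ws :: "coll set list" where
  "Ws = [range (\<lambda>c. T1 (c *\<^sub>R eta)), op_coll II ` op_coll JO ` range (\<lambda>c. T1 (c *\<^sub>R eta)),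
     range (\<lambda>x. T2 (tr x)), op_coll JO ` range (\<lambda>x. T2 (tr x)), op_coll II ` range C0, op_coll II ` op_coll JO ` range C0,
     T1 ` M6, op_coll II ` op_coll JO ` T1 ` M6, T1 ` M9, op_coll II ` op_coll JO ` T1 ` M9, T2 ` M16]"

lemma Ws_sum: "is_direct_sum (force_tensors g) Ws"
proof -
  have "is_direct_sum (op_coll II ` Vc') (map ((`) (op_coll II)) [op_coll JO ` range (\<lambda>c. T1 (c *\<^sub>R eta)), range C0, op_coll JO ` range C0,
     op_coll JO ` T1 ` M6, op_coll JO ` T1 ` M9])"
    by (rule is_direct_sum_image[OF op_coll_linear inj_on_subset[OF inj_op(2)] Vc'_decomposition]) simp
  from is_direct_sum_append[OF V_sum Vr'_decomposition this] show ?thesis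
    by (rule is_direct_sum_perm) (simp add: Ws_def)
qed

lemma intertw_op:
  assumes "intertw a M \<tau>"
  shows "intertw a M (\<lambda>x. op_coll JO (\<tau> x))" "intertw a M (\<lambda>x. op_coll II (\<tau> x))"
proof -
  have \<tau>: "linear \<tau>" "inj_on \<tau> M" "subspace M"
    and eq: "\<And>L x. L \<in> so g \<Longrightarrow> x \<in> M \<Longrightarrow> a (kap L) x \<in> M \<and> force_act L (\<tau> x) = \<tau> (a (kap L) x)"
    using assms by (auto simp: intertw_def)
  have l: "linear (\<lambda>x. op_coll K (\<tau> x))" for K
    using linear_compose[OF \<tau>(1) op_coll_linear] by (simp add: o_def)
  have i: "inj_on (\<lambda>x. op_coll JO (\<tau> x)) M" "inj_on (\<lambda>x. op_coll II (\<tau> x)) M"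
    using comp_inj_on[OF \<tau>(2) inj_on_subset[OF inj_op(1) subset_UNIV]]
      comp_inj_on[OF \<tau>(2) inj_on_subset[OF inj_op(2) subset_UNIV]] by (simp_all add: o_def)
  show "intertw a M (\<lambda>x. op_coll JO (\<tau> x))"
    unfolding intertw_def using l i \<tau>(3) eq force_act_op_coll[OF hatm_JO] by simp
  show "intertw a M (\<lambda>x. op_coll II (\<tau> x))"
    unfolding intertw_def using l i \<tau>(3) eq force_act_op_coll[OF hatm_II] by simp
qed

lemma T1_equivariant: "L \<in> so g \<Longrightarrow> force_act L (T1 X) = T1 (act2 (kap L) X)"
proof -
  assume L: "L \<in> so g"
  have "(\<chi> a. kap L *v X $ a + (\<Sum>b\<in>UNIV. kap L $ a $ b *\<^sub>R X $ b)) = act2 (kap L) X"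
    by (simp add: vec_eq_iff act2_nth matrix_vector_mult_def mult.commute add.commute)
  then show ?thesis
    unfolding T1_def using LT_equivariant[OF L linear_R1, of X "\<lambda>x. kap L *v x"] hatm_R1[OF L] by simp
qed

lemma T2_equivariant: "L \<in> so g \<Longrightarrow> force_act L (T2 F) = T2 (act3 (kap L) F)"
proof -
  assume L: "L \<in> so g"
  have "(\<chi> a. act2 (kap L) (F $ a) + (\<Sum>b\<in>UNIV. kap L $ a $ b *\<^sub>R F $ b)) = act3 (kap L) F"
    by (simp add: act3_def add.commute)
  then show ?thesis
    unfolding T2_def using LT_equivariant[OF L linear_R2, of F "act2 (kap L)"] hatm_R2[OF L] by simp
qed

lemma C0_equivariant: "L \<in> so g \<Longrightarrow> force_act L (C0 x) = C0 (kap L *v x)"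
proof -
  assume L: "L \<in> so g"
  have "(\<chi> a. 0 + (\<Sum>b\<in>UNIV. kap L $ a $ b *\<^sub>R x $ b)) = kap L *v x"
    by (simp add: vec_eq_iff matrix_vector_mult_def)
  moreover have "linear (\<lambda>c. c *\<^sub>R mat 1 :: extop)" by (rule linearI) (simp_all add: scaleR_add_left)
  ultimately show ?thesis
    unfolding C0_def using LT_equivariant[OF L, of "\<lambda>c. c *\<^sub>R mat 1" x "\<lambda>_. 0"] by (simp add: commutator_def mat_distrib)
qed

lemma intertw_models:
  "intertw (\<lambda>L c. 0) UNIV (\<lambda>c. T1 (c *\<^sub>R eta))" "intertw (*v) UNIV (\<lambda>x. T2 (tr x))" "intertw (*v) UNIV C0"
  "intertw act2 M6 T1" "intertw act2 M9 T1" "intertw act3 M16 T2"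
proof -
  have eta0: "eta \<noteq> 0" using eta_all(1) by (metis zero_index zero_neq_one)
  have "linear (\<lambda>c. T1 (c *\<^sub>R eta))" using linear_compose[OF linear_eta linear_T(1)] by (simp add: o_def)
  moreover have "inj (\<lambda>c. T1 (c *\<^sub>R eta))" using eta0 by (auto simp: inj_def inj_eq[OF inj_T(1)])
  ultimately show "intertw (\<lambda>L c. 0) UNIV (\<lambda>c. T1 (c *\<^sub>R eta))"
    unfolding intertw_def by (simp add: T1_equivariant act2_eta kap_so T_zero)
  have "linear (\<lambda>x. T2 (tr x))" using linear_compose[OF linear_tr linear_T(2)] by (simp add: o_def)
  moreover have "inj (\<lambda>x. T2 (tr x))"
    using inj_onD[OF inj_T(2) _ tr_A3 tr_A3] injD[OF inj_tr] by (intro injI) blast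
  ultimately show "intertw (*v) UNIV (\<lambda>x. T2 (tr x))"
    unfolding intertw_def by (simp add: T2_equivariant act3_tr kap_so)
  show "intertw (*v) UNIV C0"
    unfolding intertw_def by (simp add: C0_equivariant linear_T inj_T)
  show "intertw act2 M6 T1" "intertw act2 M9 T1"
    unfolding intertw_def using linear_T(1) inj_on_subset[OF inj_T(1)] subspace_M6 subspace_M9 act2_M6 act2_M9 kap_so
    by (auto simp: T1_equivariant)
  have "M16 \<subseteq> A3" by (auto simp: M16_alt)
  then show "intertw act3 M16 T2"
    unfolding intertw_def using linear_T(2) inj_on_subset[OF inj_T(2)] subspace_M16 act3_M16 kap_so
    by (auto simp: T2_equivariant)
qed

text \<open>The models live in different types, hence a disjunction instead of one quantified
  model.\<close>

definition modelled :: "coll set \<Rightarrow> bool" where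
  "modelled W \<longleftrightarrow> (\<exists>\<tau>. intertw (\<lambda>L c. 0) (UNIV :: real set) \<tau> \<and> W = range \<tau>) \<or>
    (\<exists>\<tau>. intertw (*v) (UNIV :: (real^4) set) \<tau> \<and> W = range \<tau>) \<or>
    (\<exists>\<tau>. intertw act2 M6 \<tau> \<and> W = \<tau> ` M6) \<or> (\<exists>\<tau>. intertw act2 M9 \<tau> \<and> W = \<tau> ` M9) \<or>
    (\<exists>\<tau>. intertw act3 M16 \<tau> \<and> W = \<tau> ` M16)"

lemma modelledI:
  "intertw (\<lambda>L c. 0) (UNIV :: real set) \<tau>1 \<Longrightarrow> modelled (range \<tau>1)" "intertw (*v) (UNIV :: (real^4) set) \<tau>4 \<Longrightarrow> modelled (range \<tau>4)"
  "intertw act2 M6 \<tau>6 \<Longrightarrow> modelled (\<tau>6 ` M6)" "intertw act2 M9 \<tau>6 \<Longrightarrow> modelled (\<tau>6 ` M9)"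
  "intertw act3 M16 \<tau>16 \<Longrightarrow> modelled (\<tau>16 ` M16)"
  unfolding modelled_def
  by (rule disjI1, rule exI, erule conjI, rule refl,
      rule disjI2, rule disjI1, rule exI, erule conjI, rule refl,
      rule disjI2, rule disjI2, rule disjI1, rule exI, erule conjI, rule refl,
      rule disjI2, rule disjI2, rule disjI2, rule disjI1, rule exI, erule conjI, rule refl,
      rule disjI2, rule disjI2, rule disjI2, rule disjI2, rule exI, erule conjI, rule refl)

lemmas intertw_iJ_models = intertw_models[THEN intertw_op(1), THEN intertw_op(2)]

lemma Ws_models: "W \<in> set Ws \<Longrightarrow> modelled W"
proof -
  note modelledI(1)[OF intertw_models(1)] modelledI(1)[OF intertw_iJ_models(1)] modelledI(2)[OF intertw_models(2)]
    modelledI(2)[OF intertw_op(1)[OF intertw_models(2)]] modelledI(2)[OF intertw_op(2)[OF intertw_models(3)]]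
    modelledI(2)[OF intertw_iJ_models(3)] modelledI(3)[OF intertw_models(4)] modelledI(3)[OF intertw_iJ_models(4)]
    modelledI(4)[OF intertw_models(5)] modelledI(4)[OF intertw_iJ_models(5)] modelledI(5)[OF intertw_models(6)]
  then show "W \<in> set Ws \<Longrightarrow> modelled W" unfolding Ws_def image_image by auto
qed

lemma modelledE:
  assumes "modelled W"
  obtains (1) \<tau> where "intertw (\<lambda>L c. 0) (UNIV :: real set) \<tau>" "W = range \<tau>"
    | (4) \<tau> where "intertw (*v) (UNIV :: (real^4) set) \<tau>" "W = range \<tau>"
    | (6) \<tau> where "intertw act2 M6 \<tau>" "W = \<tau> ` M6"
    | (9) \<tau> where "intertw act2 M9 \<tau>" "W = \<tau> ` M9"
    | (16) \<tau> where "intertw act3 M16 \<tau>" "W = \<tau> ` M16"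
proof -
  from assms[unfolded modelled_def] show thesis
    by (elim disjE exE conjE) (rule that, assumption, assumption)+
qed

lemma intertw_model_dims:
  "intertw a (UNIV :: real set) \<tau>1 \<Longrightarrow> dim (range \<tau>1) = 1" "intertw a4 (UNIV :: (real^4) set) \<tau>4 \<Longrightarrow> dim (range \<tau>4) = 4"
  "intertw a6 M6 \<tau>6 \<Longrightarrow> dim (\<tau>6 ` M6) = 6" "intertw a6 M9 \<tau>6 \<Longrightarrow> dim (\<tau>6 ` M9) = 9"
  "intertw a16 M16 \<tau>16 \<Longrightarrow> dim (\<tau>16 ` M16) = 16"
  by (drule intertw_dim, simp add: dim_M6 dim_M9 dim_M16)+

lemma Ws_dims: "map dim Ws = [1, 1, 4, 4, 4, 4, 6, 6, 9, 9, 16]"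
  unfolding Ws_def image_image list.map
  using intertw_model_dims(1)[OF intertw_models(1)] intertw_model_dims(1)[OF intertw_iJ_models(1)] intertw_model_dims(2)[OF intertw_models(2)]
    intertw_model_dims(2)[OF intertw_op(1)[OF intertw_models(2)]] intertw_model_dims(2)[OF intertw_op(2)[OF intertw_models(3)]]
    intertw_model_dims(2)[OF intertw_iJ_models(3)] intertw_model_dims(3)[OF intertw_models(4)] intertw_model_dims(3)[OF intertw_iJ_models(4)]
    intertw_model_dims(4)[OF intertw_models(5)] intertw_model_dims(4)[OF intertw_iJ_models(5)] intertw_model_dims(5)[OF intertw_models(6)]
  by simp

lemma Ws_irreducible:
  assumes "W \<in> set Ws"
  shows "irreducible_subrep (so g) force_act (force_tensors g) W"
proof -
  have "W \<subseteq> force_tensors g" using is_direct_sum_member[OF Ws_sum assms] .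
  note V = this
  from Ws_models[OF assms] show ?thesis
  proof (cases rule: modelledE)
    case (1 \<tau>) then show ?thesis using intertw_irreducible[OF 1(1) irreducible_trivial_line] V by simp
  next
    case (4 \<tau>) then show ?thesis using intertw_irreducible[OF 4(1) spin_type_4(2)] V by simp
  next
    case (6 \<tau>) then show ?thesis using intertw_irreducible[OF 6(1) spin_type_6(2)] V by simp
  next
    case (9 \<tau>) then show ?thesis using intertw_irreducible[OF 9(1) spin_type_9(2)] V by simp
  next
    case (16 \<tau>) then show ?thesis using intertw_irreducible[OF 16(1) spin_type_16(2)] V by simp
  qed
qed

text \<open>The five models have different dimensions, so summands of equal dimension share a model
  and \<open>intertw_iso\<close> applies.\<close>

lemma Ws_iso:
  assumes "W \<in> set Ws" "W' \<in> set Ws" "dim W = dim W'"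
  shows "rep_iso (so g) force_act W W'"
  using Ws_models[OF assms(1)]
proof (cases rule: modelledE)
  case W: (1 \<tau>)
  from Ws_models[OF assms(2)] show ?thesis
    by (cases rule: modelledE) (use assms(3) W intertw_iso[OF W(1)] in \<open>simp_all add: intertw_model_dims\<close>)
next
  case W: (4 \<tau>)
  from Ws_models[OF assms(2)] show ?thesis
    by (cases rule: modelledE) (use assms(3) W intertw_iso[OF W(1)] in \<open>simp_all add: intertw_model_dims\<close>)
next
  case W: (6 \<tau>)
  from Ws_models[OF assms(2)] show ?thesis
    by (cases rule: modelledE) (use assms(3) W intertw_iso[OF W(1)] in \<open>simp_all add: intertw_model_dims\<close>)
next
  case W: (9 \<tau>)
  from Ws_models[OF assms(2)] show ?thesis
    by (cases rule: modelledE) (use assms(3) W intertw_iso[OF W(1)] in \<open>simp_all add: intertw_model_dims\<close>)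
next
  case W: (16 \<tau>)
  from Ws_models[OF assms(2)] show ?thesis
    by (cases rule: modelledE) (use assms(3) W intertw_iso[OF W(1)] in \<open>simp_all add: intertw_model_dims\<close>)
qed

lemma Ws_htype:
  assumes "W \<in> set Ws"
  shows "dim W = 4 \<Longrightarrow> htype g P force_act W [(1/2, 1/2)]" "dim W = 6 \<Longrightarrow> htype g P force_act W [(1, 0), (0, 1)]"
    "dim W = 9 \<Longrightarrow> htype g P force_act W [(1, 1)]" "dim W = 16 \<Longrightarrow> htype g P force_act W [(3/2, 1/2), (1/2, 3/2)]"
proof -
  from Ws_models[OF assms] have "(dim W = 4 \<longrightarrow> htype g P force_act W [(1/2, 1/2)]) \<and> (dim W = 6 \<longrightarrow> htype g P force_act W [(1, 0), (0, 1)])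
    \<and> (dim W = 9 \<longrightarrow> htype g P force_act W [(1, 1)]) \<and> (dim W = 16 \<longrightarrow> htype g P force_act W [(3/2, 1/2), (1/2, 3/2)])"
  proof (cases rule: modelledE)
    case (1 \<tau>) then show ?thesis by (simp add: intertw_model_dims)
  next
    case (4 \<tau>) then show ?thesis using intertw_htype[OF 4(1) spin_type_4(1)] by (simp add: intertw_model_dims)
  next
    case (6 \<tau>) then show ?thesis using intertw_htype[OF 6(1) spin_type_6(1)] by (simp add: intertw_model_dims)
  next
    case (9 \<tau>) then show ?thesis using intertw_htype[OF 9(1) spin_type_9(1)] by (simp add: intertw_model_dims)
  next
    case (16 \<tau>) then show ?thesis using intertw_htype[OF 16(1) spin_type_16(1)] by (simp add: intertw_model_dims)
  qed
  then show "dim W = 4 \<Longrightarrow> htype g P force_act W [(1/2, 1/2)]" "dim W = 6 \<Longrightarrow> htype g P force_act W [(1, 0), (0, 1)]"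
    "dim W = 9 \<Longrightarrow> htype g P force_act W [(1, 1)]" "dim W = 16 \<Longrightarrow> htype g P force_act W [(3/2, 1/2), (1/2, 3/2)]" by simp_all
qed

lemma lie_rep_force: "lie_rep (so g) force_act (force_tensors g)"
proof -
  have "subspace (force_tensors g)" using is_direct_sum_subspace[OF V_sum] .
  moreover have "force_act L v \<in> force_tensors g" if L: "L \<in> so g" and v: "v \<in> force_tensors g" for L v
  proof -
    obtain s X F Y t where F: "F \<in> A3" "v = tot s X F Y t" using tot_surj[OF v] .
    have "force_act L v = tot (kap L *v s) (act2 (kap L) X) (act3 (kap L) F) (act2 (kap L) Y) (kap L *v t)"
      unfolding F(2) tot_def force_act_linear(1) force_act_op_coll[OF hatm_II] force_act_op_coll[OF hatm_JO[OF L]]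
      by (simp add: C0_equivariant T1_equivariant T2_equivariant L)
    then show ?thesis using tot_in[OF act3_A3[OF F(1)]] by simp
  qed
  ultimately show ?thesis unfolding lie_rep_def by (simp add: force_act_linear force_act_bracket)
qed

end

text \<open>The type of a summand with respect to another orthonormal frame is found by Schur's lemma, from the
  decomposition that this frame defines.\<close>

lemma force_tensors_decomposition:
  assumes "lorentzian g"
  shows "lie_rep (so g) force_act (force_tensors g) \<and>
      (\<exists>Ws. is_direct_sum (force_tensors g) Ws \<and>
        map dim Ws = [1, 1, 4, 4, 4, 4, 6, 6, 9, 9, 16] \<and>
        (\<forall>W\<in>set Ws. irreducible_subrep (so g) force_act (force_tensors g) W) \<and>
        (\<forall>W\<in>set Ws. \<forall>W'\<in>set Ws. dim W = dim W' \<longrightarrow> rep_iso (so g) force_act W W') \<and>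
        (\<forall>W\<in>set Ws.
          (dim W = 4 \<longrightarrow> has_type g force_act W [(1/2, 1/2)]) \<and>
          (dim W = 6 \<longrightarrow> has_type g force_act W [(1, 0), (0, 1)]) \<and>
          (dim W = 9 \<longrightarrow> has_type g force_act W [(1, 1)]) \<and>
          (dim W = 16 \<longrightarrow> has_type g force_act W [(3/2, 1/2), (1/2, 3/2)]) \<and>
          (dim W \<in> {6, 16} \<longrightarrow> cpx_reducible (so g) force_act W)))"
proof -
  obtain P where P: "transpose g = g" "orthonormal_frame g P" using assms by (auto simp: lorentzian_def)
  interpret f: lorentz_frame g P by unfold_locales (rule P)+
  have types: "(dim W = 4 \<longrightarrow> htype g Q force_act W [(1/2, 1/2)]) \<and> (dim W = 6 \<longrightarrow> htype g Q force_act W [(1, 0), (0, 1)]) \<and>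
     (dim W = 9 \<longrightarrow> htype g Q force_act W [(1, 1)]) \<and> (dim W = 16 \<longrightarrow> htype g Q force_act W [(3/2, 1/2), (1/2, 3/2)])"
    if W: "W \<in> set f.Ws" and Q: "orthonormal_frame g Q" for W Q
  proof -
    interpret h: lorentz_frame g Q by unfold_locales (rule P Q)+
    note irr = f.Ws_irreducible[OF W]
    have W0: "subspace W" using irr by (auto simp: irreducible_subrep_def subrep_def)
    obtain U where U: "U \<in> set h.Ws" "rep_iso (so g) force_act W U"
      by (rule schur_direct_sum[OF h.Ws_sum h.Ws_irreducible force_act_linear(1) irr])
    have "dim W = dim U" using rep_iso_dim[OF U(2) W0] .
    then show ?thesis using rep_iso_htype[OF U(2) _ W0] h.Ws_htype[OF U(1)] by simp
  qed
  have red: "cpx_reducible (so g) force_act W" if W: "W \<in> set f.Ws" "dim W \<in> {6, 16}" for W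
  proof -
    have s: "subspace W" "\<And>L u. L \<in> so g \<Longrightarrow> u \<in> W \<Longrightarrow> force_act L u \<in> W"
      using f.Ws_irreducible[OF W(1)] by (auto simp: irreducible_subrep_def subrep_def)
    show ?thesis using W(2) f.Ws_htype[OF W(1)] htype_cpx_reducible[OF _ _ s] by auto
  qed
  show ?thesis
    unfolding has_type_htype
    by (intro conjI exI[of _ f.Ws] f.lie_rep_force f.Ws_sum f.Ws_dims ballI impI allI)
       (simp_all add: f.Ws_irreducible f.Ws_iso types red)
qed

section \<open>The summands for the Minkowski metric\<close>

interpretation mink: lorentz_frame eta "mat 1"
proof
  show "transpose eta = eta" by (simp add: transpose_def eta_def vec_eq_iff)
  show "orthonormal_frame eta (mat 1)"
    unfolding orthonormal_frame_def by (simp add: transpose_mat invertible_def)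
qed

lemma mink_Pi: "mink.Pi = mat 1"
  using mink.P_inv(1) by simp

lemma sum_mat_one': "(\<Sum>c\<in>UNIV. (mat 1 :: real^'n^'n) $ c $ b *\<^sub>R f c) = (f b :: 'v::real_vector)"
  unfolding sum_mat_one[of b f, symmetric] by (intro sum.cong refl) (simp add: mat_def eq_commute)

definition single :: "4 \<Rightarrow> extop \<Rightarrow> coll" where
  "single b M = (\<chi> a. if a = b then M else 0)"

lemma Theta_coll_single: "Theta_coll b I = single b (Theta I)"
  by (simp add: Theta_coll_def single_def)

lemma single_linear: "single b (M + N) = single b M + single b N" "single b (c *\<^sub>R M) = c *\<^sub>R single b M"
  "single b (sum f S) = (\<Sum>i\<in>S. single b (f i))" "single b (- M) = - single b M" "single b 0 = 0"
  by (auto simp: single_def vec_eq_iff[of _ "_ :: coll"] intro!: sum.neutral)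

lemma mink_KK: "mink.KK q = (\<Sum>b\<in>UNIV. single b (q b))"
proof -
  have "mink.KK q $ a = q a" for a
    by (simp add: mink.KK_def mink_Pi sum_mat_one')
  moreover have "(\<Sum>b\<in>UNIV. single b (q b)) $ a = q a" for a
    by (simp add: single_def)
  ultimately show ?thesis by (simp add: vec_eq_iff[of _ "_ :: coll"])
qed

lemma mink_rho: "mink.rho a = mink.rr a"
  by (simp add: mink.rho_def sum_mat_one')

subsection \<open>The operators Theta\<close>

text \<open>The definite description is justified by \<open>commutant_eq_0\<close>: two candidates
  differ by an element of the commutant that kills 1.\<close>

lemma Theta_eqI:
  assumes "M \<in> mink.AA" "M *v ext_one = eI I"
  shows "Theta I = M"
  unfolding Theta_def
proof (rule the_equality)
  show "(\<forall>a. commutator M (gamma_lower eta a) = 0) \<and> M *v ext_one = eI I"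
    using assms mink.AA_commutes[OF assms(1)] by (simp add: commutator_def)
  fix N assume N: "(\<forall>a. commutator N (gamma_lower eta a) = 0) \<and> N *v ext_one = eI I"
  have "N - M = 0"
    by (rule mink.commutant_eq_0)
       (use N assms mink.AA_commutes[OF assms(1)] in \<open>simp_all add: commutator_def mat_distrib matvec_distrib\<close>)
  then show "N = M" by simp
qed

lemma cre_eI_zero: "a \<in> set I \<Longrightarrow> cre a *v eI I = 0"
proof (induction I)
  case (Cons b I)
  show ?case
  proof (cases "a = b")
    case True
    have "cre a ** cre a = 0"
      using cre_cre[of a a] by (simp add: vec_eq_iff)
    then show ?thesis using True by (simp add: matrix_vector_mul_assoc)
  next
    case False
    then have "cre a *v eI I = 0" using Cons by simp
    moreover have "cre a *v eI (b # I) = - (cre b *v (cre a *v eI I))"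
      unfolding eI_Cons matrix_vector_mul_assoc by (subst cre_cre) (simp add: matvec_distrib)
    ultimately show ?thesis by simp
  qed
qed simp

lemma eI_not_distinct: "\<not> distinct I \<Longrightarrow> eI I = 0"
  by (induction I) (auto simp: cre_eI_zero)

lemma cre_eI_snoc: "cre b *v eI I = (-1) ^ length I *\<^sub>R eI (I @ [b])"
proof (induction I)
  case (Cons a I)
  have "cre b *v eI (a # I) = - (cre a *v (cre b *v eI I))"
    unfolding eI_Cons matrix_vector_mul_assoc by (subst cre_cre) (simp add: matvec_distrib)
  then show ?case by (simp add: Cons matvec_distrib)
qed simp

lemma iota_eI_zero: "b \<notin> set I \<Longrightarrow> iota eta b *v eI I = 0"
proof (induction I)
  case (Cons a I)
  have "iota eta b *v eI (a # I) = (eta $ b $ a) *\<^sub>R eI I - cre a *v (iota eta b *v eI I)"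
    by (simp add: matrix_vector_mul_assoc iota_cre matvec_distrib)
  then show ?case using Cons by (simp add: eta_def)
qed (simp add: iota_one)

text \<open>As \<open>eta\<close> is diagonal, contraction with a new index gives zero. The parity
  sign cancels the sign of moving e_b behind all factors, so \<open>rho\<close> appends without any
  sign.\<close>

lemma rho_eI: "b \<notin> set I \<Longrightarrow> mink.rho b *v eI I = eI (I @ [b])"
  by (simp add: mink_rho mink.rr_def matrix_vector_mul_assoc[symmetric] parity_eI matvec_distrib iota_eI_zero
      cre_eI_snoc power_mult_distrib[symmetric] scaleR_add_right)

lemma AA_rho_left: "M \<in> mink.AA \<Longrightarrow> mink.rho b ** M \<in> mink.AA"
  by (simp add: mink.commutant[symmetric] mink.gamma_rho_left matrix_mul_assoc[symmetric])

lemma Theta_Nil: "Theta [] = mat 1"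
  by (rule Theta_eqI) (simp_all add: mink.AA_members)

lemma Theta_not_distinct: "\<not> distinct I \<Longrightarrow> Theta I = 0"
  by (rule Theta_eqI) (simp_all add: eI_not_distinct subspace_0[OF mink.subspace_AA])

text \<open>\<open>foldl\<close> multiplies on the left, so the factor of the last index acts last
  and appends it at the end.\<close>

lemma Theta_distinct: "distinct I \<Longrightarrow> Theta I = foldl (\<lambda>M b. mink.rho b ** M) (mat 1) I"
proof -
  assume "distinct I"
  then have "foldl (\<lambda>M b. mink.rho b ** M) (mat 1) I \<in> mink.AA \<and> foldl (\<lambda>M b. mink.rho b ** M) (mat 1) I *v ext_one = eI I"
  proof (induction I rule: rev_induct)
    case Nil
    then show ?case by (simp add: mink.AA_members)
  next
    case (snoc b I)
    then show ?case by (simp add: AA_rho_left matrix_vector_mul_assoc[symmetric] rho_eI)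
  qed
  then show ?thesis using Theta_eqI by blast
qed

lemma Theta_1: "Theta [a] = mink.rho a"
  by (simp add: Theta_distinct)

lemma Theta_2: "Theta [a, b] = mink.rho2 a b"
  by (cases "a = b") (simp_all add: Theta_not_distinct Theta_distinct mink.rho2_same mink.rho2_distinct)

lemma Theta_3: "distinct [a, b, c] \<Longrightarrow> Theta [a, b, c] = mink.rho c ** (mink.rho b ** mink.rho a)"
  by (simp add: Theta_distinct)

lemma Theta_4: "distinct [a, b, c, d] \<Longrightarrow> Theta [a, b, c, d] = mink.rho d ** (mink.rho c ** (mink.rho b ** mink.rho a))"
  by (simp add: Theta_distinct)

lemma Theta_0123: "Theta [0, 1, 2, 3] = mink.JO"
  by (subst Theta_4) (simp_all add: mink.JO_def)

lemma JJ_op_coll: "JJ = op_coll mink.JO"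
  by (simp add: JJ_def Theta_0123)

lemma op_coll_single: "op_coll M (single b N) = single b (M ** N)"
  by (simp add: op_coll_def single_def vec_eq_iff[of _ "_ :: coll"])

lemma T1_single: "mink.T1 X = (\<Sum>a\<in>UNIV. \<Sum>b\<in>UNIV. (X $ a $ b * eta $ a $ a) *\<^sub>R single a (mink.rho b))"
  by (simp add: mink.T1_def mink.LT_def mink_KK mink.R1_def single_linear scaleR_sum_right mult.commute)

lemma T2_single: "mink.T2 F = (\<Sum>a\<in>UNIV. \<Sum>r\<in>UNIV. \<Sum>s\<in>UNIV. (F $ a $ r $ s * eta $ a $ a) *\<^sub>R single a (mink.rho2 r s))"
  by (simp add: mink.T2_def mink.LT_def mink_KK mink.R2_def single_linear scaleR_sum_right mult.commute)

lemma C0_single: "mink.C0 x = (\<Sum>a\<in>UNIV. (x $ a * eta $ a $ a) *\<^sub>R single a (mat 1))"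
  by (simp add: mink.C0_def mink.LT_def mink_KK single_linear mult.commute)

lemma sum_eta: "(\<Sum>b\<in>UNIV. (c * eta $ a $ b) *\<^sub>R f b) = (c * eta $ a $ a) *\<^sub>R (f a :: 'v::real_vector)"
proof -
  have "(\<Sum>b\<in>UNIV. (c * eta $ a $ b) *\<^sub>R f b) = (\<Sum>b\<in>UNIV. if b = a then (c * eta $ a $ a) *\<^sub>R f a else 0)"
    by (intro sum.cong) (auto simp: eta_def)
  then show ?thesis by simp
qed

subsection \<open>Identification of the summands\<close>

lemma span_range4:
  fixes f :: "4 \<Rightarrow> 'v::real_vector"
  shows "span (range f) = range (\<lambda>x :: real^4. \<Sum>s\<in>UNIV. x $ s *\<^sub>R f s)"
proof
  let ?h = "\<lambda>x :: real^4. \<Sum>s\<in>UNIV. x $ s *\<^sub>R f s"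
  have l: "linear ?h" by (rule linearI) (simp_all add: scaleR_add_left sum.distrib scaleR_sum_right)
  have "f a \<in> range ?h" for a
  proof -
    have "?h (axis a 1) = (\<Sum>s\<in>UNIV. if s = a then f a else 0)"
      by (intro sum.cong) (auto simp: axis_def)
    then have "f a = ?h (axis a 1)" by simp
    then show ?thesis by blast
  qed
  then show "span (range f) \<subseteq> range ?h"
    by (intro span_minimal linear_subspace_image[OF l] subspace_UNIV) blast
  show "range ?h \<subseteq> span (range f)" by (auto intro!: span_sum span_scale intro: span_base)
qed

lemma basis_family_linear:
  assumes "linear \<tau>" "inj \<tau>" "\<And>a. b a = \<tau> (axis a (1::real))"
  shows "basis_family b (range \<tau>)"
proof -
  have B: "(Basis :: (real^'n) set) = range (\<lambda>a. axis a 1)" by (auto simp: Basis_vec_def)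
  have r: "range b = \<tau> ` Basis" using assms(3) by (auto simp: B)
  have "inj b" using assms by (auto intro!: injI dest!: injD[OF assms(2)] simp: axis_eq_axis)
  moreover have "independent (range b)"
    unfolding r using linear_independent_injective_image[OF assms(1) independent_Basis] assms(2) by (simp add: inj_on_def inj_def)
  moreover have "span (range b) = range \<tau>" unfolding r linear_span_image[OF assms(1)] span_Basis ..
  ultimately show ?thesis by (simp add: basis_family_def)
qed

lemma E1_eq: "E1 = range (\<lambda>c. mink.T1 (c *\<^sub>R eta))"
proof -
  have "mink.T1 (c *\<^sub>R eta) = c *\<^sub>R u_vec" for c
  proof -
    have "mink.T1 (c *\<^sub>R eta) = (\<Sum>a\<in>UNIV. \<Sum>b\<in>UNIV. ((c * eta $ a $ a) * eta $ a $ b) *\<^sub>R single a (mink.rho b))"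
      by (simp add: T1_single mult_ac)
    also have "\<dots> = c *\<^sub>R u_vec"
      unfolding sum_eta by (simp add: mult.assoc mink.eta_diag u_vec_def Theta_coll_single Theta_1 scaleR_sum_right)
    finally show ?thesis .
  qed
  then show ?thesis unfolding E1_def span_singleton by simp
qed

text \<open>The sign from lowering the first index cancels against \<open>eta\<close> in
  \<open>tr\<close>, and the two halves of \<open>tr\<close> agree by antisymmetry of
  \<open>rho2\<close>.\<close>

lemma T2_tr_v: "mink.T2 (tr x) = (\<Sum>s\<in>UNIV. x $ s *\<^sub>R v_vec s)"
proof -
  have "\<forall>\<alpha>. eta $ \<alpha> $ \<alpha> *\<^sub>R mink.R2 (tr x $ \<alpha>) = (\<Sum>s\<in>UNIV. x $ s *\<^sub>R mink.rho2 \<alpha> s)"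
    unfolding all4 tr_entries mink.R2_biv
    by (simp add: eta_all sum_UNIV4 mink.rho2_same mink.rho2_swap[of 1 0] mink.rho2_swap[of 2 0] mink.rho2_swap[of 3 0]
            mink.rho2_swap[of 3 2] mink.rho2_swap[of 1 3] mink.rho2_swap[of 2 1])
  then have "mink.T2 (tr x) = (\<Sum>\<alpha>\<in>UNIV. \<Sum>s\<in>UNIV. x $ s *\<^sub>R single \<alpha> (mink.rho2 \<alpha> s))"
    by (simp add: mink.T2_def mink.LT_def mink_KK single_linear)
  also have "\<dots> = (\<Sum>s\<in>UNIV. x $ s *\<^sub>R v_vec s)"
    by (subst sum.swap) (simp add: v_vec_def Theta_coll_single Theta_2 scaleR_sum_right)
  finally show ?thesis .
qed

lemma E4_eq: "E4 = range (\<lambda>x. mink.T2 (tr x))"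
  unfolding E4_def span_range4 T2_tr_v ..

lemma C0_axis: "mink.C0 x = (\<Sum>s\<in>UNIV. x $ s *\<^sub>R (\<Sum>b\<in>UNIV. eta $ s $ b *\<^sub>R Theta_coll b []))"
proof -
  have "(\<Sum>b\<in>UNIV. eta $ s $ b *\<^sub>R Theta_coll b []) = eta $ s $ s *\<^sub>R single s (mat 1)" for s
    using sum_eta[of 1 s] by (simp add: Theta_coll_single Theta_Nil)
  then show ?thesis by (simp add: C0_single)
qed

lemma E4''_eq: "E4'' = range mink.C0"
  unfolding E4''_def span_range4 C0_axis[symmetric] ..

lemma sum_axis: "(\<Sum>s\<in>UNIV. axis a (1::real) $ s *\<^sub>R f s) = (f a :: 'v::real_vector)"
proof -
  have "(\<Sum>s\<in>UNIV. axis a (1::real) $ s *\<^sub>R f s) = (\<Sum>s\<in>UNIV. if s = a then f a else 0)"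
    by (intro sum.cong) (auto simp: axis_def)
  then show ?thesis by simp
qed

lemma v_basis: "basis_family v_vec E4"
  unfolding E4_eq
  by (rule basis_family_linear) (use mink.intertw_models(2) in \<open>auto simp: mink.intertw_def T2_tr_v sum_axis\<close>)

lemma w_basis: "basis_family w_vec (imul ` E4'')"
proof -
  have "basis_family w_vec (range (\<lambda>x. op_coll II (mink.C0 x)))"
  proof (rule basis_family_linear)
    have i: "mink.intertw (*v) UNIV (\<lambda>x. op_coll II (mink.C0 x))" by (rule mink.intertw_op(2)[OF mink.intertw_models(3)])
    then show "linear (\<lambda>x. op_coll II (mink.C0 x))" "inj (\<lambda>x. op_coll II (mink.C0 x))" by (auto simp: mink.intertw_def)
    show "w_vec a = op_coll II (mink.C0 (axis a 1))" for a
      unfolding C0_axis sum_axis by (simp add: w_vec_def imul_op_coll)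
  qed
  then show ?thesis by (simp add: E4''_eq imul_op_coll image_image)
qed

lemma T1_biv: "mink.T1 (biv (e1, e2, e3, b1, b2, b3)) = (1/2) *\<^sub>R
   (e1 *\<^sub>R (single 0 (mink.rho 1) + single 1 (mink.rho 0)) + e2 *\<^sub>R (single 0 (mink.rho 2) + single 2 (mink.rho 0))
  + e3 *\<^sub>R (single 0 (mink.rho 3) + single 3 (mink.rho 0)) + b1 *\<^sub>R (single 3 (mink.rho 2) - single 2 (mink.rho 3))
  + b2 *\<^sub>R (single 1 (mink.rho 3) - single 3 (mink.rho 1)) + b3 *\<^sub>R (single 2 (mink.rho 1) - single 1 (mink.rho 2)))"
  by (simp add: T1_single sum_UNIV4 biv_entries eta_all scaleR_add_right scaleR_diff_right)

text \<open>\<open>JO\<close> brings triple products back to degree one, which is why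
  \<open>E6\<close> belongs to the antisymmetric part of \<open>T1\<close>.\<close>

lemma v2_values:
  "v2_vec 0 1 = single 2 (mink.rho 3) - single 3 (mink.rho 2)" "v2_vec 0 2 = single 3 (mink.rho 1) - single 1 (mink.rho 3)"
  "v2_vec 0 3 = single 1 (mink.rho 2) - single 2 (mink.rho 1)" "v2_vec 1 2 = single 0 (mink.rho 3) + single 3 (mink.rho 0)"
  "v2_vec 1 3 = - single 0 (mink.rho 2) - single 2 (mink.rho 0)" "v2_vec 2 3 = single 0 (mink.rho 1) + single 1 (mink.rho 0)"
  by (simp_all add: v2_vec_def sum_UNIV4 Theta_coll_single Theta_not_distinct single_linear JJ_op_coll
      linear_add[OF op_coll_linear] linear_diff[OF op_coll_linear] linear_neg[OF op_coll_linear] op_coll_single Theta_3 mink.JO_normal mink.rho_normal)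

lemma less4: "\<not> (1::4) < 0" "\<not> (2::4) < 0" "\<not> (3::4) < 0" "\<not> (2::4) < 1" "\<not> (3::4) < 1" "\<not> (3::4) < 2"
  by (simp_all add: less_bit0_def bit0.Rep_numeral bit0.Rep_0 bit0.Rep_1)

lemma less4_pos: "(0::4) < 1" "(0::4) < 2" "(0::4) < 3" "(1::4) < 2" "(1::4) < 3" "(2::4) < 3"
  by (simp_all add: less_bit0_def bit0.Rep_numeral bit0.Rep_0 bit0.Rep_1)

lemma E6_eq: "E6 = mink.T1 ` M6"
proof
  have i: "\<forall>a b. a < b \<longrightarrow> v2_vec a b \<in> mink.T1 ` M6"
  proof -
    \<comment> \<open>Up to sign, each spanning vector is the coordinate bivector of the
      complementary index pair; the 2 cancels the 1/2 in \<open>biv\<close>.\<close>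
    have "v2_vec 0 1 = mink.T1 (biv (0, 0, 0, -2, 0, 0))" "v2_vec 0 2 = mink.T1 (biv (0, 0, 0, 0, -2, 0))"
      "v2_vec 0 3 = mink.T1 (biv (0, 0, 0, 0, 0, -2))" "v2_vec 1 2 = mink.T1 (biv (0, 0, 2, 0, 0, 0))"
      "v2_vec 1 3 = mink.T1 (biv (0, -2, 0, 0, 0, 0))" "v2_vec 2 3 = mink.T1 (biv (2, 0, 0, 0, 0, 0))"
      by (simp_all add: v2_values T1_biv)
    then show ?thesis unfolding all4 by (simp add: biv_M6 less4)
  qed
  have s: "subspace (mink.T1 ` M6)" by (intro linear_subspace_image mink.linear_T subspace_M6)
  show "E6 \<subseteq> mink.T1 ` M6" unfolding E6_def by (rule span_minimal[OF _ s]) (use i in auto)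
  show "mink.T1 ` M6 \<subseteq> E6"
  proof
    fix y assume "y \<in> mink.T1 ` M6"
    then obtain e1 e2 e3 b1 b2 b3 where y: "y = mink.T1 (biv (e1, e2, e3, b1, b2, b3))" unfolding M6_eq by auto
    have y': "y = (1/2) *\<^sub>R (e1 *\<^sub>R v2_vec 2 3 - e2 *\<^sub>R v2_vec 1 3 + e3 *\<^sub>R v2_vec 1 2 - b1 *\<^sub>R v2_vec 0 1 - b2 *\<^sub>R v2_vec 0 2 - b3 *\<^sub>R v2_vec 0 3)"
      by (simp add: y T1_biv v2_values scaleR_diff_right scaleR_add_right)
    have "v2_vec 2 3 \<in> E6" "v2_vec 1 3 \<in> E6" "v2_vec 1 2 \<in> E6" "v2_vec 0 1 \<in> E6" "v2_vec 0 2 \<in> E6" "v2_vec 0 3 \<in> E6"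
      using span_base[of "v2_vec _ _" "{v2_vec a b | a b. a < b}"] less4_pos unfolding E6_def by blast+
    then show "y \<in> E6" unfolding y' E6_def by (intro span_scale span_add span_diff)
  qed
qed

text \<open>For symmetric \<open>S\<close>, interchanging the summation indices shows that both
  halves of \<open>u2_vec\<close> contribute equally.\<close>

lemma u2_sum:
  assumes "\<And>a b. S a b = S b a"
  shows "(\<Sum>a\<in>UNIV. \<Sum>b\<in>UNIV. S a b *\<^sub>R u2_vec a b) = mink.T1 (\<chi> a b. S a b)"
proof -
  let ?A = "\<Sum>a\<in>UNIV. \<Sum>b\<in>UNIV. (S a b * eta $ a $ a) *\<^sub>R single a (mink.rho b)"
  have e: "(\<Sum>e\<in>UNIV. eta $ a $ e *\<^sub>R Theta_coll e [b]) = eta $ a $ a *\<^sub>R single a (mink.rho b)" for a b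
    using sum_eta[of 1 a] by (simp add: Theta_coll_single Theta_1)
  have "(\<Sum>a\<in>UNIV. \<Sum>b\<in>UNIV. S a b *\<^sub>R u2_vec a b) = (1/2) *\<^sub>R (?A + (\<Sum>a\<in>UNIV. \<Sum>b\<in>UNIV. (S a b * eta $ b $ b) *\<^sub>R single b (mink.rho a)))"
    by (simp add: u2_vec_def e scaleR_add_right scaleR_sum_right sum.distrib mult_ac)
  also have "(\<Sum>a\<in>UNIV. \<Sum>b\<in>UNIV. (S a b * eta $ b $ b) *\<^sub>R single b (mink.rho a)) = (\<Sum>b\<in>UNIV. \<Sum>a\<in>UNIV. (S a b * eta $ b $ b) *\<^sub>R single b (mink.rho a))"
    by (rule sum.swap)
  also have "\<dots> = ?A" by (subst assms) (rule refl)
  finally show ?thesis by (simp add: T1_single scaleR_add_right scaleR_add_left[symmetric])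
qed

lemma E9_eq: "E9 = mink.T1 ` M9"
proof (intro equalityI subsetI)
  have t: "(\<Sum>a\<in>UNIV. \<Sum>b\<in>UNIV. eta $ a $ b * S a b) = S 0 0 - S 1 1 - S 2 2 - S 3 3" for S :: "4 \<Rightarrow> 4 \<Rightarrow> real"
    by (simp add: sum_UNIV4 eta_all)
  fix y
  {
    assume "y \<in> E9"
    then obtain S where S: "y = (\<Sum>a\<in>UNIV. \<Sum>b\<in>UNIV. S a b *\<^sub>R u2_vec a b)" "\<forall>a b. S a b = S b a"
      "(\<Sum>a\<in>UNIV. \<Sum>b\<in>UNIV. eta $ a $ b * S a b) = 0" unfolding E9_def by blast
    have "transpose (\<chi> a b. S a b) = (\<chi> a b. S a b)" unfolding transpose_def by (simp add: vec_eq_iff) (use S(2) in blast)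
    then have "(\<chi> a b. S a b) \<in> M9" using S(3) t[of S] by (simp add: M9_def)
    then show "y \<in> mink.T1 ` M9" unfolding S(1) using u2_sum[of S] S(2) by blast
  next
    assume "y \<in> mink.T1 ` M9"
    then obtain X where X: "X \<in> M9" "y = mink.T1 X" by blast
    have s: "X $ a $ b = X $ b $ a" for a b
    proof -
      have "transpose X $ b $ a = X $ b $ a" using X(1) by (simp add: M9_def)
      then show ?thesis by (simp add: transpose_def)
    qed
    have "y = (\<Sum>a\<in>UNIV. \<Sum>b\<in>UNIV. X $ a $ b *\<^sub>R u2_vec a b)"
      using u2_sum[of "\<lambda>a b. X $ a $ b"] s X(2) by simp
    moreover have "(\<Sum>a\<in>UNIV. \<Sum>b\<in>UNIV. eta $ a $ b * X $ a $ b) = 0"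
      using X(1) t[of "\<lambda>a b. X $ a $ b"] by (simp add: M9_def)
    ultimately show "y \<in> E9" unfolding E9_def using s by (intro CollectI exI[of _ "\<lambda>a b. X $ a $ b"]) simp
  }
qed

subsection \<open>The Levi-Civita symbol\<close>

definition index_fun :: "4 \<Rightarrow> 4 \<Rightarrow> 4 \<Rightarrow> 4 \<Rightarrow> 4 \<Rightarrow> 4" where
  "index_fun a b c d = (\<lambda>i. if i = 0 then a else if i = 1 then b else if i = 2 then c else d)"

lemma levi_civita_index_fun: "levi_civita a b c d = (if inj (index_fun a b c d) then of_int (sign (index_fun a b c d)) else 0)"
  by (simp add: levi_civita_def index_fun_def Let_def)

text \<open>Composition with a transposition preserves injectivity and reverses the sign of a
  permutation.\<close>

lemma levi_civita_compose:
  assumes "i \<noteq> j" "index_fun a' b' c' d' = index_fun a b c d \<circ> Transposition.transpose i j"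
  shows "levi_civita a' b' c' d' = - levi_civita a b c d"
proof -
  have t: "bij (Transposition.transpose i j)" by simp
  have inj: "inj (index_fun a' b' c' d') \<longleftrightarrow> inj (index_fun a b c d)"
    unfolding assms(2)
  proof
    assume "inj (index_fun a b c d \<circ> Transposition.transpose i j)"
    from inj_compose[OF this bij_is_inj[OF t]] show "inj (index_fun a b c d)"
      by (simp add: comp_assoc)
  qed (use inj_compose[OF _ bij_is_inj[OF t]] in blast)
  have "sign (index_fun a' b' c' d') = - sign (index_fun a b c d)" if i: "inj (index_fun a b c d)"
  proof -
    have "bij (index_fun a b c d)" unfolding bij_def using i finite_UNIV_inj_surj[OF _ i] by simp
    then have "permutation (index_fun a b c d)" unfolding permutation by simp
    then show ?thesis unfolding assms(2)
      using sign_compose[of "index_fun a b c d" "Transposition.transpose i j"] permutation_swap_id[of i j] sign_swap_id[of i j] assms(1) by simp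
  qed
  then show ?thesis using inj by (auto simp: levi_civita_index_fun)
qed

lemma levi_civita_swaps:
  "levi_civita b a c d = - levi_civita a b c d"
  "levi_civita a c b d = - levi_civita a b c d"
  "levi_civita a b d c = - levi_civita a b c d"
proof -
  have "index_fun b a c d = index_fun a b c d \<circ> Transposition.transpose 0 1" "index_fun a c b d = index_fun a b c d \<circ> Transposition.transpose 1 2"
    "index_fun a b d c = index_fun a b c d \<circ> Transposition.transpose 2 3"
    unfolding fun_eq_iff all4 by (simp_all add: index_fun_def Transposition.transpose_def)
  then show "levi_civita b a c d = - levi_civita a b c d"
    "levi_civita a c b d = - levi_civita a b c d" "levi_civita a b d c = - levi_civita a b c d"
    using levi_civita_compose[of 0 1] levi_civita_compose[of 1 2] levi_civita_compose[of 2 3] by simp_all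
qed

lemma levi_civita_repeat: "\<not> distinct [a, b, c, d] \<Longrightarrow> levi_civita a b c d = 0"
proof -
  assume "\<not> distinct [a, b, c, d]"
  then have "\<not> inj (index_fun a b c d)"
  proof (rule contrapos_nn)
    assume "inj (index_fun a b c d)"
    from inj_eq[OF this, of 0 1] inj_eq[OF this, of 0 2] inj_eq[OF this, of 0 3] inj_eq[OF this, of 1 2]
      inj_eq[OF this, of 1 3] inj_eq[OF this, of 2 3]
    show "distinct [a, b, c, d]" by (auto simp: index_fun_def)
  qed
  then show ?thesis by (simp add: levi_civita_index_fun)
qed

lemma levi_civita_0123: "levi_civita 0 1 2 3 = 1"
proof -
  have "index_fun 0 1 2 3 = id" unfolding fun_eq_iff all4 by (simp add: index_fun_def)
  then show ?thesis by (simp add: levi_civita_index_fun sign_id)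
qed

lemma levi_civita_values:
  "levi_civita 0 1 2 3 = 1" "levi_civita 1 0 2 3 = -1" "levi_civita 0 2 1 3 = -1" "levi_civita 2 0 1 3 = 1"
  "levi_civita 1 2 0 3 = 1" "levi_civita 2 1 0 3 = -1"
  "levi_civita 0 1 3 2 = -1" "levi_civita 1 0 3 2 = 1" "levi_civita 0 3 1 2 = 1" "levi_civita 3 0 1 2 = -1"
  "levi_civita 1 3 0 2 = -1" "levi_civita 3 1 0 2 = 1"
  "levi_civita 0 2 3 1 = 1" "levi_civita 2 0 3 1 = -1" "levi_civita 0 3 2 1 = -1" "levi_civita 3 0 2 1 = 1"
  "levi_civita 2 3 0 1 = 1" "levi_civita 3 2 0 1 = -1"
  "levi_civita 1 2 3 0 = -1" "levi_civita 2 1 3 0 = 1" "levi_civita 1 3 2 0 = 1" "levi_civita 3 1 2 0 = -1"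
  "levi_civita 2 3 1 0 = -1" "levi_civita 3 2 1 0 = 1"
proof -
  show 1: "levi_civita 0 1 2 3 = 1" by (rule levi_civita_0123)
  \<comment> \<open>The permutations are grouped by their number of inversions; each group follows
    from the previous one by adjacent swaps.\<close>
  show 2: "levi_civita 1 0 2 3 = -1" "levi_civita 0 2 1 3 = -1" "levi_civita 0 1 3 2 = -1"
    using levi_civita_swaps[of 0 1 2 3] 1 by simp_all
  show 3: "levi_civita 2 0 1 3 = 1" "levi_civita 1 2 0 3 = 1" "levi_civita 1 0 3 2 = 1" "levi_civita 0 3 1 2 = 1" "levi_civita 0 2 3 1 = 1"
    using levi_civita_swaps(1)[of 0 2 1 3] levi_civita_swaps(2)[of 1 0 2 3] levi_civita_swaps(1)[of 0 1 3 2]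
      levi_civita_swaps(2)[of 0 1 3 2] levi_civita_swaps(3)[of 0 2 1 3] 2 by simp_all
  show 4: "levi_civita 2 1 0 3 = -1" "levi_civita 3 0 1 2 = -1" "levi_civita 1 3 0 2 = -1" "levi_civita 2 0 3 1 = -1"
    "levi_civita 0 3 2 1 = -1" "levi_civita 1 2 3 0 = -1"
    using levi_civita_swaps(1)[of 1 2 0 3] levi_civita_swaps(1)[of 0 3 1 2] levi_civita_swaps(2)[of 1 0 3 2]
     levi_civita_swaps(1)[of 0 2 3 1] levi_civita_swaps(2)[of 0 2 3 1] levi_civita_swaps(3)[of 1 2 0 3] 3 by simp_all
  show 5: "levi_civita 3 1 0 2 = 1" "levi_civita 3 0 2 1 = 1" "levi_civita 2 3 0 1 = 1" "levi_civita 2 1 3 0 = 1" "levi_civita 1 3 2 0 = 1"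
    using levi_civita_swaps(1)[of 1 3 0 2] levi_civita_swaps(1)[of 0 3 2 1] levi_civita_swaps(2)[of 2 0 3 1]
     levi_civita_swaps(1)[of 1 2 3 0] levi_civita_swaps(2)[of 1 2 3 0] 4 by simp_all
  show 6: "levi_civita 3 2 0 1 = -1" "levi_civita 3 1 2 0 = -1" "levi_civita 2 3 1 0 = -1"
    using levi_civita_swaps(1)[of 2 3 0 1] levi_civita_swaps(1)[of 1 3 2 0] levi_civita_swaps(2)[of 2 1 3 0] 5 by simp_all
  show "levi_civita 3 2 1 0 = 1" using levi_civita_swaps(1)[of 2 3 1 0] 6 by simp
qed

text \<open>For fixed \<open>t\<close> the six non-zero terms pair up by antisymmetry, so the sum is
  plus or minus twice the cyclic sum over the three indices other than \<open>t\<close>.\<close>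

lemma levi_civita_cyc:
  assumes "\<And>a r s. F $ a $ r $ s = - F $ a $ s $ r"
  shows "(\<forall>t. (\<Sum>a\<in>UNIV. \<Sum>r\<in>UNIV. \<Sum>s\<in>UNIV. levi_civita a r s t * F $ a $ r $ s) = 0) \<longleftrightarrow>
    cyc F 0 1 2 = 0 \<and> cyc F 0 1 3 = 0 \<and> cyc F 0 2 3 = 0 \<and> cyc F 1 2 3 = 0"
proof -
  have e: "F $ a $ 1 $ 0 = - F $ a $ 0 $ 1" "F $ a $ 2 $ 0 = - F $ a $ 0 $ 2" "F $ a $ 3 $ 0 = - F $ a $ 0 $ 3"
    "F $ a $ 2 $ 1 = - F $ a $ 1 $ 2" "F $ a $ 3 $ 1 = - F $ a $ 1 $ 3" "F $ a $ 3 $ 2 = - F $ a $ 2 $ 3" for a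
    by (rule assms)+
  show ?thesis
    unfolding all4
    by (simp add: sum_UNIV4 levi_civita_values levi_civita_repeat cyc_def e) auto
qed

lemma E16_eq: "E16 = mink.T2 ` M16"
proof (intro equalityI subsetI)
  have T: "(\<Sum>a\<in>UNIV. \<Sum>r\<in>UNIV. \<Sum>s\<in>UNIV. \<Sum>b\<in>UNIV. (F a r s * eta $ a $ b) *\<^sub>R Theta_coll b [r, s])
      = mink.T2 (\<chi> a r s. F a r s)" for F :: "4 \<Rightarrow> 4 \<Rightarrow> 4 \<Rightarrow> real"
    unfolding sum_eta by (simp add: T2_single Theta_coll_single Theta_2)
  have C: "(\<Sum>a\<in>UNIV. \<Sum>r\<in>UNIV. eta $ a $ r * F a r s) = contr (\<chi> a r s. F a r s) s" for F :: "4 \<Rightarrow> 4 \<Rightarrow> 4 \<Rightarrow> real" and s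
    by (simp add: sum_UNIV4 eta_all contr_def)
  fix y
  {
    assume "y \<in> E16"
    then obtain F where F: "y = (\<Sum>a\<in>UNIV. \<Sum>r\<in>UNIV. \<Sum>s\<in>UNIV. \<Sum>b\<in>UNIV. (F a r s * eta $ a $ b) *\<^sub>R Theta_coll b [r, s])"
      "\<forall>a r s. F a r s = - F a s r" "\<forall>s. (\<Sum>a\<in>UNIV. \<Sum>r\<in>UNIV. eta $ a $ r * F a r s) = 0"
      "\<forall>t. (\<Sum>a\<in>UNIV. \<Sum>r\<in>UNIV. \<Sum>s\<in>UNIV. levi_civita a r s t * F a r s) = 0"
      unfolding E16_def by blast
    define G :: "real^4^4^4" where "G = (\<chi> a r s. F a r s)"
    have G: "G $ a $ r $ s = - G $ a $ s $ r" for a r s unfolding G_def vec_lambda_beta using F(2) by blast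
    have "G $ a \<in> M6" for a
    proof -
      have "transpose (G $ a) $ r $ s = (- (G $ a)) $ r $ s" for r s using G[of a s r] by (simp add: transpose_def)
      then show ?thesis by (simp add: M6_def vec_eq_iff[of _ "_ :: real^4^4"] vec_eq_iff[of _ "_ :: real^4"])
    qed
    then have "G \<in> A3" by (simp add: A3_def)
    moreover have "contr G s = 0" for s using F(3) C[of F] by (simp add: G_def)
    moreover have "\<forall>t. (\<Sum>a\<in>UNIV. \<Sum>r\<in>UNIV. \<Sum>s\<in>UNIV. levi_civita a r s t * G $ a $ r $ s) = 0" using F(4) by (simp add: G_def)
    ultimately have "G \<in> M16" using levi_civita_cyc[OF G] by (simp add: M16_def)
    then show "y \<in> mink.T2 ` M16" unfolding F(1) T G_def by blast
  next
    assume "y \<in> mink.T2 ` M16"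
    then obtain G where G: "y = mink.T2 G" "G \<in> M16" by blast
    define F where "F a r s = G $ a $ r $ s" for a r s
    have FG: "(\<chi> a r s. F a r s) = G" by (simp add: F_def vec_eq_iff)
    have a: "G $ a $ r $ s = - G $ a $ s $ r" for a r s
    proof -
      have "transpose (G $ a) $ s $ r = (- (G $ a)) $ s $ r" using G(2) by (simp add: M16_def A3_def M6_def)
      then show ?thesis by (simp add: transpose_def)
    qed
    have h1: "\<forall>s. contr G s = 0" using G(2) by (simp add: M16_def)
    have h2: "\<forall>t. (\<Sum>a\<in>UNIV. \<Sum>r\<in>UNIV. \<Sum>s\<in>UNIV. levi_civita a r s t * F a r s) = 0"
      using levi_civita_cyc[OF a] G(2) by (simp add: M16_def F_def)
    have h3: "\<forall>a r s. F a r s = - F a s r" unfolding F_def by (intro allI a)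
    have "y = (\<Sum>a\<in>UNIV. \<Sum>r\<in>UNIV. \<Sum>s\<in>UNIV. \<Sum>b\<in>UNIV. (F a r s * eta $ a $ b) *\<^sub>R Theta_coll b [r, s])"
      unfolding T FG by (rule G(1))
    moreover have "\<forall>s. (\<Sum>a\<in>UNIV. \<Sum>r\<in>UNIV. eta $ a $ r * F a r s) = 0" unfolding C FG by (rule h1)
    ultimately show "y \<in> E16"
      unfolding E16_def using h2 h3 by (intro CollectI exI[of _ F] conjI)
  }
qed

section \<open>Real spans of the Theta collections\<close>

lemma single_rho_T1: "single b (mink.rho a) \<in> range mink.T1"
proof -
  have "mink.T1 (\<chi> i. if i = b then eta $ b $ b *\<^sub>R axis a 1 else 0) = single b (mink.rho a)"
  proof -
    have "mink.T1 (\<chi> i. if i = b then eta $ b $ b *\<^sub>R axis a 1 else 0) =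
      (\<Sum>i\<in>UNIV. if i = b then (\<Sum>c\<in>UNIV. axis a (1::real) $ c *\<^sub>R single b (mink.rho c)) else 0)"
      unfolding T1_single by (intro sum.cong refl) (auto simp: mink.eta_diag mult_ac intro!: sum.cong sum.neutral)
    then show ?thesis by (simp add: sum_axis)
  qed
  then show ?thesis by (metis rangeI)
qed

lemma single_rho2_T2: "single b (mink.rho2 r s) \<in> mink.T2 ` A3"
proof -
  have s: "subspace (mink.T2 ` A3)" by (intro linear_subspace_image mink.linear_T subspace_A3)
  have n: "- z \<in> mink.T2 ` A3 \<longleftrightarrow> z \<in> mink.T2 ` A3" for z
    using subspace_neg[OF s, of z] subspace_neg[OF s, of "- z"] by auto
  have h: "single b (mink.R2 (biv p)) \<in> mink.T2 ` A3" for p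
  proof -
    let ?F = "\<chi> i. if i = b then eta $ b $ b *\<^sub>R biv p else 0"
    have "mink.T2 ?F = (\<Sum>i\<in>UNIV. single i (eta $ i $ i *\<^sub>R mink.R2 (?F $ i)))"
      by (simp only: mink.T2_def mink.LT_def mink_KK)
    also have "\<dots> = (\<Sum>i\<in>UNIV. if i = b then single b (mink.R2 (biv p)) else 0)"
      by (intro sum.cong refl) (auto simp: linear_scale[OF mink.linear_R2] linear_0[OF mink.linear_R2] mink.eta_diag single_linear)
    finally have "mink.T2 ?F = single b (mink.R2 (biv p))" by simp
    moreover have "?F \<in> A3" by (auto simp: A3_def subspace_0[OF subspace_M6] intro!: subspace_scale[OF subspace_M6] biv_M6)
    ultimately show ?thesis using imageI[of ?F A3 mink.T2] by simp
  qed
  have "\<forall>r s. single b (mink.rho2 r s) \<in> mink.T2 ` A3"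
    unfolding all4
    using h[of "(1,0,0,0,0,0)"] h[of "(0,1,0,0,0,0)"] h[of "(0,0,1,0,0,0)"] h[of "(0,0,0,1,0,0)"] h[of "(0,0,0,0,1,0)"] h[of "(0,0,0,0,0,1)"]
    by (simp add: mink.R2_biv mink.rho2_same mink.rho2_swap[of 1 0] mink.rho2_swap[of 2 0] mink.rho2_swap[of 3 0]
            mink.rho2_swap[of 3 2] mink.rho2_swap[of 1 3] mink.rho2_swap[of 2 1] single_linear n subspace_0[OF s])
  then show ?thesis by blast
qed

lemma Vr_eq: "Vr = mink.Vr'"
proof
  have s: "subspace mink.Vr'" using is_direct_sum_subspace[OF mink.Vr'_sum] .
  have m: "range mink.T1 \<subseteq> mink.Vr'" "mink.T2 ` A3 \<subseteq> mink.Vr'"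
    using is_direct_sum_member[OF mink.Vr'_sum] by auto
  have "Theta_coll b I \<in> mink.Vr'" if l: "length I \<in> {1, 2}" for b I
  proof -
    from l have "(\<exists>a. I = [a]) \<or> (\<exists>r s. I = [r, s])"
      by (auto simp: length_Suc_conv numeral_2_eq_2)
    then show ?thesis using single_rho_T1 single_rho2_T2 m by (auto simp: Theta_coll_single Theta_1 Theta_2)
  qed
  then show "Vr \<subseteq> mink.Vr'" unfolding Vr_def by (intro span_minimal s) auto
  have b: "single a (mink.rho c) \<in> Vr" "single a (mink.rho2 r s) \<in> Vr" for a c r s
    unfolding Vr_def Theta_1[symmetric] Theta_2[symmetric] Theta_coll_single[symmetric]
    by (rule span_base, rule CollectI, intro exI conjI, rule refl, simp)+
  have v: "subspace Vr" unfolding Vr_def by (rule subspace_span)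
  show "mink.Vr' \<subseteq> Vr"
    unfolding mink.Vr'_def T1_single T2_single
    by (auto intro!: subspace_add[OF v] subspace_sum[OF v] subspace_scale[OF v] b)
qed

text \<open>A product of three different generators is \<open>JO\<close> times the missing one, up
  to sign; only this inclusion is needed to place such collections in
  \<open>mink.Vc'\<close>.\<close>

lemma Theta_3_cases: "Theta [a, b, c] \<in> {0} \<union> range (\<lambda>d. mink.JO ** mink.rho d) \<union> range (\<lambda>d. - (mink.JO ** mink.rho d))"
proof (cases "distinct [a, b, c]")
  case True
  have h: "\<forall>a b c. distinct [a, b, c] \<longrightarrow> (mink.rho c ** (mink.rho b ** mink.rho a) \<in> range (\<lambda>d. mink.JO ** mink.rho d) \<union> range (\<lambda>d. - (mink.JO ** mink.rho d)))"
    unfolding all4 by (simp add: mink.rho_normal) (simp add: mink.rho_words3)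
  show ?thesis using h[rule_format, OF True] unfolding Theta_3[OF True] Un_iff by argo
qed (simp add: Theta_not_distinct)

lemma Theta_4_cases: "Theta [a, b, c, d] \<in> {0, mink.JO, - mink.JO}"
proof (cases "distinct [a, b, c, d]")
  case True
  have h: "\<forall>a b c d. distinct [a, b, c, d] \<longrightarrow> mink.rho d ** (mink.rho c ** (mink.rho b ** mink.rho a)) \<in> {mink.JO, - mink.JO}"
    unfolding all4 by (simp add: mink.rho_normal mink.JO_normal)
  show ?thesis using h[rule_format, OF True] unfolding Theta_4[OF True] insert_iff by argo
qed (simp add: Theta_not_distinct)

text \<open>The converse of \<open>Theta_3_cases\<close>, which places the generators of
  \<open>mink.Vc'\<close> in \<open>Vc\<close>.\<close>

lemma JO_rho_Theta: "mink.JO ** mink.rho 0 = - Theta [1, 2, 3]" "mink.JO ** mink.rho 1 = - Theta [0, 2, 3]"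
  "mink.JO ** mink.rho 2 = Theta [0, 1, 3]" "mink.JO ** mink.rho 3 = - Theta [0, 1, 2]"
  by (simp_all add: Theta_3 mink.JO_normal mink.rho_normal)

lemma Vc_eq: "Vc = mink.Vc'"
proof
  have s: "subspace mink.Vc'" using is_direct_sum_subspace[OF mink.Vc'_sum] .
  have m: "op_coll mink.JO ` range mink.T1 \<subseteq> mink.Vc'" "range mink.C0 \<subseteq> mink.Vc'" "op_coll mink.JO ` range mink.C0 \<subseteq> mink.Vc'"
    using is_direct_sum_member[OF mink.Vc'_sum] by auto
  have c0: "single b (mat 1) \<in> range mink.C0" for b
  proof -
    have "mink.C0 (axis b (eta $ b $ b)) = (\<Sum>a\<in>UNIV. if a = b then single b (mat 1) else 0)"
      unfolding C0_single by (intro sum.cong refl) (auto simp: axis_def mink.eta_diag)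
    then have "mink.C0 (axis b (eta $ b $ b)) = single b (mat 1)" by simp
    then show ?thesis by (metis rangeI)
  qed
  have j: "single b (mink.JO ** mink.rho d) \<in> mink.Vc'" for b d
    using single_rho_T1[of b d] m(1) unfolding op_coll_single[symmetric] by blast
  have j4: "single b mink.JO \<in> mink.Vc'" for b
  proof -
    have "single b mink.JO = op_coll mink.JO (single b (mat 1))" by (simp add: op_coll_single)
    then show ?thesis using c0[of b] m(3) by blast
  qed
  have "Theta_coll b I \<in> mink.Vc'" if l: "length I \<in> {0, 3, 4}" for b I
  proof -
    from l consider "I = []" | p q r where "I = [p, q, r]" | p q r t where "I = [p, q, r, t]"
      by (auto simp: length_Suc_conv eval_nat_numeral)
    then show ?thesis
    proof cases
      case 1
      then show ?thesis using c0[of b] m(2) by (auto simp: Theta_coll_single Theta_Nil)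
    next
      case 2
      then show ?thesis using Theta_3_cases[of p q r] j
        by (auto simp: Theta_coll_single single_linear subspace_0[OF s] intro!: subspace_neg[OF s])
    next
      case 3
      then show ?thesis using Theta_4_cases[of p q r t] j4
        by (auto simp: Theta_coll_single single_linear subspace_0[OF s] intro!: subspace_neg[OF s])
    qed
  qed
  then show "Vc \<subseteq> mink.Vc'" unfolding Vc_def by (intro span_minimal s) auto
  have v: "subspace Vc" unfolding Vc_def by (rule subspace_span)
  have b0: "single a (Theta I) \<in> Vc" if "length I \<in> {0, 3, 4}" for a I
    unfolding Vc_def Theta_coll_single[symmetric]
    by (rule span_base, rule CollectI, intro exI conjI, rule refl, rule that)
  have b1: "single a (mink.JO ** mink.rho d) \<in> Vc" for a d
  proof -
    have "\<forall>d. single a (mink.JO ** mink.rho d) \<in> Vc"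
      unfolding all4 JO_rho_Theta single_linear by (auto intro!: subspace_neg[OF v] b0)
    then show ?thesis by blast
  qed
  have b2: "single a (mat 1) \<in> Vc" "single a mink.JO \<in> Vc" for a
    using b0[of "[]" a] b0[of "[0, 1, 2, 3]" a] by (simp_all add: Theta_Nil Theta_0123)
  have ops: "op_coll mink.JO (mink.T1 Y) = (\<Sum>a\<in>UNIV. \<Sum>b\<in>UNIV. (Y $ a $ b * eta $ a $ a) *\<^sub>R single a (mink.JO ** mink.rho b))"
    "op_coll mink.JO (mink.C0 t) = (\<Sum>a\<in>UNIV. (t $ a * eta $ a $ a) *\<^sub>R single a mink.JO)" for Y t
    by (simp_all add: T1_single C0_single linear_sum[OF op_coll_linear] linear_scale[OF op_coll_linear] op_coll_single)
  show "mink.Vc' \<subseteq> Vc"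
  proof -
    have "op_coll mink.JO (mink.T1 Y) \<in> Vc" "mink.C0 t \<in> Vc" "op_coll mink.JO (mink.C0 t) \<in> Vc" for Y t
      unfolding ops by (simp_all only: C0_single) (intro subspace_sum[OF v] subspace_scale[OF v] b1 b2)+
    then show ?thesis unfolding mink.Vc'_def by (auto intro!: subspace_add[OF v])
  qed
qed

theorem mainTheorem2:
  shows "(\<forall>g. lorentzian g \<longrightarrow>
      lie_rep (so g) force_act (force_tensors g) \<and>
      (\<exists>Ws. is_direct_sum (force_tensors g) Ws \<and>
        map dim Ws = [1, 1, 4, 4, 4, 4, 6, 6, 9, 9, 16] \<and>
        (\<forall>W\<in>set Ws. irreducible_subrep (so g) force_act (force_tensors g) W) \<and>
        (\<forall>W\<in>set Ws. \<forall>W'\<in>set Ws. dim W = dim W' \<longrightarrow> rep_iso (so g) force_act W W') \<and>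
        (\<forall>W\<in>set Ws.
          (dim W = 4 \<longrightarrow> has_type g force_act W [(1/2, 1/2)]) \<and>
          (dim W = 6 \<longrightarrow> has_type g force_act W [(1, 0), (0, 1)]) \<and>
          (dim W = 9 \<longrightarrow> has_type g force_act W [(1, 1)]) \<and>
          (dim W = 16 \<longrightarrow> has_type g force_act W [(3/2, 1/2), (1/2, 3/2)]) \<and>
          (dim W \<in> {6, 16} \<longrightarrow> cpx_reducible (so g) force_act W))))
    \<and>
    (is_direct_sum (force_tensors eta) [Vr, imul ` Vc] \<and>
      is_direct_sum Vr [E1, E4, JJ ` E4, E6, E9, E16] \<and>
      is_direct_sum Vc [JJ ` E1, E4'', JJ ` E4'', JJ ` E6, JJ ` E9] \<and>
      basis_family v_vec E4 \<and>
      basis_family w_vec (imul ` E4'') \<and>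
      map dim [E1, E4, JJ ` E4, E6, E9, E16] = [1, 4, 4, 6, 9, 16] \<and>
      map dim [imul ` JJ ` E1, imul ` E4'', imul ` JJ ` E4'', imul ` JJ ` E6, imul ` JJ ` E9]
        = [1, 4, 4, 6, 9] \<and>
      (\<forall>E\<in>{E1, E4, JJ ` E4, E6, E9, E16,
             imul ` JJ ` E1, imul ` E4'', imul ` JJ ` E4'', imul ` JJ ` E6, imul ` JJ ` E9}.
         irreducible_subrep (so eta) force_act (force_tensors eta) E))"
proof -
  note eqs = E1_eq E4_eq E4''_eq E6_eq E9_eq E16_eq JJ_op_coll imul_op_coll Vr_eq Vc_eq
  \<comment> \<open>In the standard frame the general summands coincide, as sets, with the named
    ones. Irreducibility and dimensions are therefore inherited.\<close>
  have W: "mink.Ws = [E1, imul ` JJ ` E1, E4, JJ ` E4, imul ` E4'', imul ` JJ ` E4'', E6, imul ` JJ ` E6, E9, imul ` JJ ` E9, E16]"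
    unfolding mink.Ws_def eqs ..
  have d: "is_direct_sum (force_tensors eta) [Vr, imul ` Vc]"
    "is_direct_sum Vr [E1, E4, JJ ` E4, E6, E9, E16]"
    "is_direct_sum Vc [JJ ` E1, E4'', JJ ` E4'', JJ ` E6, JJ ` E9]"
    unfolding eqs by (rule mink.V_sum mink.Vr'_decomposition mink.Vc'_decomposition)+
  have dims: "map dim [E1, E4, JJ ` E4, E6, E9, E16] = [1, 4, 4, 6, 9, 16]"
    "map dim [imul ` JJ ` E1, imul ` E4'', imul ` JJ ` E4'', imul ` JJ ` E6, imul ` JJ ` E9] = [1, 4, 4, 6, 9]"
    using mink.Ws_dims unfolding W by simp_all
  have irr: "irreducible_subrep (so eta) force_act (force_tensors eta) E"
    if "E \<in> {E1, E4, JJ ` E4, E6, E9, E16, imul ` JJ ` E1, imul ` E4'', imul ` JJ ` E4'', imul ` JJ ` E6, imul ` JJ ` E9}" for E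
    by (rule mink.Ws_irreducible) (use that in \<open>unfold W list.set, elim insertE emptyE, simp_all only: insert_iff simp_thms\<close>)
  show ?thesis
    by (intro conjI allI impI d dims v_basis w_basis ballI irr force_tensors_decomposition[THEN conjunct1]
        force_tensors_decomposition[THEN conjunct2])
qed

end
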